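(* Let $K\ge 3$ be an integer, let $0\le\nu<\frac12$ and $s>\frac12$ be real numbers, and let $0<\gamma\le 1$. Then there exist $\varepsilon_0>0$ and positive constants $c$ and $C$, depending on $K$, $\nu$, $s$ (and on the fixed data $\rho,\phi,\gamma$) but not on $\varepsilon$ and not on the discretization parameters $\tau$ and $M$, such that the following holds. Let $M\ge K$ be an integer, $\tau>0$ and $0<\varepsilon\le\varepsilon_0$ be such that the non-resonance condition (for these $K,M,\tau,\varepsilon,\nu,\gamma$) holds, and let the initial values satisfy $$E_1^0\le\varepsilon,\qquad E_j^0=0\ \text{ for } |j|\ne 1 .$$ Then, for all $n\ge 0$ with $0\le t_n=n\tau\le c\,\varepsilon^{-K(1-2\nu)/2}$, the mode energies along the trigonometric integrator satisfy $$\sum_{l=0}^{M}\sigma_l\,\varepsilon^{-e(l)}E_l^n\le C\qquad\text{and}\qquad \varepsilon^{-e(1)}\,|E_1^n-E_1^0|\le C\,\varepsilon^{1-2\nu}.$$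
   Context: Fixed data. $\rho>0$, $\omega_j=\sqrt{j^2+\rho}$ for $j\in\mathbb Z$, $\operatorname{sinc}(\xi)=\sin(\xi)/\xi$; $\phi,\psi:\mathbb R\to\mathbb R$ are bounded even functions with $\phi(0)=\psi(0)=1$ and $\psi(\xi)=\operatorname{sinc}(\xi)\phi(\xi)$ (symplecticity). Trigonometric integrator (for $\partial_{tt}u-\partial_{xx}u+\rho u=u^2$ on $\mathbb R/2\pi\mathbb Z$). Let $\tau>0$, $t_n=n\tau$, and let $\equiv$ denote congruence modulo $2M$. Vectors are indexed by $j=-M,\dots,M-1$; index $M$ is identified with $-M$. $\boldsymbol\Omega,\boldsymbol\Phi,\boldsymbol\Psi$ are the diagonal matrices with entries $\omega_j$, $\phi(\tau\omega_j)$, $\psi(\tau\omega_j)$, and $(\mathbf u*\mathbf v)_j=\sum_{j_1+j_2\equiv j}u_{j_1}v_{j_2}$. From initial values $\mathbf u^0,\dot{\mathbf u}^0$, real in the sense $u^0_{-j}=\overline{u^0_j}$, $\dot u^0_{-j}=\overline{\dot u^0_j}$, one computes $$\mathbf u^1=\cos(\tau\boldsymbol\Omega)\mathbf u^0+\tau\operatorname{sinc}(\tau\boldsymbol\Omega)\dot{\mathbf u}^0+\tfrac12\tau^2\boldsymbol\Psi\big((\boldsymbol\Phi\mathbf u^0)*(\boldsymbol\Phi\mathbf u^0)\big),$$ $$\mathbf u^{n+1}-2\cos(\tau\boldsymbol\Omega)\mathbf u^n+\mathbf u^{n-1}=\tau^2\boldsymbol\Psi\big((\boldsymbol\Phi\mathbf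 u^n)*(\boldsymbol\Phi\mathbf u^n)\big),\qquad 2\tau\operatorname{sinc}(\tau\boldsymbol\Omega)\dot{\mathbf u}^n=\mathbf u^{n+1}-\mathbf u^{n-1}\quad(n\ge1).$$ Mode energies: $E_j^n=\frac12|\omega_ju_j^n|^2+\frac12|\dot u_j^n|^2$, with $E_M^n=E_{-M}^n$. Weights: $\sigma_j=\max(|j|,1)^{2s}$; energy profile: $e(0)=2$, $e(j)=|j|$ for $0<|j|<K$, $e(j)=K$ for $|j|\ge K$. Index set. For $\mathbf k=(k_0,\dots,k_M)\in\mathbb Z^{M+1}$ let $\mathbf k\cdot\boldsymbol\omega=\sum_{l=0}^Mk_l\omega_l$ and $\mu(\mathbf k)=\sum_{l=0}^M|k_l|e(l)$. $\langle j\rangle\in\mathbb Z^{M+1}$ is the $|j|$-th unit vector (entries numbered from $0$), and $i\bmod 2M$ is the representative in $\{-M,\dots,M-1\}$. $\mathcal K$ is the set of pairs $(j,\mathbf k)$, $j\in\{-M,\dots,M-1\}$, $\mathbf k\in\mathbb Z^{M+1}$, given by $$\mathcal K=\{(j,\mathbf k):\max(|j|,\mu(\mathbf k))<2K,\ k_l=0\ \text{for all } l\ge K\}$$ $$\cup\ \{(j,\pm\langle (j-r)\bmod 2M\rangle+\mathbf k): |(j-r)\bmod 2M|\ge K,\ |r|<K,\ \mu(\mathbf k)<K\}.$$ Non-resonance condition (for $K,M,\tau,\varepsilon,\nu,\gamma$): $|\sin(\frac12\tau(\omega_j\pm\mathbf k\cdot\boldsymbol\omega))|\ge\gamma\tau\varepsilon^{\nu/2}$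 for all $(j,\mathbf k)\in\mathcal K$ with $\mathbf k\ne\mp\langle j\rangle$ (for the upper sign only $\mathbf k=-\langle j\rangle$ is excluded, for the lower sign only $\mathbf k=\langle j\rangle$); and, for both signs, $|\sin(\frac12\tau(\omega_j\pm\mathbf k\cdot\boldsymbol\omega))|\ge\gamma\tau$ for all $(j,\mathbf k)\in\mathcal K$ with $\mathbf k\ne\langle j\rangle$, $\mathbf k\ne-\langle j\rangle$, $|j|\le K$. *)

theory Defs
  imports "HOL-Analysis.Analysis" "HOL-Probability.Sinc_Integral" "HOL-Number_Theory.Cong"
begin

text \<open>
  Coefficient vectors are functions on the integers that are only read at the indices
  \<open>-M, \<dots>, M - 1\<close>. An index outside this range, such as \<open>M\<close> itself, is first reduced modulo
  \<open>2 * M\<close> with \<open>mode_rep\<close>, so that \<open>M\<close> is identified with \<open>-M\<close>.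
\<close>

definition modes :: "int \<Rightarrow> int set" where
  "modes M = {-M..M - 1}"

definition mode_rep :: "int \<Rightarrow> int \<Rightarrow> int" where
  "mode_rep M i = (i + M) mod (2 * M) - M"

definition omega :: "real \<Rightarrow> int \<Rightarrow> real" where
  "omega \<rho> j = sqrt ((of_int j)\<^sup>2 + \<rho>)"

definition admissible_filters :: "(real \<Rightarrow> real) \<Rightarrow> (real \<Rightarrow> real) \<Rightarrow> bool" where
  "admissible_filters \<phi> \<psi> \<longleftrightarrow>
     bounded (range \<phi>) \<and> bounded (range \<psi>) \<and>
     (\<forall>x. \<phi> (- x) = \<phi> x) \<and> (\<forall>x. \<psi> (- x) = \<psi> x) \<and>
     \<phi> 0 = 1 \<and> \<psi> 0 = 1 \<and>
     (\<forall>x. \<psi> x = sinc x * \<phi> x)"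

definition cyclic_conv :: "int \<Rightarrow> (int \<Rightarrow> complex) \<Rightarrow> (int \<Rightarrow> complex) \<Rightarrow> int \<Rightarrow> complex" where
  "cyclic_conv M u v j =
     (\<Sum>(j1, j2) \<in> {(j1, j2) \<in> modes M \<times> modes M. [j1 + j2 = j] (mod 2 * M)}. u j1 * v j2)"

definition nonlinearity ::
  "real \<Rightarrow> (real \<Rightarrow> real) \<Rightarrow> (real \<Rightarrow> real) \<Rightarrow> int \<Rightarrow> real \<Rightarrow> (int \<Rightarrow> complex) \<Rightarrow> int \<Rightarrow> complex" where
  "nonlinearity \<rho> \<phi> \<psi> M \<tau> u j =
     of_real (\<psi> (\<tau> * omega \<rho> j)) *
     cyclic_conv M (\<lambda>i. of_real (\<phi> (\<tau> * omega \<rho> i)) * u i)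
                   (\<lambda>i. of_real (\<phi> (\<tau> * omega \<rho> i)) * u i) j"

definition real_coeffs :: "int \<Rightarrow> (int \<Rightarrow> complex) \<Rightarrow> bool" where
  "real_coeffs M u \<longleftrightarrow> (\<forall>j \<in> modes M. u (mode_rep M (- j)) = cnj (u j))"

text \<open>
  \<open>u n\<close> and \<open>v n\<close> are the approximations to the solution and to its time derivative at time
  \<open>n * \<tau>\<close>. The last equation determines \<open>v n j\<close> when \<open>sin (\<tau> * omega \<rho> j) \<noteq> 0\<close>; the
  non-resonance condition below ensures this (take \<open>k = unit_index j\<close> and the upper sign).
\<close>

definition trig_integrator ::
  "real \<Rightarrow> (real \<Rightarrow> real) \<Rightarrow> (real \<Rightarrow> real) \<Rightarrow> int \<Rightarrow> real \<Rightarrow>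
   (nat \<Rightarrow> int \<Rightarrow> complex) \<Rightarrow> (nat \<Rightarrow> int \<Rightarrow> complex) \<Rightarrow> bool" where
  "trig_integrator \<rho> \<phi> \<psi> M \<tau> u v \<longleftrightarrow>
     (\<forall>j \<in> modes M.
        u 1 j = of_real (cos (\<tau> * omega \<rho> j)) * u 0 j
                + of_real (\<tau> * sinc (\<tau> * omega \<rho> j)) * v 0 j
                + of_real (\<tau>\<^sup>2 / 2) * nonlinearity \<rho> \<phi> \<psi> M \<tau> (u 0) j) \<and>
     (\<forall>n \<ge> 1. \<forall>j \<in> modes M.
        u (n + 1) j - of_real (2 * cos (\<tau> * omega \<rho> j)) * u n j + u (n - 1) j
          = of_real (\<tau>\<^sup>2) * nonlinearity \<rho> \<phi> \<psi> M \<tau> (u n) j) \<and>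
     (\<forall>n \<ge> 1. \<forall>j \<in> modes M.
        of_real (2 * \<tau> * sinc (\<tau> * omega \<rho> j)) * v n j = u (n + 1) j - u (n - 1) j)"

definition mode_energy ::
  "real \<Rightarrow> int \<Rightarrow> (int \<Rightarrow> complex) \<Rightarrow> (int \<Rightarrow> complex) \<Rightarrow> int \<Rightarrow> real" where
  "mode_energy \<rho> M u v j =
     (1/2) * (norm (of_real (omega \<rho> (mode_rep M j)) * u (mode_rep M j)))\<^sup>2
     + (1/2) * (norm (v (mode_rep M j)))\<^sup>2"

definition sobolev_weight :: "real \<Rightarrow> int \<Rightarrow> real" where
  "sobolev_weight s j = real_of_int (max \<bar>j\<bar> 1) powr (2 * s)"

definition energy_profile :: "int \<Rightarrow> int \<Rightarrow> int" where
  "energy_profile K j = (if j = 0 then 2 else if \<bar>j\<bar> < K then \<bar>j\<bar> else K)"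

text \<open>
  Elements \<open>(k\<^sub>0, \<dots>, k\<^sub>M)\<close> of \<open>\<int>\<^sup>M\<^sup>+\<^sup>1\<close> are functions on the integers that vanish outside
  \<open>{0..M}\<close>, so that equality of functions is equality of tuples.
\<close>

definition multi_indices :: "int \<Rightarrow> (int \<Rightarrow> int) set" where
  "multi_indices M = {k. \<forall>l. l \<notin> {0..M} \<longrightarrow> k l = 0}"

definition unit_index :: "int \<Rightarrow> int \<Rightarrow> int" where
  "unit_index j = (\<lambda>l. if l = \<bar>j\<bar> then 1 else 0)"

definition dot_omega :: "real \<Rightarrow> int \<Rightarrow> (int \<Rightarrow> int) \<Rightarrow> real" where
  "dot_omega \<rho> M k = (\<Sum>l=0..M. of_int (k l) * omega \<rho> l)"

definition mu :: "int \<Rightarrow> int \<Rightarrow> (int \<Rightarrow> int) \<Rightarrow> int" where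
  "mu K M k = (\<Sum>l=0..M. \<bar>k l\<bar> * energy_profile K l)"

definition index_set :: "int \<Rightarrow> int \<Rightarrow> (int \<times> (int \<Rightarrow> int)) set" where
  "index_set K M =
     {(j, k). j \<in> modes M \<and> k \<in> multi_indices M \<and>
              max \<bar>j\<bar> (mu K M k) < 2 * K \<and> (\<forall>l \<ge> K. k l = 0)}
     \<union> {(j, \<lambda>l. \<theta> * unit_index (mode_rep M (j - r)) l + k l) | j r k \<theta>.
              j \<in> modes M \<and> k \<in> multi_indices M \<and> \<theta> \<in> {1, -1} \<and>
              \<bar>mode_rep M (j - r)\<bar> \<ge> K \<and> \<bar>r\<bar> < K \<and> mu K M k < K}"

definition nonresonant ::
  "real \<Rightarrow> int \<Rightarrow> int \<Rightarrow> real \<Rightarrow> real \<Rightarrow> real \<Rightarrow> real \<Rightarrow> bool" where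
  "nonresonant \<rho> K M \<tau> \<epsilon> \<nu> \<gamma> \<longleftrightarrow>
     (\<forall>(j, k) \<in> index_set K M.
        (k \<noteq> - unit_index j \<longrightarrow>
           \<bar>sin (\<tau> * (omega \<rho> j + dot_omega \<rho> M k) / 2)\<bar> \<ge> \<gamma> * \<tau> * \<epsilon> powr (\<nu> / 2)) \<and>
        (k \<noteq> unit_index j \<longrightarrow>
           \<bar>sin (\<tau> * (omega \<rho> j - dot_omega \<rho> M k) / 2)\<bar> \<ge> \<gamma> * \<tau> * \<epsilon> powr (\<nu> / 2)) \<and>
        (k \<noteq> unit_index j \<and> k \<noteq> - unit_index j \<and> \<bar>j\<bar> \<le> K \<longrightarrow>
           \<bar>sin (\<tau> * (omega \<rho> j + dot_omega \<rho> M k) / 2)\<bar> \<ge> \<gamma> * \<tau> \<and>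
           \<bar>sin (\<tau> * (omega \<rho> j - dot_omega \<rho> M k) / 2)\<bar> \<ge> \<gamma> * \<tau>))"

end

theory Submission
  imports Defs
begin

text \<open>
  In the variables \<open>c = \<omega> u - i v\<close>, taken half a kick away from the grid points, one step of the integrator
  is a kick followed by a rotation. We attach frequency labels \<open>k\<close> to the components of \<open>c\<close>, so that
  the kick becomes a convolution in \<open>(j, k)\<close>. For each state, the nonresonant components and their
  forward differences in time are determined, by a contraction, as functions of the state: this is a
  modulated Fourier expansion recomputed at every time step instead of on patched intervals.
  Non-resonance provides the contraction, and uniqueness of its fixed point shows that the decomposition is
  carried by the labelled dynamics up to a tiny error per step.

  The labelled dynamics, truncated to the finite index set, conserves the actions
  \<open>\<Sum> k\<^sub>l \<bar>z\<bar>\<^sup>2 / \<omega>\<^sub>j\<close> exactly, because every monomial of its cubic potential has total label zero.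
  Hence these actions drift slowly along the trajectory. They agree with the mode energies up to terms
  that are quadratic in the solution. The weights contain a large constant \<open>\<Lambda>\<close> which makes the initial
  value small relative to the ball in which the contraction works, so that a continuity argument closes.
\<close>

subsection \<open>Forward differences\<close>

text \<open>The time scale comes from a balance of powers. With \<open>h\<close> = \<epsilon> powr
  (\<nu>/2) and \<open>p\<close> = \<Lambda> \<epsilon> powr ((1-\<nu>)/2), a component of cost c
  has weight \<open>p ^ c * h ^ c\<close> up to cost K but only \<open>p ^ c * h ^ K\<close> beyond
  it. A product of total cost above K therefore carries a spare factor \<open>h\<close>, and this
  factor pays for a divisor that loses 1/h. Since labels are cut at cost 2K, the defect per unit of
  time is of order p^(2K), that is \<epsilon> powr (K(1-\<nu>)). The total action divides it by (p
  h)^K, of order \<epsilon> powr (K/2). The quotient is \<epsilon> powr (K(1-2\<nu>)/2), the inverse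
  of the time scale.

  Hence forward differences take the place of time derivatives, and conservation of the actions has
  to hold exactly for a kick of finite length, including its terms of order \<tau> squared.\<close>

definition fdiff :: "real \<Rightarrow> (nat \<Rightarrow> complex) \<Rightarrow> nat \<Rightarrow> complex" where
  "fdiff t f m = (f (Suc m) - f m) / of_real t"

text \<open>Newton's forward interpolation, the discrete Taylor polynomial: its differences at 0 are
  \<open>a\<close> up to order \<open>n\<close> and 0 beyond (\<open>jet_newton\<close>).\<close>

definition newton :: "real \<Rightarrow> nat \<Rightarrow> (nat \<Rightarrow> complex) \<Rightarrow> nat \<Rightarrow> complex" where
  "newton t n a m = (\<Sum>i\<le>n. of_nat (m choose i) * of_real t ^ i * a i)"

text \<open>A majorant norm: differences that shrink by the factor 1/\<open>R\<close> per order
  count evenly, so \<open>R\<close> measures the time scale of the variation.\<close>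

definition jet_norm :: "nat \<Rightarrow> real \<Rightarrow> (nat \<Rightarrow> complex) \<Rightarrow> real" where
  "jet_norm n R a = (\<Sum>i\<le>n. R ^ i * norm (a i))"

abbreviation jet :: "real \<Rightarrow> (nat \<Rightarrow> complex) \<Rightarrow> nat \<Rightarrow> complex" where
  "jet t f i \<equiv> (fdiff t ^^ i) f 0"

lemma fdiff_newton_Suc:
  assumes "t \<noteq> 0"
  shows "fdiff t (newton t (Suc n) a) = newton t n (\<lambda>i. a (Suc i))"
proof
  fix m
  have "newton t (Suc n) a (Suc m) - newton t (Suc n) a m
      = (\<Sum>i\<le>Suc n. of_nat (Suc m choose i) * of_real t ^ i * a i - of_nat (m choose i) * of_real t ^ i * a i)"
    unfolding newton_def by (simp only: sum_subtractf)
  also have "\<dots> = (\<Sum>i\<le>n. of_nat (m choose i) * of_real t ^ Suc i * a (Suc i))"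
    by (subst sum.atMost_Suc_shift) (simp add: algebra_simps)
  also have "\<dots> = of_real t * newton t n (\<lambda>i. a (Suc i)) m"
    unfolding newton_def sum_distrib_left by (intro sum.cong) (simp_all add: algebra_simps)
  finally show "fdiff t (newton t (Suc n) a) m = newton t n (\<lambda>i. a (Suc i)) m"
    using assms by (simp add: fdiff_def)
qed

lemma fdiff_newton_0: "fdiff t (newton t 0 a) = (\<lambda>_. 0)"
  by (simp add: fdiff_def newton_def fun_eq_iff)

lemma newton_at_0: "newton t n a 0 = a 0"
  by (induction n) (simp_all add: newton_def)

lemma fdiff_pow_zero: "(fdiff t ^^ i) (\<lambda>_. 0) = (\<lambda>_. 0)"
  by (induction i) (simp_all add: fdiff_def fun_eq_iff)

lemma jet_newton:
  assumes "t \<noteq> 0"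
  shows "jet t (newton t n a) i = (if i \<le> n then a i else 0)"
proof (induction n arbitrary: i a)
  case 0
  show ?case
    by (cases i) (simp_all add: newton_at_0 funpow_Suc_right fdiff_newton_0 fdiff_pow_zero del: funpow.simps(2))
next
  case (Suc n)
  show ?case
    by (cases i) (simp_all add: newton_at_0 funpow_Suc_right fdiff_newton_Suc[OF assms] Suc del: funpow.simps(2))
qed

lemma newton_mono_nodes:
  assumes "m \<le> n"
  shows "newton t (Suc n) a m = newton t n a m"
  using assms by (simp add: newton_def)

text \<open>Since f(m+1) = f(m) + t \<Delta>f(m), a time step acts on the differences as
  \<open>a i + t * a (Suc i)\<close>. One more order is needed to describe the result;
  \<open>extended\<close> will provide it.\<close>

lemma newton_shift:
  assumes "m \<le> n" "t \<noteq> 0"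
  shows "newton t n (\<lambda>i. a i + of_real t * a (Suc i)) m = newton t (Suc n) a (Suc m)"
proof -
  have "newton t (Suc n) a (Suc m) = newton t (Suc n) a m + of_real t * fdiff t (newton t (Suc n) a) m"
    using assms by (simp add: fdiff_def)
  also have "\<dots> = newton t n a m + of_real t * newton t n (\<lambda>i. a (Suc i)) m"
    using assms by (simp add: newton_mono_nodes fdiff_newton_Suc)
  finally show ?thesis
    by (simp add: newton_def sum.distrib sum_distrib_left algebra_simps)
qed

lemma fdiff_pow_shift: "(fdiff t ^^ i) (\<lambda>m. f (Suc m)) m = (fdiff t ^^ i) f (Suc m)"
  by (induction i arbitrary: m) (simp_all add: fdiff_def)

lemma jet_shift:
  assumes "t \<noteq> 0"
  shows "jet t (\<lambda>m. f (Suc m)) i = jet t f i + of_real t * jet t f (Suc i)"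
  using assms by (simp add: fdiff_pow_shift) (simp add: fdiff_def)

lemma jet_cong_aux:
  assumes "\<And>m. m \<le> i + k \<Longrightarrow> f m = g m"
  shows "(fdiff t ^^ i) f k = (fdiff t ^^ i) g k"
  using assms
proof (induction i arbitrary: k)
  case (Suc i)
  from Suc.IH[of k] Suc.IH[of "Suc k"] Suc.prems show ?case by (simp add: fdiff_def)
qed simp

text \<open>A difference of order i at 0 reads only the nodes 0, ..., i, where interpolants of
  higher order agree.\<close>

lemma jet_cong:
  assumes "\<And>m. m \<le> i \<Longrightarrow> f m = g m"
  shows "jet t f i = jet t g i"
  using assms by (intro jet_cong_aux) simp

lemma fdiff_pow_add: "(fdiff t ^^ i) (\<lambda>m. f m + g m) = (\<lambda>m. (fdiff t ^^ i) f m + (fdiff t ^^ i) g m)"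
  by (induction i) (simp_all add: fdiff_def fun_eq_iff add_divide_distrib diff_divide_distrib)

lemma fdiff_pow_cmult: "(fdiff t ^^ i) (\<lambda>m. c * f m) = (\<lambda>m. c * (fdiff t ^^ i) f m)"
  by (induction i) (simp_all add: fdiff_def fun_eq_iff right_diff_distrib)

lemma fdiff_pow_diff: "(fdiff t ^^ i) (\<lambda>m. f m - g m) = (\<lambda>m. (fdiff t ^^ i) f m - (fdiff t ^^ i) g m)"
  using fdiff_pow_add[of i t f "\<lambda>m. (-1) * g m"] unfolding fdiff_pow_cmult by simp

lemma fdiff_pow_sum: "(fdiff t ^^ i) (\<lambda>m. \<Sum>x\<in>A. f x m) = (\<lambda>m. \<Sum>x\<in>A. (fdiff t ^^ i) (f x) m)"
proof (induction A rule: infinite_finite_induct)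
  case (insert x F)
  then show ?case by (simp add: fdiff_pow_add)
qed (simp_all add: fdiff_pow_zero)

lemma jet_norm_nonneg: "R \<ge> 0 \<Longrightarrow> jet_norm n R a \<ge> 0"
  unfolding jet_norm_def by (intro sum_nonneg) simp

lemma jet_norm_add: "R \<ge> 0 \<Longrightarrow> jet_norm n R (\<lambda>i. a i + b i) \<le> jet_norm n R a + jet_norm n R b"
  unfolding jet_norm_def sum.distrib[symmetric]
  by (intro sum_mono) (simp add: distrib_left[symmetric] mult_left_mono norm_triangle_ineq)

lemma jet_norm_cmult: "jet_norm n R (\<lambda>i. c * a i) = norm c * jet_norm n R a"
  unfolding jet_norm_def sum_distrib_left by (simp add: norm_mult algebra_simps)

lemma jet_norm_sum: "R \<ge> 0 \<Longrightarrow> jet_norm n R (\<lambda>i. \<Sum>x\<in>A. a x i) \<le> (\<Sum>x\<in>A. jet_norm n R (a x))"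
proof (induction A rule: infinite_finite_induct)
  case (insert x F)
  then show ?case using jet_norm_add[of R n "a x" "\<lambda>i. \<Sum>x\<in>F. a x i"] by simp
qed (simp_all add: jet_norm_def)

lemma jet_norm_Suc: "jet_norm (Suc n) R a = norm (a 0) + R * jet_norm n R (\<lambda>i. a (Suc i))"
  unfolding jet_norm_def by (subst sum.atMost_Suc_shift) (simp add: sum_distrib_left algebra_simps)

lemma jet_norm_mono_n: "R \<ge> 0 \<Longrightarrow> m \<le> n \<Longrightarrow> jet_norm m R a \<le> jet_norm n R a"
  unfolding jet_norm_def by (intro sum_mono2) auto

lemma jet_norm_mono_R: "0 \<le> R' \<Longrightarrow> R' \<le> R \<Longrightarrow> jet_norm n R' a \<le> jet_norm n R a"
  unfolding jet_norm_def by (intro sum_mono mult_right_mono power_mono) auto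

lemma norm_le_jet_norm: "R \<ge> 0 \<Longrightarrow> i \<le> n \<Longrightarrow> R ^ i * norm (a i) \<le> jet_norm n R a"
  unfolding jet_norm_def by (rule member_le_sum) auto

text \<open>The discrete product rule has the extra term t \<Delta>f \<Delta>g, which t \<le>
  \<open>R\<close> keeps under control. The three terms of the rule and the value at 0 make the
  factor 4 per order.\<close>

lemma jet_norm_mult:
  assumes "0 < t" "t \<le> R"
  shows "jet_norm n R (jet t (\<lambda>m. f m * g m)) \<le> 4 ^ n * jet_norm n R (jet t f) * jet_norm n R (jet t g)"
proof (induction n arbitrary: f g)
  case 0
  show ?case by (simp add: jet_norm_def norm_mult)
next
  case (Suc n)
  have R: "R \<ge> 0" using assms by simp
  let ?J = "\<lambda>f. jet_norm n R (jet t f)"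
  let ?J' = "\<lambda>f. jet_norm (Suc n) R (jet t f)"
  have S: "?J' f = norm (f 0) + R * ?J (fdiff t f)" for f
    by (simp add: jet_norm_Suc funpow_Suc_right del: funpow.simps(2))
  have nn: "?J f \<ge> 0" for f using jet_norm_nonneg R by blast
  have 1: "R * ?J (fdiff t f) \<le> ?J' f" for f using S by simp
  have 2: "?J f \<le> ?J' f" for f using R by (intro jet_norm_mono_n) auto
  have 3: "norm (f 0) \<le> ?J' f" for f using S R nn by simp
  have "fdiff t (\<lambda>m. f m * g m)
      = (\<lambda>m. (fdiff t f m * g m + f m * fdiff t g m) + of_real t * (fdiff t f m * fdiff t g m))"
    using assms by (auto simp: fdiff_def fun_eq_iff field_simps)
  then have "?J (fdiff t (\<lambda>m. f m * g m)) \<le> ?J (\<lambda>m. fdiff t f m * g m) + ?J (\<lambda>m. f m * fdiff t g m)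
      + t * ?J (\<lambda>m. fdiff t f m * fdiff t g m)"
    using jet_norm_add[OF R, of n "jet t (\<lambda>m. fdiff t f m * g m + f m * fdiff t g m)" "\<lambda>i. of_real t * jet t (\<lambda>m. fdiff t f m * fdiff t g m) i"]
      jet_norm_add[OF R, of n "jet t (\<lambda>m. fdiff t f m * g m)" "jet t (\<lambda>m. f m * fdiff t g m)"] assms
    by (simp add: fdiff_pow_add fdiff_pow_cmult jet_norm_cmult)
  also have "\<dots> \<le> 4 ^ n * ?J (fdiff t f) * ?J g + 4 ^ n * ?J f * ?J (fdiff t g)
      + R * (4 ^ n * ?J (fdiff t f) * ?J (fdiff t g))"
    using Suc.IH assms nn by (intro add_mono mult_mono) auto
  finally have "R * ?J (fdiff t (\<lambda>m. f m * g m)) \<le> 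
      R * (4 ^ n * ?J (fdiff t f) * ?J g + 4 ^ n * ?J f * ?J (fdiff t g)
      + R * (4 ^ n * ?J (fdiff t f) * ?J (fdiff t g)))"
    using R by (rule mult_left_mono)
  also have "\<dots> = 4 ^ n * ((R * ?J (fdiff t f)) * ?J g + ?J f * (R * ?J (fdiff t g)) 
      + (R * ?J (fdiff t f)) * (R * ?J (fdiff t g)))"
    by (simp add: algebra_simps)
  also have "\<dots> \<le> 4 ^ n * (?J' f * ?J' g + ?J' f * ?J' g + ?J' f * ?J' g)"
    using 1 2 nn R by (intro mult_left_mono add_mono mult_mono) (auto intro: order_trans[OF nn 2])
  finally have 4: "R * ?J (fdiff t (\<lambda>m. f m * g m)) \<le> 4 ^ n * (3 * (?J' f * ?J' g))" by simp
  have "norm (f 0 * g 0) \<le> ?J' f * ?J' g"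
    unfolding norm_mult using 3 by (intro mult_mono) (auto intro: order_trans[OF norm_ge_zero 3])
  also have "\<dots> \<le> 4 ^ n * (?J' f * ?J' g)"
  proof -
    have "1 * (?J' f * ?J' g) \<le> 4 ^ n * (?J' f * ?J' g)"
      using order_trans[OF nn[of f] 2] order_trans[OF nn[of g] 2] by (intro mult_right_mono) auto
    then show ?thesis by simp
  qed
  finally show ?case unfolding S[of "\<lambda>m. f m * g m"] using 4 by simp
qed

subsection \<open>Convolution in weighted sequence spaces\<close>

lemma mode_rep_in: "M > 0 \<Longrightarrow> mode_rep M i \<in> modes M"
  using pos_mod_bound[of "2*M" "i+M"] pos_mod_sign[of "2*M" "i+M"]
  by (auto simp: mode_rep_def modes_def simp del: pos_mod_bound pos_mod_sign)

lemma mode_rep_id: "i \<in> modes M \<Longrightarrow> mode_rep M i = i"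
  by (auto simp: mode_rep_def modes_def)

lemma cong_mode_rep: "[mode_rep M i = i] (mod 2 * M)"
  by (simp add: mode_rep_def cong_def mod_simps)

lemma mode_rep_eq_iff: "mode_rep M i = mode_rep M j \<longleftrightarrow> [i = j] (mod 2 * M)"
  unfolding mode_rep_def by (auto simp: cong_def) (metis add_diff_cancel_right' mod_diff_left_eq, metis mod_add_left_eq)

lemma mode_rep_add_left: "mode_rep M (mode_rep M i + j) = mode_rep M (i + j)"
  by (simp add: mode_rep_eq_iff cong_add cong_mode_rep)
lemma mode_rep_add_right: "mode_rep M (i + mode_rep M j) = mode_rep M (i + j)"
  by (simp add: mode_rep_eq_iff cong_add cong_mode_rep)
lemma mode_rep_diff_left: "mode_rep M (mode_rep M i - j) = mode_rep M (i - j)"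
  by (simp add: mode_rep_eq_iff cong_diff cong_mode_rep)
lemma mode_rep_diff_right: "mode_rep M (i - mode_rep M j) = mode_rep M (i - j)"
  by (simp add: mode_rep_eq_iff cong_diff cong_mode_rep)
lemma mode_rep_minus: "mode_rep M (- mode_rep M j) = mode_rep M (- j)"
  using mode_rep_diff_right[of M 0 j] by simp

lemmas mode_rep_simps = mode_rep_add_left mode_rep_add_right mode_rep_diff_left mode_rep_diff_right mode_rep_minus

text \<open>Each class has a representative of least absolute value in
  \<open>modes M\<close>.\<close>

lemma abs_mode_rep_le: 
  assumes "M > 0" shows "\<bar>mode_rep M i\<bar> \<le> \<bar>i\<bar>"
proof (cases "i \<in> modes M")
  case False
  then show ?thesis using mode_rep_in[OF assms, of i] by (auto simp: modes_def)
qed (simp add: mode_rep_id)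

text \<open>Using the bound for both signs avoids a separate treatment of the mode -M, whose
  negative is again represented by -M.\<close>

lemma abs_mode_rep_minus: 
  assumes "M > 0" shows "\<bar>mode_rep M (- i)\<bar> = \<bar>mode_rep M i\<bar>"
proof -
  have *: "\<bar>mode_rep M (- i)\<bar> \<le> \<bar>mode_rep M i\<bar>" for i
    using abs_mode_rep_le[OF assms, of "- mode_rep M i"] by (simp add: mode_rep_simps)
  from *[of i] *[of "-i"] show ?thesis by simp
qed

lemma finite_modes [simp]: "finite (modes M)" by (simp add: modes_def)

lemma bij_mode_rep_diff: "M > 0 \<Longrightarrow> bij_betw (\<lambda>j. mode_rep M (j - i)) (modes M) (modes M)"
  by (rule bij_betwI[where g = "\<lambda>j. mode_rep M (j + i)"]) (auto simp: mode_rep_in mode_rep_simps mode_rep_id)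

lemma bij_mode_rep_rdiff: "M > 0 \<Longrightarrow> bij_betw (\<lambda>j. mode_rep M (i - j)) (modes M) (modes M)"
  by (rule bij_betwI[where g = "\<lambda>j. mode_rep M (i - j)"]) (auto simp: mode_rep_in mode_rep_simps mode_rep_id)

lemma bij_mode_rep_uminus: "M > 0 \<Longrightarrow> bij_betw (\<lambda>j. mode_rep M (- j)) (modes M) (modes M)"
  using bij_mode_rep_rdiff[of M 0] by simp

lemma L2_set_reindex:
  assumes "bij_betw g A B" shows "L2_set (\<lambda>x. f (g x)) A = L2_set f B"
  unfolding L2_set_def using sum.reindex_bij_betw[OF assms, of "\<lambda>x. (f x)\<^sup>2"] by simp

section \<open>Sobolev weights and the algebra property on the cyclic group\<close>

definition sobolev_root :: "real \<Rightarrow> int \<Rightarrow> real" where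
  "sobolev_root s j = real_of_int (max \<bar>j\<bar> 1) powr s"

lemma sobolev_root_sq: "(sobolev_root s j)\<^sup>2 = sobolev_weight s j"
  by (simp add: sobolev_root_def sobolev_weight_def power2_eq_square powr_add[symmetric])

lemma sobolev_root_ge_1: "s \<ge> 0 \<Longrightarrow> sobolev_root s j \<ge> 1"
  unfolding sobolev_root_def by (intro ge_one_powr_ge_zero) auto

lemma sobolev_root_cong_abs: "\<bar>i\<bar> = \<bar>j\<bar> \<Longrightarrow> sobolev_root s i = sobolev_root s j"
  by (simp add: sobolev_root_def)

definition sobolev_sum :: "real \<Rightarrow> real" where
  "sobolev_sum s = 1 + 2 * (\<Sum>n. real (Suc n) powr (- 2 * s))"

text \<open>Here s > 1/2 enters: the full series converges, which makes the bound uniform in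
  M.\<close>

lemma sum_inverse_sobolev:
  assumes "s > 1/2"
  shows "(\<Sum>j\<in>modes M. 1 / sobolev_weight s j) \<le> sobolev_sum s"
proof -
  let ?f = "\<lambda>n. real (Suc n) powr (- 2 * s)"
  have "summable (\<lambda>n. real n powr (-2 * s))" using assms by (subst summable_real_powr_iff) auto
  then have sm: "summable ?f" by (subst summable_Suc_iff)
  have e: "1 / sobolev_weight s j = real_of_int (max \<bar>j\<bar> 1) powr (-2 * s)" for j
    by (simp add: sobolev_weight_def powr_minus_divide)
  have im: "(\<Sum>j\<in>(\<lambda>n. c * int (Suc n)) ` {..<nat M}. 1 / sobolev_weight s j) \<le> (\<Sum>n. ?f n)" if "\<bar>c\<bar> = 1" for c :: int
  proof -
    have "inj_on (\<lambda>n. c * int (Suc n)) {..<nat M}" using that by (auto simp: inj_on_def)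
    then have "(\<Sum>j\<in>(\<lambda>n. c * int (Suc n)) ` {..<nat M}. 1 / sobolev_weight s j) = (\<Sum>n<nat M. ?f n)"
      using that by (auto simp: sum.reindex e abs_mult max_def simp flip: of_int_abs intro!: sum.cong)
    also have "\<dots> \<le> (\<Sum>n. ?f n)" by (rule sum_le_suminf[OF sm]) auto
    finally show ?thesis .
  qed
  have "modes M \<subseteq> {0} \<union> ((\<lambda>n. 1 * int (Suc n)) ` {..<nat M} \<union> (\<lambda>n. (-1) * int (Suc n)) ` {..<nat M})"
  proof
    fix j assume j: "j \<in> modes M"
    show "j \<in> {0} \<union> ((\<lambda>n. 1 * int (Suc n)) ` {..<nat M} \<union> (\<lambda>n. (-1) * int (Suc n)) ` {..<nat M})"
    proof (cases "j = 0")
      case False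
      then show ?thesis using j
        by (cases "j > 0") (auto simp: modes_def image_iff intro!: bexI[of _ "nat (\<bar>j\<bar> - 1)"])
    qed simp
  qed
  then have "(\<Sum>j\<in>modes M. 1 / sobolev_weight s j) \<le> 
     (\<Sum>j\<in>{0} \<union> ((\<lambda>n. 1 * int (Suc n)) ` {..<nat M} \<union> (\<lambda>n. (-1) * int (Suc n)) ` {..<nat M}). 1 / sobolev_weight s j)"
    by (intro sum_mono2) (auto simp: e)
  also have "\<dots> \<le> (\<Sum>j\<in>{0}. 1 / sobolev_weight s j) + ((\<Sum>j\<in>(\<lambda>n. 1 * int (Suc n)) ` {..<nat M}. 1 / sobolev_weight s j)
      + (\<Sum>j\<in>(\<lambda>n. (-1) * int (Suc n)) ` {..<nat M}. 1 / sobolev_weight s j))"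
    (is "sum ?h (?A \<union> (?B \<union> ?C)) \<le> _")
  proof -
    have un: "sum ?h (A \<union> B) \<le> sum ?h A + sum ?h B" if "finite A" "finite B" for A B
      using sum.union_inter[OF that, of ?h] sum_nonneg[of "A \<inter> B" ?h] by (auto simp: e)
    have "sum ?h (?A \<union> (?B \<union> ?C)) \<le> sum ?h ?A + sum ?h (?B \<union> ?C)" by (rule un) auto
    also have "sum ?h (?B \<union> ?C) \<le> sum ?h ?B + sum ?h ?C" by (rule un) auto
    finally show ?thesis by simp
  qed
  also have "\<dots> \<le> 1 + ((\<Sum>n. ?f n) + (\<Sum>n. ?f n))"
    by (intro add_mono im) (auto simp: e)
  finally show ?thesis by (simp add: sobolev_sum_def)
qed

definition conv_const :: "real \<Rightarrow> real" where
  "conv_const s = 2 powr s * 2 * sqrt (sobolev_sum s)"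

lemma sobolev_root_triangle:
  assumes "s \<ge> 0" "M > 0" and that: "j \<in> modes M"
  shows "sobolev_root s j \<le> 2 powr s * (sobolev_root s i + sobolev_root s (mode_rep M (j - i)))"
proof -
  let ?i = "real_of_int (max \<bar>i\<bar> 1)" let ?k = "real_of_int (max \<bar>mode_rep M (j - i)\<bar> 1)"
  have "\<bar>mode_rep M (i + mode_rep M (j - i))\<bar> \<le> \<bar>i + mode_rep M (j - i)\<bar>" using abs_mode_rep_le assms by blast
  then have "\<bar>j\<bar> \<le> \<bar>i\<bar> + \<bar>mode_rep M (j - i)\<bar>" using that by (simp add: mode_rep_simps mode_rep_id)
  then have "max \<bar>j\<bar> 1 \<le> 2 * max (max \<bar>i\<bar> 1) (max \<bar>mode_rep M (j - i)\<bar> 1)" by linarith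
  then have "real_of_int (max \<bar>j\<bar> 1) \<le> real_of_int (2 * max (max \<bar>i\<bar> 1) (max \<bar>mode_rep M (j - i)\<bar> 1))"
    by (simp only: of_int_le_iff)
  also have "\<dots> = 2 * max ?i ?k" by (simp only: of_int_mult of_int_max of_int_numeral)
  finally have *: "real_of_int (max \<bar>j\<bar> 1) \<le> 2 * max ?i ?k" .
  have "sobolev_root s j \<le> (2 * max ?i ?k) powr s"
    unfolding sobolev_root_def by (rule powr_mono2[OF assms(1) _ *]) simp
  also have "\<dots> = 2 powr s * (max ?i ?k) powr s" by (rule powr_mult)
  also have "(max ?i ?k) powr s \<le> ?i powr s + ?k powr s" by (auto simp: max_def)
  finally show ?thesis by (simp add: sobolev_root_def)
qed

text \<open>The Sobolev norm is an algebra norm up to a constant that does not depend on M: the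
  weight of j is split between i and j - i, and Cauchy-Schwarz spends the summable inverse weight of
  the factor that did not receive it.\<close>

lemma L2_conv:
  fixes A B :: "int \<Rightarrow> real"
  assumes s: "s > 1/2" and M: "M > 0" and A: "\<And>j. A j \<ge> 0" and B: "\<And>j. B j \<ge> 0"
  shows "L2_set (\<lambda>j. sobolev_root s j * (\<Sum>i\<in>modes M. A i * B (mode_rep M (j - i)))) (modes M)
     \<le> conv_const s * L2_set (\<lambda>j. sobolev_root s j * A j) (modes M) * L2_set (\<lambda>j. sobolev_root s j * B j) (modes M)"
proof -
  let ?g = "sobolev_root s" let ?r = "mode_rep M"
  define a where "a = (\<lambda>j. ?g j * A j)"
  define b where "b = (\<lambda>j. ?g j * B j)"
  have g0: "?g j > 0" for j using sobolev_root_ge_1[of s j] s by simp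
  have ab: "a j \<ge> 0" "b j \<ge> 0" for j using A B g0 by (simp_all add: a_def b_def less_imp_le)
  have S0: "sobolev_sum s \<ge> 0"
    using order_trans[OF sum_nonneg sum_inverse_sobolev[OF s, of 1]] by (auto simp: sobolev_weight_def)
  have inv: "(\<Sum>i\<in>modes M. (1 / ?g i)\<^sup>2) \<le> sobolev_sum s"
    using sum_inverse_sobolev[OF s, of M] by (simp add: power_divide sobolev_root_sq)
  have inv2: "(\<Sum>i\<in>modes M. (1 / ?g (?r (j - i)))\<^sup>2) \<le> sobolev_sum s" for j
    using inv sum.reindex_bij_betw[OF bij_mode_rep_rdiff[OF M, of j], of "\<lambda>i. (1 / ?g i)\<^sup>2"] by simp
  have pt: "(?g j * (\<Sum>i\<in>modes M. A i * B (?r (j - i))))\<^sup>2 \<le>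
       (2 powr s)\<^sup>2 * 4 * sobolev_sum s * (\<Sum>i\<in>modes M. (a i)\<^sup>2 * (b (?r (j - i)))\<^sup>2)" if j: "j \<in> modes M" for j
  proof -
    let ?c = "\<lambda>i. 1 / ?g i + 1 / ?g (?r (j - i))"
    have "?g j * (\<Sum>i\<in>modes M. A i * B (?r (j - i))) \<le> (\<Sum>i\<in>modes M. 2 powr s * (?c i * (a i * b (?r (j - i)))))"
      unfolding sum_distrib_left
    proof (rule sum_mono)
      fix i
      have "?g j * (A i * B (?r (j - i))) \<le> 2 powr s * (?g i + ?g (?r (j - i))) * (A i * B (?r (j - i)))"
        using sobolev_root_triangle[of s M j i] M j s A B by (intro mult_right_mono) auto
      also have "\<dots> = 2 powr s * (?c i * (a i * b (?r (j - i))))"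
        using g0[of i] g0[of "?r (j - i)"] by (simp add: a_def b_def field_simps)
      finally show "?g j * (A i * B (?r (j - i))) \<le> \<dots>" .
    qed
    also have "\<dots> = 2 powr s * (\<Sum>i\<in>modes M. \<bar>?c i\<bar> * \<bar>a i * b (?r (j - i))\<bar>)"
      unfolding sum_distrib_left using ab g0 by (intro sum.cong) (auto simp: abs_of_nonneg less_imp_le)
    also have "\<dots> \<le> 2 powr s * (L2_set ?c (modes M) * L2_set (\<lambda>i. a i * b (?r (j - i))) (modes M))"
      by (intro mult_left_mono L2_set_mult_ineq) simp
    finally have "(?g j * (\<Sum>i\<in>modes M. A i * B (?r (j - i))))\<^sup>2 \<le> 
      (2 powr s * (L2_set ?c (modes M) * L2_set (\<lambda>i. a i * b (?r (j - i))) (modes M)))\<^sup>2"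
      using A B g0 by (intro power_mono mult_nonneg_nonneg sum_nonneg) (auto simp: less_imp_le)
    also have "\<dots> = (2 powr s)\<^sup>2 * (L2_set ?c (modes M))\<^sup>2 * (\<Sum>i\<in>modes M. (a i)\<^sup>2 * (b (?r (j - i)))\<^sup>2)"
      by (simp add: power_mult_distrib L2_set_def sum_nonneg)
    also have "(L2_set ?c (modes M))\<^sup>2 \<le> (L2_set (\<lambda>i. 1 / ?g i) (modes M) + L2_set (\<lambda>i. 1 / ?g (?r (j - i))) (modes M))\<^sup>2"
      by (intro power_mono L2_set_triangle_ineq) simp
    also have "\<dots> \<le> (2 * sqrt (sobolev_sum s))\<^sup>2"
      using inv inv2[of j] by (intro power_mono) (auto simp: L2_set_def sum_nonneg intro!: add_mono[of _ "sqrt (sobolev_sum s)" _ "sqrt (sobolev_sum s)", simplified])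
    also have "\<dots> = 4 * sobolev_sum s" using S0 by (simp add: power_mult_distrib)
    finally show ?thesis by (simp add: mult_right_mono mult_left_mono sum_nonneg mult.assoc)
  qed
  have "(\<Sum>j\<in>modes M. (?g j * (\<Sum>i\<in>modes M. A i * B (?r (j - i))))\<^sup>2)
     \<le> (\<Sum>j\<in>modes M. (2 powr s)\<^sup>2 * 4 * sobolev_sum s * (\<Sum>i\<in>modes M. (a i)\<^sup>2 * (b (?r (j - i)))\<^sup>2))"
    by (rule sum_mono[OF pt])
  also have "\<dots> = (2 powr s)\<^sup>2 * 4 * sobolev_sum s * (\<Sum>i\<in>modes M. (a i)\<^sup>2 * (\<Sum>j\<in>modes M. (b (?r (j - i)))\<^sup>2))"
    unfolding sum_distrib_left[symmetric] by (subst sum.swap) (simp add: sum_distrib_left)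
  also have "\<dots> = (2 powr s)\<^sup>2 * 4 * sobolev_sum s * (\<Sum>i\<in>modes M. (a i)\<^sup>2 * (\<Sum>j\<in>modes M. (b j)\<^sup>2))"
    using sum.reindex_bij_betw[OF bij_mode_rep_diff[OF M], of "\<lambda>j. (b j)\<^sup>2"] by simp
  also have "\<dots> = (2 powr s)\<^sup>2 * 4 * sobolev_sum s * ((\<Sum>i\<in>modes M. (a i)\<^sup>2) * (\<Sum>j\<in>modes M. (b j)\<^sup>2))"
    by (simp add: sum_distrib_right)
  finally have "L2_set (\<lambda>j. ?g j * (\<Sum>i\<in>modes M. A i * B (?r (j - i)))) (modes M) \<le>
     sqrt ((2 powr s)\<^sup>2 * 4 * sobolev_sum s * ((\<Sum>i\<in>modes M. (a i)\<^sup>2) * (\<Sum>j\<in>modes M. (b j)\<^sup>2)))"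
    unfolding L2_set_def by (rule real_sqrt_le_mono)
  also have "\<dots> = conv_const s * L2_set a (modes M) * L2_set b (modes M)"
    by (simp add: conv_const_def L2_set_def real_sqrt_mult)
  finally show ?thesis by (simp add: a_def b_def)
qed

subsection \<open>A contraction principle for families with finite index set\<close>

text \<open>Banach's iteration from 0 for a seminorm that sees only the coordinates in
  \<open>S\<close>. By \<open>dom\<close> the iterates are Cauchy in each coordinate, and
  \<open>lim\<close> turns coordinatewise convergence into convergence in \<open>P\<close>, in place
  of completeness.\<close>

lemma contraction_fixpoint:
  fixes T :: "('a \<Rightarrow> complex) \<Rightarrow> ('a \<Rightarrow> complex)" and P :: "('a \<Rightarrow> complex) \<Rightarrow> real"
  assumes nonneg: "\<And>z. P z \<ge> 0"
    and dom: "\<And>z x. x \<in> S \<Longrightarrow> norm (z x) \<le> C * P z"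
    and tri: "\<And>z z'. P (\<lambda>x. z x + z' x) \<le> P z + P z'"
    and zero: "P (\<lambda>_. 0) = 0"
    and lim: "\<And>Z. (\<And>x. x \<in> S \<Longrightarrow> (\<lambda>n. Z n x) \<longlonglongrightarrow> 0) \<Longrightarrow> (\<lambda>n. P (Z n)) \<longlonglongrightarrow> 0"
    and contr: "\<And>z z'. P z \<le> r \<Longrightarrow> P z' \<le> r \<Longrightarrow> P (\<lambda>x. T z x - T z' x) \<le> P (\<lambda>x. z x - z' x) / 2"
    and start: "2 * P (T (\<lambda>_. 0)) \<le> r"
  shows "\<exists>z. (\<forall>x\<in>S. T z x = z x) \<and> P z \<le> 2 * P (T (\<lambda>_. 0))"
proof -
  define q where "q = P (T (\<lambda>_. 0))"
  define Z where "Z = (\<lambda>n. (T ^^ n) (\<lambda>_. 0))"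
  have Z0: "Z 0 = (\<lambda>_. 0)" and ZS: "Z (Suc n) = T (Z n)" for n by (simp_all add: Z_def)
  have q0: "q \<ge> 0" using nonneg q_def by simp
  have tri3: "P (\<lambda>x. a x - c x) \<le> P (\<lambda>x. a x - b x) + P (\<lambda>x. b x - c x)" for a b c
    using tri[of "\<lambda>x. a x - b x" "\<lambda>x. b x - c x"] by simp
  \<comment> \<open>The geometric sum of the increments stays below 2 * \<open>q\<close>, so no
    iterate leaves the ball where \<open>T\<close> contracts.\<close>
  have step: "P (Z n) \<le> 2 * q - q / 2 ^ n * 2 \<and> P (\<lambda>x. Z (Suc n) x - Z n x) \<le> q / 2 ^ n" for n
  proof (induction n)
    case 0
    then show ?case by (simp add: Z0 ZS zero q_def)
  next
    case (Suc n)
    have "P (Z (Suc n)) \<le> P (\<lambda>x. Z (Suc n) x - Z n x) + P (Z n)"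
      using tri[of "\<lambda>x. Z (Suc n) x - Z n x" "Z n"] by simp
    then have a: "P (Z (Suc n)) \<le> 2 * q - q / 2 ^ Suc n * 2" using conjunct1[OF Suc.IH] conjunct2[OF Suc.IH] by simp
    have pos: "q / 2 ^ i * 2 \<ge> 0" for i using q0 by simp
    have b: "P (Z n) \<le> r" using conjunct1[OF Suc.IH] start pos[of n] unfolding q_def by linarith
    have c: "P (Z (Suc n)) \<le> r" using a start pos[of "Suc n"] unfolding q_def by linarith
    have "P (\<lambda>x. Z (Suc (Suc n)) x - Z (Suc n) x) \<le> P (\<lambda>x. Z (Suc n) x - Z n x) / 2"
      using contr[OF c b] by (simp only: ZS)
    with Suc a show ?case by simp
  qed
  have bound: "P (Z n) \<le> 2 * q" for n
  proof -
    have "q / 2 ^ n * 2 \<ge> 0" using q0 by simp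
    then show ?thesis using step[of n] by linarith
  qed
  have far: "P (\<lambda>x. Z (n + m) x - Z n x) \<le> 2 * q / 2 ^ n - 2 * q / 2 ^ (n + m)" for n m
  proof (induction m)
    case 0
    then show ?case using zero by simp
  next
    case (Suc m)
    have "P (\<lambda>x. Z (n + Suc m) x - Z n x) \<le> q / 2 ^ (n + m) + (2 * q / 2 ^ n - 2 * q / 2 ^ (n + m))"
      using tri3[of "Z (n + Suc m)" "Z n" "Z (n+m)"] step[of "n+m"] Suc by simp
    then show ?case by (simp add: field_simps)
  qed
  have far': "P (\<lambda>x. Z (n + m) x - Z n x) \<le> 2 * q / 2 ^ n" for n m
  proof -
    have "0 \<le> 2 * q / 2 ^ (n + m)" using q0 by simp
    with far[of n m] show ?thesis by linarith
  qed
  have conv: "\<exists>l. (\<lambda>n. Z n x) \<longlonglongrightarrow> l" if x: "x \<in> S" for x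
  proof -
    have "Cauchy (\<lambda>n. Z n x)"
    proof (rule metric_CauchyI)
      fix e :: real assume e: "e > 0"
      have "(\<lambda>n. \<bar>C\<bar> * (2 * q) * (1 / 2) ^ n) \<longlonglongrightarrow> \<bar>C\<bar> * (2 * q) * 0"
        by (intro tendsto_intros LIMSEQ_power_zero) auto
      then have "\<forall>\<^sub>F n in sequentially. \<bar>C\<bar> * (2 * q) * (1 / 2) ^ n < e / 2"
        using e by (intro order_tendstoD(2)) auto
      then obtain n0 where n0: "\<bar>C\<bar> * (2 * q) * (1 / 2) ^ n0 < e / 2" by (auto simp: eventually_sequentially)
      have d: "norm (Z n x - Z n0 x) < e / 2" if "n \<ge> n0" for n
      proof -
        have "norm (Z n x - Z n0 x) \<le> C * P (\<lambda>x. Z n x - Z n0 x)" using dom[OF x, of "\<lambda>x. Z n x - Z n0 x"] .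
        also have "\<dots> \<le> \<bar>C\<bar> * (2 * q / 2 ^ n0)"
          using far'[of n0 "n - n0"] that nonneg by (intro mult_mono) auto
        also have "\<dots> < e / 2" using n0 by (simp add: power_one_over)
        finally show ?thesis .
      qed
      show "\<exists>M. \<forall>m\<ge>M. \<forall>n\<ge>M. dist (Z m x) (Z n x) < e"
        using d by (intro exI[of _ n0]) (metis dist_triangle_half_l dist_norm norm_minus_commute)
    qed
    then show ?thesis by (simp add: Cauchy_convergent_iff convergent_def)
  qed
  then obtain l where l: "\<And>x. x \<in> S \<Longrightarrow> (\<lambda>n. Z n x) \<longlonglongrightarrow> l x" by metis
  have lP: "(\<lambda>n. P (\<lambda>x. l x - Z n x)) \<longlonglongrightarrow> 0"
  proof (rule lim)
    fix x assume "x \<in> S"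
    from tendsto_diff[OF tendsto_const[of "l x"] l[OF this]] show "(\<lambda>n. l x - Z n x) \<longlonglongrightarrow> 0" by simp
  qed
  have lb: "P l \<le> 2 * q"
  proof -
    have "P l \<le> P (\<lambda>x. l x - Z n x) + 2 * q" for n
      using tri[of "\<lambda>x. l x - Z n x" "Z n"] bound[of n] by simp
    moreover have "(\<lambda>n. P (\<lambda>x. l x - Z n x) + 2 * q) \<longlonglongrightarrow> 0 + 2 * q" by (intro tendsto_intros lP)
    ultimately show ?thesis by (intro LIMSEQ_le_const[where a = "P l"]) auto
  qed
  have "T l x = l x" if x: "x \<in> S" for x
  proof -
    have le: "norm (T l x - Z (Suc n) x) \<le> \<bar>C\<bar> * (P (\<lambda>x. l x - Z n x) / 2)" for n
    proof -
      have "norm (T l x - Z (Suc n) x) \<le> C * P (\<lambda>x. T l x - T (Z n) x)"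
        using dom[OF x, of "\<lambda>x. T l x - T (Z n) x"] by (simp add: ZS)
      also have "\<dots> \<le> \<bar>C\<bar> * (P (\<lambda>x. l x - Z n x) / 2)"
        using contr[of l "Z n"] lb bound[of n] start nonneg by (intro mult_mono) (auto simp: q_def)
      finally show ?thesis .
    qed
    have "(\<lambda>n. \<bar>C\<bar> * (P (\<lambda>x. l x - Z n x) / 2)) \<longlonglongrightarrow> \<bar>C\<bar> * (0 / 2)" by (intro tendsto_intros lP) simp
    then have "(\<lambda>n. \<bar>C\<bar> * (P (\<lambda>x. l x - Z n x) / 2)) \<longlonglongrightarrow> 0" by simp
    from Lim_null_comparison[OF _ this, of "\<lambda>n. T l x - Z (Suc n) x"] le
    have "(\<lambda>n. T l x - Z (Suc n) x) \<longlonglongrightarrow> 0" by simp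
    from tendsto_diff[OF tendsto_const[of "T l x"] this]
    have "(\<lambda>n. Z (Suc n) x) \<longlonglongrightarrow> T l x" by simp
    moreover have "(\<lambda>n. Z (Suc n) x) \<longlonglongrightarrow> l x" using l[OF x] by (rule LIMSEQ_Suc)
    ultimately show ?thesis by (rule LIMSEQ_unique)
  qed
  then show ?thesis using lb by (auto simp: q_def)
qed

subsection \<open>Frequency labels\<close>

type_synonym label = "int \<times> (int \<Rightarrow> int)"

locale label_costs =
  fixes K M :: int
  assumes K3: "K \<ge> 3" and MK: "M \<ge> K"
begin

definition high_sum :: "(int \<Rightarrow> int) \<Rightarrow> int" where
  "high_sum k = (\<Sum>l=K..M. \<bar>k l\<bar>)"

definition low_cost :: "(int \<Rightarrow> int) \<Rightarrow> int" where
  "low_cost k = (\<Sum>l\<in>{0..<K}. \<bar>k l\<bar> * energy_profile K l)"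

text \<open>In contrast to \<open>energy_profile\<close> there is no cap at K: labels without a high
  index must become inactive exactly when the mode or the index reaches 2K, as in the first part of
  \<open>index_set\<close>.\<close>

definition mode_cost :: "int \<Rightarrow> int" where
  "mode_cost j = (if j = 0 then 2 else \<bar>j\<bar>)"

text \<open>Both signs occur because the index of the modes j and -j is the same.\<close>

definition mode_dist :: "int \<Rightarrow> int \<Rightarrow> int" where
  "mode_dist j l = min \<bar>mode_rep M (j - l)\<bar> \<bar>mode_rep M (j + l)\<bar>"

definition high_dist :: "int \<Rightarrow> (int \<Rightarrow> int) \<Rightarrow> int" where
  "high_dist j k = (\<Sum>l=K..M. \<bar>k l\<bar> * mode_dist j l)"

text \<open>
  A component with label \<open>(j, k)\<close> is of size \<open>\<epsilon>\<close> to half its cost, up to losses caused by small divisors.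
  The labels of cost below \<open>2 * K\<close> lie in \<^const>\<open>index_set\<close>; everything else is truncated, so the cost
  is capped there. Labels with one high index are charged for their distance in \<open>j\<close> from that index.
\<close>

definition cost :: "label \<Rightarrow> int" where
  "cost x = min (2 * K)
     (if high_sum (snd x) = 0 then max (mode_cost (fst x)) (if low_cost (snd x) = 0 then 2 else low_cost (snd x))
      else if high_sum (snd x) = 1 then K + max (high_dist (fst x) (snd x)) (low_cost (snd x))
      else 2 * K)"

definition active :: "label set" where
  "active = {x. fst x \<in> modes M \<and> snd x \<in> multi_indices M \<and> cost x < 2 * K}"

definition isub :: "label \<Rightarrow> label \<Rightarrow> label" where
  "isub x y = (mode_rep M (fst x - fst y), snd x - snd y)"

text \<open>The label under complex conjugation: the conjugate of a component labelled (j, k)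
  contributes to the mode -j and oscillates with -k.\<close>

definition ineg :: "label \<Rightarrow> label" where
  "ineg x = (mode_rep M (- fst x), - snd x)"

lemma M0: "M > 0" using K3 MK by simp

lemma profile_pos: "energy_profile K l \<ge> 1" and profile_le: "energy_profile K l \<le> K"
  using K3 by (auto simp: energy_profile_def)

lemma profile_le_mode_cost: "energy_profile K j \<le> mode_cost j"
  using K3 by (auto simp: energy_profile_def mode_cost_def)

lemma profile_abs: "energy_profile K \<bar>j\<bar> = energy_profile K j"
  by (simp add: energy_profile_def)

lemma high_sum_nonneg: "high_sum k \<ge> 0" and low_cost_nonneg: "low_cost k \<ge> 0"
  unfolding high_sum_def low_cost_def using profile_pos
  by (auto intro!: sum_nonneg mult_nonneg_nonneg intro: order_trans[OF _ profile_pos])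

lemma mode_dist_nonneg: "mode_dist j l \<ge> 0" by (simp add: mode_dist_def)

lemma high_dist_nonneg: "high_dist j k \<ge> 0"
  unfolding high_dist_def using mode_dist_nonneg by (auto intro!: sum_nonneg)

lemma mode_cost_pos: "mode_cost j \<ge> 1" by (auto simp: mode_cost_def)

lemma high_sum_triangle:
  assumes "\<And>l. k l = k1 l + k2 l" shows "high_sum k \<le> high_sum k1 + high_sum k2"
  unfolding high_sum_def sum.distrib[symmetric] assms by (intro sum_mono) (rule abs_triangle_ineq)

lemma low_cost_triangle:
  assumes "\<And>l. k l = k1 l + k2 l" shows "low_cost k \<le> low_cost k1 + low_cost k2"
  unfolding low_cost_def sum.distrib[symmetric] assms distrib_right[symmetric]
  by (intro sum_mono mult_right_mono abs_triangle_ineq) (use order_trans[OF _ profile_pos] in auto)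

lemma high_sum_0: "high_sum k = 0 \<Longrightarrow> l \<in> {K..M} \<Longrightarrow> k l = 0"
  unfolding high_sum_def by (subst (asm) sum_nonneg_eq_0_iff) auto

lemma low_cost_ge: "l \<in> {0..<K} \<Longrightarrow> \<bar>k l\<bar> * energy_profile K l \<le> low_cost k"
  unfolding low_cost_def
  by (rule member_le_sum) (use order_trans[OF _ profile_pos] in \<open>auto intro!: mult_nonneg_nonneg\<close>)

lemma high_sum_ge: "l \<in> {K..M} \<Longrightarrow> \<bar>k l\<bar> \<le> high_sum k"
  unfolding high_sum_def by (rule member_le_sum) auto

lemma mode_cost_add: "mode_cost (mode_rep M (i + j)) \<le> mode_cost i + mode_cost j"
  using abs_mode_rep_le[OF M0, of "i + j"] by (auto simp: mode_cost_def)

lemma mode_dist_add: "mode_dist (mode_rep M (i + j)) l \<le> mode_dist i l + \<bar>j\<bar>"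
proof -
  have *: "\<bar>mode_rep M (a + j)\<bar> \<le> \<bar>mode_rep M a\<bar> + \<bar>j\<bar>" for a
    using abs_mode_rep_le[OF M0, of "mode_rep M a + j"] by (simp add: mode_rep_simps)
  from *[of "i - l"] *[of "i + l"] show ?thesis
    unfolding mode_dist_def mode_rep_simps by (simp add: algebra_simps min_def)
qed

lemma cost_pos: "cost x \<ge> 1"
  using K3 mode_cost_pos[of "fst x"] high_dist_nonneg[of "fst x" "snd x"] by (auto simp: cost_def)

lemma cost_le: "cost x \<le> 2 * K" by (simp add: cost_def)

lemma cost_high: "high_sum (snd x) \<ge> 1 \<Longrightarrow> cost x \<ge> K"
  using K3 low_cost_nonneg[of "snd x"] by (auto simp: cost_def)

lemma cost_high2: "high_sum (snd x) \<ge> 2 \<Longrightarrow> cost x = 2 * K"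
  by (auto simp: cost_def)

text \<open>The high index of x is that of y alone. Adding the mode of z moves it by at most
  \<bar>fst z\<bar>, which the cost of z covers.\<close>

lemma cost_add_aux:
  assumes j: "fst x = mode_rep M (fst y + fst z)" and k: "\<And>l. snd x l = snd y l + snd z l"
    and y: "high_sum (snd y) = 1" and z: "high_sum (snd z) = 0"
  shows "cost x \<le> cost y + cost z"
proof -
  have e: "snd x l = snd y l" if "l \<in> {K..M}" for l using k high_sum_0[OF z that] by simp
  have hx: "high_sum (snd x) = 1" using y e unfolding high_sum_def by (metis (no_types, lifting) sum.cong)
  have "high_dist (fst x) (snd x) \<le> (\<Sum>l=K..M. \<bar>snd y l\<bar> * (mode_dist (fst y) l + \<bar>fst z\<bar>))"
    unfolding high_dist_def using e j mode_dist_add by (intro sum_mono) (auto intro!: mult_left_mono)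
  also have "\<dots> = high_dist (fst y) (snd y) + \<bar>fst z\<bar>"
    using y by (simp add: high_dist_def high_sum_def distrib_left sum.distrib sum_distrib_right[symmetric])
  finally have "high_dist (fst x) (snd x) \<le> high_dist (fst y) (snd y) + \<bar>fst z\<bar>" .
  moreover have "low_cost (snd x) \<le> low_cost (snd y) + low_cost (snd z)" by (rule low_cost_triangle) (use k in auto)
  moreover have "\<bar>fst z\<bar> \<le> mode_cost (fst z)" by (simp add: mode_cost_def)
  ultimately show ?thesis unfolding cost_def using hx y z K3 high_dist_nonneg[of "fst y" "snd y"] low_cost_nonneg[of "snd y"] low_cost_nonneg[of "snd z"] mode_cost_pos[of "fst z"] by (auto split: if_splits)
qed

text \<open>Subadditivity makes the weights submultiplicative, which is what convolution over labels
  requires. If both factors have a high index, or one has two, the right-hand side has already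
  reached the cap 2K.\<close>

lemma cost_add:
  assumes j: "fst x = mode_rep M (fst y + fst z)" and k: "\<And>l. snd x l = snd y l + snd z l"
  shows "cost x \<le> cost y + cost z"
proof -
  consider (a) "high_sum (snd y) \<ge> 1" "high_sum (snd z) \<ge> 1" | (b) "high_sum (snd y) \<ge> 2" | (c) "high_sum (snd z) \<ge> 2"
    | (d) "high_sum (snd y) = 1" "high_sum (snd z) = 0" | (e) "high_sum (snd y) = 0" "high_sum (snd z) = 1"
    | (f) "high_sum (snd y) = 0" "high_sum (snd z) = 0"
    using high_sum_nonneg[of "snd y"] high_sum_nonneg[of "snd z"] by linarith
  then show ?thesis
  proof cases
    case a
    then show ?thesis using cost_high[of y] cost_high[of z] cost_le[of x] by simp
  next
    case b
    then show ?thesis using cost_high2[of y] cost_pos[of z] cost_le[of x] by simp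
  next
    case c
    then show ?thesis using cost_high2[of z] cost_pos[of y] cost_le[of x] by simp
  next
    case d
    then show ?thesis using cost_add_aux[OF j] k by simp
  next
    case e
    then show ?thesis using cost_add_aux[of x z y] j k by (simp add: add.commute)
  next
    case f
    have hx: "high_sum (snd x) = 0" using high_sum_triangle[of "snd x" "snd y" "snd z"] k f high_sum_nonneg[of "snd x"] by simp
    have "low_cost (snd x) \<le> low_cost (snd y) + low_cost (snd z)" by (rule low_cost_triangle) (use k in auto)
    moreover have "mode_cost (fst x) \<le> mode_cost (fst y) + mode_cost (fst z)" using j mode_cost_add by simp
    ultimately show ?thesis unfolding cost_def using hx f K3 low_cost_nonneg[of "snd y"] low_cost_nonneg[of "snd z"] mode_cost_pos[of "fst z"] mode_cost_pos[of "fst y"] 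
      by (auto split: if_splits)
  qed
qed

lemma isub_fst_add: "fst x \<in> modes M \<Longrightarrow> fst x = mode_rep M (fst y + fst (isub x y))"
  by (simp add: isub_def mode_rep_simps mode_rep_id)

lemma isub_snd_add: "snd x l = snd y l + snd (isub x y) l"
  by (simp add: isub_def)

lemma cost_isub: "fst x \<in> modes M \<Longrightarrow> cost x \<le> cost y + cost (isub x y)"
  by (rule cost_add[OF isub_fst_add isub_snd_add])

lemma cost_ge_profile: "energy_profile K (fst x) \<le> cost x"
  using K3 profile_le[of "fst x"] profile_le_mode_cost[of "fst x"] high_dist_nonneg[of "fst x" "snd x"] by (auto simp: cost_def)

text \<open>For l \<ge> K the profile is K, the least cost of a label with a high index. Hence a
  component that contributes to \<open>action l\<close> has a weight not above the level of the mode
  l (\<open>wt_le_level\<close>).\<close>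

lemma cost_ge_profile_index:
  assumes "snd x l \<noteq> 0" "l \<in> {0..M}"
  shows "energy_profile K l \<le> cost x"
proof (cases "l < K")
  case True
  then have "1 * energy_profile K l \<le> \<bar>snd x l\<bar> * energy_profile K l"
    using assms profile_pos[of l] by (intro mult_right_mono) auto
  then have "energy_profile K l \<le> low_cost (snd x)" using low_cost_ge[of l "snd x"] assms True by simp
  then show ?thesis using profile_pos[of l] profile_le[of l] K3 by (auto simp: cost_def)
next
  case False
  then have "high_sum (snd x) \<ge> 1" using high_sum_ge[of l "snd x"] assms by simp
  then show ?thesis using cost_high profile_le[of l] by fastforce
qed

lemma mode_dist_minus: "mode_dist (mode_rep M (- j)) l = mode_dist j l"
proof -
  have "\<bar>mode_rep M (- j - l)\<bar> = \<bar>mode_rep M (j + l)\<bar>" "\<bar>mode_rep M (- j + l)\<bar> = \<bar>mode_rep M (j - l)\<bar>"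
    using abs_mode_rep_minus[OF M0, of "j + l"] abs_mode_rep_minus[OF M0, of "j - l"] by (simp_all add: algebra_simps)
  then show ?thesis unfolding mode_dist_def mode_rep_simps by (simp add: min.commute)
qed

lemma cost_ineg: 
  assumes "fst x \<in> modes M" shows "cost (ineg x) = cost x"
proof -
  have "\<bar>mode_rep M (- fst x)\<bar> = \<bar>fst x\<bar>" using abs_mode_rep_minus[OF M0, of "fst x"] assms by (simp add: mode_rep_id)
  then have "mode_cost (mode_rep M (- fst x)) = mode_cost (fst x)" by (auto simp: mode_cost_def)
  then show ?thesis
    by (simp add: cost_def ineg_def high_sum_def low_cost_def high_dist_def mode_dist_minus)
qed

lemma unit_index_sum:
  assumes "\<And>l. \<bar>k l\<bar> = unit_index j l" "finite A"
  shows "(\<Sum>l\<in>A. \<bar>k l\<bar> * f l) = (if \<bar>j\<bar> \<in> A then f \<bar>j\<bar> else 0)"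
proof -
  have "(\<Sum>l\<in>A. \<bar>k l\<bar> * f l) = (\<Sum>l\<in>A. if \<bar>j\<bar> = l then f l else 0)"
    using assms(1) by (intro sum.cong) (auto simp: unit_index_def)
  also have "\<dots> = (if \<bar>j\<bar> \<in> A then f \<bar>j\<bar> else 0)" using assms(2) by (rule sum.delta')
  finally show ?thesis .
qed

text \<open>The absolute values admit both <j> and -<j>. On resonant labels the cost is the energy
  profile, so their weights are those of the theorem.\<close>

lemma cost_unit:
  assumes k: "\<And>l. \<bar>k l\<bar> = unit_index j l" and j: "j \<in> modes M"
  shows "cost (j, k) = energy_profile K j"
proof -
  have hs: "high_sum k = (if \<bar>j\<bar> \<ge> K then 1 else 0)"
    using unit_index_sum[OF k, of "{K..M}" "\<lambda>_. 1"] j by (auto simp: high_sum_def modes_def)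
  have lc: "low_cost k = (if \<bar>j\<bar> < K then energy_profile K j else 0)"
    using unit_index_sum[OF k, of "{0..<K}" "energy_profile K"] by (auto simp: low_cost_def profile_abs)
  have "mode_dist j \<bar>j\<bar> = 0" by (cases "j \<ge> 0") (auto simp: mode_dist_def mode_rep_def)
  then have hd: "high_dist j k = 0"
    using unit_index_sum[OF k, of "{K..M}" "mode_dist j"] by (auto simp: high_dist_def)
  show ?thesis using hs lc hd K3 profile_pos[of j] profile_le[of j] 
    by (auto simp: cost_def mode_cost_def energy_profile_def)
qed

text \<open>Without cancellation both vectors would be supported at the entry of the unit vector,
  where two nonzero integers would have absolute values adding up to 1. A cancellation costs at
  least 2.\<close>

lemma low_cost_split:
  assumes k: "\<And>l. k l = ky l + kz l" and u: "\<And>l. \<bar>k l\<bar> = unit_index j l"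
    and y: "low_cost ky \<noteq> 0" and z: "low_cost kz \<noteq> 0"
  shows "low_cost k + 2 \<le> low_cost ky + low_cost kz"
proof -
  obtain ly where ly: "ly \<in> {0..<K}" "ky ly \<noteq> 0"
    using y unfolding low_cost_def by (metis (mono_tags, lifting) abs_zero mult_zero_left sum.neutral)
  obtain lz where lz: "lz \<in> {0..<K}" "kz lz \<noteq> 0"
    using z unfolding low_cost_def by (metis (mono_tags, lifting) abs_zero mult_zero_left sum.neutral)
  have "\<exists>l\<in>{0..<K}. \<bar>k l\<bar> + 2 \<le> \<bar>ky l\<bar> + \<bar>kz l\<bar>"
  proof (rule ccontr)
    assume "\<not> ?thesis"
    then have c: "\<bar>ky l\<bar> + \<bar>kz l\<bar> < \<bar>ky l + kz l\<bar> + 2" if "l \<in> {0..<K}" for l using k that by force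
    \<comment> \<open>\<open>\<bar>a\<bar> + \<bar>b\<bar> - \<bar>a + b\<bar>\<close> is even, so
      below 2 it is 0.\<close>
    have d: "\<bar>ky l\<bar> + \<bar>kz l\<bar> = \<bar>k l\<bar>" if "l \<in> {0..<K}" for l using c[OF that] k[of l] by presburger
    have "ly = \<bar>j\<bar>" using d[OF ly(1)] ly u[of ly] by (auto simp: unit_index_def split: if_splits)
    moreover have "lz = \<bar>j\<bar>" using d[OF lz(1)] lz u[of lz] by (auto simp: unit_index_def split: if_splits)
    ultimately show False using d[OF ly(1)] ly lz u[of ly] by (auto simp: unit_index_def split: if_splits)
  qed
  then obtain l0 where l0: "l0 \<in> {0..<K}" "\<bar>k l0\<bar> + 2 \<le> \<bar>ky l0\<bar> + \<bar>kz l0\<bar>" by blast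
  have "low_cost k + 2 \<le> low_cost k + 2 * energy_profile K l0" using profile_pos[of l0] by simp
  also have "\<dots> = (\<Sum>l\<in>{0..<K}. \<bar>k l\<bar> * energy_profile K l + (if l0 = l then 2 * energy_profile K l else 0))"
    using l0 by (simp add: low_cost_def sum.distrib sum.delta')
  also have "\<dots> \<le> (\<Sum>l\<in>{0..<K}. (\<bar>ky l\<bar> + \<bar>kz l\<bar>) * energy_profile K l)"
  proof (rule sum_mono)
    fix l
    have "(\<bar>k l\<bar> + (if l0 = l then 2 else 0)) * energy_profile K l \<le> (\<bar>ky l\<bar> + \<bar>kz l\<bar>) * energy_profile K l"
      using l0 k[of l] profile_pos[of l] by (intro mult_right_mono) auto
    then show "\<bar>k l\<bar> * energy_profile K l + (if l0 = l then 2 * energy_profile K l else 0) \<le> (\<bar>ky l\<bar> + \<bar>kz l\<bar>) * energy_profile K l"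
      by (auto simp: algebra_simps)
  qed
  also have "\<dots> = low_cost ky + low_cost kz" by (simp add: low_cost_def distrib_right sum.distrib)
  finally show ?thesis .
qed

text \<open>Below K the entries of y and z cancel, so both pay the same low cost. If it is 0, the
  gain is the 2 that \<open>cost\<close> charges for a vanishing low part.\<close>

lemma cost_unit_gain_high:
  assumes k: "\<And>l. snd y l + snd z l = k l" and u: "\<And>l. \<bar>k l\<bar> = unit_index j l" and j: "\<bar>j\<bar> \<ge> K"
    and y: "high_sum (snd y) = 0" and z: "high_sum (snd z) \<ge> 1"
  shows "K + 2 \<le> cost y + cost z"
proof -
  have "low_cost (snd z) = low_cost (snd y)"
    unfolding low_cost_def
  proof (intro sum.cong refl)
    fix l assume "l \<in> {0..<K}"
    then have "k l = 0" using u[of l] j by (auto simp: unit_index_def)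
    then have "\<bar>snd z l\<bar> = \<bar>snd y l\<bar>" using k[of l] by presburger
    then show "\<bar>snd z l\<bar> * energy_profile K l = \<bar>snd y l\<bar> * energy_profile K l" by simp
  qed
  then show ?thesis unfolding cost_def using y z K3 low_cost_nonneg[of "snd y"] high_dist_nonneg[of "fst z" "snd z"] by auto
qed

text \<open>A product reaches <j> or -<j> only with a surplus of 2. On <j> this makes the resonant
  components slow; on -<j> it pays for the weak divisor. For the splitting <j> + 0 the surplus is
  the 2 charged to k = 0.\<close>

lemma cost_unit_gain:
  assumes k: "\<And>l. snd y l + snd z l = k l" and u: "\<And>l. \<bar>k l\<bar> = unit_index j l" and j: "j \<in> modes M"
  shows "energy_profile K j + 2 \<le> cost y + cost z"
proof (cases "\<bar>j\<bar> < K")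
  case True
  have kh: "snd z l = - snd y l" if "l \<in> {K..M}" for l
    using k[of l] u[of l] True that by (auto simp: unit_index_def split: if_splits)
  have hs: "high_sum (snd z) = high_sum (snd y)"
    unfolding high_sum_def using kh by (intro sum.cong) auto
  show ?thesis
  proof (cases "high_sum (snd y) = 0")
    case False
    then have "cost y \<ge> K" "cost z \<ge> K" using hs high_sum_nonneg[of "snd y"] cost_high[of y] cost_high[of z] by auto
    then show ?thesis using True K3 by (auto simp: energy_profile_def)
  next
    case hy: True
    have lk: "low_cost k = energy_profile K j"
      using unit_index_sum[OF u, of "{0..<K}" "energy_profile K"] True by (auto simp: low_cost_def profile_abs)
    have tri: "low_cost k \<le> low_cost (snd y) + low_cost (snd z)" using k by (intro low_cost_triangle) simp
    have gain: "low_cost (snd y) \<noteq> 0 \<Longrightarrow> low_cost (snd z) \<noteq> 0 \<Longrightarrow> low_cost k + 2 \<le> low_cost (snd y) + low_cost (snd z)"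
      using low_cost_split[of k "snd y" "snd z" j] k u by simp
    have "energy_profile K j + 2 \<le> 2 * K" using profile_le[of j] K3 by simp
    then show ?thesis using hs hy lk tri gain profile_pos[of j] low_cost_nonneg[of "snd y"] low_cost_nonneg[of "snd z"] K3 
      unfolding cost_def by (auto simp: max_def min_def split: if_splits)
  qed
next
  case False
  have ej: "energy_profile K j = K" using False K3 by (simp add: energy_profile_def)
  have "high_sum k = 1" using unit_index_sum[OF u, of "{K..M}" "\<lambda>_. 1"] j False by (auto simp: high_sum_def modes_def)
  then have "1 \<le> high_sum (snd y) + high_sum (snd z)" using high_sum_triangle[of k "snd y" "snd z"] k by simp
  then consider "high_sum (snd y) \<ge> 1" "high_sum (snd z) \<ge> 1" | "high_sum (snd y) = 0" "high_sum (snd z) \<ge> 1" | "high_sum (snd y) \<ge> 1" "high_sum (snd z) = 0"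
    using high_sum_nonneg[of "snd y"] high_sum_nonneg[of "snd z"] by linarith
  then show ?thesis
  proof cases
    case 1
    then show ?thesis using cost_high[of y] cost_high[of z] ej K3 by simp
  next
    case 2
    then show ?thesis using cost_unit_gain_high[OF k u] False ej by simp
  next
    case 3
    then show ?thesis using cost_unit_gain_high[of z y, OF _ u] k False ej by (simp add: add.commute)
  qed
qed

text \<open>In modes beyond K only the weak divisor bound is available. The surplus over K provides
  the factor \<open>h\<close> that compensates for it.\<close>

lemma cost_high_mode:
  assumes "fst x = mode_rep M (fst y + fst z)" "\<bar>fst x\<bar> > K"
  shows "K + 1 \<le> cost y + cost z"
proof (cases "high_sum (snd y) = 0 \<and> high_sum (snd z) = 0")
  case True
  have "\<bar>fst x\<bar> \<le> \<bar>fst y\<bar> + \<bar>fst z\<bar>" using assms(1) abs_mode_rep_le[OF M0, of "fst y + fst z"] by simp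
  moreover have "\<bar>fst y\<bar> \<le> mode_cost (fst y)" "\<bar>fst z\<bar> \<le> mode_cost (fst z)" by (simp_all add: mode_cost_def)
  moreover have "min (2 * K) (mode_cost (fst y)) \<le> cost y" "min (2 * K) (mode_cost (fst z)) \<le> cost z"
    using True by (auto simp: cost_def)
  ultimately show ?thesis using assms(2) cost_pos[of y] cost_pos[of z] K3 by linarith
next
  case False
  then have "high_sum (snd y) \<ge> 1 \<or> high_sum (snd z) \<ge> 1"
    using high_sum_nonneg[of "snd y"] high_sum_nonneg[of "snd z"] by linarith
  then show ?thesis using cost_high[of y] cost_high[of z] cost_pos[of y] cost_pos[of z] by auto
qed

text \<open>If \<bar>i\<bar> = 1, then j - i is 0 or \<plusminus>2, and e(0) = 2; \<open>M\<close>
  \<ge> 3 excludes aliasing. Hence the nonlinearity acts on the excited mode only at third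
  order.\<close>

lemma profile_sum_mode_1:
  assumes "j \<in> {1, -1}" "i \<in> modes M"
  shows "3 \<le> energy_profile K i + energy_profile K (mode_rep M (j - i))"
proof (cases "energy_profile K i = 1")
  case True
  then have "\<bar>i\<bar> = 1" using K3 by (auto simp: energy_profile_def split: if_splits)
  then have "j - i \<in> {0, 2, -2}" using assms by auto
  moreover have "mode_rep M (j - i) = j - i" using calculation K3 MK by (intro mode_rep_id) (auto simp: modes_def)
  ultimately show ?thesis using True K3 by (auto simp: energy_profile_def)
next
  case False
  then show ?thesis using profile_pos[of i] profile_pos[of "mode_rep M (j - i)"] by simp
qed

lemma abs_index_le:
  assumes "x \<in> active" shows "\<bar>snd x l\<bar> \<le> 2 * K"
proof -
  consider "l \<notin> {0..M}" | "l \<in> {0..<K}" | "l \<in> {K..M}" using K3 by force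
  then show ?thesis
  proof cases
    case 1
    then show ?thesis using assms K3 by (auto simp: active_def multi_indices_def)
  next
    case 2
    have "\<bar>snd x l\<bar> * 1 \<le> \<bar>snd x l\<bar> * energy_profile K l" using profile_pos[of l] by (intro mult_left_mono) auto
    then have "\<bar>snd x l\<bar> \<le> low_cost (snd x)" using low_cost_ge[OF 2, of "snd x"] by simp
    then show ?thesis using assms K3 by (auto simp: active_def cost_def split: if_splits)
  next
    case 3
    have "high_sum (snd x) < 2" using assms cost_high2[of x] by (force simp: active_def)
    then show ?thesis using high_sum_ge[OF 3, of "snd x"] K3 by simp
  qed
qed

lemma finite_active: "finite active"
proof -
  have "active \<subseteq> modes M \<times> {k. \<forall>l. (l \<in> {0..M} \<longrightarrow> k l \<in> {-2*K..2*K}) \<and> (l \<notin> {0..M} \<longrightarrow> k l = 0)}"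
  proof (safe)
    fix j k assume x: "(j, k) \<in> active"
    then show "j \<in> modes M" by (simp add: active_def)
    fix l
    show "k l \<in> {-2*K..2*K}" using abs_index_le[OF x, of l] by auto
    assume "l \<notin> {0..M}"
    then show "k l = 0" using x by (auto simp: active_def multi_indices_def)
  qed
  moreover have "finite (modes M \<times> {k. \<forall>l. (l \<in> {0..M} \<longrightarrow> k l \<in> {-2*K..2*K}) \<and> (l \<notin> {0..M} \<longrightarrow> k l = 0)})"
    by (intro finite_cartesian_product finite_modes finite_set_of_finite_funs) auto
  ultimately show ?thesis by (rule finite_subset)
qed

lemma mu_split: "mu K M k = low_cost k + K * high_sum k"
proof -
  have *: "{0..M} = {0..<K} \<union> {K..M}" using K3 MK by auto
  have "(\<Sum>l=K..M. \<bar>k l\<bar> * energy_profile K l) = K * high_sum k"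
    unfolding high_sum_def sum_distrib_left using K3 by (intro sum.cong) (auto simp: energy_profile_def)
  then show ?thesis unfolding mu_def low_cost_def * by (subst sum.union_disjoint) auto
qed

lemma high_sum_1:
  assumes "high_sum k = 1"
  obtains l where "l \<in> {K..M}" "\<bar>k l\<bar> = 1" "\<And>l'. l' \<in> {K..M} \<Longrightarrow> l' \<noteq> l \<Longrightarrow> k l' = 0"
proof -
  obtain l where l: "l \<in> {K..M}" "k l \<noteq> 0"
    using assms unfolding high_sum_def by (metis (mono_tags, lifting) abs_zero sum.neutral zero_neq_one)
  have "high_sum k = \<bar>k l\<bar> + (\<Sum>l'\<in>{K..M}-{l}. \<bar>k l'\<bar>)" unfolding high_sum_def using l by (subst sum.remove) auto
  moreover have "(\<Sum>l'\<in>{K..M}-{l}. \<bar>k l'\<bar>) \<ge> 0" by (intro sum_nonneg) auto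
  ultimately have a: "\<bar>k l\<bar> = 1" "(\<Sum>l'\<in>{K..M}-{l}. \<bar>k l'\<bar>) = 0" using l assms by linarith+
  have "k l' = 0" if "l' \<in> {K..M}" "l' \<noteq> l" for l'
    using a(2) that by (subst (asm) sum_nonneg_eq_0_iff) auto
  with that l a show ?thesis by blast
qed

text \<open>A cost below 2K leaves at most one high index l, with entry \<plusminus>1 and within
  distance K of the mode. The shift r of the second part of \<open>index_set\<close> is then the
  residue of j - l or of j + l.\<close>

lemma active_subset: "active \<subseteq> index_set K M"
proof
  fix x assume x: "x \<in> active"
  obtain j k where xe: "x = (j, k)" by (cases x)
  have j: "j \<in> modes M" and k: "k \<in> multi_indices M" and c: "cost (j, k) < 2 * K" using x by (auto simp: xe active_def)
  have h2: "high_sum k = 0 \<or> high_sum k = 1"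
    using c cost_high2[of "(j,k)"] high_sum_nonneg[of k] by fastforce
  show "x \<in> index_set K M"
  proof (cases "high_sum k = 0")
    case True
    have "k l = 0" if "l \<ge> K" for l using high_sum_0[OF True, of l] that k by (cases "l \<le> M") (auto simp: multi_indices_def)
    moreover have "max \<bar>j\<bar> (mu K M k) < 2 * K"
      using c True K3 by (auto simp: cost_def mu_split mode_cost_def split: if_splits)
    ultimately show ?thesis using j k by (auto simp: xe index_set_def)
  next
    case False
    then have h: "high_sum k = 1" using h2 by simp
    obtain l where l: "l \<in> {K..M}" "\<bar>k l\<bar> = 1" "\<And>l'. l' \<in> {K..M} \<Longrightarrow> l' \<noteq> l \<Longrightarrow> k l' = 0"
      using high_sum_1[OF h] by metis
    have "high_dist j k = (\<Sum>l'=K..M. if l' = l then mode_dist j l else 0)"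
      unfolding high_dist_def using l by (intro sum.cong) auto
    then have hd: "high_dist j k = mode_dist j l" using l by simp
    have dist: "mode_dist j l < K" and low: "low_cost k < K" using c h hd by (auto simp: cost_def)
    obtain r where r: "\<bar>r\<bar> < K" "\<bar>mode_rep M (j - r)\<bar> = l"
    proof -
      have ab: "\<bar>mode_rep M i\<bar> = l" if "\<bar>i\<bar> = l" for i
      proof (cases "i \<in> modes M")
        case True then show ?thesis using that by (simp add: mode_rep_id)
      next
        case False
        \<comment> \<open>The one index without a mode of the same sign: it belongs to the mode
          -M.\<close>
        then have "i = M" using that l by (auto simp: modes_def)
        then show ?thesis using that M0 by (simp add: mode_rep_def)
      qed
      consider "\<bar>mode_rep M (j - l)\<bar> < K" | "\<bar>mode_rep M (j + l)\<bar> < K" using dist by (auto simp: mode_dist_def min_def split: if_splits)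
      then show ?thesis
      proof cases
        case 1
        show ?thesis by (rule that[OF 1]) (use ab[of l] l K3 in \<open>simp add: mode_rep_simps\<close>)
      next
        case 2
        show ?thesis by (rule that[OF 2]) (use ab[of "-l"] l K3 in \<open>simp add: mode_rep_simps\<close>)
      qed
    qed
    define k' where "k' = (\<lambda>i. if i = l then 0 else k i)"
    have "mu K M k' = low_cost k"
    proof -
      have "low_cost k' = low_cost k" using l unfolding low_cost_def k'_def by (intro sum.cong) auto
      moreover have "high_sum k' = 0" unfolding high_sum_def k'_def using l by (intro sum.neutral) auto
      ultimately show ?thesis by (simp add: mu_split)
    qed
    moreover have "k = (\<lambda>i. k l * unit_index (mode_rep M (j - r)) i + k' i)"
      using r by (auto simp: fun_eq_iff unit_index_def k'_def)
    moreover have "k' \<in> multi_indices M" using k by (auto simp: multi_indices_def k'_def)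
    moreover have "k l \<in> {1, -1}" using l by auto
    moreover have "\<bar>mode_rep M (j - r)\<bar> \<ge> K" using r l by simp
    ultimately have "(j, k) \<in> {(j, \<lambda>l. \<theta> * unit_index (mode_rep M (j - r)) l + k l) | j r k \<theta>.
              j \<in> modes M \<and> k \<in> multi_indices M \<and> \<theta> \<in> {1, -1} \<and>
              \<bar>mode_rep M (j - r)\<bar> \<ge> K \<and> \<bar>r\<bar> < K \<and> mu K M k < K}"
      using j r low l by (simp, intro exI[of _ r] exI[of _ k'] exI[of _ "k l"], auto)
    then show ?thesis unfolding xe index_set_def by (rule UnI2)
  qed
qed

lemma unit_multi: "j \<in> modes M \<Longrightarrow> unit_index j \<in> multi_indices M"
  by (auto simp: modes_def multi_indices_def unit_index_def)

lemma active_unit: "j \<in> modes M \<Longrightarrow> (j, unit_index j) \<in> active"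
  using cost_unit[of "unit_index j" j] profile_le[of j] K3 unit_multi[of j] by (auto simp: active_def unit_index_def)

lemma ineg_active: "x \<in> active \<Longrightarrow> ineg x \<in> active"
  using cost_ineg[of x] mode_rep_in[OF M0] by (auto simp: active_def multi_indices_def) (auto simp: ineg_def mode_rep_in M0)

lemma ineg_ineg: "fst x \<in> modes M \<Longrightarrow> ineg (ineg x) = x"
  by (auto simp: ineg_def mode_rep_simps mode_rep_id prod_eq_iff)

lemma isub_isub: "fst y \<in> modes M \<Longrightarrow> isub x (isub x y) = y"
  by (auto simp: isub_def mode_rep_simps mode_rep_id prod_eq_iff)

end

subsection \<open>Modulation equations\<close>

text \<open>In the application \<open>fl j\<close> is \<phi>(\<tau> \<omega>_j) and \<open>b\<close>
  bounds \<phi>, while 1/\<open>h\<close> is the loss of a weak divisor and \<open>p * h\<close> is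
  of order \<epsilon> powr (1/2), the size of the excited mode. \<open>N\<close> is the highest
  difference kept. The factor 2 in the divisor bounds comes from |cis t - 1| = 2 |sin
  (t/2)|.\<close>

locale modulation = label_costs +
  fixes \<rho> s \<gamma> b \<tau> p h :: real and fl :: "int \<Rightarrow> real" and N :: nat
  assumes rho0: "\<rho> > 0" and s12: "s > 1/2" and gam0: "0 < \<gamma>" and gam1: "\<gamma> \<le> 1"
    and tau0: "\<tau> > 0" and p0: "0 < p" and p4: "p \<le> 1/4" and h0: "0 < h" and h1: "h \<le> 1"
    and ph4: "4 * p\<^sup>2 \<le> \<gamma> * h" and tau_gam: "\<tau> * \<gamma> \<le> 1" and N1: "N \<ge> 1"
    and fl_bound: "\<And>j. \<bar>fl j\<bar> \<le> b"
    and fl_sym: "\<And>j. j \<in> modes M \<Longrightarrow> fl (mode_rep M (- j)) = fl j"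
    and divisor_weak: "\<And>x. x \<in> active \<Longrightarrow> snd x \<noteq> unit_index (fst x) \<Longrightarrow>
      2 * \<gamma> * \<tau> * h \<le> norm (cis (\<tau> * (dot_omega \<rho> M (snd x) - omega \<rho> (fst x))) - 1)"
    and divisor_strong: "\<And>x. x \<in> active \<Longrightarrow> snd x \<noteq> unit_index (fst x) \<Longrightarrow> snd x \<noteq> - unit_index (fst x) \<Longrightarrow>
      \<bar>fst x\<bar> \<le> K \<Longrightarrow> 2 * \<gamma> * \<tau> \<le> norm (cis (\<tau> * (dot_omega \<rho> M (snd x) - omega \<rho> (fst x))) - 1)"
begin

abbreviation "om \<equiv> omega \<rho>"
abbreviation "sg \<equiv> sobolev_root s"

text \<open>
  Every mode \<open>c\<^sub>j\<close> is written as a sum of components \<open>z\<close> with labels \<open>x = (j, k)\<close>, where the component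
  oscillates like \<open>phase x\<close>. The resonant ones, \<open>k = \<langle>j\<rangle>\<close>, carry the slow motion.
\<close>

definition divisor :: "label \<Rightarrow> complex" where
  "divisor x = cis (\<tau> * (dot_omega \<rho> M (snd x) - om (fst x))) - 1"

definition phase :: "label \<Rightarrow> complex" where
  "phase x = cis (\<tau> * dot_omega \<rho> M (snd x))"

definition resonant :: "label \<Rightarrow> bool" where
  "resonant x \<longleftrightarrow> snd x = unit_index (fst x)"

text \<open>The labelled form of the filtered position, since c_j + cnj c_(-j) = 2 \<omega>_j u_j.
  The value 0 outside \<open>active\<close> is what truncates the convolution in
  \<open>bil\<close>.\<close>

definition pos_part :: "(label \<Rightarrow> complex) \<Rightarrow> label \<Rightarrow> complex" where
  "pos_part Z x = (if x \<in> active then of_real (fl (fst x) / (2 * om (fst x))) * (Z x + cnj (Z (ineg x))) else 0)"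

definition bil :: "(label \<Rightarrow> complex) \<Rightarrow> (label \<Rightarrow> complex) \<Rightarrow> label \<Rightarrow> complex" where
  "bil Z Z' x = - \<i> * of_real (fl (fst x)) * (\<Sum>y\<in>active. pos_part Z y * pos_part Z' (isub x y))"

text \<open>
  \<open>a x i\<close> stands for the \<open>i\<close>-th forward difference of the component \<open>x\<close> in time, after division by its
  phase; \<open>node n a m\<close> recovers the values after \<open>m\<close> time steps from the differences up to order \<open>n\<close>.
\<close>

definition node :: "nat \<Rightarrow> (label \<Rightarrow> nat \<Rightarrow> complex) \<Rightarrow> nat \<Rightarrow> label \<Rightarrow> complex" where
  "node n a m x = newton \<tau> n (a x) m"

definition bil_jet where
  "bil_jet n a a' x i = jet \<tau> (\<lambda>m. bil (node n a m) (node n a' m) x) i"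

definition sec :: "int \<Rightarrow> (int \<Rightarrow> int) set" where
  "sec j = {k. (j, k) \<in> active}"

text \<open>Summation over the labels of a mode makes convolution in k bounded without counting
  labels; the weighted square sum over modes matches the energy sum of the theorem.\<close>

definition rn :: "(label \<Rightarrow> real) \<Rightarrow> (label \<Rightarrow> real) \<Rightarrow> real" where
  "rn v \<alpha> = L2_set (\<lambda>j. sg j * (\<Sum>k\<in>sec j. \<alpha> (j, k) / v (j, k))) (modes M)"

definition mode_norm :: "(label \<Rightarrow> real) \<Rightarrow> (int \<Rightarrow> complex) \<Rightarrow> real" where
  "mode_norm v c = L2_set (\<lambda>j. sg j * (norm (c j) / v (j, unit_index j))) (modes M)"

abbreviation nrm :: "nat \<Rightarrow> (label \<Rightarrow> real) \<Rightarrow> real \<Rightarrow> (label \<Rightarrow> nat \<Rightarrow> complex) \<Rightarrow> real" where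
  "nrm n v R a \<equiv> rn v (\<lambda>x. jet_norm n R (a x))"

text \<open>Up to cost K this is a power of \<open>p * h\<close>, the size demanded by the theorem.
  Saturating the exponent of \<open>h\<close> at K leaves products of higher cost with spare powers
  of \<open>h\<close>.\<close>

definition ww :: "nat \<Rightarrow> real" where
  "ww c = p ^ c * h ^ min c (nat K)"

definition wt :: "label \<Rightarrow> real" where
  "wt x = ww (nat (cost x))"

text \<open>The constant of the quadratic term: outer filter, product rule, convolution, and one
  factor b / sqrt \<rho> for each \<open>pos_part\<close>.\<close>

definition hconst :: "nat \<Rightarrow> real" where
  "hconst n = b * 4 ^ n * conv_const s * (b / sqrt \<rho>)\<^sup>2"

lemma b0: "b \<ge> 0" using fl_bound[of 0] by simp

lemma om_ge: "om j \<ge> sqrt \<rho>" by (simp add: omega_def)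
lemma om_pos: "om j > 0" using om_ge[of j] rho0 by (smt (verit) real_sqrt_gt_0_iff)
lemma om_sym: "om (mode_rep M (- j)) = om j" if "j \<in> modes M"
proof -
  have "\<bar>mode_rep M (- j)\<bar> = \<bar>j\<bar>" using abs_mode_rep_minus[OF M0, of j] that by (simp add: mode_rep_id)
  then have "(mode_rep M (- j))\<^sup>2 = j\<^sup>2" by (metis power2_abs)
  then have "(real_of_int (mode_rep M (- j)))\<^sup>2 = (real_of_int j)\<^sup>2" by (metis of_int_power)
  then show ?thesis by (simp add: omega_def)
qed

lemma sg_ge_1: "sg j \<ge> 1" using sobolev_root_ge_1 s12 by simp
lemma sg_pos: "sg j > 0" using sg_ge_1[of j] by simp

lemma sg_sym: "sg (mode_rep M (- j)) = sg j" if "j \<in> modes M"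
  using abs_mode_rep_minus[OF M0, of j] that by (intro sobolev_root_cong_abs) (simp add: mode_rep_id)

lemma conv_const_nonneg: "conv_const s \<ge> 0"
proof -
  have "0 \<le> sobolev_sum s"
    using order_trans[OF sum_nonneg sum_inverse_sobolev[OF s12, of 1]] by (auto simp: sobolev_weight_def)
  then show ?thesis by (simp add: conv_const_def)
qed

lemma hconst_nonneg: "hconst n \<ge> 0"
  unfolding hconst_def using b0 conv_const_nonneg by simp

lemma hconst_mono: "m \<le> n \<Longrightarrow> hconst m \<le> hconst n"
  unfolding hconst_def using b0 conv_const_nonneg by (intro mult_right_mono mult_left_mono power_increasing) auto

lemma finite_sec [simp]: "finite (sec j)"
  using finite_vimageI[OF finite_active, of "Pair j"] by (simp add: sec_def vimage_def inj_on_def)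

lemma sum_active: "(\<Sum>x\<in>active. f x) = (\<Sum>j\<in>modes M. \<Sum>k\<in>sec j. f (j, k))"
proof -
  have "active = Sigma (modes M) sec" by (auto simp: sec_def active_def)
  then show ?thesis by (simp add: sum.Sigma)
qed

lemma active_mode: "x \<in> active \<Longrightarrow> fst x \<in> modes M" by (simp add: active_def)

lemma cost_nat_pos: "nat (cost x) \<ge> 1" using cost_pos[of x] by linarith

lemma ww_pos: "ww c > 0" by (simp add: ww_def p0 h0)
lemma wt_pos: "wt x > 0" by (simp add: wt_def ww_pos)

lemma p1: "p \<le> 1" using p4 by simp

lemma ww_mult: "ww c1 * ww c2 = p ^ (c1 + c2) * h ^ (min c1 (nat K) + min c2 (nat K))"
  by (simp add: ww_def power_add)

lemma ww_mult_le:
  assumes "c \<le> c1 + c2" shows "ww c1 * ww c2 \<le> ww c"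
  unfolding ww_mult unfolding ww_def using assms p0 p1 h0 h1 by (intro mult_mono power_decreasing) auto

text \<open>Both costs are at least 1. So even if one exponent of \<open>h\<close> is saturated at
  K, the other adds a power.\<close>

lemma ww_mult_gain_h:
  assumes "c \<le> c1 + c2" "c < c1 + c2 \<or> nat K < c1 + c2" "c1 \<ge> 1" "c2 \<ge> 1" shows "ww c1 * ww c2 \<le> h * ww c"
proof -
  have "p ^ (c1 + c2) * h ^ (min c1 (nat K) + min c2 (nat K)) \<le> p ^ c * h ^ Suc (min c (nat K))"
    using assms p0 p1 h0 h1 K3 by (intro mult_mono power_decreasing) auto
  then show ?thesis unfolding ww_mult unfolding ww_def by (simp add: mult_ac)
qed

lemma ww_mult_gain_p:
  assumes "c + 2 \<le> c1 + c2" shows "ww c1 * ww c2 \<le> p\<^sup>2 * ww c"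
proof -
  have "p ^ (c1 + c2) * h ^ (min c1 (nat K) + min c2 (nat K)) \<le> p ^ (2 + c) * h ^ (min c (nat K))"
    using assms p0 p1 h0 h1 K3 by (intro mult_mono power_decreasing) auto
  then show ?thesis unfolding ww_mult unfolding ww_def by (simp add: power2_eq_square mult_ac)
qed

text \<open>This is the size of the products that leave the active set, hence of the truncation
  remainder.\<close>

lemma ww_mult_high:
  assumes "nat (2 * K) \<le> c1 + c2" shows "ww c1 * ww c2 \<le> p ^ nat (2 * K)"
proof -
  have "p ^ (c1 + c2) * h ^ (min c1 (nat K) + min c2 (nat K)) \<le> p ^ nat (2 * K) * 1"
    using assms p0 p1 h0 h1 K3 by (intro mult_mono power_decreasing power_le_one) auto
  then show ?thesis by (simp add: ww_mult)
qed

lemma ww_antimono: "c \<le> c' \<Longrightarrow> ww c' \<le> ww c"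
  unfolding ww_def using p0 p1 h0 h1 by (intro mult_mono power_decreasing) auto

lemma ww_le_low: "c \<le> c' \<Longrightarrow> c \<le> nat K \<Longrightarrow> ww c' \<le> (p * h) ^ c"
  using ww_antimono[of c c'] by (simp add: ww_def power_mult_distrib min_absorb1)

lemma wt_le_ph: "wt x \<le> p * h"
  using ww_le_low[OF cost_nat_pos, of x] K3 by (simp add: wt_def)

lemma wt_le_1: "wt x \<le> 1"
  using wt_le_ph[of x] p0 p1 h0 h1 mult_le_one[of p h] by simp

lemma wt_unit: "j \<in> modes M \<Longrightarrow> wt (j, unit_index j) = (p * h) ^ nat (energy_profile K j)"
  using cost_unit[of "unit_index j" j] profile_le[of j] by (simp add: wt_def ww_def power_mult_distrib unit_index_def min_absorb1 nat_mono)

lemma wt_ineg: "fst x \<in> modes M \<Longrightarrow> wt (ineg x) = wt x"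
  by (simp add: wt_def cost_ineg)

lemma norm_divisor_1: "norm (divisor x + 1) = 1" by (simp add: divisor_def)

lemma divisor_bound_weak: "x \<in> active \<Longrightarrow> \<not> resonant x \<Longrightarrow> \<tau> / norm (divisor x) \<le> 1 / (2 * \<gamma> * h)"
  using divisor_weak[of x] gam0 tau0 h0 
  by (smt (verit, best) divide_divide_eq_right divisor_def frac_le mult.commute mult_pos_pos nonzero_mult_divide_mult_cancel_left resonant_def times_divide_eq_left mult_1 nonzero_divide_mult_cancel_left mult.assoc)

lemma divisor_bound_strong: "x \<in> active \<Longrightarrow> \<not> resonant x \<Longrightarrow> snd x \<noteq> - unit_index (fst x) \<Longrightarrow> \<bar>fst x\<bar> \<le> K \<Longrightarrow>
   \<tau> / norm (divisor x) \<le> 1 / (2 * \<gamma>)"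
  using divisor_strong[of x] gam0 tau0 frac_le[of \<tau> \<tau> "2 * \<gamma> * \<tau>" "norm (divisor x)"] by (simp add: divisor_def resonant_def)

lemma divisor_nz: "x \<in> active \<Longrightarrow> \<not> resonant x \<Longrightarrow> divisor x \<noteq> 0"
  using divisor_weak[of x] mult_pos_pos[OF mult_pos_pos[OF gam0 tau0] h0] by (auto simp: divisor_def resonant_def mult.assoc)

text \<open>The two halves of the non-resonance condition are balanced by the weights: wherever a divisor is
  small, the two factors of the product have a total cost exceeding that of the label.\<close>

lemma weight_nonres:
  assumes x: "x \<in> active" "\<not> resonant x"
  shows "\<tau> / norm (divisor x) * wt y * wt (isub x y) \<le> 1 / (2 * \<gamma>) * wt x"
proof -
  let ?z = "isub x y"
  have c: "nat (cost x) \<le> nat (cost y) + nat (cost ?z)"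
    using cost_isub[OF active_mode[OF x(1)], of y] by linarith
  note pos = cost_nat_pos[of y] cost_nat_pos[of ?z]
  show ?thesis
  proof (cases "snd x = - unit_index (fst x) \<or> \<bar>fst x\<bar> > K")
    case True
    have "nat (cost x) < nat (cost y) + nat (cost ?z) \<or> nat K < nat (cost y) + nat (cost ?z)"
    proof (cases "snd x = - unit_index (fst x)")
      case True
      have u: "\<bar>snd x l\<bar> = unit_index (fst x) l" for l using True by (simp add: unit_index_def)
      have "energy_profile K (fst x) + 2 \<le> cost y + cost ?z"
        by (rule cost_unit_gain[OF isub_snd_add[symmetric] u active_mode[OF x(1)]])
      moreover have "cost x = energy_profile K (fst x)"
        using cost_unit[OF u active_mode[OF x(1)]] by simp
      ultimately show ?thesis using cost_pos[of x] by linarith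
    next
      case False
      then have "K + 1 \<le> cost y + cost ?z"
        using cost_high_mode[OF isub_fst_add[OF active_mode[OF x(1)]], of y] True by simp
      then show ?thesis using K3 by linarith
    qed
    then have "wt y * wt ?z \<le> h * wt x" unfolding wt_def by (intro ww_mult_gain_h c pos)
    then have "\<tau> / norm (divisor x) * (wt y * wt ?z) \<le> 1 / (2 * \<gamma> * h) * (h * wt x)"
      by (rule mult_mono[OF divisor_bound_weak[OF x]]) (use wt_pos gam0 h0 in \<open>simp_all add: less_imp_le\<close>)
    then show ?thesis using h0 by (simp add: mult.assoc)
  next
    case False
    have "wt y * wt ?z \<le> wt x" unfolding wt_def by (rule ww_mult_le[OF c])
    then have "\<tau> / norm (divisor x) * (wt y * wt ?z) \<le> 1 / (2 * \<gamma>) * (wt x)"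
      using divisor_bound_strong[OF x] False wt_pos[of y] wt_pos[of ?z] gam0 mult_mono[of "\<tau> / norm (divisor x)" "1 / (2 * \<gamma>)" "wt y * wt ?z" "wt x"]
      by (simp add: less_imp_le)
    then show ?thesis by (simp add: mult.assoc)
  qed
qed

text \<open>The surplus 2 of \<open>cost_unit_gain\<close> becomes the factor p squared. Resonant
  components thus vary on the time scale \<open>Rbig\<close>.\<close>

lemma weight_res:
  assumes x: "x \<in> active" "resonant x"
  shows "wt y * wt (isub x y) \<le> p\<^sup>2 * wt x"
proof -
  have u: "\<bar>snd x l\<bar> = unit_index (fst x) l" for l using x by (simp add: unit_index_def resonant_def)
  have "energy_profile K (fst x) + 2 \<le> cost y + cost (isub x y)"
    by (rule cost_unit_gain[OF isub_snd_add[symmetric] u active_mode[OF x(1)]])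
  moreover have "cost x = energy_profile K (fst x)"
    using cost_unit[OF u active_mode[OF x(1)]] by simp
  ultimately show ?thesis unfolding wt_def using cost_pos[of x] by (intro ww_mult_gain_p) linarith
qed

text \<open>In each mode the resonant component has the largest weight, so the nonresonant parts can
  be moved into it without loss.\<close>

lemma weight_unit: "x \<in> active \<Longrightarrow> wt x \<le> wt (fst x, unit_index (fst x))"
  unfolding wt_def using cost_ge_profile[of x] cost_unit[of "unit_index (fst x)" "fst x"] active_mode[of x]
  by (intro ww_antimono) (simp add: unit_index_def)

subsection \<open>Norms\<close>

lemma rn_nonneg: "rn v \<alpha> \<ge> 0" by (simp add: rn_def L2_set_nonneg)

lemma rn_mono:
  assumes "\<And>x. x \<in> active \<Longrightarrow> 0 \<le> \<alpha> x" "\<And>x. x \<in> active \<Longrightarrow> \<alpha> x \<le> \<beta> x" "\<And>x. v x > 0"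
  shows "rn v \<alpha> \<le> rn v \<beta>"
  unfolding rn_def
  using assms sg_pos by (intro L2_set_mono mult_left_mono sum_mono mult_nonneg_nonneg sum_nonneg divide_right_mono divide_nonneg_pos) (auto simp: sec_def intro: less_imp_le)

lemma rn_add: "rn v (\<lambda>x. \<alpha> x + \<beta> x) \<le> rn v \<alpha> + rn v \<beta>"
  unfolding rn_def add_divide_distrib sum.distrib distrib_left by (rule L2_set_triangle_ineq)

lemma rn_cmult: "c \<ge> 0 \<Longrightarrow> rn v (\<lambda>x. c * \<alpha> x) = c * rn v \<alpha>"
  unfolding rn_def by (subst L2_set_right_distrib) (simp_all add: sum_distrib_left mult_ac)

lemma sum_le_rn:
  assumes "j \<in> modes M" "\<And>x. x \<in> active \<Longrightarrow> 0 \<le> \<alpha> x" "\<And>x. v x > 0"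
  shows "(\<Sum>k\<in>sec j. \<alpha> (j, k) / v (j, k)) \<le> rn v \<alpha>"
proof -
  have n: "(\<Sum>k\<in>sec j. \<alpha> (j, k) / v (j, k)) \<ge> 0"
    using assms by (intro sum_nonneg) (auto simp: sec_def intro!: divide_nonneg_pos)
  have "1 * (\<Sum>k\<in>sec j. \<alpha> (j, k) / v (j, k)) \<le> sg j * (\<Sum>k\<in>sec j. \<alpha> (j, k) / v (j, k))"
    using n sg_ge_1 by (rule mult_right_mono[rotated])
  also have "\<dots> \<le> rn v \<alpha>" unfolding rn_def using assms by (intro member_le_L2_set) auto
  finally show ?thesis by simp
qed

lemma le_rn:
  assumes "x \<in> active" "\<And>x. x \<in> active \<Longrightarrow> 0 \<le> \<alpha> x" "\<And>x. v x > 0"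
  shows "\<alpha> x \<le> v x * rn v \<alpha>"
proof -
  have "\<alpha> x / v x \<le> (\<Sum>k\<in>sec (fst x). \<alpha> (fst x, k) / v (fst x, k))"
  proof -
    have "(\<lambda>k. \<alpha> (fst x, k) / v (fst x, k)) (snd x) \<le> (\<Sum>k\<in>sec (fst x). \<alpha> (fst x, k) / v (fst x, k))"
      using assms(1) by (intro member_le_sum) (simp_all add: assms divide_nonneg_pos, simp_all add: sec_def assms divide_nonneg_pos)
    then show ?thesis by simp
  qed
  also have "\<dots> \<le> rn v \<alpha>" using assms active_mode by (intro sum_le_rn) auto
  finally show ?thesis using assms(3)[of x] by (simp add: field_simps)
qed

lemma rn_ineg:
  assumes "\<And>x. x \<in> active \<Longrightarrow> v (ineg x) = v x"
  shows "rn v (\<lambda>x. \<alpha> (ineg x)) = rn v \<alpha>"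
proof -
  have "sg j * (\<Sum>k\<in>sec j. \<alpha> (ineg (j, k)) / v (j, k)) = 
     (\<lambda>j. sg j * (\<Sum>k\<in>sec j. \<alpha> (j, k) / v (j, k))) (mode_rep M (- j))" if j: "j \<in> modes M" for j
  proof -
    have "(\<Sum>k\<in>sec j. \<alpha> (ineg (j, k)) / v (j, k)) = (\<Sum>k\<in>sec j. \<alpha> (mode_rep M (- j), - k) / v (mode_rep M (- j), - k))"
      using assms by (intro sum.cong) (auto simp: sec_def ineg_def)
    also have "\<dots> = (\<Sum>k\<in>sec (mode_rep M (- j)). \<alpha> (mode_rep M (- j), k) / v (mode_rep M (- j), k))"
    proof (rule sum.reindex_bij_witness[of _ uminus uminus])
      fix k assume "k \<in> sec j"
      then show "- k \<in> sec (mode_rep M (- j))" using ineg_active[of "(j,k)"] by (simp add: sec_def ineg_def)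
    next
      fix k assume "k \<in> sec (mode_rep M (- j))"
      then show "- k \<in> sec j" using ineg_active[of "(mode_rep M (- j),k)"] j by (simp add: sec_def ineg_def mode_rep_simps mode_rep_id)
    qed auto
    finally show ?thesis using sg_sym[OF j] by simp
  qed
  then have "rn v (\<lambda>x. \<alpha> (ineg x)) = L2_set (\<lambda>j. (\<lambda>j. sg j * (\<Sum>k\<in>sec j. \<alpha> (j, k) / v (j, k))) (mode_rep M (- j))) (modes M)"
    unfolding rn_def by (intro L2_set_cong) auto
  also have "\<dots> = rn v \<alpha>" unfolding rn_def by (rule L2_set_reindex[OF bij_mode_rep_uminus[OF M0]])
  finally show ?thesis .
qed

text \<open>\<open>H\<close> is tested on each pair of labels, so that a divisor in \<open>g\<close>
  can be charged to the weights of the factors. The second weight \<open>w\<close> allows the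
  stability estimate to measure one factor without weight.\<close>

lemma rn_conv:
  assumes \<alpha>: "\<And>x. \<alpha> x \<ge> 0" and \<beta>: "\<And>x. \<beta> x \<ge> 0" and v: "\<And>x. v x > 0" and w: "\<And>x. w x > 0" and \<theta>: "\<theta> \<ge> 0"
    and g: "\<And>x. g x \<ge> 0"
    and H: "\<And>x y. x \<in> active \<Longrightarrow> y \<in> active \<Longrightarrow> isub x y \<in> active \<Longrightarrow> g x * w y * v (isub x y) \<le> \<theta> * v x"
  shows "rn v (\<lambda>x. g x * (\<Sum>y\<in>{y \<in> active. isub x y \<in> active}. \<alpha> y * \<beta> (isub x y))) \<le> \<theta> * conv_const s * rn w \<alpha> * rn v \<beta>"
proof -
  define A where "A = (\<lambda>j. \<Sum>k\<in>sec j. \<alpha> (j, k) / w (j, k))"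
  define B where "B = (\<lambda>j. \<Sum>k\<in>sec j. \<beta> (j, k) / v (j, k))"
  have A0: "A j \<ge> 0" and B0: "B j \<ge> 0" for j
    unfolding A_def B_def using \<alpha> \<beta> v w by (auto intro!: sum_nonneg divide_nonneg_pos)
  have *: "(\<Sum>k\<in>sec j. g (j, k) * (\<Sum>y\<in>{y \<in> active. isub (j, k) y \<in> active}. \<alpha> y * \<beta> (isub (j, k) y)) / v (j, k))
      \<le> \<theta> * (\<Sum>i\<in>modes M. A i * B (mode_rep M (j - i)))" if j: "j \<in> modes M" for j
  proof -
    let ?t = "\<lambda>k y. if isub (j, k) y \<in> active then \<alpha> y / w y * (\<beta> (isub (j, k) y) / v (isub (j, k) y)) else 0"
    have "(\<Sum>k\<in>sec j. g (j, k) * (\<Sum>y\<in>{y \<in> active. isub (j, k) y \<in> active}. \<alpha> y * \<beta> (isub (j, k) y)) / v (j, k))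
       \<le> (\<Sum>k\<in>sec j. \<theta> * (\<Sum>y\<in>active. ?t k y))"
    proof (rule sum_mono)
      fix k assume k: "k \<in> sec j"
      have "g (j, k) * (\<Sum>y\<in>{y \<in> active. isub (j, k) y \<in> active}. \<alpha> y * \<beta> (isub (j, k) y)) / v (j, k) =
         (\<Sum>y\<in>{y \<in> active. isub (j, k) y \<in> active}. g (j, k) * (\<alpha> y * \<beta> (isub (j, k) y)) / v (j, k))"
        by (simp add: sum_distrib_left sum_divide_distrib)
      also have "\<dots> \<le> (\<Sum>y\<in>{y \<in> active. isub (j, k) y \<in> active}. \<theta> * (\<alpha> y / w y * (\<beta> (isub (j, k) y) / v (isub (j, k) y))))"
      proof (rule sum_mono)
        fix y assume y: "y \<in> {y \<in> active. isub (j, k) y \<in> active}"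
        let ?q = "\<alpha> y / w y * (\<beta> (isub (j, k) y) / v (isub (j, k) y)) / v (j, k)"
        have "g (j, k) * (\<alpha> y * \<beta> (isub (j, k) y)) / v (j, k) = g (j, k) * w y * v (isub (j, k) y) * ?q"
          using v[of "isub (j,k) y"] w[of y] by (simp add: field_simps)
        also have "\<dots> \<le> \<theta> * v (j, k) * ?q"
        proof (rule mult_right_mono)
          show "g (j, k) * w y * v (isub (j, k) y) \<le> \<theta> * v (j, k)" using H[of "(j, k)" y] k y by (simp add: sec_def)
          show "?q \<ge> 0" by (intro divide_nonneg_pos mult_nonneg_nonneg \<alpha> \<beta> v w)
        qed
        also have "\<dots> = \<theta> * (\<alpha> y / w y * (\<beta> (isub (j, k) y) / v (isub (j, k) y)))"
          using v[of "(j, k)"] by simp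
        finally show "g (j, k) * (\<alpha> y * \<beta> (isub (j, k) y)) / v (j, k) \<le> \<dots>" .
      qed
      also have "\<dots> = \<theta> * (\<Sum>y\<in>active. ?t k y)"
        unfolding sum_distrib_left by (subst sum.inter_filter[OF finite_active]) (auto intro!: sum.cong)
      finally show "g (j, k) * (\<Sum>y\<in>{y \<in> active. isub (j, k) y \<in> active}. \<alpha> y * \<beta> (isub (j, k) y)) / v (j, k) \<le> \<theta> * (\<Sum>y\<in>active. ?t k y)" .
    qed
    also have "\<dots> = \<theta> * (\<Sum>y\<in>active. \<Sum>k\<in>sec j. ?t k y)"
      unfolding sum_distrib_left[symmetric] by (subst sum.swap) simp
    also have "\<dots> \<le> \<theta> * (\<Sum>y\<in>active. \<alpha> y / w y * B (mode_rep M (j - fst y)))"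
    proof (intro mult_left_mono sum_mono \<theta>)
      fix y assume "y \<in> active"
      let ?r = "mode_rep M (j - fst y)"
      let ?S = "{k \<in> sec j. k - snd y \<in> sec ?r}"
      have "(\<Sum>k\<in>sec j. ?t k y) = (\<Sum>k\<in>?S. \<alpha> y / w y * (\<beta> (?r, k - snd y) / v (?r, k - snd y)))"
        by (subst sum.inter_filter[OF finite_sec]) (auto simp: isub_def sec_def intro!: sum.cong)
      also have "\<dots> = (\<Sum>k\<in>(\<lambda>k. k - snd y) ` ?S. \<alpha> y / w y * (\<beta> (?r, k) / v (?r, k)))"
        by (subst sum.reindex) (auto simp: inj_on_def fun_eq_iff)
      also have "\<dots> \<le> (\<Sum>k\<in>sec ?r. \<alpha> y / w y * (\<beta> (?r, k) / v (?r, k)))"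
        by (intro sum_mono2 mult_nonneg_nonneg divide_nonneg_pos \<alpha> \<beta> v w finite_sec) auto
      also have "\<dots> = \<alpha> y / w y * B ?r" by (simp add: B_def sum_distrib_left)
      finally show "(\<Sum>k\<in>sec j. ?t k y) \<le> \<alpha> y / w y * B ?r" .
    qed
    also have "(\<Sum>y\<in>active. \<alpha> y / w y * B (mode_rep M (j - fst y))) = (\<Sum>i\<in>modes M. A i * B (mode_rep M (j - i)))"
      by (simp add: sum_active A_def sum_distrib_right)
    finally show ?thesis .
  qed
  have "rn v (\<lambda>x. g x * (\<Sum>y\<in>{y \<in> active. isub x y \<in> active}. \<alpha> y * \<beta> (isub x y)))
     \<le> L2_set (\<lambda>j. \<theta> * (sg j * (\<Sum>i\<in>modes M. A i * B (mode_rep M (j - i))))) (modes M)"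
    unfolding rn_def
  proof (rule L2_set_mono)
    fix j assume j: "j \<in> modes M"
    show "sg j * (\<Sum>k\<in>sec j. g (j, k) * (\<Sum>y\<in>{y \<in> active. isub (j, k) y \<in> active}. \<alpha> y * \<beta> (isub (j, k) y)) / v (j, k))
      \<le> \<theta> * (sg j * (\<Sum>i\<in>modes M. A i * B (mode_rep M (j - i))))"
      using mult_left_mono[OF *[OF j], of "sg j"] sg_pos[of j] by (simp add: mult_ac)
    show "0 \<le> sg j * (\<Sum>k\<in>sec j. g (j, k) * (\<Sum>y\<in>{y \<in> active. isub (j, k) y \<in> active}. \<alpha> y * \<beta> (isub (j, k) y)) / v (j, k))"
      using sg_pos[of j] \<alpha> \<beta> v g by (intro mult_nonneg_nonneg sum_nonneg divide_nonneg_pos) (auto intro: less_imp_le)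
  qed
  also have "\<dots> = \<theta> * L2_set (\<lambda>j. sg j * (\<Sum>i\<in>modes M. A i * B (mode_rep M (j - i)))) (modes M)"
    using \<theta> by (rule L2_set_right_distrib[symmetric])
  also have "\<dots> \<le> \<theta> * (conv_const s * L2_set (\<lambda>j. sg j * A j) (modes M) * L2_set (\<lambda>j. sg j * B j) (modes M))"
    using L2_conv[OF s12 M0 A0 B0] \<theta> by (rule mult_left_mono)
  finally show ?thesis by (simp add: rn_def A_def B_def mult.assoc)
qed

lemma pos_part_newton:
  "pos_part (node n a m) x = newton \<tau> n (\<lambda>i. pos_part (\<lambda>x. a x i) x) m"
proof -
  have "cnj (newton \<tau> n f m) = newton \<tau> n (\<lambda>i. cnj (f i)) m" for f
    by (simp add: newton_def)
  then show ?thesis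
    by (auto simp: pos_part_def node_def newton_def sum.distrib[symmetric] sum_distrib_left algebra_simps add_divide_distrib intro!: sum.cong)
qed

lemma pos_part_bound:
  assumes "R \<ge> 0"
  shows "jet_norm n R (\<lambda>i. pos_part (\<lambda>x. a x i) x) \<le> b / (2 * sqrt \<rho>) * (jet_norm n R (a x) + jet_norm n R (a (ineg x)))"
proof (cases "x \<in> active")
  case True
  have "jet_norm n R (\<lambda>i. pos_part (\<lambda>x. a x i) x) = \<bar>fl (fst x) / (2 * om (fst x))\<bar> * jet_norm n R (\<lambda>i. a x i + cnj (a (ineg x) i))"
    using True jet_norm_cmult[of n R "complex_of_real (fl (fst x) / (2 * om (fst x)))" "\<lambda>i. a x i + cnj (a (ineg x) i)"]
    by (simp add: pos_part_def norm_divide norm_mult abs_mult)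
  also have "\<dots> \<le> b / (2 * sqrt \<rho>) * (jet_norm n R (a x) + jet_norm n R (\<lambda>i. cnj (a (ineg x) i)))"
  proof (intro mult_mono jet_norm_add assms jet_norm_nonneg)
    show "\<bar>fl (fst x) / (2 * om (fst x))\<bar> \<le> b / (2 * sqrt \<rho>)"
      unfolding abs_divide using fl_bound om_pos[of "fst x"] om_ge[of "fst x"] rho0 b0 by (intro frac_le) auto
  qed (use b0 rho0 in auto)
  also have "jet_norm n R (\<lambda>i. cnj (a (ineg x) i)) = jet_norm n R (a (ineg x))" by (simp add: jet_norm_def)
  finally show ?thesis .
next
  case False
  then show ?thesis using b0 rho0 jet_norm_nonneg[OF assms] by (simp add: pos_part_def jet_norm_def)
qed

lemma rn_pos_part:
  assumes "R \<ge> 0" and v: "\<And>x. v x > 0" and vs: "\<And>x. x \<in> active \<Longrightarrow> v (ineg x) = v x"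
  shows "rn v (\<lambda>x. jet_norm n R (\<lambda>i. pos_part (\<lambda>x. a x i) x)) \<le> b / sqrt \<rho> * nrm n v R a"
proof -
  have "rn v (\<lambda>x. jet_norm n R (\<lambda>i. pos_part (\<lambda>x. a x i) x)) \<le>
      rn v (\<lambda>x. b / (2 * sqrt \<rho>) * (jet_norm n R (a x) + jet_norm n R (a (ineg x))))"
    by (intro rn_mono pos_part_bound jet_norm_nonneg assms)
  also have "\<dots> = b / (2 * sqrt \<rho>) * rn v (\<lambda>x. jet_norm n R (a x) + jet_norm n R (a (ineg x)))"
    using b0 rho0 by (intro rn_cmult) simp
  also have "\<dots> \<le> b / (2 * sqrt \<rho>) * (nrm n v R a + rn v (\<lambda>x. jet_norm n R (a (ineg x))))"
    using b0 rho0 by (intro mult_left_mono rn_add) simp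
  also have "rn v (\<lambda>x. jet_norm n R (a (ineg x))) = nrm n v R a"
    using rn_ineg[of v "\<lambda>x. jet_norm n R (a x)"] vs by simp
  finally show ?thesis by simp
qed

lemma bil_jet_bound:
  assumes "\<tau> \<le> R"
  shows "jet_norm n R (bil_jet n a a' x) \<le> b * 4 ^ n * (\<Sum>y\<in>{y \<in> active. isub x y \<in> active}.
     jet_norm n R (\<lambda>i. pos_part (\<lambda>x. a x i) y) * jet_norm n R (\<lambda>i. pos_part (\<lambda>x. a' x i) (isub x y)))"
proof -
  have R: "R \<ge> 0" using assms tau0 by simp
  let ?A = "{y \<in> active. isub x y \<in> active}"
  let ?f = "\<lambda>a y m. newton \<tau> n (\<lambda>i. pos_part (\<lambda>x. a x i) y) m"
  have "bil_jet n a a' x i = (- \<i> * of_real (fl (fst x))) * (\<Sum>y\<in>?A. jet \<tau> (\<lambda>m. ?f a y m * ?f a' (isub x y) m) i)" for i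
  proof -
    have "bil (node n a m) (node n a' m) x = - \<i> * of_real (fl (fst x)) * (\<Sum>y\<in>?A. ?f a y m * ?f a' (isub x y) m)" for m
    proof -
      have "(\<Sum>y\<in>active. pos_part (node n a m) y * pos_part (node n a' m) (isub x y)) = (\<Sum>y\<in>?A. ?f a y m * ?f a' (isub x y) m)"
        unfolding pos_part_newton[symmetric] by (rule sum.mono_neutral_right[OF finite_active]) (auto simp: pos_part_def)
      then show ?thesis by (simp add: bil_def)
    qed
    then show ?thesis unfolding bil_jet_def by (simp only: fdiff_pow_cmult fdiff_pow_sum)
  qed
  then have "bil_jet n a a' x = (\<lambda>i. (- \<i> * of_real (fl (fst x))) * (\<Sum>y\<in>?A. jet \<tau> (\<lambda>m. ?f a y m * ?f a' (isub x y) m) i))"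
    by (rule ext)
  then have "jet_norm n R (bil_jet n a a' x) = \<bar>fl (fst x)\<bar> * jet_norm n R (\<lambda>i. \<Sum>y\<in>?A. jet \<tau> (\<lambda>m. ?f a y m * ?f a' (isub x y) m) i)"
    by (simp only: jet_norm_cmult) (simp add: norm_mult)
  also have "\<dots> \<le> b * (\<Sum>y\<in>?A. jet_norm n R (jet \<tau> (\<lambda>m. ?f a y m * ?f a' (isub x y) m)))"
    by (intro mult_mono fl_bound jet_norm_sum jet_norm_nonneg R b0)
  also have "\<dots> \<le> b * (\<Sum>y\<in>?A. 4 ^ n * jet_norm n R (jet \<tau> (?f a y)) * jet_norm n R (jet \<tau> (?f a' (isub x y))))"
    by (intro mult_left_mono sum_mono jet_norm_mult tau0 assms b0)
  also have "\<dots> = b * 4 ^ n * (\<Sum>y\<in>?A. jet_norm n R (\<lambda>i. pos_part (\<lambda>x. a x i) y) * jet_norm n R (\<lambda>i. pos_part (\<lambda>x. a' x i) (isub x y)))"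
  proof -
    have "jet_norm n R (jet \<tau> (newton \<tau> n c)) = jet_norm n R c" for c
      unfolding jet_norm_def using tau0 by (simp add: jet_newton)
    then show ?thesis by (simp add: sum_distrib_left mult_ac)
  qed
  finally show ?thesis .
qed

lemma rn_bil_jet:
  assumes R: "\<tau> \<le> R" and v: "\<And>x. v x > 0" and w: "\<And>x. w x > 0" and \<theta>: "\<theta> \<ge> 0" and g: "\<And>x. g x \<ge> 0"
    and vs: "\<And>x. x \<in> active \<Longrightarrow> v (ineg x) = v x" and ws: "\<And>x. x \<in> active \<Longrightarrow> w (ineg x) = w x"
    and H: "\<And>x y. x \<in> active \<Longrightarrow> y \<in> active \<Longrightarrow> isub x y \<in> active \<Longrightarrow> g x * w y * v (isub x y) \<le> \<theta> * v x"
  shows "rn v (\<lambda>x. g x * jet_norm n R (bil_jet n a a' x)) \<le> \<theta> * hconst n * nrm n w R a * nrm n v R a'"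
proof -
  have R0: "R \<ge> 0" using R tau0 by simp
  let ?j = "\<lambda>a y. jet_norm n R (\<lambda>i. pos_part (\<lambda>x. a x i) y)"
  have "rn v (\<lambda>x. g x * jet_norm n R (bil_jet n a a' x)) \<le>
     rn v (\<lambda>x. b * 4 ^ n * (g x * (\<Sum>y\<in>{y \<in> active. isub x y \<in> active}. ?j a y * ?j a' (isub x y))))"
  proof (rule rn_mono)
    fix x
    show "0 \<le> g x * jet_norm n R (bil_jet n a a' x)" using g jet_norm_nonneg[OF R0] by simp
    show "g x * jet_norm n R (bil_jet n a a' x) \<le> b * 4 ^ n * (g x * (\<Sum>y\<in>{y \<in> active. isub x y \<in> active}. ?j a y * ?j a' (isub x y)))"
      using mult_left_mono[OF bil_jet_bound[OF R, of n a a' x] g[of x]] by (simp add: mult_ac)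
  qed (rule v)
  also have "\<dots> = b * 4 ^ n * rn v (\<lambda>x. g x * (\<Sum>y\<in>{y \<in> active. isub x y \<in> active}. ?j a y * ?j a' (isub x y)))"
    using b0 by (intro rn_cmult) simp
  also have "\<dots> \<le> b * 4 ^ n * (\<theta> * conv_const s * rn w (?j a) * rn v (?j a'))"
    using b0 by (intro mult_left_mono rn_conv v w \<theta> g H jet_norm_nonneg R0) auto
  also have "\<dots> \<le> b * 4 ^ n * (\<theta> * conv_const s * (b / sqrt \<rho> * nrm n w R a) * (b / sqrt \<rho> * nrm n v R a'))"
    using b0 conv_const_nonneg \<theta> rho0 rn_nonneg
    by (intro mult_left_mono mult_mono rn_pos_part R0 v w vs ws) (auto intro!: mult_nonneg_nonneg)
  also have "\<dots> = \<theta> * hconst n * nrm n w R a * nrm n v R a'"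
    by (simp add: hconst_def power2_eq_square mult_ac)
  finally show ?thesis .
qed

lemma bil_commute:
  shows "bil Z Z' x = bil Z' Z x"
proof -
  have *: "(\<Sum>y\<in>active. pos_part Z y * pos_part Z' (isub x y)) = (\<Sum>y\<in>{y \<in> active. isub x y \<in> active}. pos_part Z y * pos_part Z' (isub x y))" for Z Z'
    by (rule sum.mono_neutral_right[OF finite_active]) (auto simp: pos_part_def)
  have "(\<Sum>y\<in>{y \<in> active. isub x y \<in> active}. pos_part Z y * pos_part Z' (isub x y)) 
     = (\<Sum>y\<in>{y \<in> active. isub x y \<in> active}. pos_part Z' y * pos_part Z (isub x y))"
    by (rule sum.reindex_bij_witness[of _ "isub x" "isub x"]) (auto simp: isub_isub active_mode)
  then show ?thesis by (simp add: bil_def *)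
qed

text \<open>Polarization, through which a single bilinear bound also gives the Lipschitz
  estimates.\<close>

lemma bil_square_diff: "bil Z Z x - bil Z' Z' x = bil (\<lambda>x. Z x + Z' x) (\<lambda>x. Z x - Z' x) x"
proof -
  have "pos_part (\<lambda>x. Z x + Z' x) y = pos_part Z y + pos_part Z' y" "pos_part (\<lambda>x. Z x - Z' x) y = pos_part Z y - pos_part Z' y" for y
    by (auto simp: pos_part_def algebra_simps add_divide_distrib diff_divide_distrib)
  then have "bil (\<lambda>x. Z x + Z' x) (\<lambda>x. Z x - Z' x) x = bil Z Z x - bil Z Z' x + bil Z' Z x - bil Z' Z' x"
    unfolding bil_def by (simp only:) (simp add: algebra_simps sum.distrib sum_subtractf)
  then show ?thesis using bil_commute[of Z Z' x] by simp
qed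

lemma bil_jet_diff: "bil_jet n a a x i - bil_jet n a' a' x i = bil_jet n (\<lambda>x i. a x i + a' x i) (\<lambda>x i. a x i - a' x i) x i"
proof -
  have "node n (\<lambda>x i. a x i + a' x i) m = (\<lambda>x. node n a m x + node n a' m x)" 
       "node n (\<lambda>x i. a x i - a' x i) m = (\<lambda>x. node n a m x - node n a' m x)" for m
    by (auto simp: node_def newton_def fun_eq_iff algebra_simps sum.distrib sum_subtractf)
  then show ?thesis by (simp add: bil_jet_def bil_square_diff[symmetric] fdiff_pow_diff)
qed

text \<open>
  The modulation equations as a fixed-point problem. Dropping the difference of order \<open>N + 1\<close> in the
  nonresonant components closes the system and selects the solution that varies slowly; the value of
  the resonant component is what is left of \<open>c\<^sub>j\<close>.
\<close>

definition mod_nonres :: "(label \<Rightarrow> nat \<Rightarrow> complex) \<Rightarrow> label \<Rightarrow> nat \<Rightarrow> complex" where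
  "mod_nonres a x i = of_real \<tau> / divisor x *
     (bil_jet N a a x i - (divisor x + 1) * (if i < N then a x (Suc i) else 0))"

text \<open>The resonant value subtracts the updated nonresonant values \<open>mod_nonres a\<close>,
  not those of \<open>a\<close>, so that the small factors in \<open>mod_nonres\<close> make this
  entry contract as well.\<close>

definition mod_map :: "(int \<Rightarrow> complex) \<Rightarrow> (label \<Rightarrow> nat \<Rightarrow> complex) \<Rightarrow> label \<Rightarrow> nat \<Rightarrow> complex" where
  "mod_map c a x i =
     (if \<not> resonant x then mod_nonres a x i
      else if i = 0 then c (fst x) - (\<Sum>k\<in>sec (fst x) - {snd x}. mod_nonres a (fst x, k) 0)
      else bil_jet N a a x (i - 1))"

lemma unit_in_sec: "j \<in> modes M \<Longrightarrow> unit_index j \<in> sec j"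
  using active_unit by (simp add: sec_def)

lemma jet_norm_shift:
  assumes "R > 0"
  shows "R * jet_norm n R (\<lambda>i. if i < n then a (Suc i) else 0) \<le> jet_norm n R a"
proof (cases n)
  case 0
  then show ?thesis by (simp add: jet_norm_def)
next
  case (Suc m)
  have "jet_norm n R (\<lambda>i. if i < n then a (Suc i) else 0) = jet_norm m R (\<lambda>i. a (Suc i))"
    by (simp add: jet_norm_def Suc)
  then show ?thesis by (simp add: jet_norm_Suc Suc)
qed

text \<open>Passing to the next difference gains 1/\<open>R\<close> in the norm, which outweighs a
  divisor loss of at most \<open>R\<close> / 8.\<close>

lemma mod_nonres_diff:
  assumes R: "R > 0" and g: "\<tau> / norm (divisor x) \<le> R / 8"
  shows "jet_norm N R (\<lambda>i. mod_nonres a x i - mod_nonres a' x i) \<le>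
    \<tau> / norm (divisor x) * jet_norm N R (bil_jet N (\<lambda>x i. a x i + a' x i) (\<lambda>x i. a x i - a' x i) x)
    + 1 / 8 * jet_norm N R (\<lambda>i. a x i - a' x i)"
proof -
  let ?B = "bil_jet N (\<lambda>x i. a x i + a' x i) (\<lambda>x i. a x i - a' x i) x"
  let ?S = "\<lambda>i. if i < N then a x (Suc i) - a' x (Suc i) else 0"
  have e: "mod_nonres a x i - mod_nonres a' x i = of_real \<tau> / divisor x * (?B i + (- (divisor x + 1)) * ?S i)" for i
    unfolding mod_nonres_def bil_jet_diff[symmetric] right_diff_distrib[symmetric] by (simp add: algebra_simps diff_divide_distrib)
  have "jet_norm N R (\<lambda>i. mod_nonres a x i - mod_nonres a' x i) =
     \<tau> / norm (divisor x) * jet_norm N R (\<lambda>i. ?B i + (- (divisor x + 1)) * ?S i)"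
    unfolding e jet_norm_cmult using tau0 by (simp add: norm_divide)
  also have "\<dots> \<le> \<tau> / norm (divisor x) * (jet_norm N R ?B + jet_norm N R ?S)"
    using jet_norm_add[of R N ?B "\<lambda>i. (- (divisor x + 1)) * ?S i"] R tau0
    unfolding jet_norm_cmult norm_minus_cancel norm_divisor_1 by (intro mult_left_mono) auto
  also have "\<dots> = \<tau> / norm (divisor x) * jet_norm N R ?B + \<tau> / norm (divisor x) * jet_norm N R ?S"
    by (rule distrib_left)
  also have "\<tau> / norm (divisor x) * jet_norm N R ?S \<le> R / 8 * jet_norm N R ?S"
    using g R by (intro mult_right_mono jet_norm_nonneg) auto
  also have "\<dots> \<le> 1 / 8 * jet_norm N R (\<lambda>i. a x i - a' x i)"
    using jet_norm_shift[OF R, of N "\<lambda>i. a x i - a' x i"] by simp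
  finally show ?thesis by simp
qed

lemma jet_norm_res:
  assumes R: "R > 0"
  shows "jet_norm N R (\<lambda>i. if i = 0 then c else f (i - 1)) \<le> norm c + R * jet_norm N R f"
proof -
  obtain n where n: "N = Suc n" using N1 by (cases N) auto
  have "jet_norm N R (\<lambda>i. if i = 0 then c else f (i - 1)) = norm c + R * jet_norm n R f"
    unfolding n jet_norm_Suc by simp
  also have "\<dots> \<le> norm c + R * jet_norm N R f" using R n by (intro add_left_mono mult_left_mono jet_norm_mono_n) auto
  finally show ?thesis .
qed

text \<open>A nonresonant change counts twice, in its own label and in the resonant value. This
  doubles the divisor factor and turns 1/8 into 1/4.\<close>

lemma mod_map_section:
  assumes j: "j \<in> modes M" and R: "R > 0" and v: "\<And>x. v x > 0"
    and vu: "\<And>x. x \<in> active \<Longrightarrow> v x \<le> v (fst x, unit_index (fst x))"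
    and C: "\<And>x. x \<in> active \<Longrightarrow> \<not> resonant x \<Longrightarrow> \<tau> / norm (divisor x) \<le> R / 8"
  shows "(\<Sum>k\<in>sec j. jet_norm N R (\<lambda>i. mod_map c a (j, k) i - mod_map c' a' (j, k) i) / v (j, k)) \<le>
     norm (c j - c' j) / v (j, unit_index j)
     + (\<Sum>k\<in>sec j. (if resonant (j, k) then R else 2 * \<tau> / norm (divisor (j, k))) *
         jet_norm N R (bil_jet N (\<lambda>x i. a x i + a' x i) (\<lambda>x i. a x i - a' x i) (j, k)) / v (j, k))
     + 1 / 4 * (\<Sum>k\<in>sec j. jet_norm N R (\<lambda>i. a (j, k) i - a' (j, k) i) / v (j, k))"
proof -
  let ?u = "unit_index j" and ?S = "sec j - {unit_index j}"
  let ?d = "\<lambda>k i. mod_nonres a (j, k) i - mod_nonres a' (j, k) i"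
  let ?B = "\<lambda>k. jet_norm N R (bil_jet N (\<lambda>x i. a x i + a' x i) (\<lambda>x i. a x i - a' x i) (j, k))"
  let ?D = "\<lambda>k. jet_norm N R (\<lambda>i. a (j, k) i - a' (j, k) i)"
  let ?n = "\<lambda>k. \<tau> / norm (divisor (j, k)) * ?B k + 1 / 8 * ?D k"
  have res: "resonant (j, k) \<longleftrightarrow> k = ?u" for k by (simp add: resonant_def)
  have act: "k \<in> sec j \<Longrightarrow> (j, k) \<in> active" for k by (simp add: sec_def)
  have n: "jet_norm N R (?d k) \<le> ?n k" if "k \<in> ?S" for k
    using that by (intro mod_nonres_diff R C) (auto simp: res act)
  have split: "(\<Sum>k\<in>sec j. f k) = f ?u + (\<Sum>k\<in>?S. f k)" for f :: "_ \<Rightarrow> real"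
    by (rule sum.remove) (auto simp: unit_in_sec j)
  have "(\<lambda>i. mod_map c a (j, ?u) i - mod_map c' a' (j, ?u) i) = (\<lambda>i. if i = 0 then (c j - c' j) - (\<Sum>k\<in>?S. ?d k 0)
       else (\<lambda>i. bil_jet N a a (j, ?u) i - bil_jet N a' a' (j, ?u) i) (i - 1))"
    by (auto simp: mod_map_def res fun_eq_iff sum_subtractf)
  then have "jet_norm N R (\<lambda>i. mod_map c a (j, ?u) i - mod_map c' a' (j, ?u) i)
      \<le> norm ((c j - c' j) - (\<Sum>k\<in>?S. ?d k 0)) + R * ?B ?u"
    using jet_norm_res[OF R, of "(c j - c' j) - (\<Sum>k\<in>?S. ?d k 0)" "\<lambda>i. bil_jet N a a (j, ?u) i - bil_jet N a' a' (j, ?u) i"]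
    unfolding bil_jet_diff by simp
  also have "norm ((c j - c' j) - (\<Sum>k\<in>?S. ?d k 0)) \<le> norm (c j - c' j) + (\<Sum>k\<in>?S. ?n k)"
  proof -
    have "norm (\<Sum>k\<in>?S. ?d k 0) \<le> (\<Sum>k\<in>?S. ?n k)"
    proof (rule sum_norm_le)
      fix k assume k: "k \<in> ?S"
      show "norm (?d k 0) \<le> ?n k" using norm_le_jet_norm[of R 0 N "?d k"] R n[OF k] by simp
    qed
    then show ?thesis using norm_triangle_ineq4[of "c j - c' j" "\<Sum>k\<in>?S. ?d k 0"] by linarith
  qed
  finally have u: "jet_norm N R (\<lambda>i. mod_map c a (j, ?u) i - mod_map c' a' (j, ?u) i) / v (j, ?u)
     \<le> (norm (c j - c' j) + (\<Sum>k\<in>?S. ?n k) + R * ?B ?u) / v (j, ?u)"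
    using v by (intro divide_right_mono) (auto intro: less_imp_le)
  have n0: "0 \<le> ?n k" for k using jet_norm_nonneg R tau0 by (auto intro!: add_nonneg_nonneg mult_nonneg_nonneg)
  have "(\<Sum>k\<in>?S. ?n k) / v (j, ?u) \<le> (\<Sum>k\<in>?S. ?n k / v (j, k))"
    unfolding sum_divide_distrib
  proof (rule sum_mono)
    fix k assume "k \<in> ?S"
    then have "v (j, k) \<le> v (j, ?u)" using vu[of "(j, k)"] act by simp
    then show "?n k / v (j, ?u) \<le> ?n k / v (j, k)" using n0[of k] v[of "(j, k)"] by (intro divide_left_mono) auto
  qed
  with u have u': "jet_norm N R (\<lambda>i. mod_map c a (j, ?u) i - mod_map c' a' (j, ?u) i) / v (j, ?u)
     \<le> norm (c j - c' j) / v (j, ?u) + (\<Sum>k\<in>?S. ?n k / v (j, k)) + R * ?B ?u / v (j, ?u)"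
    by (simp add: add_divide_distrib)
  have "(\<Sum>k\<in>?S. jet_norm N R (\<lambda>i. mod_map c a (j, k) i - mod_map c' a' (j, k) i) / v (j, k)) \<le> (\<Sum>k\<in>?S. ?n k / v (j, k))"
  proof (rule sum_mono)
    fix k assume k: "k \<in> ?S"
    have "(\<lambda>i. mod_map c a (j, k) i - mod_map c' a' (j, k) i) = ?d k" using k by (auto simp: mod_map_def res)
    then show "jet_norm N R (\<lambda>i. mod_map c a (j, k) i - mod_map c' a' (j, k) i) / v (j, k) \<le> ?n k / v (j, k)"
      using n[OF k] v[of "(j, k)"] by (simp add: divide_right_mono)
  qed
  with u' have "(\<Sum>k\<in>sec j. jet_norm N R (\<lambda>i. mod_map c a (j, k) i - mod_map c' a' (j, k) i) / v (j, k))
      \<le> norm (c j - c' j) / v (j, ?u) + R * ?B ?u / v (j, ?u) + 2 * (\<Sum>k\<in>?S. ?n k / v (j, k))"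
    unfolding split[of "\<lambda>k. jet_norm N R (\<lambda>i. mod_map c a (j, k) i - mod_map c' a' (j, k) i) / v (j, k)"] by linarith
  also have "2 * (\<Sum>k\<in>?S. ?n k / v (j, k)) = (\<Sum>k\<in>?S. 2 * \<tau> / norm (divisor (j, k)) * ?B k / v (j, k)) + 1 / 4 * (\<Sum>k\<in>?S. ?D k / v (j, k))"
    by (simp add: sum_distrib_left sum.distrib[symmetric] add_divide_distrib mult.assoc)
  also have "(\<Sum>k\<in>?S. ?D k / v (j, k)) \<le> (\<Sum>k\<in>sec j. ?D k / v (j, k))"
    using v R jet_norm_nonneg by (intro sum_mono2) (auto intro!: divide_nonneg_pos)
  also have "(\<Sum>k\<in>?S. 2 * \<tau> / norm (divisor (j, k)) * ?B k / v (j, k)) 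
     = (\<Sum>k\<in>?S. (if resonant (j, k) then R else 2 * \<tau> / norm (divisor (j, k))) * ?B k / v (j, k))"
    by (intro sum.cong) (auto simp: res)
  finally show ?thesis
    unfolding split[of "\<lambda>k. (if resonant (j, k) then R else 2 * \<tau> / norm (divisor (j, k))) * ?B k / v (j, k)"]
    by (simp add: res)
qed

text \<open>The choice of \<open>r\<close> makes the quadratic term contribute 1/4, and the shift of
  differences contributes the other 1/4. Allowing two states \<open>c\<close> and \<open>c'\<close>
  yields existence and continuous dependence at once.\<close>

lemma mod_map_contraction:
  assumes R: "\<tau> \<le> R" and v: "\<And>x. v x > 0" and vs: "\<And>x. x \<in> active \<Longrightarrow> v (ineg x) = v x"
    and vu: "\<And>x. x \<in> active \<Longrightarrow> v x \<le> v (fst x, unit_index (fst x))"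
    and A: "\<And>x y. x \<in> active \<Longrightarrow> \<not> resonant x \<Longrightarrow> \<tau> / norm (divisor x) * wt y * v (isub x y) \<le> 1 / \<gamma> * v x"
    and B: "\<And>x y. x \<in> active \<Longrightarrow> resonant x \<Longrightarrow> R * wt y * v (isub x y) \<le> 2 / \<gamma> * v x"
    and C: "\<And>x. x \<in> active \<Longrightarrow> \<not> resonant x \<Longrightarrow> \<tau> / norm (divisor x) \<le> R / 8"
    and a: "nrm N wt R a \<le> r" and a': "nrm N wt R a' \<le> r" and r: "16 * hconst N * r \<le> \<gamma>"
  shows "nrm N v R (\<lambda>x i. mod_map c a x i - mod_map c' a' x i) \<le>
     mode_norm v (\<lambda>j. c j - c' j) + nrm N v R (\<lambda>x i. a x i - a' x i) / 2"
proof -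
  have R0: "R > 0" using R tau0 by simp
  let ?g = "\<lambda>x. if resonant x then R else 2 * \<tau> / norm (divisor x)"
  let ?p = "\<lambda>x i. a x i + a' x i" and ?m = "\<lambda>x i. a x i - a' x i"
  let ?B = "\<lambda>x. ?g x * jet_norm N R (bil_jet N ?p ?m x)"
  have "nrm N v R (\<lambda>x i. mod_map c a x i - mod_map c' a' x i) \<le>
     L2_set (\<lambda>j. sg j * (norm (c j - c' j) / v (j, unit_index j)) + (sg j * (\<Sum>k\<in>sec j. ?B (j, k) / v (j, k))
        + sg j * (\<Sum>k\<in>sec j. (1 / 4 * jet_norm N R (?m (j, k))) / v (j, k)))) (modes M)"
    unfolding rn_def
  proof (rule L2_set_mono)
    fix j assume j: "j \<in> modes M"
    show "sg j * (\<Sum>k\<in>sec j. jet_norm N R (\<lambda>i. mod_map c a (j, k) i - mod_map c' a' (j, k) i) / v (j, k)) \<le>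
       sg j * (norm (c j - c' j) / v (j, unit_index j)) + (sg j * (\<Sum>k\<in>sec j. ?B (j, k) / v (j, k))
        + sg j * (\<Sum>k\<in>sec j. (1 / 4 * jet_norm N R (?m (j, k))) / v (j, k)))"
      using mult_left_mono[OF mod_map_section[where v = v and R = R, OF j R0 v vu C, of c a c' a'], of "sg j"] sg_pos[of j]
      by (simp add: distrib_left sum_distrib_left less_imp_le algebra_simps)
    show "0 \<le> sg j * (\<Sum>k\<in>sec j. jet_norm N R (\<lambda>i. mod_map c a (j, k) i - mod_map c' a' (j, k) i) / v (j, k))"
      using sg_pos[of j] v R0 by (intro mult_nonneg_nonneg sum_nonneg divide_nonneg_pos jet_norm_nonneg) (auto intro: less_imp_le)
  qed
  also have "\<dots> \<le> mode_norm v (\<lambda>j. c j - c' j) + (rn v ?B + rn v (\<lambda>x. 1 / 4 * jet_norm N R (?m x)))"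
    unfolding mode_norm_def rn_def by (intro order_trans[OF L2_set_triangle_ineq] add_left_mono L2_set_triangle_ineq)
  also have "rn v (\<lambda>x. 1 / 4 * jet_norm N R (?m x)) = 1 / 4 * nrm N v R ?m" by (rule rn_cmult) simp
  also have "rn v ?B \<le> 2 / \<gamma> * hconst N * nrm N wt R ?p * nrm N v R ?m"
  proof (rule rn_bil_jet[OF R v])
    fix x y assume x: "x \<in> active"
    show "?g x * wt y * v (isub x y) \<le> 2 / \<gamma> * v x"
    proof (cases "resonant x")
      case False
      then show ?thesis using A[OF x False, of y] by simp
    qed (use B[OF x] in simp)
  qed (use wt_pos gam0 R0 tau0 vs wt_ineg active_mode in auto)
  finally have main: "nrm N v R (\<lambda>x i. mod_map c a x i - mod_map c' a' x i) \<le> mode_norm v (\<lambda>j. c j - c' j) +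
     (2 / \<gamma> * hconst N * nrm N wt R ?p * nrm N v R ?m + 1 / 4 * nrm N v R ?m)" by simp
  have "nrm N wt R ?p \<le> 2 * r"
  proof -
    have "nrm N wt R ?p \<le> rn wt (\<lambda>x. jet_norm N R (a x) + jet_norm N R (a' x))"
      using R0 by (intro rn_mono jet_norm_add jet_norm_nonneg wt_pos) auto
    also have "\<dots> \<le> 2 * r" using rn_add[of wt "\<lambda>x. jet_norm N R (a x)" "\<lambda>x. jet_norm N R (a' x)"] a a' by linarith
    finally show ?thesis .
  qed
  then have "2 / \<gamma> * hconst N * nrm N wt R ?p \<le> 2 / \<gamma> * hconst N * (2 * r)"
    using gam0 hconst_nonneg by (intro mult_left_mono) auto
  also have "\<dots> \<le> 1 / 4" using r gam0 by (simp add: field_simps)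
  finally have "2 / \<gamma> * hconst N * nrm N wt R ?p * nrm N v R ?m \<le> 1 / 4 * nrm N v R ?m"
    by (rule mult_right_mono[OF _ rn_nonneg])
  with main show ?thesis by simp
qed

text \<open>
  The contraction is used twice: with the weights \<open>wt\<close> and the scale \<open>Rbig\<close> of the slow variation for
  existence, and without weights and with the smallest admissible scale \<open>Rsmall\<close> for stability. The
  \<open>N\<close>-th power of the ratio of the two scales is the gain from discarding high differences.
\<close>

definition Rbig :: real where "Rbig = 1 / p\<^sup>2"
definition Rsmall :: real where "Rsmall = 4 / (\<gamma> * h)"

lemma Rsmall_le: "Rsmall \<le> Rbig"
  using ph4 p0 gam0 h0 by (simp add: Rbig_def Rsmall_def field_simps)

lemma tau_le_gam: "\<tau> \<le> 1 / \<gamma>" using tau_gam gam0 by (simp add: field_simps)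

lemma tau_le_Rsmall: "4 * \<tau> \<le> Rsmall"
proof -
  have "4 * \<tau> \<le> 4 * (1 / \<gamma>)" using tau_le_gam by simp
  also have "\<dots> \<le> Rsmall" unfolding Rsmall_def using gam0 h0 h1 by (simp add: field_simps)
  finally show ?thesis .
qed

lemma Rsmall_pos: "Rsmall > 0" using gam0 h0 by (simp add: Rsmall_def)
lemma tau_le_Rbig: "\<tau> \<le> Rbig" using tau_le_Rsmall Rsmall_le tau0 by linarith

lemma divisor_Rsmall: "x \<in> active \<Longrightarrow> \<not> resonant x \<Longrightarrow> \<tau> / norm (divisor x) \<le> Rsmall / 8"
  using divisor_bound_weak[of x] by (simp add: Rsmall_def)

lemma mod_map_contraction_big:
  assumes "nrm N wt Rbig a \<le> r" "nrm N wt Rbig a' \<le> r" "16 * hconst N * r \<le> \<gamma>"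
  shows "nrm N wt Rbig (\<lambda>x i. mod_map c a x i - mod_map c' a' x i) \<le>
     mode_norm wt (\<lambda>j. c j - c' j) + nrm N wt Rbig (\<lambda>x i. a x i - a' x i) / 2"
proof (rule mod_map_contraction[where v = wt and R = Rbig, OF tau_le_Rbig wt_pos _ weight_unit _ _ _ assms])
  fix x y assume x: "x \<in> active"
  show "wt (ineg x) = wt x" using x by (intro wt_ineg active_mode)
  { assume r: "\<not> resonant x"
    have "1 / (2 * \<gamma>) * wt x \<le> 1 / \<gamma> * wt x" using gam0 wt_pos[of x] by (intro mult_right_mono) (auto simp: field_simps)
    then show "\<tau> / norm (divisor x) * wt y * wt (isub x y) \<le> 1 / \<gamma> * wt x"
      using weight_nonres[OF x r, of y] by linarith
    show "\<tau> / norm (divisor x) \<le> Rbig / 8" using divisor_Rsmall[OF x r] Rsmall_le by linarith }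
  assume r: "resonant x"
  have "Rbig * (wt y * wt (isub x y)) \<le> Rbig * (p\<^sup>2 * wt x)" using weight_res[OF x r, of y] by (intro mult_left_mono) (auto simp: Rbig_def)
  also have "\<dots> = 1 * wt x" using p0 by (simp add: Rbig_def)
  also have "\<dots> \<le> 2 / \<gamma> * wt x" using gam0 gam1 wt_pos[of x] by (intro mult_right_mono) (auto simp: field_simps)
  finally show "Rbig * wt y * wt (isub x y) \<le> 2 / \<gamma> * wt x" by (simp add: mult.assoc)
qed

text \<open>The difference is measured without weight and earns nothing from costs. The other factor
  keeps its weight, at most \<open>p * h\<close>, and this alone cancels the worst divisor 1 / (2
  \<gamma> h).\<close>

lemma mod_map_contraction_small:
  assumes "nrm N wt Rsmall a \<le> r" "nrm N wt Rsmall a' \<le> r" "16 * hconst N * r \<le> \<gamma>"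
  shows "nrm N (\<lambda>_. 1) Rsmall (\<lambda>x i. mod_map c a x i - mod_map c' a' x i) \<le>
     mode_norm (\<lambda>_. 1) (\<lambda>j. c j - c' j) + nrm N (\<lambda>_. 1) Rsmall (\<lambda>x i. a x i - a' x i) / 2"
proof (rule mod_map_contraction[where v = "\<lambda>_. 1" and R = Rsmall, OF _ _ _ _ _ _ _ assms])
  show "\<tau> \<le> Rsmall" using tau_le_Rsmall tau0 by linarith
  fix x y assume x: "x \<in> active"
  { assume r: "\<not> resonant x"
    show "\<tau> / norm (divisor x) \<le> Rsmall / 8" by (rule divisor_Rsmall[OF x r])
    have "\<tau> / norm (divisor x) * wt y \<le> 1 / (2 * \<gamma> * h) * (p * h)"
      using gam0 h0 p0 wt_pos[of y] by (intro mult_mono divisor_bound_weak x r wt_le_ph) auto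
    also have "\<dots> = p / (2 * \<gamma>)" using h0 by simp
    also have "\<dots> \<le> 1 / \<gamma>" using p1 gam0 by (simp add: field_simps)
    finally show "\<tau> / norm (divisor x) * wt y * 1 \<le> 1 / \<gamma> * 1" by simp }
  assume r: "resonant x"
  have "Rsmall * wt y \<le> 4 / (\<gamma> * h) * (p * h)"
    unfolding Rsmall_def using gam0 h0 by (intro mult_left_mono wt_le_ph) auto
  also have "\<dots> = 4 * p / \<gamma>" using h0 by simp
  also have "\<dots> \<le> 2 / \<gamma>" using p4 gam0 by (intro divide_right_mono) auto
  finally show "Rsmall * wt y * 1 \<le> 2 / \<gamma> * 1" by simp
qed auto

lemma mod_map_zero:
  "mod_map c (\<lambda>_ _. 0) x i = (if resonant x \<and> i = 0 then c (fst x) else 0)"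
proof -
  have "bil_jet N (\<lambda>_ _. 0) (\<lambda>_ _. 0) x i = 0" for x i
    by (simp add: bil_jet_def node_def newton_def bil_def pos_part_def fdiff_pow_zero)
  then show ?thesis by (simp add: mod_map_def mod_nonres_def)
qed

lemma nrm_mod_map_zero:
  assumes v: "\<And>x. v x > 0"
  shows "nrm N v R (mod_map c (\<lambda>_ _. 0)) = mode_norm v c"
  unfolding rn_def mode_norm_def
proof (rule L2_set_cong[OF refl])
  fix j assume j: "j \<in> modes M"
  have e: "jet_norm N R (mod_map c (\<lambda>_ _. 0) (j, k)) = (if k = unit_index j then norm (c j) else 0)" for k
  proof -
    have "jet_norm N R (mod_map c (\<lambda>_ _. 0) (j, k)) = (\<Sum>i\<le>N. if i = 0 then (if k = unit_index j then norm (c j) else 0) else 0)"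
      unfolding jet_norm_def by (intro sum.cong) (auto simp: mod_map_zero resonant_def)
    then show ?thesis by simp
  qed
  have "(\<Sum>k\<in>sec j. jet_norm N R (mod_map c (\<lambda>_ _. 0) (j, k)) / v (j, k)) = (\<Sum>k\<in>sec j. if unit_index j = k then norm (c j) / v (j, k) else 0)"
    by (intro sum.cong) (auto simp: e)
  then show "sg j * (\<Sum>k\<in>sec j. jet_norm N R (mod_map c (\<lambda>_ _. 0) (j, k)) / v (j, k)) = sg j * (norm (c j) / v (j, unit_index j))"
    using unit_in_sec[OF j] by (simp add: sum.delta')
qed

lemma rn_tendsto_0:
  assumes "\<And>x. x \<in> active \<Longrightarrow> (\<lambda>n. \<alpha> n x) \<longlonglongrightarrow> 0"
  shows "(\<lambda>n. rn v (\<alpha> n)) \<longlonglongrightarrow> 0"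
proof -
  have "(\<lambda>n. \<alpha> n (j, k) / v (j, k)) \<longlonglongrightarrow> 0" if "k \<in> sec j" for j k
    using tendsto_mult[OF assms[of "(j, k)"] tendsto_const[of "1 / v (j, k)"]] that by (simp add: sec_def)
  then have "(\<lambda>n. sg j * (\<Sum>k\<in>sec j. \<alpha> n (j, k) / v (j, k))) \<longlonglongrightarrow> sg j * (\<Sum>k\<in>sec j. 0)" for j
    by (intro tendsto_mult tendsto_sum tendsto_const)
  then have "(\<lambda>n. sqrt (\<Sum>j\<in>modes M. (sg j * (\<Sum>k\<in>sec j. \<alpha> n (j, k) / v (j, k)))\<^sup>2)) \<longlonglongrightarrow> sqrt (\<Sum>j\<in>modes M. (sg j * (\<Sum>k\<in>sec j. 0))\<^sup>2)"
    by (intro tendsto_real_sqrt tendsto_sum tendsto_power)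
  then show ?thesis by (simp add: rn_def L2_set_def)
qed

lemma mod_map_fixpoint:
  assumes c: "2 * mode_norm wt c \<le> r" and r: "16 * hconst N * r \<le> \<gamma>"
  shows "\<exists>a. (\<forall>x\<in>active. \<forall>i\<le>N. mod_map c a x i = a x i) \<and> nrm N wt Rbig a \<le> 2 * mode_norm wt c"
proof -
  define Pn where "Pn = (\<lambda>z :: label \<times> nat \<Rightarrow> complex. nrm N wt Rbig (\<lambda>x i. z (x, i)))"
  define T where "T = (\<lambda>(z :: label \<times> nat \<Rightarrow> complex) xi. mod_map c (\<lambda>x i. z (x, i)) (fst xi) (snd xi))"
  define C where "C = (\<Sum>xi\<in>active \<times> {..N}. wt (fst xi) / Rbig ^ snd xi)"
  have Rb: "Rbig > 0" using p0 by (simp add: Rbig_def)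
  have PT0: "Pn (T (\<lambda>_. 0)) = mode_norm wt c"
    using nrm_mod_map_zero[of wt Rbig c] wt_pos by (simp add: Pn_def T_def)
  have "\<exists>z. (\<forall>xi\<in>active \<times> {..N}. T z xi = z xi) \<and> Pn z \<le> 2 * Pn (T (\<lambda>_. 0))"
  proof (rule contraction_fixpoint)
    fix z
    show "0 \<le> Pn z" by (simp add: Pn_def rn_nonneg)
    show "Pn (\<lambda>_. 0) = 0" by (simp add: Pn_def rn_def jet_norm_def L2_set_def)
    fix z'
    have "Pn (\<lambda>x. z x + z' x) \<le> rn wt (\<lambda>x. jet_norm N Rbig (\<lambda>i. z (x, i)) + jet_norm N Rbig (\<lambda>i. z' (x, i)))"
      unfolding Pn_def using Rb by (intro rn_mono jet_norm_add jet_norm_nonneg wt_pos) auto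
    also have "\<dots> \<le> Pn z + Pn z'" unfolding Pn_def by (rule rn_add)
    finally show "Pn (\<lambda>x. z x + z' x) \<le> Pn z + Pn z'" .
    show "Pn (\<lambda>x. T z x - T z' x) \<le> Pn (\<lambda>x. z x - z' x) / 2" if "Pn z \<le> r" "Pn z' \<le> r"
      using mod_map_contraction_big[of "\<lambda>x i. z (x, i)" r "\<lambda>x i. z' (x, i)" c c] that r
      by (simp add: Pn_def T_def mode_norm_def L2_set_def)
  next
    fix z :: "label \<times> nat \<Rightarrow> complex" and xi assume xi: "xi \<in> active \<times> {..N}"
    obtain x i where xe: "xi = (x, i)" by (cases xi)
    have x: "x \<in> active" "i \<le> N" using xi xe by auto
    have "Rbig ^ i * norm (z (x, i)) \<le> jet_norm N Rbig (\<lambda>i. z (x, i))"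
      using norm_le_jet_norm[of Rbig i N "\<lambda>i. z (x, i)"] Rb x by simp
    also have "\<dots> \<le> wt x * Pn z" unfolding Pn_def using Rb by (intro le_rn x jet_norm_nonneg wt_pos) auto
    finally have "norm (z xi) \<le> wt x / Rbig ^ i * Pn z" using Rb xe by (simp add: field_simps)
    also have "wt x / Rbig ^ i \<le> C"
      unfolding C_def using member_le_sum[OF xi, of "\<lambda>xi. wt (fst xi) / Rbig ^ snd xi"] finite_active xe
      by (simp add: wt_pos Rb less_imp_le)
    finally show "norm (z xi) \<le> C * Pn z" using rn_nonneg by (simp add: Pn_def mult_right_mono)
  next
    fix Z :: "nat \<Rightarrow> label \<times> nat \<Rightarrow> complex"
    assume Z: "\<And>x. x \<in> active \<times> {..N} \<Longrightarrow> (\<lambda>n. Z n x) \<longlonglongrightarrow> 0"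
    show "(\<lambda>n. Pn (Z n)) \<longlonglongrightarrow> 0"
      unfolding Pn_def
    proof (rule rn_tendsto_0)
      fix x assume x: "x \<in> active"
      have "(\<lambda>n. \<Sum>i\<le>N. Rbig ^ i * norm (Z n (x, i))) \<longlonglongrightarrow> (\<Sum>i\<le>N. Rbig ^ i * norm (0::complex))"
        using Z x by (intro tendsto_sum tendsto_mult tendsto_const tendsto_norm) auto
      then show "(\<lambda>n. jet_norm N Rbig (\<lambda>i. Z n (x, i))) \<longlonglongrightarrow> 0" by (simp add: jet_norm_def)
    qed
  next
    show "2 * Pn (T (\<lambda>_. 0)) \<le> r" using c PT0 by simp
  qed
  then obtain z where z: "\<forall>xi\<in>active \<times> {..N}. T z xi = z xi" "Pn z \<le> 2 * mode_norm wt c" using PT0 by metis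
  show ?thesis
    by (rule exI[of _ "\<lambda>x i. z (x, i)"]) (use z in \<open>auto simp: T_def Pn_def\<close>)
qed

section \<open>Transport of the decomposition over one time step\<close>

definition decomp :: "(int \<Rightarrow> complex) \<Rightarrow> (label \<Rightarrow> nat \<Rightarrow> complex) \<Rightarrow> bool" where
  "decomp c a \<longleftrightarrow> (\<forall>x\<in>active. \<forall>i\<le>N. mod_map c a x i = a x i) \<and> nrm N wt Rbig a \<le> 2 * mode_norm wt c"

definition rot :: "int \<Rightarrow> complex" where "rot j = cis (\<tau> * om j)"

definition force :: "(int \<Rightarrow> complex) \<Rightarrow> int \<Rightarrow> complex" where
  "force c j = - \<i> * of_real (fl j) * (\<Sum>i\<in>modes M.
     (of_real (fl i / (2 * om i)) * (c i + cnj (c (mode_rep M (- i))))) *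
     (of_real (fl (mode_rep M (j - i)) / (2 * om (mode_rep M (j - i)))) *
       (c (mode_rep M (j - i)) + cnj (c (mode_rep M (- mode_rep M (j - i)))))))"

definition flow_step :: "(int \<Rightarrow> complex) \<Rightarrow> int \<Rightarrow> complex" where
  "flow_step c j = rot j * (c j + of_real \<tau> * force c j)"

definition graded_step :: "(label \<Rightarrow> complex) \<Rightarrow> label \<Rightarrow> complex" where
  "graded_step Z x = rot (fst x) * (Z x + of_real \<tau> * bil Z Z x)"

text \<open>Adds the difference of order N + 1: for resonant labels from the modulation equation,
  for the others the 0 prescribed by the closure.\<close>

definition extended :: "(label \<Rightarrow> nat \<Rightarrow> complex) \<Rightarrow> label \<Rightarrow> nat \<Rightarrow> complex" where
  "extended a x i = (if i \<le> N then a x i else if i = Suc N \<and> resonant x then bil_jet N a a x N else 0)"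

text \<open>The decomposition predicted for the next time step. \<open>newton_shift\<close> moves
  the differences, and the phase is taken anew relative to the new time.\<close>

definition shifted :: "(label \<Rightarrow> nat \<Rightarrow> complex) \<Rightarrow> label \<Rightarrow> nat \<Rightarrow> complex" where
  "shifted a x i = phase x * (extended a x i + of_real \<tau> * extended a x (Suc i))"

lemma phase_rot: "phase x = rot (fst x) * (divisor x + 1)"
  by (simp add: phase_def rot_def divisor_def cis_mult algebra_simps)

lemma phase_resonant: 
  assumes "x \<in> active" "resonant x" shows "phase x = rot (fst x)"
proof -
  have "\<bar>fst x\<bar> \<in> {0..M}" using active_mode[OF assms(1)] by (auto simp: modes_def)
  then have "dot_omega \<rho> M (snd x) = om \<bar>fst x\<bar>"
    using assms unfolding resonant_def dot_omega_def unit_index_def by (simp add: if_distrib[of real_of_int] if_distrib[of "\<lambda>x. x * _"] cong: if_cong)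
  also have "\<dots> = om (fst x)" by (simp add: omega_def)
  finally show ?thesis by (simp add: phase_def rot_def)
qed

lemma norm_phase: "norm (phase x) = 1" by (simp add: phase_def)
lemma norm_rot: "norm (rot x) = 1" by (simp add: rot_def)

lemma phase_ineg: "phase (ineg x) = cnj (phase x)"
proof -
  have "dot_omega \<rho> M (- snd x) = - dot_omega \<rho> M (snd x)" by (simp add: dot_omega_def sum_negf)
  then show ?thesis by (simp add: phase_def ineg_def cis_cnj)
qed

lemma phase_isub: "phase y * phase (isub x y) = phase x"
proof -
  have "dot_omega \<rho> M (snd x - snd y) = dot_omega \<rho> M (snd x) - dot_omega \<rho> M (snd y)"
    by (simp add: dot_omega_def sum_subtractf algebra_simps)
  then show ?thesis unfolding phase_def isub_def cis_mult by (simp add: distrib_left[symmetric])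
qed

lemma pos_part_phase: "pos_part (\<lambda>x. phase x * Z x) y = phase y * pos_part Z y"
  by (simp add: pos_part_def phase_ineg algebra_simps add_divide_distrib)

text \<open>Because labels add in a product, the phases factor out. This removes explicit time from
  the modulation equations and lets the same fixed-point problem serve at every step.\<close>

lemma bil_phase: "bil (\<lambda>x. phase x * Z x) (\<lambda>x. phase x * Z x) x = phase x * bil Z Z x"
proof -
  have "(\<Sum>y\<in>active. pos_part (\<lambda>x. phase x * Z x) y * pos_part (\<lambda>x. phase x * Z x) (isub x y))
     = (\<Sum>y\<in>active. phase x * (pos_part Z y * pos_part Z (isub x y)))"
  proof (intro sum.cong refl)
    fix y
    have "pos_part (\<lambda>x. phase x * Z x) y * pos_part (\<lambda>x. phase x * Z x) (isub x y)
       = (phase y * phase (isub x y)) * (pos_part Z y * pos_part Z (isub x y))" by (simp only: pos_part_phase) (simp only: mult_ac)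
    then show "pos_part (\<lambda>x. phase x * Z x) y * pos_part (\<lambda>x. phase x * Z x) (isub x y) = phase x * (pos_part Z y * pos_part Z (isub x y))"
      by (simp add: phase_isub)
  qed
  then show ?thesis by (simp add: bil_def sum_distrib_left[symmetric])
qed

lemma node_ext: "m \<le> N \<Longrightarrow> node (Suc N) (extended a) m = node N a m"
  by (auto simp: node_def fun_eq_iff newton_mono_nodes) (simp add: newton_def extended_def)

lemma bil_jet_ext: "i \<le> N \<Longrightarrow> bil_jet (Suc N) (extended a) (extended a) x i = bil_jet N a a x i"
  unfolding bil_jet_def by (rule jet_cong) (simp add: node_ext)

lemma node_shifted: "m \<le> N \<Longrightarrow> node N (shifted a) m = (\<lambda>x. phase x * node (Suc N) (extended a) (Suc m) x)"
proof
  fix x assume m: "m \<le> N"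
  have "newton \<tau> N (\<lambda>i. phase x * (extended a x i + of_real \<tau> * extended a x (Suc i))) m
     = phase x * newton \<tau> N (\<lambda>i. extended a x i + of_real \<tau> * extended a x (Suc i)) m"
    by (simp add: newton_def sum_distrib_left algebra_simps)
  then show "node N (shifted a) m x = phase x * node (Suc N) (extended a) (Suc m) x"
    using m tau0 unfolding node_def shifted_def by (simp add: newton_shift)
qed

lemma bil_jet_shifted:
  assumes "i \<le> N"
  shows "bil_jet N (shifted a) (shifted a) x i =
    phase x * (bil_jet (Suc N) (extended a) (extended a) x i + of_real \<tau> * bil_jet (Suc N) (extended a) (extended a) x (Suc i))"
proof -
  let ?G = "\<lambda>m. bil (node (Suc N) (extended a) m) (node (Suc N) (extended a) m) x"
  have "bil_jet N (shifted a) (shifted a) x i = jet \<tau> (\<lambda>m. phase x * ?G (Suc m)) i"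
    unfolding bil_jet_def using assms by (intro jet_cong) (simp add: node_shifted bil_phase)
  also have "\<dots> = phase x * (jet \<tau> ?G i + of_real \<tau> * jet \<tau> ?G (Suc i))"
    using tau0 by (simp only: fdiff_pow_cmult) (subst jet_shift, simp_all)
  finally show ?thesis unfolding bil_jet_def .
qed

lemma decomp_nonres:
  assumes "decomp c a" "x \<in> active" "\<not> resonant x" "i \<le> N"
  shows "a x i = mod_nonres a x i"
  using assms unfolding decomp_def mod_map_def by metis

text \<open>Written with \<open>extended\<close>, the equation has one form for all orders including
  N, where the closure acts.\<close>

lemma decomp_nonres_ext:
  assumes "decomp c a" "x \<in> active" "\<not> resonant x" "i \<le> N"
  shows "divisor x * extended a x i = of_real \<tau> * (bil_jet (Suc N) (extended a) (extended a) x i - (divisor x + 1) * extended a x (Suc i))"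
  using decomp_nonres[OF assms] divisor_nz[OF assms(2,3)] assms(3,4)
  by (auto simp: mod_nonres_def bil_jet_ext extended_def field_simps)

lemma decomp_res_ext:
  assumes "decomp c a" "x \<in> active" "resonant x" "i \<le> N"
  shows "extended a x (Suc i) = bil_jet (Suc N) (extended a) (extended a) x i"
proof (cases "i = N")
  case False
  then have "mod_map c a x (Suc i) = a x (Suc i)" using assms by (simp add: decomp_def)
  then show ?thesis using assms False by (auto simp: mod_map_def extended_def bil_jet_ext)
qed (use assms in \<open>simp add: extended_def bil_jet_ext\<close>)

lemma sum_sec_split: "j \<in> modes M \<Longrightarrow> (\<Sum>k\<in>sec j. f k) = f (unit_index j) + (\<Sum>k\<in>sec j - {unit_index j}. f k)" for f :: "_ \<Rightarrow> complex"
  by (rule sum.remove) (auto simp: unit_in_sec)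

lemma sec_nonres: "k \<in> sec j - {unit_index j} \<Longrightarrow> (j, k) \<in> active \<and> \<not> resonant (j, k)"
  by (simp add: sec_def resonant_def)

lemma decomp_sum:
  assumes d: "decomp c a" and j: "j \<in> modes M"
  shows "(\<Sum>k\<in>sec j. a (j, k) 0) = c j"
proof -
  have "mod_map c a (j, unit_index j) 0 = a (j, unit_index j) 0"
    using d active_unit[OF j] by (simp add: decomp_def)
  moreover have "(\<Sum>k\<in>sec j - {unit_index j}. mod_nonres a (j, k) 0) = (\<Sum>k\<in>sec j - {unit_index j}. a (j, k) 0)"
    using decomp_nonres[OF d] sec_nonres by (intro sum.cong) auto
  ultimately have "c j - (\<Sum>k\<in>sec j - {unit_index j}. a (j, k) 0) = a (j, unit_index j) 0" by (simp add: mod_map_def resonant_def)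
  then show ?thesis unfolding sum_sec_split[OF j] by (simp add: algebra_simps)
qed

text \<open>The modulation equation of order 0 is the labelled step itself, multiplied out; the
  closure leaves no error in the values.\<close>

lemma shifted_0:
  assumes d: "decomp c a" and x: "x \<in> active"
  shows "shifted a x 0 = graded_step (\<lambda>x. a x 0) x"
proof -
  have B: "bil_jet (Suc N) (extended a) (extended a) x 0 = bil (\<lambda>x. a x 0) (\<lambda>x. a x 0) x"
  proof -
    have "node N a 0 = (\<lambda>x. a x 0)" by (rule HOL.ext) (simp add: node_def newton_at_0)
    then show ?thesis by (simp add: bil_jet_ext) (simp add: bil_jet_def)
  qed
  have e0: "extended a x 0 = a x 0" by (simp add: extended_def)
  show ?thesis
  proof (cases "resonant x")
    case True
    then show ?thesis using decomp_res_ext[OF d x True, of 0] phase_resonant[OF x True] by (simp add: shifted_def graded_step_def e0 B)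
  next
    case False
    have "(divisor x + 1) * (extended a x 0 + of_real \<tau> * extended a x (Suc 0)) = a x 0 + of_real \<tau> * bil (\<lambda>x. a x 0) (\<lambda>x. a x 0) x"
      using decomp_nonres_ext[OF d x False, of 0] unfolding B e0 by (simp add: algebra_simps)
    then show ?thesis by (simp add: shifted_def graded_step_def phase_rot mult.assoc)
  qed
qed

text \<open>The difference of order N + 1 of the quadratic term, divided by the divisor: what the
  closure at order N ignores after a shift.\<close>

definition shift_err :: "(label \<Rightarrow> nat \<Rightarrow> complex) \<Rightarrow> label \<Rightarrow> nat \<Rightarrow> complex" where
  "shift_err a x i = (if \<not> resonant x \<and> i = N
     then of_real \<tau> / divisor x * phase x * of_real \<tau> * bil_jet (Suc N) (extended a) (extended a) x (Suc N) else 0)"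

text \<open>The equation of order i for the shifted data combines the old equations of orders i and
  i + 1. Only for nonresonant labels at i = N is the second one missing.\<close>

lemma mod_map_shifted:
  assumes d: "decomp c a" and x: "x \<in> active" and i: "i \<le> N"
    and c': "\<And>j. j \<in> modes M \<Longrightarrow> c' j = (\<Sum>k\<in>sec j. shifted a (j, k) 0)"
  shows "mod_map c' (shifted a) x i = shifted a x i + shift_err a x i"
proof -
  let ?B = "\<lambda>x. bil_jet (Suc N) (extended a) (extended a) x" and ?t = "complex_of_real \<tau>"
  have nr: "mod_nonres (shifted a) x i = shifted a x i + shift_err a x i"
    if x: "x \<in> active" and n: "\<not> resonant x" and i: "i \<le> N" for x i
  proof (cases "i = N")
    case True
    have "divisor x * extended a x N = ?t * ?B x N"
      using decomp_nonres_ext[OF d x n, of N] n by (simp add: extended_def)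
    then have "extended a x N = ?t / divisor x * ?B x N" using divisor_nz[OF x n] by (simp add: field_simps)
    moreover have "extended a x (Suc N) = 0" using n by (simp add: extended_def)
    ultimately show ?thesis using True n
      by (simp add: mod_nonres_def shift_err_def bil_jet_shifted) (simp add: shifted_def algebra_simps add_divide_distrib)
  next
    case False
    let ?e = "extended a x"
    have h1: "divisor x * ?e i = ?t * (?B x i - (divisor x + 1) * ?e (Suc i))" by (rule decomp_nonres_ext[OF d x n i])
    have h2: "divisor x * ?e (Suc i) = ?t * (?B x (Suc i) - (divisor x + 1) * ?e (Suc (Suc i)))"
      using False i by (intro decomp_nonres_ext[OF d x n]) simp
    have "divisor x * (?e i + ?t * ?e (Suc i)) = divisor x * ?e i + ?t * (divisor x * ?e (Suc i))"
      by (simp add: algebra_simps)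
    also have "\<dots> = ?t * (?B x i + ?t * ?B x (Suc i) - (divisor x + 1) * (?e (Suc i) + ?t * ?e (Suc (Suc i))))"
      unfolding h1 h2 by (simp add: algebra_simps)
    finally have e: "divisor x * (?e i + ?t * ?e (Suc i)) =
       ?t * (?B x i + ?t * ?B x (Suc i) - (divisor x + 1) * (?e (Suc i) + ?t * ?e (Suc (Suc i))))" .
    have "mod_nonres (shifted a) x i = phase x * (?t * (?B x i + ?t * ?B x (Suc i) - (divisor x + 1) * (?e (Suc i) + ?t * ?e (Suc (Suc i)))) / divisor x)"
      using False i by (simp add: mod_nonres_def bil_jet_shifted shifted_def) (simp add: algebra_simps diff_divide_distrib add_divide_distrib)
    also have "\<dots> = phase x * (?e i + ?t * ?e (Suc i))" unfolding e[symmetric] using divisor_nz[OF x n] by simp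
    finally show ?thesis using False by (simp add: shifted_def shift_err_def)
  qed
  show ?thesis
  proof (cases "resonant x")
    case False
    then show ?thesis using nr[OF x False i] by (simp add: mod_map_def)
  next
    case True
    have er: "shift_err a x i = 0" using True by (simp add: shift_err_def)
    have xe: "x = (fst x, unit_index (fst x))" using True by (simp add: resonant_def prod_eq_iff)
    have j: "fst x \<in> modes M" by (rule active_mode[OF x])
    show ?thesis
    proof (cases i)
      case 0
      have "(\<Sum>k\<in>sec (fst x) - {unit_index (fst x)}. mod_nonres (shifted a) (fst x, k) 0) =
          (\<Sum>k\<in>sec (fst x) - {unit_index (fst x)}. shifted a (fst x, k) 0)"
      proof (rule sum.cong[OF refl])
        fix k assume "k \<in> sec (fst x) - {unit_index (fst x)}"
        then show "mod_nonres (shifted a) (fst x, k) 0 = shifted a (fst x, k) 0"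
          using nr[of "(fst x, k)" 0] sec_nonres N1 by (simp add: shift_err_def)
      qed
      moreover have "snd x = unit_index (fst x)" using True by (simp add: resonant_def)
      ultimately show ?thesis using True 0 er xe c'[OF j] sum_sec_split[OF j, of "\<lambda>k. shifted a (fst x, k) 0"]
        by (simp add: mod_map_def)
    next
      case (Suc n)
      have "extended a x (Suc n) = ?B x n" "extended a x (Suc (Suc n)) = ?B x (Suc n)"
        using decomp_res_ext[OF d x True] i Suc by auto
      then show ?thesis using True Suc i er by (simp add: mod_map_def bil_jet_shifted) (simp add: shifted_def)
    qed
  qed
qed

text \<open>The additional order of a resonant component costs one factor \<open>Rbig\<close>, which
  the factor p squared of \<open>weight_res\<close> cancels.\<close>

lemma nrm_ext:
  assumes d: "decomp c a" and na: "nrm N wt Rbig a \<le> r" and r: "16 * hconst N * r \<le> \<gamma>"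
  shows "nrm (Suc N) wt Rbig (extended a) \<le> 2 * nrm N wt Rbig a"
proof -
  have Rb: "Rbig > 0" using p0 by (simp add: Rbig_def)
  let ?g = "\<lambda>x. if resonant x then Rbig else 0"
  have "nrm (Suc N) wt Rbig (extended a) \<le> rn wt (\<lambda>x. jet_norm N Rbig (a x) + ?g x * jet_norm N Rbig (bil_jet N a a x))"
  proof (rule rn_mono)
    fix x
    show "0 \<le> jet_norm (Suc N) Rbig (extended a x)" using Rb by (intro jet_norm_nonneg) simp
    have "jet_norm (Suc N) Rbig (extended a x) = jet_norm N Rbig (a x) + Rbig ^ Suc N * norm (extended a x (Suc N))"
      by (simp add: jet_norm_def extended_def)
    also have "Rbig ^ Suc N * norm (extended a x (Suc N)) \<le> ?g x * jet_norm N Rbig (bil_jet N a a x)"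
      using norm_le_jet_norm[of Rbig N N "bil_jet N a a x"] Rb by (auto simp: extended_def mult.assoc)
    finally show "jet_norm (Suc N) Rbig (extended a x) \<le> jet_norm N Rbig (a x) + ?g x * jet_norm N Rbig (bil_jet N a a x)" by simp
  qed (rule wt_pos)
  also have "\<dots> \<le> nrm N wt Rbig a + rn wt (\<lambda>x. ?g x * jet_norm N Rbig (bil_jet N a a x))" by (rule rn_add)
  also have "rn wt (\<lambda>x. ?g x * jet_norm N Rbig (bil_jet N a a x)) \<le> 1 * hconst N * nrm N wt Rbig a * nrm N wt Rbig a"
  proof (rule rn_bil_jet[OF tau_le_Rbig wt_pos wt_pos])
    fix x y assume x: "x \<in> active"
    show "?g x * wt y * wt (isub x y) \<le> 1 * wt x"
    proof (cases "resonant x")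
      case True
      have "Rbig * (wt y * wt (isub x y)) \<le> Rbig * (p\<^sup>2 * wt x)" using weight_res[OF x True, of y] Rb by (intro mult_left_mono) auto
      then show ?thesis using True p0 by (simp add: Rbig_def mult.assoc)
    qed (use wt_pos[of x] in simp)
  qed (use Rb wt_ineg active_mode in auto)
  also have "1 * hconst N * nrm N wt Rbig a * nrm N wt Rbig a \<le> 1 * nrm N wt Rbig a"
  proof (rule mult_right_mono[OF _ rn_nonneg])
    have "hconst N * nrm N wt Rbig a \<le> hconst N * r" using na hconst_nonneg by (rule mult_left_mono)
    then show "1 * hconst N * nrm N wt Rbig a \<le> 1" using r gam1 by simp
  qed
  finally show ?thesis by simp
qed

lemma jet_norm_shifted:
  assumes R: "R > 0" and tR: "4 * \<tau> \<le> R"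
  shows "jet_norm N R (shifted a x) \<le> 5 / 4 * jet_norm (Suc N) R (extended a x)"
proof -
  have "jet_norm N R (shifted a x) = jet_norm N R (\<lambda>i. extended a x i + of_real \<tau> * extended a x (Suc i))"
    using jet_norm_cmult[of N R "phase x"] unfolding shifted_def norm_phase by simp
  also have "\<dots> \<le> jet_norm N R (extended a x) + \<tau> * jet_norm N R (\<lambda>i. extended a x (Suc i))"
    using jet_norm_add[of R N "extended a x" "\<lambda>i. of_real \<tau> * extended a x (Suc i)"] R tau0 by (simp add: jet_norm_cmult)
  also have "\<tau> * jet_norm N R (\<lambda>i. extended a x (Suc i)) \<le> R / 4 * jet_norm N R (\<lambda>i. extended a x (Suc i))"
    using tR R by (intro mult_right_mono jet_norm_nonneg) auto
  also have "\<dots> \<le> 1 / 4 * jet_norm (Suc N) R (extended a x)" by (simp add: jet_norm_Suc)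
  also have "jet_norm N R (extended a x) \<le> jet_norm (Suc N) R (extended a x)" using R by (intro jet_norm_mono_n) auto
  finally show ?thesis by simp
qed

lemma nrm_shifted_small:
  assumes d: "decomp c a" and na: "nrm N wt Rbig a \<le> r / 4" and r: "16 * hconst N * r \<le> \<gamma>" and r0: "r \<ge> 0"
  shows "nrm N wt Rsmall (shifted a) \<le> r"
proof -
  have "nrm N wt Rsmall (shifted a) \<le> rn wt (\<lambda>x. 5 / 4 * jet_norm (Suc N) Rsmall (extended a x))"
    using Rsmall_pos tau_le_Rsmall by (intro rn_mono jet_norm_shifted jet_norm_nonneg wt_pos) auto
  also have "\<dots> = 5 / 4 * nrm (Suc N) wt Rsmall (extended a)" by (rule rn_cmult) simp
  also have "nrm (Suc N) wt Rsmall (extended a) \<le> nrm (Suc N) wt Rbig (extended a)"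
    using Rsmall_pos Rsmall_le by (intro rn_mono jet_norm_nonneg jet_norm_mono_R wt_pos) auto
  also have "\<dots> \<le> 2 * nrm N wt Rbig a" using nrm_ext[OF d _ r] na r0 by simp
  also have "\<dots> \<le> 2 * (r / 4)" using na by simp
  finally show ?thesis using r0 by simp
qed

lemma rn_one_le: "(\<And>x. x \<in> active \<Longrightarrow> 0 \<le> \<alpha> x) \<Longrightarrow> rn (\<lambda>_. 1) \<alpha> \<le> rn wt \<alpha>"
proof -
  assume a: "\<And>x. x \<in> active \<Longrightarrow> 0 \<le> \<alpha> x"
  have "\<alpha> x / 1 \<le> \<alpha> x / wt x" if "x \<in> active" for x
    using a[OF that] wt_pos[of x] wt_le_1[of x] by (intro divide_left_mono) auto
  then show ?thesis unfolding rn_def using a sg_pos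
    by (intro L2_set_mono mult_left_mono sum_mono mult_nonneg_nonneg sum_nonneg) (auto simp: sec_def intro: less_imp_le)
qed

lemma nonres_one_weight:
  assumes "x \<in> active" "\<not> resonant x" shows "\<tau> / norm (divisor x) * wt y \<le> 1 / \<gamma>"
proof -
  have "\<tau> / norm (divisor x) * wt y \<le> 1 / (2 * \<gamma> * h) * (p * h)"
    using gam0 h0 p0 wt_pos[of y] by (intro mult_mono divisor_bound_weak assms wt_le_ph) auto
  also have "\<dots> = p / (2 * \<gamma>)" using h0 by simp
  also have "\<dots> \<le> 1 / \<gamma>" using p1 gam0 by (simp add: field_simps)
  finally show ?thesis .
qed

text \<open>The defect sits at order N. The target norm weights it only by
  \<open>Rsmall ^ N\<close>, while slow variation bounds the difference by a multiple of 1 /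
  \<open>Rbig ^ Suc N\<close>; this is where the N-th power of the ratio arises.\<close>

lemma nrm_shift_err:
  assumes d: "decomp c a" and na: "nrm N wt Rbig a \<le> r / 4" and r: "16 * hconst (Suc N) * r \<le> \<gamma>" and r0: "r \<ge> 0"
  shows "nrm N (\<lambda>_. 1) Rsmall (shift_err a) \<le> \<tau> * ((Rsmall / Rbig) ^ N * r)"
proof -
  have Rb: "Rbig > 0" using p0 by (simp add: Rbig_def)
  have Rb1: "Rbig \<ge> 1" using p0 p1 by (simp add: Rbig_def power_le_one)
  have rN: "16 * hconst N * r \<le> \<gamma>"
    using r mult_right_mono[OF hconst_mono[of N "Suc N"] r0] by simp
  let ?g = "\<lambda>x. if resonant x then 0 else \<tau> / norm (divisor x)"
  let ?B = "\<lambda>x. bil_jet (Suc N) (extended a) (extended a) x"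
  let ?q = "\<tau> * (Rsmall ^ N / Rbig ^ Suc N)"
  have q0: "?q \<ge> 0" using tau0 Rsmall_pos Rb by simp
  have "nrm N (\<lambda>_. 1) Rsmall (shift_err a) \<le> rn (\<lambda>_. 1) (\<lambda>x. ?q * (?g x * jet_norm (Suc N) Rbig (?B x)))"
  proof (rule rn_mono)
    fix x
    show "0 \<le> jet_norm N Rsmall (shift_err a x)" using Rsmall_pos by (intro jet_norm_nonneg) simp
    have "jet_norm N Rsmall (shift_err a x) = (\<Sum>i\<le>N. if i = N then Rsmall ^ i * norm (shift_err a x i) else 0)"
      unfolding jet_norm_def by (intro sum.cong) (auto simp: shift_err_def)
    also have "\<dots> = Rsmall ^ N * (\<tau> * (?g x * norm (?B x (Suc N))))"
      using tau0 by (simp add: shift_err_def norm_mult norm_divide norm_phase)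
    also have "\<dots> = ?q * (?g x * (Rbig ^ Suc N * norm (?B x (Suc N))))"
      using Rb by (simp add: field_simps)
    also have "\<dots> \<le> ?q * (?g x * jet_norm (Suc N) Rbig (?B x))"
      using Rb tau0 q0 by (intro mult_left_mono norm_le_jet_norm) auto
    finally show "jet_norm N Rsmall (shift_err a x) \<le> ?q * (?g x * jet_norm (Suc N) Rbig (?B x))" .
  qed simp
  also have "\<dots> = ?q * rn (\<lambda>_. 1) (\<lambda>x. ?g x * jet_norm (Suc N) Rbig (?B x))"
    using q0 by (rule rn_cmult)
  finally have 0: "nrm N (\<lambda>_. 1) Rsmall (shift_err a) \<le> ?q * rn (\<lambda>_. 1) (\<lambda>x. ?g x * jet_norm (Suc N) Rbig (?B x))" .
  have "rn (\<lambda>_. 1) (\<lambda>x. ?g x * jet_norm (Suc N) Rbig (?B x)) \<le>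
     1 / \<gamma> * hconst (Suc N) * nrm (Suc N) wt Rbig (extended a) * nrm (Suc N) (\<lambda>_. 1) Rbig (extended a)"
    by (rule rn_bil_jet[OF tau_le_Rbig _ wt_pos])
       (use nonres_one_weight gam0 tau0 wt_ineg active_mode in auto)
  also have "\<dots> \<le> 1 / \<gamma> * hconst (Suc N) * r * r"
  proof -
    have e: "nrm (Suc N) wt Rbig (extended a) \<le> r" using nrm_ext[OF d _ rN] na r0 by simp
    have "nrm (Suc N) (\<lambda>_. 1) Rbig (extended a) \<le> r"
      using rn_one_le[of "\<lambda>x. jet_norm (Suc N) Rbig (extended a x)"] Rb jet_norm_nonneg[of Rbig] e by simp
    with e show ?thesis using gam0 hconst_nonneg[of "Suc N"] r0 rn_nonneg by (intro mult_mono mult_left_mono) auto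
  qed
  also have "\<dots> \<le> 1 * r" using r gam0 r0 by (intro mult_right_mono) (simp_all add: field_simps)
  finally have "rn (\<lambda>_. 1) (\<lambda>x. ?g x * jet_norm (Suc N) Rbig (?B x)) \<le> r" by simp
  from order_trans[OF 0 mult_left_mono[OF this q0]] have 1: "nrm N (\<lambda>_. 1) Rsmall (shift_err a) \<le> ?q * r" .
  have "Rsmall ^ N / Rbig ^ Suc N \<le> Rsmall ^ N / Rbig ^ N"
    using Rsmall_pos Rb Rb1 by (intro divide_left_mono) auto
  then have "?q * r \<le> \<tau> * (Rsmall ^ N / Rbig ^ N) * r" using tau0 r0 by (intro mult_right_mono mult_left_mono) auto
  with 1 show ?thesis by (simp add: power_divide)
qed

subsection \<open>The truncation remainder\<close>

lemma sum_pos_part: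
  assumes d: "\<And>j. j \<in> modes M \<Longrightarrow> (\<Sum>k\<in>sec j. Z (j, k)) = c j" and i: "i \<in> modes M"
  shows "of_real (fl i / (2 * om i)) * (c i + cnj (c (mode_rep M (- i)))) = (\<Sum>k\<in>sec i. pos_part Z (i, k))"
proof -
  let ?n = "mode_rep M (- i)"
  have n: "?n \<in> modes M" by (rule mode_rep_in[OF M0])
  have "(\<Sum>k\<in>sec i. Z (ineg (i, k))) = (\<Sum>k\<in>sec ?n. Z (?n, k))"
  proof (rule sum.reindex_bij_witness[of _ uminus uminus])
    fix k assume "k \<in> sec i"
    then show "- k \<in> sec ?n" using ineg_active[of "(i,k)"] by (simp add: sec_def ineg_def)
  next
    fix k assume "k \<in> sec ?n"
    then show "- k \<in> sec i" using ineg_active[of "(?n,k)"] i by (simp add: sec_def ineg_def mode_rep_simps mode_rep_id)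
  qed (auto simp: ineg_def)
  then have "c ?n = (\<Sum>k\<in>sec i. Z (ineg (i, k)))" using d[OF n] by simp
  then have "cnj (c ?n) = (\<Sum>k\<in>sec i. cnj (Z (ineg (i, k))))" by (simp add: cnj_sum)
  then have "of_real (fl i / (2 * om i)) * (c i + cnj (c ?n)) = (\<Sum>k\<in>sec i. of_real (fl i / (2 * om i)) * (Z (i, k) + cnj (Z (ineg (i, k)))))"
    unfolding d[OF i, symmetric] sum_distrib_left[symmetric] sum.distrib by simp
  also have "\<dots> = (\<Sum>k\<in>sec i. pos_part Z (i, k))" by (intro sum.cong) (auto simp: pos_part_def sec_def)
  finally show ?thesis .
qed

text \<open>The labelled sum misses exactly the pairs of active labels whose sum is inactive. By
  \<open>cost_add\<close> such a pair has total cost at least 2K.\<close>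

lemma force_remainder:
  assumes d: "\<And>j. j \<in> modes M \<Longrightarrow> (\<Sum>k\<in>sec j. Z (j, k)) = c j" and j: "j \<in> modes M"
  shows "norm (force c j - (\<Sum>k\<in>sec j. bil Z Z (j, k))) \<le> b * p ^ nat (2 * K) *
     (\<Sum>i\<in>modes M. (\<Sum>k\<in>sec i. norm (pos_part Z (i, k)) / wt (i, k)) * 
        (\<Sum>k\<in>sec (mode_rep M (j - i)). norm (pos_part Z (mode_rep M (j - i), k)) / wt (mode_rep M (j - i), k)))"
proof -
  let ?W = "pos_part Z" and ?r = "\<lambda>i. mode_rep M (j - i)"
  let ?in = "\<lambda>k1. {k2. (\<lambda>l. k1 l + k2 l) \<in> sec j}"
  have f: "force c j = - \<i> * of_real (fl j) * (\<Sum>y\<in>active. ?W y * (\<Sum>k\<in>sec (?r (fst y)). ?W (?r (fst y), k)))"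
  proof -
    have "force c j = - \<i> * of_real (fl j) * (\<Sum>i\<in>modes M. (\<Sum>k\<in>sec i. ?W (i, k)) * (\<Sum>k\<in>sec (?r i). ?W (?r i, k)))"
      unfolding force_def using sum_pos_part[OF d] mode_rep_in[OF M0] by (intro arg_cong2[where f = "(*)"] refl sum.cong) auto
    then show ?thesis by (simp add: sum_active sum_distrib_right)
  qed
  have inn: "(\<Sum>k\<in>sec j. ?W (isub (j, k) y)) = (\<Sum>k\<in>sec (?r (fst y)) \<inter> ?in (snd y). ?W (?r (fst y), k))" for y
  proof -
    have "(\<Sum>k\<in>sec j. ?W (isub (j, k) y)) = (\<Sum>k\<in>{k \<in> sec j. k - snd y \<in> sec (?r (fst y))}. ?W (?r (fst y), k - snd y))"
      unfolding isub_def fst_conv snd_conv by (rule sum.mono_neutral_right[OF finite_sec]) (auto simp: pos_part_def sec_def)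
    also have "\<dots> = (\<Sum>k\<in>sec (?r (fst y)) \<inter> ?in (snd y). ?W (?r (fst y), k))"
      by (rule sum.reindex_bij_witness[of _ "\<lambda>k l. snd y l + k l" "\<lambda>k. k - snd y"]) (auto simp: fun_eq_iff fun_diff_def)
    finally show ?thesis .
  qed
  have g: "(\<Sum>k\<in>sec j. bil Z Z (j, k)) = - \<i> * of_real (fl j) * (\<Sum>y\<in>active. ?W y * (\<Sum>k\<in>sec (?r (fst y)) \<inter> ?in (snd y). ?W (?r (fst y), k)))"
    unfolding bil_def fst_conv sum_distrib_left[symmetric] inn[symmetric]
    by (subst sum.swap) (simp add: sum_distrib_left)
  have "force c j - (\<Sum>k\<in>sec j. bil Z Z (j, k)) = - \<i> * of_real (fl j) * (\<Sum>y\<in>active. ?W y * (\<Sum>k\<in>sec (?r (fst y)) - ?in (snd y). ?W (?r (fst y), k)))"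
  proof -
    have dd: "(\<Sum>k\<in>sec (?r (fst y)). ?W (?r (fst y), k)) - (\<Sum>k\<in>sec (?r (fst y)) \<inter> ?in (snd y). ?W (?r (fst y), k))
       = (\<Sum>k\<in>sec (?r (fst y)) - ?in (snd y). ?W (?r (fst y), k))" for y
      using sum.Int_Diff[OF finite_sec, of "\<lambda>k. ?W (?r (fst y), k)" "?r (fst y)" "?in (snd y)"] by simp
    show ?thesis unfolding f g dd[symmetric] right_diff_distrib sum_subtractf ..
  qed
  then have "norm (force c j - (\<Sum>k\<in>sec j. bil Z Z (j, k))) = \<bar>fl j\<bar> * norm (\<Sum>y\<in>active. ?W y * (\<Sum>k\<in>sec (?r (fst y)) - ?in (snd y). ?W (?r (fst y), k)))"
    by (simp add: norm_mult)
  also have "\<dots> \<le> b * (\<Sum>y\<in>active. p ^ nat (2 * K) * (norm (?W y) / wt y * (\<Sum>k\<in>sec (?r (fst y)). norm (?W (?r (fst y), k)) / wt (?r (fst y), k))))"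
  proof (intro mult_mono fl_bound sum_norm_le b0)
    fix y assume y: "y \<in> active"
    have "norm (\<Sum>k\<in>sec (?r (fst y)) - ?in (snd y). ?W (?r (fst y), k)) \<le> (\<Sum>k\<in>sec (?r (fst y)) - ?in (snd y). p ^ nat (2 * K) / wt y * (norm (?W (?r (fst y), k)) / wt (?r (fst y), k)))"
    proof (rule sum_norm_le)
      fix k assume k: "k \<in> sec (?r (fst y)) - ?in (snd y)"
      let ?z = "(?r (fst y), k)" and ?x = "(j, \<lambda>l. snd y l + k l)"
      have "?x \<notin> active" using k by (simp add: sec_def)
      moreover have "snd ?x \<in> multi_indices M" using y k by (auto simp: sec_def active_def multi_indices_def)
      ultimately have "2 * K \<le> cost ?x" using j by (auto simp: active_def)
      also have "cost ?x \<le> cost y + cost ?z" by (rule cost_add) (use j in \<open>auto simp: mode_rep_simps mode_rep_id\<close>)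
      finally have "nat (2 * K) \<le> nat (cost y) + nat (cost ?z)" using cost_pos[of y] cost_pos[of ?z] by linarith
      then have "wt y * wt ?z \<le> p ^ nat (2 * K)" unfolding wt_def by (rule ww_mult_high)
      then have "1 \<le> p ^ nat (2 * K) / wt y / wt ?z" using wt_pos[of y] wt_pos[of ?z] by (simp add: field_simps)
      then show "norm (?W ?z) \<le> p ^ nat (2 * K) / wt y * (norm (?W ?z) / wt ?z)"
        using mult_right_mono[of 1 "p ^ nat (2 * K) / wt y / wt ?z" "norm (?W ?z)"] by simp
    qed
    also have "\<dots> \<le> (\<Sum>k\<in>sec (?r (fst y)). p ^ nat (2 * K) / wt y * (norm (?W (?r (fst y), k)) / wt (?r (fst y), k)))"
      using p0 by (intro sum_mono2 finite_sec) (auto intro!: mult_nonneg_nonneg divide_nonneg_pos mult_pos_pos wt_pos)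
    also have "\<dots> = p ^ nat (2 * K) / wt y * (\<Sum>k\<in>sec (?r (fst y)). norm (?W (?r (fst y), k)) / wt (?r (fst y), k))"
      by (simp only: sum_distrib_left)
    finally have "norm (?W y) * norm (\<Sum>k\<in>sec (?r (fst y)) - ?in (snd y). ?W (?r (fst y), k)) \<le> norm (?W y) * (p ^ nat (2 * K) / wt y * (\<Sum>k\<in>sec (?r (fst y)). norm (?W (?r (fst y), k)) / wt (?r (fst y), k)))"
      by (rule mult_left_mono) simp
    then show "norm (?W y * (\<Sum>k\<in>sec (?r (fst y)) - ?in (snd y). ?W (?r (fst y), k))) \<le> p ^ nat (2 * K) * (norm (?W y) / wt y * (\<Sum>k\<in>sec (?r (fst y)). norm (?W (?r (fst y), k)) / wt (?r (fst y), k)))"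
      by (simp add: norm_mult mult_ac)
  qed simp
  also have "\<dots> = b * p ^ nat (2 * K) * (\<Sum>i\<in>modes M. (\<Sum>k\<in>sec i. norm (?W (i, k)) / wt (i, k)) * (\<Sum>k\<in>sec (?r i). norm (?W (?r i, k)) / wt (?r i, k)))"
    unfolding sum_distrib_left[symmetric] by (simp add: sum_active sum_distrib_right mult.assoc)
  finally show ?thesis .
qed

lemma mode_norm_remainder:
  assumes d: "decomp c a"
  shows "mode_norm (\<lambda>_. 1) (\<lambda>j. force c j - (\<Sum>k\<in>sec j. bil (\<lambda>x. a x 0) (\<lambda>x. a x 0) (j, k))) 
     \<le> hconst 0 * p ^ nat (2 * K) * (nrm N wt Rbig a)\<^sup>2"
proof -
  have Rb: "Rbig > 0" using p0 by (simp add: Rbig_def)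
  let ?Z = "\<lambda>x. a x 0"
  let ?A = "\<lambda>i. \<Sum>k\<in>sec i. norm (pos_part ?Z (i, k)) / wt (i, k)"
  have A0: "?A i \<ge> 0" for i using wt_pos by (intro sum_nonneg divide_nonneg_pos) auto
  have nA: "L2_set (\<lambda>j. sg j * ?A j) (modes M) \<le> b / sqrt \<rho> * nrm N wt Rbig a"
  proof -
    have "L2_set (\<lambda>j. sg j * ?A j) (modes M) = rn wt (\<lambda>x. jet_norm 0 Rbig (\<lambda>i. pos_part (\<lambda>x. a x i) x))"
      by (simp add: rn_def jet_norm_def)
    also have "\<dots> \<le> b / sqrt \<rho> * nrm 0 wt Rbig a" using Rb wt_ineg active_mode by (intro rn_pos_part wt_pos) auto
    also have "\<dots> \<le> b / sqrt \<rho> * nrm N wt Rbig a" using b0 rho0 Rb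
      by (intro mult_left_mono rn_mono jet_norm_mono_n jet_norm_nonneg wt_pos) auto
    finally show ?thesis .
  qed
  have "mode_norm (\<lambda>_. 1) (\<lambda>j. force c j - (\<Sum>k\<in>sec j. bil ?Z ?Z (j, k))) \<le>
     L2_set (\<lambda>j. (b * p ^ nat (2 * K)) * (sg j * (\<Sum>i\<in>modes M. ?A i * ?A (mode_rep M (j - i))))) (modes M)"
    unfolding mode_norm_def
  proof (rule L2_set_mono)
    fix j assume j: "j \<in> modes M"
    have "norm (force c j - (\<Sum>k\<in>sec j. bil ?Z ?Z (j, k))) \<le> b * p ^ nat (2 * K) * (\<Sum>i\<in>modes M. ?A i * ?A (mode_rep M (j - i)))"
      using decomp_sum[OF d] j by (intro force_remainder) auto
    from mult_left_mono[OF this, of "sg j"] show "sg j * (norm (force c j - (\<Sum>k\<in>sec j. bil ?Z ?Z (j, k))) / 1) \<le> (b * p ^ nat (2 * K)) * (sg j * (\<Sum>i\<in>modes M. ?A i * ?A (mode_rep M (j - i))))"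
      using sg_pos[of j] by (simp add: mult_ac)
  qed (use sg_pos in \<open>simp add: less_imp_le\<close>)
  also have "\<dots> = (b * p ^ nat (2 * K)) * L2_set (\<lambda>j. sg j * (\<Sum>i\<in>modes M. ?A i * ?A (mode_rep M (j - i)))) (modes M)"
    using b0 p0 by (intro L2_set_right_distrib[symmetric]) simp
  also have "\<dots> \<le> (b * p ^ nat (2 * K)) * (conv_const s * L2_set (\<lambda>j. sg j * ?A j) (modes M) * L2_set (\<lambda>j. sg j * ?A j) (modes M))"
    using b0 p0 by (intro mult_left_mono L2_conv[OF s12 M0 A0 A0]) simp
  also have "\<dots> \<le> (b * p ^ nat (2 * K)) * (conv_const s * (b / sqrt \<rho> * nrm N wt Rbig a) * (b / sqrt \<rho> * nrm N wt Rbig a))"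
    using b0 p0 conv_const_nonneg nA rho0 rn_nonneg
    by (intro mult_left_mono mult_mono) (auto intro!: mult_nonneg_nonneg simp: L2_set_nonneg)
  also have "\<dots> = hconst 0 * p ^ nat (2 * K) * (nrm N wt Rbig a)\<^sup>2"
    by (simp add: hconst_def power2_eq_square mult_ac)
  finally show ?thesis .
qed

lemma mode_norm_nonneg: "mode_norm v c \<ge> 0" by (simp add: mode_norm_def L2_set_nonneg)

text \<open>The new decomposition solves its fixed-point problem exactly, the shifted old one up to
  \<open>shift_err\<close> and for a slightly different state. The unweighted contraction turns both
  defects into a bound for the distance.\<close>

lemma decomp_step:
  assumes d: "decomp c a" and d': "decomp (flow_step c) a'"
    and r: "16 * hconst (Suc N) * r \<le> \<gamma>" and r0: "r \<ge> 0"
    and c: "mode_norm wt c \<le> r / 8" and c': "mode_norm wt (flow_step c) \<le> r / 2"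
  shows "rn (\<lambda>_. 1) (\<lambda>x. norm (a' x 0 - graded_step (\<lambda>x. a x 0) x)) \<le> 2 * \<tau> * r * ((Rsmall / Rbig) ^ N + p ^ nat (2 * K))"
proof -
  have rN: "16 * hconst n * r \<le> \<gamma>" if "n \<le> Suc N" for n
    using r mult_right_mono[OF hconst_mono[OF that] r0] by simp
  have na: "nrm N wt Rbig a \<le> r / 4" using d c by (simp add: decomp_def)
  have big: "nrm N wt Rsmall f \<le> nrm N wt Rbig f" for f
    using Rsmall_pos Rsmall_le by (intro rn_mono jet_norm_nonneg jet_norm_mono_R wt_pos) auto
  have na': "nrm N wt Rsmall a' \<le> r" using d' c' big[of a'] by (simp add: decomp_def)
  have ns: "nrm N wt Rsmall (shifted a) \<le> r" by (rule nrm_shifted_small[OF d na rN r0]) simp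
  \<comment> \<open>The state reproduced by the labelled step; it differs from
    \<open>flow_step c\<close> by \<tau> times the truncation remainder.\<close>
  define c1 where "c1 = (\<lambda>j. \<Sum>k\<in>sec j. shifted a (j, k) 0)"
  let ?D = "nrm N (\<lambda>_. 1) Rsmall (\<lambda>x i. a' x i - shifted a x i)"
  let ?E = "nrm N (\<lambda>_. 1) Rsmall (shift_err a)"
  have "?D \<le> rn (\<lambda>_. 1) (\<lambda>x. jet_norm N Rsmall (\<lambda>i. mod_map (flow_step c) a' x i - mod_map c1 (shifted a) x i) + jet_norm N Rsmall (shift_err a x))"
  proof (rule rn_mono)
    fix x assume x: "x \<in> active"
    have "jet_norm N Rsmall (\<lambda>i. a' x i - shifted a x i) = jet_norm N Rsmall (\<lambda>i. (mod_map (flow_step c) a' x i - mod_map c1 (shifted a) x i) + shift_err a x i)"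
      unfolding jet_norm_def using d' x mod_map_shifted[OF d x, of _ c1] by (intro sum.cong) (auto simp: decomp_def c1_def)
    also have "\<dots> \<le> jet_norm N Rsmall (\<lambda>i. mod_map (flow_step c) a' x i - mod_map c1 (shifted a) x i) + jet_norm N Rsmall (shift_err a x)"
      using Rsmall_pos by (intro jet_norm_add) simp
    finally show "jet_norm N Rsmall (\<lambda>i. a' x i - shifted a x i) \<le> \<dots>" .
    show "0 \<le> jet_norm N Rsmall (\<lambda>i. a' x i - shifted a x i)" using Rsmall_pos by (intro jet_norm_nonneg) simp
  qed simp
  also have "\<dots> \<le> nrm N (\<lambda>_. 1) Rsmall (\<lambda>x i. mod_map (flow_step c) a' x i - mod_map c1 (shifted a) x i) + ?E"
    by (rule rn_add)
  also have "\<dots> \<le> (mode_norm (\<lambda>_. 1) (\<lambda>j. flow_step c j - c1 j) + ?D / 2) + ?E"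
    using mod_map_contraction_small[OF na' ns rN, of "flow_step c" c1] by simp
  finally have D: "?D \<le> 2 * (mode_norm (\<lambda>_. 1) (\<lambda>j. flow_step c j - c1 j) + ?E)" by simp
  have "mode_norm (\<lambda>_. 1) (\<lambda>j. flow_step c j - c1 j) = 
     L2_set (\<lambda>j. \<tau> * (sg j * (norm (force c j - (\<Sum>k\<in>sec j. bil (\<lambda>x. a x 0) (\<lambda>x. a x 0) (j, k))) / 1))) (modes M)"
    unfolding mode_norm_def
  proof (rule L2_set_cong[OF refl])
    fix j assume j: "j \<in> modes M"
    have "c1 j = (\<Sum>k\<in>sec j. rot j * (a (j, k) 0 + of_real \<tau> * bil (\<lambda>x. a x 0) (\<lambda>x. a x 0) (j, k)))"
      unfolding c1_def using shifted_0[OF d] by (intro sum.cong) (auto simp: sec_def graded_step_def)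
    also have "\<dots> = rot j * (c j + of_real \<tau> * (\<Sum>k\<in>sec j. bil (\<lambda>x. a x 0) (\<lambda>x. a x 0) (j, k)))"
      unfolding sum_distrib_left[symmetric] sum.distrib decomp_sum[OF d j] ..
    finally have "flow_step c j - c1 j = rot j * (of_real \<tau> * (force c j - (\<Sum>k\<in>sec j. bil (\<lambda>x. a x 0) (\<lambda>x. a x 0) (j, k))))"
      by (simp add: flow_step_def algebra_simps)
    then show "sg j * (norm (flow_step c j - c1 j) / 1) = \<tau> * (sg j * (norm (force c j - (\<Sum>k\<in>sec j. bil (\<lambda>x. a x 0) (\<lambda>x. a x 0) (j, k))) / 1))"
      using tau0 by (simp add: norm_mult norm_rot)
  qed
  also have "\<dots> = \<tau> * mode_norm (\<lambda>_. 1) (\<lambda>j. force c j - (\<Sum>k\<in>sec j. bil (\<lambda>x. a x 0) (\<lambda>x. a x 0) (j, k)))"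
    unfolding mode_norm_def using tau0 by (intro L2_set_right_distrib[symmetric]) simp
  also have "\<dots> \<le> \<tau> * (hconst 0 * p ^ nat (2 * K) * (nrm N wt Rbig a)\<^sup>2)"
    using tau0 by (intro mult_left_mono mode_norm_remainder[OF d]) simp
  also have "\<dots> \<le> \<tau> * (p ^ nat (2 * K) * r)"
  proof -
    have "hconst 0 * (nrm N wt Rbig a)\<^sup>2 \<le> hconst 0 * r\<^sup>2"
      using na r0 rn_nonneg hconst_nonneg by (intro mult_left_mono power_mono) auto
    also have "\<dots> = (hconst 0 * r) * r" by (simp add: power2_eq_square)
    also have "\<dots> \<le> 1 * r" using rN[of 0] gam1 r0 by (intro mult_right_mono) auto
    finally have "p ^ nat (2 * K) * (hconst 0 * (nrm N wt Rbig a)\<^sup>2) \<le> p ^ nat (2 * K) * r" using p0 by (intro mult_left_mono) auto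
    then show ?thesis using tau0 by (intro mult_left_mono) (auto simp: mult_ac)
  qed
  finally have m: "mode_norm (\<lambda>_. 1) (\<lambda>j. flow_step c j - c1 j) \<le> \<tau> * (p ^ nat (2 * K) * r)" .
  have "?D \<le> 2 * (\<tau> * (p ^ nat (2 * K) * r) + \<tau> * ((Rsmall / Rbig) ^ N * r))"
    by (rule order_trans[OF D], intro mult_left_mono add_mono m nrm_shift_err[OF d na r r0]) simp
  moreover have "rn (\<lambda>_. 1) (\<lambda>x. norm (a' x 0 - graded_step (\<lambda>x. a x 0) x)) \<le> ?D"
  proof (rule rn_mono)
    fix x assume x: "x \<in> active"
    show "norm (a' x 0 - graded_step (\<lambda>x. a x 0) x) \<le> jet_norm N Rsmall (\<lambda>i. a' x i - shifted a x i)"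
      using norm_le_jet_norm[of Rsmall 0 N "\<lambda>i. a' x i - shifted a x i"] Rsmall_pos shifted_0[OF d x] by simp
  qed auto
  ultimately show ?thesis by (simp add: algebra_simps)
qed

subsection \<open>Exact invariants of the graded dynamics\<close>

text \<open>|Z|^2 / \<omega>_j is, up to normalization, the action of an oscillator of frequency
  \<omega>_j. The entry k_l is its charge under rotation of the l-th phase.\<close>

definition action :: "int \<Rightarrow> (label \<Rightarrow> complex) \<Rightarrow> real" where
  "action l Z = (\<Sum>x\<in>active. of_int (snd x l) / om (fst x) * (norm (Z x))\<^sup>2)"

lemma ineg_active_iff: "fst x \<in> modes M \<Longrightarrow> ineg x \<in> active \<longleftrightarrow> x \<in> active"
  using ineg_active[of x] ineg_active[of "ineg x"] by (auto simp: ineg_ineg)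

lemma sum_ineg: "(\<Sum>x\<in>active. f (ineg x)) = (\<Sum>x\<in>active. f x)"
  by (rule sum.reindex_bij_witness[of _ ineg ineg]) (auto simp: ineg_active ineg_ineg active_mode)

lemma pos_part_ineg: 
  assumes "fst x \<in> modes M" shows "pos_part Z (ineg x) = cnj (pos_part Z x)"
proof (cases "x \<in> active")
  case True
  then show ?thesis using assms ineg_active[OF True] fl_sym[OF assms] om_sym[OF assms]
    by (simp add: pos_part_def ineg_ineg) (simp add: ineg_def add.commute)
next
  case False
  then show ?thesis using ineg_active_iff[OF assms] by (simp add: pos_part_def)
qed

lemma isub_ineg: "isub (ineg x) (ineg y) = ineg (isub x y)"
  by (auto simp: isub_def ineg_def mode_rep_simps algebra_simps fun_eq_iff)

lemma isub_swap: "isub y x = ineg (isub x y)"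
  by (auto simp: isub_def ineg_def mode_rep_simps algebra_simps fun_eq_iff)

lemma isub_mode: "fst (isub x y) \<in> modes M"
  by (simp add: isub_def mode_rep_in M0)

text \<open>Each monomial of the cubic potential has total label zero, so it is invariant under rotating
  the phases of all labels; this is the first variation of that invariance.\<close>

lemma cubic_invariance:
  fixes Z :: "label \<Rightarrow> complex"
  defines "W \<equiv> pos_part Z"
  shows "(\<Sum>x\<in>active. \<Sum>y\<in>active. of_int (snd x l) * cnj (W x) * W y * W (isub x y)) = 0"
proof -
  define t where "t = (\<lambda>x y. cnj (W x) * W y * W (isub x y))"
  define T where "T = (\<Sum>x\<in>active. \<Sum>y\<in>active. of_int (snd x l) * t x y)"
  define T2 where "T2 = (\<Sum>x\<in>active. \<Sum>y\<in>active. of_int (snd y l) * t x y)"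
  have sw: "(\<Sum>y\<in>active. of_int (snd (isub x y) l) * t x y) = (\<Sum>y\<in>active. of_int (snd y l) * t x y)" for x
  proof -
    have r: "(\<Sum>y\<in>active. f y * t x y) = (\<Sum>y\<in>{y \<in> active. isub x y \<in> active}. f y * t x y)" for f
      by (rule sum.mono_neutral_right[OF finite_active]) (auto simp: t_def W_def pos_part_def)
    show ?thesis unfolding r
      by (rule sum.reindex_bij_witness[of _ "isub x" "isub x"]) (auto simp: isub_isub active_mode t_def)
  qed
  have "of_int (snd x l) * t x y = of_int (snd y l) * t x y + of_int (snd (isub x y) l) * t x y" for x y
    by (simp add: isub_snd_add[of x l y] distrib_right)
  then have "T = (\<Sum>x\<in>active. (\<Sum>y\<in>active. of_int (snd y l) * t x y) + (\<Sum>y\<in>active. of_int (snd (isub x y) l) * t x y))"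
    unfolding T_def by (simp only: sum.distrib)
  \<comment> \<open>Exchanging the two factors of the convolution gives T = 2 T2. Conjugating all
    labels below gives T2 = -T, and the two relations force T = 0.\<close>
  then have 1: "T = T2 + T2" unfolding sw by (simp only: sum.distrib T2_def)
  define g where "g = (\<lambda>x y. of_int (snd y l) * t x y)"
  have "(\<Sum>x\<in>active. \<Sum>y\<in>active. g (ineg x) (ineg y)) = (\<Sum>x\<in>active. \<Sum>y\<in>active. g (ineg x) y)"
    by (intro sum.cong refl sum_ineg)
  also have "\<dots> = (\<Sum>x\<in>active. \<Sum>y\<in>active. g x y)" by (rule sum_ineg[of "\<lambda>x. \<Sum>y\<in>active. g x y"])
  also have "\<dots> = T2" by (simp add: T2_def g_def)
  finally have "T2 = (\<Sum>x\<in>active. \<Sum>y\<in>active. of_int (snd (ineg y) l) * t (ineg x) (ineg y))"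
    by (simp add: g_def)
  also have "\<dots> = (\<Sum>x\<in>active. \<Sum>y\<in>active. - (of_int (snd y l) * t y x))"
  proof (intro sum.cong refl)
    fix x y assume xy: "x \<in> active" "y \<in> active"
    have "W (isub (ineg x) (ineg y)) = W (isub y x)" by (simp add: isub_ineg isub_swap[of y x])
    then have "t (ineg x) (ineg y) = t y x"
      using pos_part_ineg[OF active_mode[OF xy(1)]] pos_part_ineg[OF active_mode[OF xy(2)]] by (simp add: t_def W_def mult_ac)
    then show "of_int (snd (ineg y) l) * t (ineg x) (ineg y) = - (of_int (snd y l) * t y x)" by (simp add: ineg_def)
  qed
  also have "\<dots> = - T" unfolding T_def by (subst sum.swap) (simp add: sum_negf)
  finally have "T = 0" using 1 by simp
  then show ?thesis by (simp add: T_def t_def mult.assoc)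
qed

text \<open>The term linear in \<tau> vanishes by \<open>cubic_invariance\<close>. The quadratic one
  vanishes because |\<open>bil\<close>| is even and k is odd under \<open>ineg\<close>. So
  conservation is exact at finite \<tau>.\<close>

lemma action_graded_step: "action l (graded_step Z) = action l Z"
proof -
  define W where "W = pos_part Z"
  define G where "G = (\<lambda>x. \<Sum>y\<in>active. W y * W (isub x y))"
  have F: "bil Z Z x = - \<i> * of_real (fl (fst x)) * G x" for x by (simp add: bil_def G_def W_def)
  have Gn: "G (ineg x) = cnj (G x)" for x
  proof -
    have "G (ineg x) = (\<Sum>y\<in>active. W (ineg y) * W (isub (ineg x) (ineg y)))"
      unfolding G_def by (subst sum_ineg[symmetric]) simp
    also have "\<dots> = (\<Sum>y\<in>active. cnj (W y * W (isub x y)))"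
      by (intro sum.cong refl) (simp add: isub_ineg W_def pos_part_ineg active_mode isub_mode)
    finally show ?thesis by (simp add: G_def cnj_sum)
  qed
  have sym: "fl (fst (ineg x)) = fl (fst x)" "om (fst (ineg x)) = om (fst x)" "snd (ineg x) l = - snd x l" if "x \<in> active" for x
    using fl_sym[OF active_mode[OF that]] om_sym[OF active_mode[OF that]] by (simp_all add: ineg_def)
  define q where "q = (\<lambda>x. of_int (snd x l) / om (fst x) * (norm (bil Z Z x))\<^sup>2)"
  have "q (ineg x) = - q x" if "x \<in> active" for x
    using sym[OF that] by (simp add: q_def F norm_mult Gn)
  then have "(\<Sum>x\<in>active. q (ineg x)) = - (\<Sum>x\<in>active. q x)" by (simp add: sum_negf)
  then have q: "(\<Sum>x\<in>active. q x) = 0" using sum_ineg[of q] by simp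
  define f where "f = (\<lambda>x. of_int (snd x l) / om (fst x) * Re (cnj (Z x) * bil Z Z x))"
  have ff: "f x + f (ineg x) = 2 * Im (of_int (snd x l) * cnj (W x) * G x)" if x: "x \<in> active" for x
  proof -
    have a: "f x = of_int (snd x l) * (fl (fst x) / om (fst x)) * Im (cnj (Z x) * G x)"
      by (simp add: f_def F algebra_simps)
    have b: "f (ineg x) = of_int (snd x l) * (fl (fst x) / om (fst x)) * Im (Z (ineg x) * G x)"
      unfolding f_def F sym[OF x] Gn by (simp add: algebra_simps)
    have c: "cnj (W x) = of_real (fl (fst x) / (2 * om (fst x))) * (cnj (Z x) + Z (ineg x))"
      using x by (simp add: W_def pos_part_def)
    show ?thesis unfolding a b c using om_pos[of "fst x"] by (simp add: field_simps)
  qed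
  have "2 * (\<Sum>x\<in>active. f x) = (\<Sum>x\<in>active. f x + f (ineg x))" by (simp add: sum.distrib sum_ineg)
  also have "\<dots> = 2 * Im (\<Sum>x\<in>active. of_int (snd x l) * cnj (W x) * G x)"
    by (simp add: ff Im_sum sum_distrib_left)
  also have "(\<Sum>x\<in>active. of_int (snd x l) * cnj (W x) * G x) = 0"
    using cubic_invariance[of l Z] by (simp add: G_def W_def sum_distrib_left mult.assoc)
  finally have f: "(\<Sum>x\<in>active. f x) = 0" by simp
  have "(norm (graded_step Z x))\<^sup>2 = (norm (Z x))\<^sup>2 + 2 * \<tau> * Re (cnj (Z x) * bil Z Z x) + \<tau>\<^sup>2 * (norm (bil Z Z x))\<^sup>2" for x
    by (simp add: graded_step_def norm_mult norm_rot) (simp only: cmod_power2, simp add: algebra_simps power2_eq_square)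
  then have "action l (graded_step Z) = (\<Sum>x\<in>active. of_int (snd x l) / om (fst x) * (norm (Z x))\<^sup>2 + (2 * \<tau> * f x + \<tau>\<^sup>2 * q x))"
    unfolding action_def by (intro sum.cong refl) (simp add: f_def q_def distrib_left mult_ac)
  also have "\<dots> = action l Z + (2 * \<tau> * (\<Sum>x\<in>active. f x) + \<tau>\<^sup>2 * (\<Sum>x\<in>active. q x))"
    by (simp only: sum.distrib sum_distrib_left action_def)
  finally show ?thesis using f q by simp
qed

subsection \<open>Bounds for the slow decomposition\<close>

definition nonres :: "(label \<Rightarrow> complex) \<Rightarrow> label \<Rightarrow> real" where
  "nonres Z x = (if resonant x then 0 else norm (Z x))"

lemma Rbig_pos: "Rbig > 0" using p0 by (simp add: Rbig_def)

lemma nonres_pointwise: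
  assumes d: "decomp c a" and x: "x \<in> active" and n: "\<not> resonant x"
  shows "norm (a x 0) \<le> \<tau> / norm (divisor x) * (jet_norm N Rbig (bil_jet N a a x) + p\<^sup>2 * jet_norm N Rbig (a x))"
proof -
  have "norm (a x 0) = \<tau> / norm (divisor x) * norm (bil_jet N a a x 0 - (divisor x + 1) * a x (Suc 0))"
    using decomp_nonres[OF d x n, of 0] N1 tau0 by (simp add: mod_nonres_def norm_mult norm_divide)
  note eq = this
  have "norm (bil_jet N a a x 0 - (divisor x + 1) * a x (Suc 0)) \<le> norm (bil_jet N a a x 0) + norm (a x (Suc 0))"
    using norm_triangle_ineq4[of "bil_jet N a a x 0" "(divisor x + 1) * a x (Suc 0)"] by (simp add: norm_mult norm_divisor_1)
  also have "norm (bil_jet N a a x 0) \<le> jet_norm N Rbig (bil_jet N a a x)"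
    using norm_le_jet_norm[of Rbig 0 N "bil_jet N a a x"] Rbig_pos by simp
  also have "norm (a x (Suc 0)) \<le> p\<^sup>2 * jet_norm N Rbig (a x)"
    using norm_le_jet_norm[of Rbig 1 N "a x"] Rbig_pos N1 p0 by (simp add: Rbig_def field_simps)
  finally show ?thesis unfolding eq using tau0 by (intro mult_left_mono) auto
qed

lemma rn_le_nrm: "rn wt (\<lambda>x. norm (a x 0)) \<le> nrm N wt Rbig a"
  using norm_le_jet_norm[of Rbig 0 N] Rbig_pos by (intro rn_mono wt_pos) auto

text \<open>Both terms are small multiples of \<open>mode_norm wt c\<close>: one is quadratic, and
  the other reflects the slow variation divided by the worst divisor.\<close>

lemma nonres_bound:
  assumes d: "decomp c a"
  shows "rn wt (nonres (\<lambda>x. a x 0)) \<le> 4 / \<gamma> * hconst N * (mode_norm wt c)\<^sup>2 + p\<^sup>2 / (\<gamma> * h) * mode_norm wt c"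
proof -
  let ?n = "nrm N wt Rbig a"
  let ?g = "\<lambda>x. if resonant x then 0 else \<tau> / norm (divisor x)"
  have na: "?n \<le> 2 * mode_norm wt c" using d by (simp add: decomp_def)
  have "rn wt (nonres (\<lambda>x. a x 0)) \<le> rn wt (\<lambda>x. ?g x * jet_norm N Rbig (bil_jet N a a x) + p\<^sup>2 / (2 * \<gamma> * h) * jet_norm N Rbig (a x))"
  proof (rule rn_mono)
    fix x assume x: "x \<in> active"
    show "0 \<le> nonres (\<lambda>x. a x 0) x" by (simp add: nonres_def)
    show "nonres (\<lambda>x. a x 0) x \<le> ?g x * jet_norm N Rbig (bil_jet N a a x) + p\<^sup>2 / (2 * \<gamma> * h) * jet_norm N Rbig (a x)"
    proof (cases "resonant x")
      case True
      then show ?thesis using gam0 h0 jet_norm_nonneg[of Rbig N "a x"] Rbig_pos by (simp add: nonres_def)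
    next
      case False
      have "\<tau> / norm (divisor x) * (p\<^sup>2 * jet_norm N Rbig (a x)) \<le> 1 / (2 * \<gamma> * h) * (p\<^sup>2 * jet_norm N Rbig (a x))"
        using divisor_bound_weak[OF x False] jet_norm_nonneg[of Rbig N "a x"] Rbig_pos by (intro mult_right_mono) auto
      then show ?thesis using nonres_pointwise[OF d x False] False by (simp add: nonres_def distrib_left)
    qed
  qed (rule wt_pos)
  also have "\<dots> \<le> rn wt (\<lambda>x. ?g x * jet_norm N Rbig (bil_jet N a a x)) + rn wt (\<lambda>x. p\<^sup>2 / (2 * \<gamma> * h) * jet_norm N Rbig (a x))"
    by (rule rn_add)
  also have "rn wt (\<lambda>x. p\<^sup>2 / (2 * \<gamma> * h) * jet_norm N Rbig (a x)) = p\<^sup>2 / (2 * \<gamma> * h) * ?n"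
    using gam0 h0 by (intro rn_cmult) simp
  also have "p\<^sup>2 / (2 * \<gamma> * h) * ?n \<le> p\<^sup>2 / (2 * \<gamma> * h) * (2 * mode_norm wt c)" using na gam0 h0 by (intro mult_left_mono) auto
  also have "rn wt (\<lambda>x. ?g x * jet_norm N Rbig (bil_jet N a a x)) \<le> 1 / \<gamma> * hconst N * ?n * ?n"
  proof (rule rn_bil_jet[OF tau_le_Rbig wt_pos wt_pos])
    fix x y assume x: "x \<in> active"
    show "?g x * wt y * wt (isub x y) \<le> 1 / \<gamma> * wt x"
    proof (cases "resonant x")
      case False
      have "1 / (2 * \<gamma>) * wt x \<le> 1 / \<gamma> * wt x" using gam0 wt_pos[of x] by (intro mult_right_mono) (auto simp: field_simps)
      then show ?thesis using weight_nonres[OF x False, of y] False by simp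
    qed (use wt_pos[of x] gam0 in simp)
  qed (use gam0 tau0 wt_ineg active_mode in auto)
  also have "\<dots> \<le> 1 / \<gamma> * hconst N * (2 * mode_norm wt c) * (2 * mode_norm wt c)"
    using na gam0 hconst_nonneg mode_norm_nonneg rn_nonneg by (intro mult_mono mult_left_mono) auto
  finally show ?thesis by (simp add: power2_eq_square mult_ac)
qed

text \<open>State and resonant part differ by a sum of nonresonant components, which
  \<open>weight_unit\<close> lets one measure with the larger resonant weight.\<close>

lemma mode_norm_le_resonant:
  assumes d: "decomp c a"
  shows "mode_norm wt c \<le> mode_norm wt (\<lambda>j. a (j, unit_index j) 0) + rn wt (nonres (\<lambda>x. a x 0))"
    and "mode_norm wt (\<lambda>j. a (j, unit_index j) 0) \<le> mode_norm wt c + rn wt (nonres (\<lambda>x. a x 0))"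
proof -
  let ?y = "\<lambda>j. a (j, unit_index j) 0" and ?z = "nonres (\<lambda>x. a x 0)"
  have key: "norm (c j - ?y j) / wt (j, unit_index j) \<le> (\<Sum>k\<in>sec j. ?z (j, k) / wt (j, k))" if j: "j \<in> modes M" for j
  proof -
    have "c j - ?y j = (\<Sum>k\<in>sec j - {unit_index j}. a (j, k) 0)"
      using decomp_sum[OF d j] sum_sec_split[OF j, of "\<lambda>k. a (j, k) 0"] by (metis add_diff_cancel_left')
    then have "norm (c j - ?y j) \<le> (\<Sum>k\<in>sec j - {unit_index j}. ?z (j, k))"
      by (simp, intro sum_norm_le) (auto simp: nonres_def resonant_def)
    also have "\<dots> \<le> (\<Sum>k\<in>sec j. ?z (j, k))" by (intro sum_mono2) (auto simp: nonres_def)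
    finally have "norm (c j - ?y j) / wt (j, unit_index j) \<le> (\<Sum>k\<in>sec j. ?z (j, k)) / wt (j, unit_index j)"
      using wt_pos[of "(j, unit_index j)"] by (simp add: divide_right_mono)
    also have "\<dots> \<le> (\<Sum>k\<in>sec j. ?z (j, k) / wt (j, k))"
      unfolding sum_divide_distrib using weight_unit wt_pos by (intro sum_mono divide_left_mono) (auto simp: sec_def nonres_def)
    finally show ?thesis .
  qed
  have gen: "mode_norm wt f \<le> mode_norm wt g + rn wt ?z"
    if "\<And>j. j \<in> modes M \<Longrightarrow> norm (f j) \<le> norm (g j) + norm (c j - ?y j)" for f g
  proof -
    have "mode_norm wt f \<le> L2_set (\<lambda>j. sg j * (norm (g j) / wt (j, unit_index j)) + sg j * (\<Sum>k\<in>sec j. ?z (j, k) / wt (j, k))) (modes M)"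
      unfolding mode_norm_def
    proof (rule L2_set_mono)
      fix j assume j: "j \<in> modes M"
      have "norm (f j) / wt (j, unit_index j) \<le> norm (g j) / wt (j, unit_index j) + norm (c j - ?y j) / wt (j, unit_index j)"
        unfolding add_divide_distrib[symmetric] using that[OF j] wt_pos[of "(j, unit_index j)"] by (intro divide_right_mono) auto
      also have "\<dots> \<le> norm (g j) / wt (j, unit_index j) + (\<Sum>k\<in>sec j. ?z (j, k) / wt (j, k))" using key[OF j] by simp
      finally show "sg j * (norm (f j) / wt (j, unit_index j)) \<le> sg j * (norm (g j) / wt (j, unit_index j)) + sg j * (\<Sum>k\<in>sec j. ?z (j, k) / wt (j, k))"
        unfolding distrib_left[symmetric] using sg_pos[of j] by (intro mult_left_mono) auto
      show "0 \<le> sg j * (norm (f j) / wt (j, unit_index j))" using sg_pos[of j] wt_pos[of "(j, unit_index j)"] by simp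
    qed
    also have "\<dots> \<le> mode_norm wt g + rn wt ?z" unfolding mode_norm_def rn_def by (rule L2_set_triangle_ineq)
    finally show ?thesis .
  qed
  show "mode_norm wt c \<le> mode_norm wt ?y + rn wt ?z"
  proof (rule gen)
    fix j show "norm (c j) \<le> norm (?y j) + norm (c j - ?y j)" using norm_triangle_ineq[of "?y j" "c j - ?y j"] by simp
  qed
  show "mode_norm wt ?y \<le> mode_norm wt c + rn wt ?z"
  proof (rule gen)
    fix j show "norm (?y j) \<le> norm (c j) + norm (c j - ?y j)" using norm_triangle_ineq4[of "c j" "c j - ?y j"] by simp
  qed
qed

subsection \<open>Weighted sums of the actions\<close>

text \<open>The factors bound the total multiplicity of an active index, the quotient of Sobolev
  weights and the quotient of frequencies between l and the mode.\<close>

definition CJ :: real where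
  "CJ = (2 * K + 1) * ((K + 1) powr (2 * s) * ((K + 1) * sqrt ((1 + \<rho>) / \<rho>)))"

lemma CJ_pos: "CJ > 0" using K3 rho0 by (simp add: CJ_def)

text \<open>A high index costs K plus its distance to the mode, so a cost below 2K keeps that
  distance below K. Indices below K satisfy the bound trivially.\<close>

lemma active_support:
  assumes x: "x \<in> active" and l: "l \<in> {0..M}" and k: "snd x l \<noteq> 0"
  shows "l \<le> \<bar>fst x\<bar> + K"
proof (cases "l < K")
  case False
  then have lK: "l \<in> {K..M}" using l by simp
  have h1: "high_sum (snd x) \<ge> 1" using high_sum_ge[OF lK, of "snd x"] k by simp
  moreover have "high_sum (snd x) < 2" using x cost_high2[of x] by (force simp: active_def)
  ultimately have h: "high_sum (snd x) = 1" by simp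
  then have "high_dist (fst x) (snd x) < K" using x by (auto simp: active_def cost_def)
  moreover have "\<bar>snd x l\<bar> * mode_dist (fst x) l \<le> high_dist (fst x) (snd x)"
    unfolding high_dist_def using lK mode_dist_nonneg by (intro member_le_sum) auto
  moreover have "1 * mode_dist (fst x) l \<le> \<bar>snd x l\<bar> * mode_dist (fst x) l"
    using k mode_dist_nonneg by (intro mult_right_mono) auto
  ultimately have "mode_dist (fst x) l < K" by linarith
  then consider "\<bar>mode_rep M (fst x - l)\<bar> < K" | "\<bar>mode_rep M (fst x + l)\<bar> < K" by (auto simp: mode_dist_def min_def split: if_splits)
  moreover have ml: "\<bar>mode_rep M l\<bar> = l"
  proof (cases "l = M")
    case True then show ?thesis using M0 by (simp add: mode_rep_def)
  next
    case False then show ?thesis using l M0 by (subst mode_rep_id) (auto simp: modes_def)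
  qed
  ultimately show ?thesis
  proof cases
    case 1
    have "l = \<bar>mode_rep M (fst x - mode_rep M (fst x - l))\<bar>" using ml by (simp add: mode_rep_simps)
    also have "\<dots> \<le> \<bar>fst x\<bar> + \<bar>mode_rep M (fst x - l)\<bar>" using abs_mode_rep_le[OF M0, of "fst x - mode_rep M (fst x - l)"] by linarith
    finally show ?thesis using 1 by simp
  next
    case 2
    have "l = \<bar>mode_rep M (mode_rep M (fst x + l) - fst x)\<bar>" using ml by (simp add: mode_rep_simps)
    also have "\<dots> \<le> \<bar>fst x\<bar> + \<bar>mode_rep M (fst x + l)\<bar>" using abs_mode_rep_le[OF M0, of "mode_rep M (fst x + l) - fst x"] by linarith
    finally show ?thesis using 2 by simp
  qed
qed auto

lemma omega_comparable:
  assumes "0 \<le> l" "l \<le> (K + 1) * max \<bar>j\<bar> 1"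
  shows "om l \<le> (K + 1) * sqrt ((1 + \<rho>) / \<rho>) * om j"
proof -
  let ?m = "real_of_int (max \<bar>j\<bar> 1)"
  have "real_of_int l \<le> real_of_int ((K + 1) * max \<bar>j\<bar> 1)" using assms(2) by (simp only: of_int_le_iff)
  then have "real_of_int l \<le> (K + 1) * ?m" by (simp only: of_int_mult of_int_add of_int_1)
  then have "(real_of_int l)\<^sup>2 \<le> ((K + 1) * ?m)\<^sup>2" using assms(1) by (intro power_mono) auto
  then have "(real_of_int l)\<^sup>2 \<le> (real_of_int (K + 1))\<^sup>2 * ?m\<^sup>2" by (simp only: power_mult_distrib)
  moreover have "1 * \<rho> \<le> (real_of_int (K + 1))\<^sup>2 * \<rho>" using K3 rho0 by (intro mult_right_mono one_le_power) auto
  ultimately have "(real_of_int l)\<^sup>2 + \<rho> \<le> (real_of_int (K + 1))\<^sup>2 * (?m\<^sup>2 + \<rho>)" unfolding distrib_left by linarith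
  \<comment> \<open>The factor (1 + \<rho>) / \<rho> is forced by j = 0, where equality
    holds.\<close>
  also have "?m\<^sup>2 + \<rho> \<le> (1 + \<rho>) / \<rho> * ((real_of_int j)\<^sup>2 + \<rho>)"
  proof (cases "j = 0")
    case True
    then show ?thesis using rho0 by simp
  next
    case False
    then have "max \<bar>j\<bar> 1 = \<bar>j\<bar>" by linarith
    then have "?m = \<bar>real_of_int j\<bar>" by simp
    then have "?m\<^sup>2 = (real_of_int j)\<^sup>2" by simp
    then have "?m\<^sup>2 + \<rho> = 1 * ((real_of_int j)\<^sup>2 + \<rho>)" by simp
    also have "\<dots> \<le> (1 + \<rho>) / \<rho> * ((real_of_int j)\<^sup>2 + \<rho>)" using rho0 by (intro mult_right_mono) (auto simp: field_simps)
    finally show ?thesis .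
  qed
  finally have "(real_of_int l)\<^sup>2 + \<rho> \<le> (real_of_int (K + 1))\<^sup>2 * ((1 + \<rho>) / \<rho> * ((real_of_int j)\<^sup>2 + \<rho>))"
    by (simp add: mult_left_mono)
  then have "om l \<le> sqrt ((real_of_int (K + 1))\<^sup>2 * ((1 + \<rho>) / \<rho> * ((real_of_int j)\<^sup>2 + \<rho>)))"
    unfolding omega_def by (rule real_sqrt_le_mono)
  also have "\<dots> = (K + 1) * sqrt ((1 + \<rho>) / \<rho>) * om j"
    using K3 by (simp only: real_sqrt_mult omega_def real_sqrt_abs)
  finally show ?thesis .
qed

lemma sum_abs_index:
  assumes x: "x \<in> active" shows "(\<Sum>l=0..M. \<bar>snd x l\<bar>) \<le> 2 * K + 1"
proof -
  have *: "{0..M} = {0..<K} \<union> {K..M}" using K3 MK by auto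
  have "(\<Sum>l=0..M. \<bar>snd x l\<bar>) = (\<Sum>l\<in>{0..<K}. \<bar>snd x l\<bar>) + high_sum (snd x)"
    unfolding * high_sum_def by (rule sum.union_disjoint) auto
  also have "(\<Sum>l\<in>{0..<K}. \<bar>snd x l\<bar>) \<le> low_cost (snd x)"
    unfolding low_cost_def using profile_pos by (intro sum_mono) (simp add: mult_le_cancel_left1)
  finally have "(\<Sum>l=0..M. \<bar>snd x l\<bar>) \<le> low_cost (snd x) + high_sum (snd x)" by simp
  moreover have h: "high_sum (snd x) < 2" using x cost_high2[of x] by (force simp: active_def)
  moreover have "low_cost (snd x) \<le> 2 * K" using x h high_sum_nonneg[of "snd x"] K3 by (auto simp: active_def cost_def split: if_splits)
  ultimately show ?thesis by simp
qed

lemma index_weight: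
  assumes x: "x \<in> active"
  shows "(\<Sum>l=0..M. \<bar>of_int (snd x l)\<bar> * (sobolev_weight s l * om l)) \<le> CJ * (sobolev_weight s (fst x) * om (fst x))"
proof -
  let ?j = "fst x"
  let ?C = "((K + 1) powr (2 * s) * ((K + 1) * sqrt ((1 + \<rho>) / \<rho>))) * (sobolev_weight s ?j * om ?j)"
  have C0: "?C \<ge> 0" using om_pos[of ?j] rho0 K3 by (auto simp: sobolev_weight_def intro!: mult_nonneg_nonneg)
  have "(\<Sum>l=0..M. \<bar>of_int (snd x l)\<bar> * (sobolev_weight s l * om l)) \<le> (\<Sum>l=0..M. \<bar>real_of_int (snd x l)\<bar> * ?C)"
  proof (rule sum_mono)
    fix l assume l: "l \<in> {0..M}"
    show "\<bar>of_int (snd x l)\<bar> * (sobolev_weight s l * om l) \<le> \<bar>real_of_int (snd x l)\<bar> * ?C"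
    proof (cases "snd x l = 0")
      case False
      have "l \<le> \<bar>?j\<bar> + K" by (rule active_support[OF x l False])
      also have "\<bar>?j\<bar> + K \<le> max \<bar>?j\<bar> 1 + K * max \<bar>?j\<bar> 1" using K3 mult_left_mono[of 1 "max \<bar>?j\<bar> 1" K] by linarith
      finally have lj: "l \<le> (K + 1) * max \<bar>?j\<bar> 1" by (simp add: algebra_simps)
      moreover have "1 * 1 \<le> (K + 1) * max \<bar>?j\<bar> 1" using K3 by (intro mult_mono) auto
      ultimately have "max \<bar>l\<bar> 1 \<le> (K + 1) * max \<bar>?j\<bar> 1" using l by auto
      then have "real_of_int (max \<bar>l\<bar> 1) \<le> real_of_int ((K + 1) * max \<bar>?j\<bar> 1)" by (simp only: of_int_le_iff)
      then have "sobolev_weight s l \<le> real_of_int ((K + 1) * max \<bar>?j\<bar> 1) powr (2 * s)"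
        unfolding sobolev_weight_def using s12 by (intro powr_mono2) auto
      also have "\<dots> = (K + 1) powr (2 * s) * sobolev_weight s ?j"
        using K3 by (simp only: of_int_mult powr_mult sobolev_weight_def)
      finally have sw: "sobolev_weight s l \<le> (K + 1) powr (2 * s) * sobolev_weight s ?j" .
      have "sobolev_weight s l * om l \<le> ((K + 1) powr (2 * s) * sobolev_weight s ?j) * ((K + 1) * sqrt ((1 + \<rho>) / \<rho>) * om ?j)"
        using om_pos[of l] l by (intro mult_mono sw omega_comparable lj) (auto simp: sobolev_weight_def)
      then show ?thesis by (intro mult_left_mono) (auto simp: mult_ac)
    qed simp
  qed
  also have "\<dots> = real_of_int (\<Sum>l=0..M. \<bar>snd x l\<bar>) * ?C" by (simp only: sum_distrib_right of_int_sum of_int_abs)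
  also have "\<dots> \<le> (2 * K + 1) * ?C"
  proof (rule mult_right_mono[OF _ C0])
    show "real_of_int (\<Sum>l=0..M. \<bar>snd x l\<bar>) \<le> real_of_int (2 * K + 1)" using sum_abs_index[OF x] by (simp only: of_int_le_iff)
  qed
  finally show ?thesis by (simp add: CJ_def mult_ac)
qed

text \<open>Its square is \<epsilon> to the power e(l), up to a power of \<Lambda>.\<close>

definition level_weight :: "int \<Rightarrow> real" where
  "level_weight l = (p * h) ^ nat (energy_profile K l)"

lemma ph_pos: "p * h > 0" using p0 h0 by simp
lemma ph_le_1: "p * h \<le> 1" using p0 p1 h0 h1 by (simp add: mult_le_one)

lemma level_weight_pos: "level_weight l > 0" using ph_pos by (simp add: level_weight_def)

lemma level_weight_ge: "(p * h) ^ nat K \<le> level_weight l"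
  unfolding level_weight_def using ph_pos ph_le_1 profile_le[of l] by (intro power_decreasing) auto

lemma wt_unit_level: "j \<in> modes M \<Longrightarrow> wt (j, unit_index j) = level_weight j"
  by (simp add: wt_unit level_weight_def)

lemma wt_le_level:
  assumes "snd x l \<noteq> 0" "l \<in> {0..M}" shows "wt x \<le> level_weight l"
  unfolding wt_def level_weight_def using cost_ge_profile_index[OF assms] profile_le[of l] profile_pos[of l] by (intro ww_le_low) auto

text \<open>The coefficients are chosen so that the resonant components contribute exactly the
  square of their \<open>mode_norm\<close> (\<open>unit_index_factor\<close>).\<close>

definition total_action :: "(label \<Rightarrow> complex) \<Rightarrow> real" where
  "total_action Z = (\<Sum>l=0..M. sobolev_weight s l * om l / (level_weight l)\<^sup>2 * action l Z)"

text \<open>Indices have entries of both signs, and so do these coefficients: positivity is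
  available only for the resonant components.\<close>

definition index_factor :: "label \<Rightarrow> real" where
  "index_factor x = (\<Sum>l=0..M. sobolev_weight s l * om l / (level_weight l)\<^sup>2 * (of_int (snd x l) / om (fst x)))"

lemma sobolev_weight_nonneg: "sobolev_weight s l \<ge> 0" by (simp add: sobolev_weight_def)

lemma total_action_alt: "total_action Z = (\<Sum>x\<in>active. index_factor x * (norm (Z x))\<^sup>2)"
proof -
  have "total_action Z = (\<Sum>l=0..M. \<Sum>x\<in>active. sobolev_weight s l * om l / (level_weight l)\<^sup>2 * (of_int (snd x l) / om (fst x)) * (norm (Z x))\<^sup>2)"
    by (simp add: total_action_def action_def sum_distrib_left mult.assoc)
  also have "\<dots> = (\<Sum>x\<in>active. index_factor x * (norm (Z x))\<^sup>2)"
    by (subst sum.swap) (simp add: index_factor_def sum_distrib_right)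
  finally show ?thesis .
qed

lemma index_factor_bound:
  assumes x: "x \<in> active" and D: "D > 0" and le: "\<And>l. l \<in> {0..M} \<Longrightarrow> snd x l \<noteq> 0 \<Longrightarrow> D \<le> (level_weight l)\<^sup>2"
  shows "\<bar>index_factor x\<bar> \<le> CJ * sobolev_weight s (fst x) / D"
proof -
  have "\<bar>index_factor x\<bar> \<le> (\<Sum>l=0..M. \<bar>sobolev_weight s l * om l / (level_weight l)\<^sup>2 * (of_int (snd x l) / om (fst x))\<bar>)"
    unfolding index_factor_def by (rule sum_abs)
  also have "\<dots> \<le> (\<Sum>l=0..M. \<bar>of_int (snd x l)\<bar> * (sobolev_weight s l * om l) / (D * om (fst x)))"
  proof (rule sum_mono)
    fix l assume l: "l \<in> {0..M}"
    show "\<bar>sobolev_weight s l * om l / (level_weight l)\<^sup>2 * (of_int (snd x l) / om (fst x))\<bar> \<le> \<bar>of_int (snd x l)\<bar> * (sobolev_weight s l * om l) / (D * om (fst x))"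
    proof (cases "snd x l = 0")
      case False
      have "\<bar>sobolev_weight s l * om l / (level_weight l)\<^sup>2 * (of_int (snd x l) / om (fst x))\<bar> = \<bar>of_int (snd x l)\<bar> * (sobolev_weight s l * om l) / ((level_weight l)\<^sup>2 * om (fst x))"
        using om_pos[of l] om_pos[of "fst x"] by (simp add: abs_mult sobolev_weight_def)
      also have "\<dots> \<le> \<bar>of_int (snd x l)\<bar> * (sobolev_weight s l * om l) / (D * om (fst x))"
        using le[OF l False] D om_pos[of l] om_pos[of "fst x"] level_weight_pos[of l]
        by (intro divide_left_mono mult_right_mono mult_nonneg_nonneg mult_pos_pos) (auto simp: sobolev_weight_def)
      finally show ?thesis .
    qed simp
  qed
  also have "\<dots> = (\<Sum>l=0..M. \<bar>of_int (snd x l)\<bar> * (sobolev_weight s l * om l)) / (D * om (fst x))"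
    by (simp add: sum_divide_distrib)
  also have "\<dots> \<le> CJ * (sobolev_weight s (fst x) * om (fst x)) / (D * om (fst x))"
    using D om_pos[of "fst x"] by (intro divide_right_mono index_weight x) auto
  also have "\<dots> = CJ * sobolev_weight s (fst x) / D" using om_pos[of "fst x"] by simp
  finally show ?thesis .
qed

lemma sum_prod_le_rn:
  assumes "\<And>x. \<alpha> x \<ge> 0" "\<And>x. \<beta> x \<ge> 0" "\<And>x. v x > 0" "\<And>x. w x > 0"
  shows "(\<Sum>x\<in>active. sobolev_weight s (fst x) * (\<alpha> x / v x * (\<beta> x / w x))) \<le> rn v \<alpha> * rn w \<beta>"
proof -
  have "(\<Sum>x\<in>active. sobolev_weight s (fst x) * (\<alpha> x / v x * (\<beta> x / w x))) = (\<Sum>j\<in>modes M. (sg j)\<^sup>2 * (\<Sum>k\<in>sec j. \<alpha> (j, k) / v (j, k) * (\<beta> (j, k) / w (j, k))))"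
    by (simp add: sum_active sum_distrib_left sobolev_root_sq)
  also have "\<dots> \<le> (\<Sum>j\<in>modes M. (sg j)\<^sup>2 * ((\<Sum>k\<in>sec j. \<alpha> (j, k) / v (j, k)) * (\<Sum>k\<in>sec j. \<beta> (j, k) / w (j, k))))"
  proof (intro sum_mono mult_left_mono)
    fix j
    have "(\<Sum>k\<in>sec j. \<alpha> (j, k) / v (j, k) * (\<beta> (j, k) / w (j, k))) \<le> (\<Sum>k\<in>sec j. \<alpha> (j, k) / v (j, k) * (\<Sum>k\<in>sec j. \<beta> (j, k) / w (j, k)))"
      by (intro sum_mono mult_left_mono member_le_sum[of _ _ "\<lambda>k. \<beta> (j, k) / w (j, k)"] divide_nonneg_pos assms finite_sec)
    then show "(\<Sum>k\<in>sec j. \<alpha> (j, k) / v (j, k) * (\<beta> (j, k) / w (j, k))) \<le> (\<Sum>k\<in>sec j. \<alpha> (j, k) / v (j, k)) * (\<Sum>k\<in>sec j. \<beta> (j, k) / w (j, k))"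
      by (simp add: sum_distrib_right)
  qed simp
  also have "\<dots> \<le> (\<Sum>j\<in>modes M. \<bar>sg j * (\<Sum>k\<in>sec j. \<alpha> (j, k) / v (j, k))\<bar> * \<bar>sg j * (\<Sum>k\<in>sec j. \<beta> (j, k) / w (j, k))\<bar>)"
  proof (rule sum_mono)
    fix j
    have "t \<le> \<bar>t\<bar>" for t :: real by simp
    then have "(sg j)\<^sup>2 * ((\<Sum>k\<in>sec j. \<alpha> (j, k) / v (j, k)) * (\<Sum>k\<in>sec j. \<beta> (j, k) / w (j, k))) \<le> \<bar>(sg j * (\<Sum>k\<in>sec j. \<alpha> (j, k) / v (j, k))) * (sg j * (\<Sum>k\<in>sec j. \<beta> (j, k) / w (j, k)))\<bar>"
      by (metis (no_types, lifting) power2_eq_square mult.assoc mult.left_commute)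
    then show "(sg j)\<^sup>2 * ((\<Sum>k\<in>sec j. \<alpha> (j, k) / v (j, k)) * (\<Sum>k\<in>sec j. \<beta> (j, k) / w (j, k))) \<le> \<bar>sg j * (\<Sum>k\<in>sec j. \<alpha> (j, k) / v (j, k))\<bar> * \<bar>sg j * (\<Sum>k\<in>sec j. \<beta> (j, k) / w (j, k))\<bar>"
      by (simp only: abs_mult)
  qed
  also have "\<dots> \<le> rn v \<alpha> * rn w \<beta>" unfolding rn_def by (rule L2_set_mult_ineq)
  finally show ?thesis .
qed

lemma square_diff_bound: "\<bar>(norm u)\<^sup>2 - (norm w)\<^sup>2\<bar> \<le> (norm u + norm w) * norm (u - w)" for u w :: complex
proof -
  have "\<bar>(norm u)\<^sup>2 - (norm w)\<^sup>2\<bar> = (norm u + norm w) * \<bar>norm u - norm w\<bar>"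
    by (simp add: power2_eq_square square_diff_square_factored abs_mult)
  also have "\<dots> \<le> (norm u + norm w) * norm (u - w)" by (intro mult_left_mono norm_triangle_ineq3) auto
  finally show ?thesis .
qed

text \<open>Of the two inverse level weights one is absorbed by the size of the components. Only the
  other one appears as the factor (p h)^(-K), which limits the length of the time interval.\<close>

lemma total_action_diff:
  "\<bar>total_action Z - total_action Z'\<bar> \<le> CJ / (p * h) ^ nat K * rn wt (\<lambda>x. norm (Z x) + norm (Z' x)) * rn (\<lambda>_. 1) (\<lambda>x. norm (Z x - Z' x))"
proof -
  let ?D = "(p * h) ^ nat K"
  have D0: "?D > 0" using ph_pos by simp
  have "\<bar>total_action Z - total_action Z'\<bar> = \<bar>\<Sum>x\<in>active. index_factor x * ((norm (Z x))\<^sup>2 - (norm (Z' x))\<^sup>2)\<bar>"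
    by (simp add: total_action_alt sum_subtractf[symmetric] right_diff_distrib)
  also have "\<dots> \<le> (\<Sum>x\<in>active. CJ / ?D * (sobolev_weight s (fst x) * ((norm (Z x) + norm (Z' x)) / wt x * (norm (Z x - Z' x) / 1))))"
  proof (rule order_trans[OF sum_abs], rule sum_mono)
    fix x assume x: "x \<in> active"
    have "\<bar>index_factor x\<bar> \<le> CJ * sobolev_weight s (fst x) / (?D * wt x)"
    proof (rule index_factor_bound[OF x])
      fix l assume l: "l \<in> {0..M}" "snd x l \<noteq> 0"
      show "?D * wt x \<le> (level_weight l)\<^sup>2"
        unfolding power2_eq_square using wt_le_level[OF l(2,1)] level_weight_ge[of l] less_imp_le[OF wt_pos[of x]] less_imp_le[OF level_weight_pos[of l]]
        by (intro mult_mono)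
    qed (use D0 wt_pos in simp)
    then have "\<bar>index_factor x\<bar> * \<bar>(norm (Z x))\<^sup>2 - (norm (Z' x))\<^sup>2\<bar> \<le> CJ * sobolev_weight s (fst x) / (?D * wt x) * ((norm (Z x) + norm (Z' x)) * norm (Z x - Z' x))"
      using CJ_pos D0 wt_pos[of x] by (intro mult_mono square_diff_bound) (auto simp: sobolev_weight_def)
    then show "\<bar>index_factor x * ((norm (Z x))\<^sup>2 - (norm (Z' x))\<^sup>2)\<bar> \<le> CJ / ?D * (sobolev_weight s (fst x) * ((norm (Z x) + norm (Z' x)) / wt x * (norm (Z x - Z' x) / 1)))"
      by (simp add: abs_mult mult_ac)
  qed
  also have "\<dots> = CJ / ?D * (\<Sum>x\<in>active. sobolev_weight s (fst x) * ((norm (Z x) + norm (Z' x)) / wt x * (norm (Z x - Z' x) / 1)))"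
    by (simp add: sum_distrib_left)
  also have "\<dots> \<le> CJ / ?D * (rn wt (\<lambda>x. norm (Z x) + norm (Z' x)) * rn (\<lambda>_. 1) (\<lambda>x. norm (Z x - Z' x)))"
    using CJ_pos D0 wt_pos by (intro mult_left_mono sum_prod_le_rn) auto
  finally show ?thesis by (simp add: mult.assoc)
qed

lemma unit_index_factor:
  assumes j: "j \<in> modes M"
  shows "index_factor (j, unit_index j) = sobolev_weight s j / (level_weight j)\<^sup>2"
proof -
  have l: "\<bar>j\<bar> \<in> {0..M}" using j by (auto simp: modes_def)
  have "index_factor (j, unit_index j) = (\<Sum>l=0..M. if l = \<bar>j\<bar> then sobolev_weight s l * om l / (level_weight l)\<^sup>2 * (1 / om j) else 0)"
    unfolding index_factor_def unit_index_def by (intro sum.cong) auto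
  also have "\<dots> = sobolev_weight s \<bar>j\<bar> * om \<bar>j\<bar> / (level_weight \<bar>j\<bar>)\<^sup>2 * (1 / om j)" using l by simp
  also have "\<dots> = sobolev_weight s j / (level_weight j)\<^sup>2"
    using om_pos[of j] by (simp add: sobolev_weight_def omega_def level_weight_def profile_abs)
  finally show ?thesis .
qed

lemma sum_active_res:
  "(\<Sum>x\<in>active. f x) = (\<Sum>j\<in>modes M. f (j, unit_index j)) + (\<Sum>x\<in>active. if resonant x then 0 else f x)" for f :: "_ \<Rightarrow> real"
proof -
  have "(\<Sum>k\<in>sec j. f (j, k)) = f (j, unit_index j) + (\<Sum>k\<in>sec j. if resonant (j, k) then 0 else f (j, k))" if j: "j \<in> modes M" for j
    using sum.remove[OF finite_sec unit_in_sec[OF j], of "\<lambda>k. f (j, k)"]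
      sum.remove[OF finite_sec unit_in_sec[OF j], of "\<lambda>k. if resonant (j, k) then 0 else f (j, k)"]
    by (simp add: resonant_def)
  then show ?thesis by (simp add: sum_active sum.distrib)
qed

text \<open>The large coefficients are harmless on nonresonant labels: k_l \<noteq> 0 implies that
  the weight of the component is at most the level weight of l.\<close>

lemma total_action_resonant:
  "\<bar>total_action Z - (mode_norm wt (\<lambda>j. Z (j, unit_index j)))\<^sup>2\<bar> \<le> CJ * (rn wt (nonres Z))\<^sup>2"
proof -
  have "(mode_norm wt (\<lambda>j. Z (j, unit_index j)))\<^sup>2 = (\<Sum>j\<in>modes M. index_factor (j, unit_index j) * (norm (Z (j, unit_index j)))\<^sup>2)"
    unfolding mode_norm_def L2_set_def
    by (subst real_sqrt_pow2) (auto intro!: sum_nonneg sum.cong simp: sobolev_weight_nonneg unit_index_factor wt_unit_level power_mult_distrib power_divide sobolev_root_sq)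
  then have "total_action Z - (mode_norm wt (\<lambda>j. Z (j, unit_index j)))\<^sup>2 = (\<Sum>x\<in>active. if resonant x then 0 else index_factor x * (norm (Z x))\<^sup>2)"
    unfolding total_action_alt by (subst sum_active_res) simp
  also have "\<bar>\<dots>\<bar> \<le> (\<Sum>x\<in>active. CJ * (sobolev_weight s (fst x) * (nonres Z x / wt x * (nonres Z x / wt x))))"
  proof (rule order_trans[OF sum_abs], rule sum_mono)
    fix x assume x: "x \<in> active"
    show "\<bar>if resonant x then 0 else index_factor x * (norm (Z x))\<^sup>2\<bar> \<le> CJ * (sobolev_weight s (fst x) * (nonres Z x / wt x * (nonres Z x / wt x)))"
    proof (cases "resonant x")
      case False
      have "\<bar>index_factor x\<bar> \<le> CJ * sobolev_weight s (fst x) / (wt x)\<^sup>2"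
        using wt_pos[of x] wt_le_level by (intro index_factor_bound x power_mono) (auto intro: less_imp_le)
      then have "\<bar>index_factor x\<bar> * (norm (Z x))\<^sup>2 \<le> CJ * sobolev_weight s (fst x) / (wt x)\<^sup>2 * (norm (Z x))\<^sup>2"
        by (rule mult_right_mono) simp
      then show ?thesis using False by (simp add: nonres_def power2_eq_square abs_mult mult_ac)
    qed (simp add: nonres_def)
  qed
  also have "\<dots> = CJ * (\<Sum>x\<in>active. sobolev_weight s (fst x) * (nonres Z x / wt x * (nonres Z x / wt x)))"
    by (simp add: sum_distrib_left)
  also have "\<dots> \<le> CJ * (rn wt (nonres Z) * rn wt (nonres Z))"
    using CJ_pos wt_pos by (intro mult_left_mono sum_prod_le_rn) (auto simp: nonres_def)
  finally show ?thesis by (simp add: power2_eq_square)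
qed

lemma total_action_graded_step: "total_action (graded_step Z) = total_action Z"
  by (simp add: total_action_def action_graded_step)

subsection \<open>Bounds for the force\<close>

text \<open>The exponent \<open>d\<close> is kept free: it will be e(j) for a general mode and 3 for
  the excited one.\<close>

lemma force_bound_aux:
  fixes c :: "int \<Rightarrow> complex"
  assumes j: "j \<in> modes M" and d: "\<And>i. i \<in> modes M \<Longrightarrow> int d \<le> energy_profile K i + energy_profile K (mode_rep M (j - i))"
  defines "A \<equiv> \<lambda>i. (norm (c i) + norm (c (mode_rep M (- i)))) / level_weight i"
  shows "norm (force c j) \<le> b * (b / (2 * sqrt \<rho>))\<^sup>2 * (p * h) ^ d * (\<Sum>i\<in>modes M. A i * A (mode_rep M (j - i)))"
proof -
  let ?u = "b / (2 * sqrt \<rho>)"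
  have u0: "?u \<ge> 0" using b0 rho0 by simp
  have W: "norm (of_real (fl i / (2 * om i)) * (c i + cnj (c (mode_rep M (- i))))) \<le> ?u * (level_weight i * A i)" for i
  proof -
    have "\<bar>fl i / (2 * om i)\<bar> \<le> ?u"
      unfolding abs_divide using fl_bound om_pos[of i] om_ge[of i] rho0 b0 by (intro frac_le) auto
    moreover have "norm (c i + cnj (c (mode_rep M (- i)))) \<le> level_weight i * A i"
      using norm_triangle_ineq[of "c i" "cnj (c (mode_rep M (- i)))"] level_weight_pos[of i] by (simp add: A_def)
    ultimately show ?thesis using u0 unfolding norm_mult norm_of_real by (intro mult_mono) auto
  qed
  have A0: "A i \<ge> 0" for i using level_weight_pos[of i] by (simp add: A_def)
  have "norm (force c j) \<le> b * (\<Sum>i\<in>modes M. ?u\<^sup>2 * (p * h) ^ d * (A i * A (mode_rep M (j - i))))"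
    unfolding force_def norm_mult[of "- \<i> * of_real (fl j)"]
  proof (intro mult_mono sum_norm_le b0)
    show "norm (- \<i> * complex_of_real (fl j)) \<le> b" using fl_bound by (simp add: norm_mult)
    fix i assume i: "i \<in> modes M"
    let ?k = "mode_rep M (j - i)"
    have "level_weight i * level_weight ?k = (p * h) ^ (nat (energy_profile K i) + nat (energy_profile K ?k))"
      by (simp add: level_weight_def power_add)
    also have "\<dots> \<le> (p * h) ^ d" using d[OF i] ph_pos ph_le_1 profile_pos[of i] profile_pos[of ?k] by (intro power_decreasing) auto
    finally have lw: "level_weight i * level_weight ?k \<le> (p * h) ^ d" .
    have "norm (of_real (fl i / (2 * om i)) * (c i + cnj (c (mode_rep M (- i)))) * (of_real (fl ?k / (2 * om ?k)) * (c ?k + cnj (c (mode_rep M (- ?k))))))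
       \<le> ?u * (level_weight i * A i) * (?u * (level_weight ?k * A ?k))"
      unfolding norm_mult[of "_ * _" "_ * _"] using u0 A0 less_imp_le[OF level_weight_pos] by (intro mult_mono W mult_nonneg_nonneg norm_ge_zero) auto
    also have "\<dots> = (level_weight i * level_weight ?k) * (?u\<^sup>2 * (A i * A ?k))" by (simp add: power2_eq_square mult_ac)
    also have "\<dots> \<le> (p * h) ^ d * (?u\<^sup>2 * (A i * A ?k))" using lw A0 by (intro mult_right_mono) auto
    finally show "norm (of_real (fl i / (2 * om i)) * (c i + cnj (c (mode_rep M (- i)))) * (of_real (fl ?k / (2 * om ?k)) * (c ?k + cnj (c (mode_rep M (- ?k))))))
       \<le> ?u\<^sup>2 * (p * h) ^ d * (A i * A ?k)" by (simp add: mult_ac)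
  qed simp
  then show ?thesis by (simp add: sum_distrib_left mult_ac)
qed

lemma L2_symmetrized:
  "L2_set (\<lambda>j. sg j * ((norm (c j) + norm (c (mode_rep M (- j)))) / level_weight j)) (modes M) \<le> 2 * mode_norm wt c"
proof -
  have lw: "level_weight (mode_rep M (- j)) = level_weight j" if "j \<in> modes M" for j
  proof -
    have "\<bar>mode_rep M (- j)\<bar> = \<bar>j\<bar>" using abs_mode_rep_minus[OF M0, of j] that by (simp add: mode_rep_id)
    then have "energy_profile K (mode_rep M (- j)) = energy_profile K j" by (metis profile_abs)
    then show ?thesis by (simp add: level_weight_def)
  qed
  let ?f = "\<lambda>j. sg j * (norm (c j) / level_weight j)"
  have "L2_set (\<lambda>j. sg j * ((norm (c j) + norm (c (mode_rep M (- j)))) / level_weight j)) (modes M) = L2_set (\<lambda>j. ?f j + ?f (mode_rep M (- j))) (modes M)"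
    by (intro L2_set_cong) (auto simp: lw sg_sym add_divide_distrib distrib_left)
  also have "\<dots> \<le> L2_set ?f (modes M) + L2_set (\<lambda>j. ?f (mode_rep M (- j))) (modes M)" by (rule L2_set_triangle_ineq)
  also have "L2_set (\<lambda>j. ?f (mode_rep M (- j))) (modes M) = L2_set ?f (modes M)" by (rule L2_set_reindex[OF bij_mode_rep_uminus[OF M0]])
  also have "L2_set ?f (modes M) = mode_norm wt c" unfolding mode_norm_def by (intro L2_set_cong) (auto simp: wt_unit_level)
  finally show ?thesis by simp
qed

text \<open>The profile inherits subadditivity from \<open>cost\<close> on resonant labels, since
  the cost of any label of the mode j is at least e(j).\<close>

lemma profile_add: 
  assumes "j \<in> modes M" "i \<in> modes M"
  shows "energy_profile K j \<le> energy_profile K i + energy_profile K (mode_rep M (j - i))"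
proof -
  let ?y = "(i, unit_index i)" and ?z = "(mode_rep M (j - i), unit_index (mode_rep M (j - i)))"
  let ?x = "(j, \<lambda>l. unit_index i l + unit_index (mode_rep M (j - i)) l)"
  have "cost ?x \<le> cost ?y + cost ?z" using assms by (intro cost_add) (auto simp: mode_rep_simps mode_rep_id)
  moreover have "cost ?y = energy_profile K i" "cost ?z = energy_profile K (mode_rep M (j - i))"
    using assms mode_rep_in[OF M0] by (auto intro!: cost_unit simp: unit_index_def)
  ultimately show ?thesis using cost_ge_profile[of ?x] by simp
qed

lemma force_bound: "mode_norm wt (force c) \<le> hconst 0 * (mode_norm wt c)\<^sup>2"
proof -
  define A where "A = (\<lambda>i. (norm (c i) + norm (c (mode_rep M (- i)))) / level_weight i)"
  have A0: "A i \<ge> 0" for i using level_weight_pos[of i] by (simp add: A_def)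
  let ?B = "b * (b / (2 * sqrt \<rho>))\<^sup>2"
  have B0: "?B \<ge> 0" using b0 by simp
  have "mode_norm wt (force c) \<le> L2_set (\<lambda>j. ?B * (sg j * (\<Sum>i\<in>modes M. A i * A (mode_rep M (j - i))))) (modes M)"
    unfolding mode_norm_def
  proof (rule L2_set_mono)
    fix j assume j: "j \<in> modes M"
    have "norm (force c j) \<le> ?B * level_weight j * (\<Sum>i\<in>modes M. A i * A (mode_rep M (j - i)))"
      unfolding level_weight_def[of j] A_def using profile_add[OF j] profile_pos[of j] by (intro force_bound_aux[OF j]) simp
    then have "norm (force c j) / level_weight j \<le> ?B * (\<Sum>i\<in>modes M. A i * A (mode_rep M (j - i)))"
      using level_weight_pos[of j] by (simp add: field_simps)
    then have "sg j * (norm (force c j) / level_weight j) \<le> sg j * (?B * (\<Sum>i\<in>modes M. A i * A (mode_rep M (j - i))))"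
      using sg_pos[of j] by (intro mult_left_mono) auto
    then show "sg j * (norm (force c j) / wt (j, unit_index j)) \<le> ?B * (sg j * (\<Sum>i\<in>modes M. A i * A (mode_rep M (j - i))))"
      using j by (simp add: wt_unit_level mult_ac)
  qed (use sg_pos wt_pos in \<open>auto intro!: mult_nonneg_nonneg divide_nonneg_pos intro: less_imp_le\<close>)
  also have "\<dots> = ?B * L2_set (\<lambda>j. sg j * (\<Sum>i\<in>modes M. A i * A (mode_rep M (j - i)))) (modes M)"
    using B0 by (rule L2_set_right_distrib[symmetric])
  also have "\<dots> \<le> ?B * (conv_const s * L2_set (\<lambda>j. sg j * A j) (modes M) * L2_set (\<lambda>j. sg j * A j) (modes M))"
    by (rule mult_left_mono[OF L2_conv[OF s12 M0 A0 A0] B0])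
  also have "\<dots> \<le> ?B * (conv_const s * (2 * mode_norm wt c) * (2 * mode_norm wt c))"
    using B0 conv_const_nonneg L2_symmetrized[of c] mode_norm_nonneg unfolding A_def
    by (intro mult_left_mono mult_mono) (auto intro!: mult_nonneg_nonneg simp: L2_set_nonneg)
  also have "\<dots> = hconst 0 * (mode_norm wt c)\<^sup>2" by (simp add: hconst_def power2_eq_square field_simps)
  finally show ?thesis .
qed

text \<open>For a single mode Cauchy-Schwarz suffices, and the exponent 3 is that of
  \<open>profile_sum_mode_1\<close>.\<close>

lemma force_bound_mode_1:
  assumes j: "j \<in> {1, -1}"
  shows "norm (force c j) \<le> b * (b / sqrt \<rho>)\<^sup>2 * (p * h) ^ 3 * (mode_norm wt c)\<^sup>2"
proof -
  define A where "A = (\<lambda>i. (norm (c i) + norm (c (mode_rep M (- i)))) / level_weight i)"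
  have A0: "A i \<ge> 0" for i using level_weight_pos[of i] by (simp add: A_def)
  have jm: "j \<in> modes M" using j K3 MK by (auto simp: modes_def)
  have LA: "L2_set A (modes M) \<le> 2 * mode_norm wt c"
  proof -
    have "L2_set A (modes M) \<le> L2_set (\<lambda>j. sg j * A j) (modes M)"
    proof (rule L2_set_mono)
      fix i show "A i \<le> sg i * A i" using mult_right_mono[OF sg_ge_1 A0, of i i] by simp
    qed (rule A0)
    also have "\<dots> \<le> 2 * mode_norm wt c" using L2_symmetrized[of c] by (simp add: A_def)
    finally show ?thesis .
  qed
  have "(\<Sum>i\<in>modes M. A i * A (mode_rep M (j - i))) = (\<Sum>i\<in>modes M. \<bar>A i\<bar> * \<bar>A (mode_rep M (j - i))\<bar>)" using A0 by simp
  also have "\<dots> \<le> L2_set A (modes M) * L2_set (\<lambda>i. A (mode_rep M (j - i))) (modes M)" by (rule L2_set_mult_ineq)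
  also have "L2_set (\<lambda>i. A (mode_rep M (j - i))) (modes M) = L2_set A (modes M)" by (rule L2_set_reindex[OF bij_mode_rep_rdiff[OF M0]])
  also have "L2_set A (modes M) * L2_set A (modes M) \<le> (2 * mode_norm wt c) * (2 * mode_norm wt c)"
    using LA mode_norm_nonneg by (intro mult_mono) (auto simp: L2_set_nonneg)
  finally have S: "(\<Sum>i\<in>modes M. A i * A (mode_rep M (j - i))) \<le> 4 * (mode_norm wt c)\<^sup>2" by (simp add: power2_eq_square)
  have "norm (force c j) \<le> b * (b / (2 * sqrt \<rho>))\<^sup>2 * (p * h) ^ 3 * (\<Sum>i\<in>modes M. A i * A (mode_rep M (j - i)))"
    unfolding A_def using profile_sum_mode_1[OF j] by (intro force_bound_aux[OF jm]) simp
  also have "\<dots> \<le> b * (b / (2 * sqrt \<rho>))\<^sup>2 * (p * h) ^ 3 * (4 * (mode_norm wt c)\<^sup>2)"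
    using S b0 ph_pos by (intro mult_left_mono) auto
  also have "\<dots> = b * (b / sqrt \<rho>)\<^sup>2 * (p * h) ^ 3 * (mode_norm wt c)\<^sup>2" by (simp add: power_divide power_mult_distrib)
  finally show ?thesis .
qed

lemma flow_step_bound: "mode_norm wt (flow_step c) \<le> mode_norm wt c + \<tau> * (hconst 0 * (mode_norm wt c)\<^sup>2)"
proof -
  have "mode_norm wt (flow_step c) \<le> L2_set (\<lambda>j. sg j * (norm (c j) / wt (j, unit_index j)) + \<tau> * (sg j * (norm (force c j) / wt (j, unit_index j)))) (modes M)"
    unfolding mode_norm_def
  proof (rule L2_set_mono)
    fix j
    have "norm (flow_step c j) \<le> norm (c j) + \<tau> * norm (force c j)"
      using norm_triangle_ineq[of "c j" "of_real \<tau> * force c j"] tau0 by (simp add: flow_step_def norm_mult norm_rot)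
    then have "sg j * (norm (flow_step c j) / wt (j, unit_index j)) \<le> sg j * ((norm (c j) + \<tau> * norm (force c j)) / wt (j, unit_index j))"
      using sg_pos[of j] wt_pos[of "(j, unit_index j)"] by (intro mult_left_mono divide_right_mono) auto
    then show "sg j * (norm (flow_step c j) / wt (j, unit_index j)) \<le> sg j * (norm (c j) / wt (j, unit_index j)) + \<tau> * (sg j * (norm (force c j) / wt (j, unit_index j)))"
      by (simp add: add_divide_distrib distrib_left mult_ac)
    show "0 \<le> sg j * (norm (flow_step c j) / wt (j, unit_index j))" using sg_pos[of j] wt_pos[of "(j, unit_index j)"] by simp
  qed
  also have "\<dots> \<le> mode_norm wt c + L2_set (\<lambda>j. \<tau> * (sg j * (norm (force c j) / wt (j, unit_index j)))) (modes M)"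
    unfolding mode_norm_def by (rule L2_set_triangle_ineq)
  also have "L2_set (\<lambda>j. \<tau> * (sg j * (norm (force c j) / wt (j, unit_index j)))) (modes M) = \<tau> * mode_norm wt (force c)"
    unfolding mode_norm_def using tau0 by (intro L2_set_right_distrib[symmetric]) simp
  also have "\<dots> \<le> \<tau> * (hconst 0 * (mode_norm wt c)\<^sup>2)" using tau0 force_bound by (intro mult_left_mono) auto
  finally show ?thesis by simp
qed

subsection \<open>The excited mode\<close>

lemma mode_1: "j \<in> {1, -1} \<Longrightarrow> j \<in> modes M"
  using K3 MK by (auto simp: modes_def)

lemma weight_mode_1:
  assumes "fst x \<in> {1, -1}" and y: "fst y \<in> modes M"
  shows "wt y * wt (isub x y) \<le> (p * h) ^ 3"
proof -
  let ?c1 = "nat (cost y)" and ?c2 = "nat (cost (isub x y))"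
  have "3 \<le> energy_profile K (fst y) + energy_profile K (fst (isub x y))"
    using profile_sum_mode_1[OF assms] by (simp add: isub_def)
  then have "3 \<le> cost y + cost (isub x y)" using cost_ge_profile[of y] cost_ge_profile[of "isub x y"] by linarith
  \<comment> \<open>K \<ge> 3 ensures that saturation at K does not reduce the exponent of
    \<open>h\<close> below 3.\<close>
  then have "3 \<le> ?c1 + ?c2" "3 \<le> min ?c1 (nat K) + min ?c2 (nat K)" using cost_pos[of y] cost_pos[of "isub x y"] K3 by (auto simp: min_def)
  then have "p ^ (?c1 + ?c2) * h ^ (min ?c1 (nat K) + min ?c2 (nat K)) \<le> p ^ 3 * h ^ 3"
    using p0 p1 h0 h1 by (intro mult_mono power_decreasing) auto
  then show ?thesis unfolding wt_def ww_mult by (simp add: power_mult_distrib)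
qed

text \<open>Third-order smallness of the quadratic term, divided by the worst divisor 1 / (2
  \<gamma> h), leaves p^3. The slow-variation term gives p^2 times p h over h, which is of the same
  size.\<close>

lemma nonres_mode_1:
  assumes d: "decomp c a" and c: "mode_norm wt c \<le> r / 8" and r: "16 * hconst N * r \<le> \<gamma>" and r0: "r \<ge> 0" and j: "j \<in> {1, -1}"
  shows "(\<Sum>k\<in>sec j. nonres (\<lambda>x. a x 0) (j, k)) \<le> p ^ 3 * r / \<gamma>"
proof -
  let ?n = "nrm N wt Rbig a"
  let ?J = "\<lambda>x. jet_norm N Rbig (bil_jet N a a x)" and ?A = "\<lambda>x. jet_norm N Rbig (a x)"
  \<comment> \<open>This factor replaces the weight of labels in the modes \<plusminus>1 by (p h)^3,
    so that \<open>rn_bil_jet\<close> applies with constant 1.\<close>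
  let ?g = "\<lambda>x. if fst x \<in> {1, -1} then wt x / (p * h) ^ 3 else 0"
  have na: "?n \<le> r" using d c r0 by (simp add: decomp_def)
  have J0: "?J x \<ge> 0" "?A x \<ge> 0" for x using Rbig_pos by (auto intro!: jet_norm_nonneg)
  have g: "rn wt (\<lambda>x. ?g x * ?J x) \<le> 1 * hconst N * ?n * ?n"
  proof (rule rn_bil_jet[OF tau_le_Rbig wt_pos wt_pos])
    fix x y assume x: "x \<in> active" "y \<in> active"
    show "?g x * wt y * wt (isub x y) \<le> 1 * wt x"
    proof (cases "fst x \<in> {1, -1}")
      case True
      have "wt x / (p * h) ^ 3 * (wt y * wt (isub x y)) \<le> wt x / (p * h) ^ 3 * (p * h) ^ 3"
        using wt_pos[of x] ph_pos by (intro mult_left_mono weight_mode_1 True active_mode x) auto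
      then show ?thesis using True p0 h0 by (simp add: mult.assoc)
    qed (use wt_pos[of x] in auto)
  qed (use wt_pos ph_pos wt_ineg active_mode in \<open>auto intro: less_imp_le\<close>)
  have "hconst N * ?n * ?n \<le> 1 * r"
  proof (rule mult_mono)
    have "hconst N * ?n \<le> hconst N * r" using na hconst_nonneg by (rule mult_left_mono)
    also have "\<dots> \<le> 1" using r gam1 by simp
    finally show "hconst N * ?n \<le> 1" .
  qed (use na rn_nonneg in auto)
  with g have g': "rn wt (\<lambda>x. ?g x * ?J x) \<le> r" by simp
  have "(\<Sum>k\<in>sec j. ?g (j, k) * ?J (j, k) / wt (j, k)) \<le> rn wt (\<lambda>x. ?g x * ?J x)"
    using J0 wt_pos ph_pos by (intro sum_le_rn mode_1 j) (auto intro!: mult_nonneg_nonneg divide_nonneg_pos intro: less_imp_le)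
  also have "(\<Sum>k\<in>sec j. ?g (j, k) * ?J (j, k) / wt (j, k)) = (\<Sum>k\<in>sec j. ?J (j, k)) / (p * h) ^ 3"
    unfolding sum_divide_distrib using j wt_pos by (intro sum.cong) (auto simp: less_imp_neq[THEN not_sym])
  finally have "(\<Sum>k\<in>sec j. ?J (j, k)) / (p * h) ^ 3 \<le> r" using g' by linarith
  then have SJ: "(\<Sum>k\<in>sec j. ?J (j, k)) \<le> r * (p * h) ^ 3" using ph_pos by (simp add: pos_divide_le_eq)
  have "(\<Sum>k\<in>sec j. ?A (j, k)) \<le> (\<Sum>k\<in>sec j. p * h * (?A (j, k) / wt (j, k)))"
  proof (rule sum_mono)
    fix k
    have "wt (j, k) * (?A (j, k) / wt (j, k)) \<le> p * h * (?A (j, k) / wt (j, k))"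
      using J0 wt_pos[of "(j, k)"] by (intro mult_right_mono wt_le_ph divide_nonneg_pos)
    then show "?A (j, k) \<le> p * h * (?A (j, k) / wt (j, k))" using wt_pos[of "(j,k)"] by simp
  qed
  also have "\<dots> = p * h * (\<Sum>k\<in>sec j. ?A (j, k) / wt (j, k))" by (simp add: sum_distrib_left)
  also have "\<dots> \<le> p * h * ?n" using ph_pos J0 by (intro mult_left_mono sum_le_rn mode_1 j wt_pos) auto
  also have "\<dots> \<le> p * h * r" using na ph_pos by (intro mult_left_mono) auto
  finally have SA: "(\<Sum>k\<in>sec j. ?A (j, k)) \<le> p * h * r" .
  have "(\<Sum>k\<in>sec j. nonres (\<lambda>x. a x 0) (j, k)) \<le> (\<Sum>k\<in>sec j. 1 / (2 * \<gamma> * h) * (?J (j, k) + p\<^sup>2 * ?A (j, k)))"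
  proof (rule sum_mono)
    fix k assume k: "k \<in> sec j"
    then have x: "(j, k) \<in> active" by (simp add: sec_def)
    have q0: "0 \<le> ?J (j, k) + p\<^sup>2 * ?A (j, k)" using J0 by (intro add_nonneg_nonneg mult_nonneg_nonneg) auto
    show "nonres (\<lambda>x. a x 0) (j, k) \<le> 1 / (2 * \<gamma> * h) * (?J (j, k) + p\<^sup>2 * ?A (j, k))"
    proof (cases "resonant (j, k)")
      case True
      then show ?thesis using q0 gam0 h0 by (simp add: nonres_def)
    next
      case False
      have "norm (a (j, k) 0) \<le> \<tau> / norm (divisor (j, k)) * (?J (j, k) + p\<^sup>2 * ?A (j, k))" by (rule nonres_pointwise[OF d x False])
      also have "\<dots> \<le> 1 / (2 * \<gamma> * h) * (?J (j, k) + p\<^sup>2 * ?A (j, k))" by (intro mult_right_mono divisor_bound_weak x False q0)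
      finally show ?thesis using False by (simp add: nonres_def)
    qed
  qed
  also have "\<dots> = 1 / (2 * \<gamma> * h) * ((\<Sum>k\<in>sec j. ?J (j, k)) + p\<^sup>2 * (\<Sum>k\<in>sec j. ?A (j, k)))"
    by (simp only: sum_distrib_left[symmetric] sum.distrib)
  also have "\<dots> \<le> 1 / (2 * \<gamma> * h) * (r * (p * h) ^ 3 + p\<^sup>2 * (p * h * r))"
    using SJ SA gam0 h0 by (intro mult_left_mono add_mono) auto
  also have "\<dots> = p ^ 3 * r / (2 * \<gamma>) * (h\<^sup>2 + 1)" using h0 gam0 by (simp add: field_simps power2_eq_square power3_eq_cube)
  also have "\<dots> \<le> p ^ 3 * r / (2 * \<gamma>) * 2" using p0 r0 gam0 h0 h1 power_le_one[of h 2] by (intro mult_left_mono) auto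
  finally show ?thesis by simp
qed

definition C1 :: real where "C1 = 2 * K * om 1 / sqrt \<rho>"

lemma C1_nonneg: "C1 \<ge> 0" using K3 om_pos[of 1] rho0 by (simp add: C1_def)

lemma index_1_bound: 
  assumes "x \<in> active" shows "\<bar>om 1 * (of_int (snd x 1) / om (fst x))\<bar> \<le> C1"
proof -
  have "\<bar>real_of_int (snd x 1)\<bar> \<le> real_of_int (2 * K)" using abs_index_le[OF assms, of 1] by (metis of_int_abs of_int_le_iff)
  then have "om 1 * \<bar>real_of_int (snd x 1)\<bar> / om (fst x) \<le> om 1 * (2 * K) / sqrt \<rho>"
    using om_pos[of 1] om_ge[of "fst x"] rho0 K3 by (intro frac_le mult_left_mono) auto
  then show ?thesis using om_pos[of 1] om_pos[of "fst x"] by (simp add: C1_def abs_mult mult_ac)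
qed

lemma sobolev_weight_ge_1: "sobolev_weight s j \<ge> 1"
  unfolding sobolev_root_sq[symmetric] using sg_ge_1 by (rule one_le_power)

text \<open>The coefficients of a single action are bounded. Hence the drift has no factor (p
  h)^(-K) and even gains \<open>p * h\<close> from the size of the components.\<close>

lemma action_1_diff:
  "om 1 * \<bar>action 1 Z - action 1 Z'\<bar> \<le> C1 * (p * h) * rn wt (\<lambda>x. norm (Z x) + norm (Z' x)) * rn (\<lambda>_. 1) (\<lambda>x. norm (Z x - Z' x))"
proof -
  have "om 1 * \<bar>action 1 Z - action 1 Z'\<bar> = \<bar>om 1 * (action 1 Z - action 1 Z')\<bar>" using om_pos[of 1] by (simp add: abs_mult)
  also have "\<dots> = \<bar>\<Sum>x\<in>active. om 1 * (of_int (snd x 1) / om (fst x)) * ((norm (Z x))\<^sup>2 - (norm (Z' x))\<^sup>2)\<bar>"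
    unfolding action_def by (simp only: right_diff_distrib sum_subtractf sum_distrib_left mult.assoc)
  also have "\<dots> \<le> (\<Sum>x\<in>active. C1 * (p * h) * (sobolev_weight s (fst x) * ((norm (Z x) + norm (Z' x)) / wt x * (norm (Z x - Z' x) / 1))))"
  proof (rule order_trans[OF sum_abs], rule sum_mono)
    fix x assume x: "x \<in> active"
    let ?q = "(norm (Z x) + norm (Z' x)) * norm (Z x - Z' x)"
    have "\<bar>om 1 * (of_int (snd x 1) / om (fst x)) * ((norm (Z x))\<^sup>2 - (norm (Z' x))\<^sup>2)\<bar> \<le> C1 * ?q"
      unfolding abs_mult[of "om 1 * _"] using C1_nonneg by (intro mult_mono index_1_bound x square_diff_bound) auto
    also have "\<dots> \<le> C1 * ((p * h) / wt x * sobolev_weight s (fst x) * ?q)"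
    proof (intro mult_left_mono C1_nonneg)
      have "1 * 1 \<le> (p * h) / wt x * sobolev_weight s (fst x)"
        using wt_le_ph[of x] wt_pos[of x] sobolev_weight_ge_1 ph_pos by (intro mult_mono) auto
      then have "1 * ?q \<le> (p * h) / wt x * sobolev_weight s (fst x) * ?q" by (intro mult_right_mono) auto
      then show "?q \<le> (p * h) / wt x * sobolev_weight s (fst x) * ?q" by simp
    qed
    finally show "\<bar>om 1 * (of_int (snd x 1) / om (fst x)) * ((norm (Z x))\<^sup>2 - (norm (Z' x))\<^sup>2)\<bar> \<le> C1 * (p * h) * (sobolev_weight s (fst x) * ((norm (Z x) + norm (Z' x)) / wt x * (norm (Z x - Z' x) / 1)))"
      by (simp add: mult_ac)
  qed
  also have "\<dots> = C1 * (p * h) * (\<Sum>x\<in>active. sobolev_weight s (fst x) * ((norm (Z x) + norm (Z' x)) / wt x * (norm (Z x - Z' x) / 1)))"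
    by (simp add: sum_distrib_left)
  also have "\<dots> \<le> C1 * (p * h) * (rn wt (\<lambda>x. norm (Z x) + norm (Z' x)) * rn (\<lambda>_. 1) (\<lambda>x. norm (Z x - Z' x)))"
    using C1_nonneg ph_pos wt_pos by (intro mult_left_mono sum_prod_le_rn) auto
  finally show ?thesis by (simp add: mult.assoc)
qed

text \<open>Outside the modes \<plusminus>1 every weight is at most (p h)^2, whose square is the
  fourth power. In the modes \<plusminus>1 weights give only p h, so \<open>nonres_mode_1\<close>
  must supply the rest.\<close>

lemma action_1_resonant:
  "\<bar>om 1 * action 1 Z - (\<Sum>j\<in>{1, -1}. (norm (Z (j, unit_index j)))\<^sup>2)\<bar> \<le>
     C1 * ((p * h) ^ 4 * (rn wt (nonres Z))\<^sup>2 + (\<Sum>j\<in>{1, -1}. (\<Sum>k\<in>sec j. nonres Z (j, k))\<^sup>2))"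
proof -
  let ?f = "\<lambda>x. om 1 * (of_int (snd x 1) / om (fst x)) * (norm (Z x))\<^sup>2"
  have sub: "{1, -1} \<subseteq> modes M" using mode_1 by blast
  have om1: "om (-1) = om 1" by (simp add: omega_def)
  have nz: "om 1 \<noteq> 0" using om_pos[of 1] by simp
  have r: "(\<Sum>j\<in>modes M. ?f (j, unit_index j)) = (\<Sum>j\<in>{1, -1}. (norm (Z (j, unit_index j)))\<^sup>2)"
  proof -
    have "(\<Sum>j\<in>modes M. ?f (j, unit_index j)) = (\<Sum>j\<in>{1, -1}. ?f (j, unit_index j))"
      using sub by (intro sum.mono_neutral_right) (auto simp: unit_index_def)
    also have "\<dots> = (\<Sum>j\<in>{1, -1}. (norm (Z (j, unit_index j)))\<^sup>2)"
      using nz om1 by (intro sum.cong) (auto simp: unit_index_def)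
    finally show ?thesis .
  qed
  have "om 1 * action 1 Z = (\<Sum>x\<in>active. ?f x)" by (simp add: action_def sum_distrib_left mult.assoc)
  also have "\<dots> = (\<Sum>j\<in>{1, -1}. (norm (Z (j, unit_index j)))\<^sup>2) + (\<Sum>x\<in>active. if resonant x then 0 else ?f x)"
    unfolding r[symmetric] by (rule sum_active_res)
  finally have "\<bar>om 1 * action 1 Z - (\<Sum>j\<in>{1, -1}. (norm (Z (j, unit_index j)))\<^sup>2)\<bar> = \<bar>\<Sum>x\<in>active. if resonant x then 0 else ?f x\<bar>" by simp
  also have "\<dots> \<le> (\<Sum>x\<in>active. C1 * (nonres Z x)\<^sup>2)"
  proof (rule order_trans[OF sum_abs], rule sum_mono)
    fix x assume x: "x \<in> active"
    show "\<bar>if resonant x then 0 else ?f x\<bar> \<le> C1 * (nonres Z x)\<^sup>2"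
    proof (cases "resonant x")
      case False
      have "\<bar>?f x\<bar> \<le> C1 * (norm (Z x))\<^sup>2"
        unfolding abs_mult[of "om 1 * _"] using C1_nonneg by (intro mult_mono index_1_bound x) auto
      then show ?thesis using False by (simp add: nonres_def)
    qed (simp add: nonres_def)
  qed
  also have "\<dots> = C1 * (\<Sum>j\<in>modes M. \<Sum>k\<in>sec j. (nonres Z (j, k))\<^sup>2)"
    by (simp add: sum_active sum_distrib_left)
  also have "\<dots> \<le> C1 * (\<Sum>j\<in>modes M. (\<Sum>k\<in>sec j. (p * h) ^ 4 * (sobolev_weight s j * (nonres Z (j, k) / wt (j, k) * (nonres Z (j, k) / wt (j, k))))) 
      + (if j \<in> {1, -1} then (\<Sum>k\<in>sec j. nonres Z (j, k))\<^sup>2 else 0))"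
  proof (intro mult_left_mono C1_nonneg sum_mono)
    fix j assume j: "j \<in> modes M"
    have n0: "nonres Z x \<ge> 0" for x by (simp add: nonres_def)
    have s0: "0 \<le> (\<Sum>k\<in>sec j. (p * h) ^ 4 * (sobolev_weight s j * (nonres Z (j, k) / wt (j, k) * (nonres Z (j, k) / wt (j, k)))))"
      using ph_pos sobolev_weight_nonneg by (intro sum_nonneg mult_nonneg_nonneg divide_nonneg_pos n0 wt_pos) auto
    show "(\<Sum>k\<in>sec j. (nonres Z (j, k))\<^sup>2) \<le> (\<Sum>k\<in>sec j. (p * h) ^ 4 * (sobolev_weight s j * (nonres Z (j, k) / wt (j, k) * (nonres Z (j, k) / wt (j, k))))) 
      + (if j \<in> {1, -1} then (\<Sum>k\<in>sec j. nonres Z (j, k))\<^sup>2 else 0)"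
    proof (cases "j \<in> {1, -1}")
      case True
      have "(\<Sum>k\<in>sec j. (nonres Z (j, k))\<^sup>2) \<le> (\<Sum>k\<in>sec j. nonres Z (j, k) * (\<Sum>k\<in>sec j. nonres Z (j, k)))"
        unfolding power2_eq_square by (intro sum_mono mult_left_mono member_le_sum[of _ _ "\<lambda>k. nonres Z (j, k)"] n0 finite_sec)
      then show ?thesis using True s0 by (simp add: power2_eq_square sum_distrib_right)
    next
      case False
      have "(nonres Z (j, k))\<^sup>2 \<le> (p * h) ^ 4 * (sobolev_weight s j * (nonres Z (j, k) / wt (j, k) * (nonres Z (j, k) / wt (j, k))))" for k
      proof -
        have "2 \<le> energy_profile K j" using False K3 by (auto simp: energy_profile_def)
        then have "wt (j, k) \<le> (p * h) ^ 2" unfolding wt_def using cost_ge_profile[of "(j, k)"] K3 by (intro ww_le_low) auto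
        then have "(wt (j, k))\<^sup>2 \<le> ((p * h)\<^sup>2)\<^sup>2" using wt_pos[of "(j, k)"] by (intro power_mono) auto
        then have "(wt (j, k))\<^sup>2 * 1 \<le> (p * h) ^ 4 * sobolev_weight s j" using sobolev_weight_ge_1 ph_pos by (intro mult_mono) auto
        then have "(wt (j, k))\<^sup>2 * 1 * (nonres Z (j, k) / wt (j, k))\<^sup>2 \<le> (p * h) ^ 4 * sobolev_weight s j * (nonres Z (j, k) / wt (j, k))\<^sup>2"
          by (rule mult_right_mono) simp
        then show ?thesis using wt_pos[of "(j, k)"] by (simp add: power_divide) (simp add: power2_eq_square)
      qed
      then show ?thesis using False by (simp add: sum_mono)
    qed
  qed
  also have "\<dots> = C1 * ((p * h) ^ 4 * (\<Sum>x\<in>active. sobolev_weight s (fst x) * (nonres Z x / wt x * (nonres Z x / wt x))) + (\<Sum>j\<in>{1, -1}. (\<Sum>k\<in>sec j. nonres Z (j, k))\<^sup>2))"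
  proof -
    have "(\<Sum>j\<in>modes M. if j \<in> {1, -1} then (\<Sum>k\<in>sec j. nonres Z (j, k))\<^sup>2 else 0) = (\<Sum>j\<in>{1, -1}. (\<Sum>k\<in>sec j. nonres Z (j, k))\<^sup>2)"
    proof -
      have "modes M \<inter> {1, -1} = {1, -1}" using sub by auto
      then show ?thesis using sum.inter_restrict[of "modes M" "\<lambda>j. (\<Sum>k\<in>sec j. nonres Z (j, k))\<^sup>2" "{1, -1}"] by simp
    qed
    then show ?thesis by (simp only: sum.distrib sum_active sum_distrib_left[symmetric] fst_conv)
  qed
  also have "\<dots> \<le> C1 * ((p * h) ^ 4 * (rn wt (nonres Z) * rn wt (nonres Z)) + (\<Sum>j\<in>{1, -1}. (\<Sum>k\<in>sec j. nonres Z (j, k))\<^sup>2))"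
    using C1_nonneg ph_pos wt_pos by (intro mult_left_mono add_right_mono sum_prod_le_rn) (auto simp: nonres_def)
  finally show ?thesis by (simp add: power2_eq_square)
qed

definition C2 :: real where "C2 = 4 / \<gamma> + C1 * (1 + 2 / \<gamma>\<^sup>2)"

lemma mode_1_norm_le:
  assumes "j \<in> {1, -1}" shows "norm (c j) \<le> p * h * mode_norm wt c"
proof -
  have j: "j \<in> modes M" using mode_1 assms by blast
  have "sg j * (norm (c j) / wt (j, unit_index j)) \<le> mode_norm wt c"
    unfolding mode_norm_def using j sg_pos wt_pos by (intro member_le_L2_set) auto
  moreover have "1 * (norm (c j) / wt (j, unit_index j)) \<le> sg j * (norm (c j) / wt (j, unit_index j))"
    using sg_ge_1 wt_pos[of "(j, unit_index j)"] by (intro mult_right_mono) auto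
  moreover have "wt (j, unit_index j) = p * h" using wt_unit[OF j] assms K3 by (auto simp: energy_profile_def)
  ultimately have "norm (c j) / (p * h) \<le> mode_norm wt c" by simp
  then show ?thesis using ph_pos by (simp add: pos_divide_le_eq mult.commute)
qed

text \<open>The cross term is of size p times p^3. The resulting p^4 is of order \<epsilon> powr (2
  - 2\<nu>), which after division by \<epsilon> is the deviation allowed in the theorem.\<close>

lemma mode_1_action:
  assumes d: "decomp c a" and c: "mode_norm wt c \<le> r / 8" and r: "16 * hconst N * r \<le> \<gamma>" and r0: "r \<ge> 0"
    and z: "rn wt (nonres (\<lambda>x. a x 0)) \<le> r / 8"
  shows "\<bar>(\<Sum>j\<in>{1, -1}. (norm (c j))\<^sup>2) - om 1 * action 1 (\<lambda>x. a x 0)\<bar> \<le> p ^ 4 * r\<^sup>2 * C2"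
proof -
  let ?Z = "\<lambda>x. a x 0" and ?y = "\<lambda>j. a (j, unit_index j) 0"
  have y: "mode_norm wt ?y \<le> r" using mode_norm_le_resonant(2)[OF d] c z r0 by simp
  have n0: "nonres ?Z x \<ge> 0" for x by (simp add: nonres_def)
  have each: "\<bar>(norm (c j))\<^sup>2 - (norm (?y j))\<^sup>2\<bar> \<le> 2 * p ^ 4 * r\<^sup>2 / \<gamma>" if j: "j \<in> {1, -1}" for j
  proof -
    have "c j - ?y j = (\<Sum>k\<in>sec j - {unit_index j}. a (j, k) 0)"
      using decomp_sum[OF d mode_1[OF j]] sum_sec_split[OF mode_1[OF j], of "\<lambda>k. a (j, k) 0"] by (metis add_diff_cancel_left')
    then have "norm (c j - ?y j) \<le> (\<Sum>k\<in>sec j - {unit_index j}. nonres ?Z (j, k))"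
      by (simp, intro sum_norm_le) (auto simp: nonres_def resonant_def)
    also have "\<dots> \<le> (\<Sum>k\<in>sec j. nonres ?Z (j, k))" by (intro sum_mono2) (auto simp: n0)
    also have "\<dots> \<le> p ^ 3 * r / \<gamma>" by (rule nonres_mode_1[OF d c r r0 j])
    finally have df: "norm (c j - ?y j) \<le> p ^ 3 * r / \<gamma>" .
    have ph_p: "p * h \<le> p" using p0 h1 by simp
    have cj: "norm (c j) \<le> p * r"
    proof (rule order_trans[OF mode_1_norm_le[OF j]])
      show "p * h * mode_norm wt c \<le> p * r" by (rule mult_mono[OF ph_p]) (use c r0 p0 mode_norm_nonneg[of wt c] in auto)
    qed
    have yj: "norm (?y j) \<le> p * r"
    proof (rule order_trans[OF mode_1_norm_le[OF j, of ?y]])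
      show "p * h * mode_norm wt ?y \<le> p * r" by (rule mult_mono[OF ph_p y]) (use p0 mode_norm_nonneg[of wt ?y] in auto)
    qed
    have "\<bar>(norm (c j))\<^sup>2 - (norm (?y j))\<^sup>2\<bar> \<le> (norm (c j) + norm (?y j)) * norm (c j - ?y j)" by (rule square_diff_bound)
    also have "\<dots> \<le> (p * r + p * r) * (p ^ 3 * r / \<gamma>)" using cj yj df p0 r0 by (intro mult_mono add_mono) auto
    also have "\<dots> = 2 * p ^ 4 * r\<^sup>2 / \<gamma>" by (simp add: power2_eq_square power3_eq_cube power4_eq_xxxx)
    finally show ?thesis .
  qed
  have "\<bar>(\<Sum>j\<in>{1, -1}. (norm (c j))\<^sup>2) - (\<Sum>j\<in>{1, -1}. (norm (?y j))\<^sup>2)\<bar> \<le> 4 * p ^ 4 * r\<^sup>2 / \<gamma>"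
    using each[of 1] each[of "-1"] by (simp add: abs_le_iff)
  moreover have "\<bar>om 1 * action 1 ?Z - (\<Sum>j\<in>{1, -1}. (norm (?y j))\<^sup>2)\<bar> \<le> C1 * (p ^ 4 * r\<^sup>2 + 2 * (p ^ 4 * r\<^sup>2 / \<gamma>\<^sup>2))"
  proof (rule order_trans[OF action_1_resonant], intro mult_left_mono C1_nonneg add_mono)
    have "(p * h) ^ 4 \<le> p ^ 4" using p0 h0 h1 by (intro power_mono) auto
    moreover have "(rn wt (nonres ?Z))\<^sup>2 \<le> r\<^sup>2" using z r0 rn_nonneg by (intro power_mono) auto
    ultimately show "(p * h) ^ 4 * (rn wt (nonres ?Z))\<^sup>2 \<le> p ^ 4 * r\<^sup>2" using p0 by (intro mult_mono) auto
    have sq: "(\<Sum>k\<in>sec j. nonres ?Z (j, k))\<^sup>2 \<le> p ^ 4 * r\<^sup>2 / \<gamma>\<^sup>2" if j: "j \<in> {1, -1}" for j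
    proof -
      have "(\<Sum>k\<in>sec j. nonres ?Z (j, k))\<^sup>2 \<le> (p ^ 3 * r / \<gamma>)\<^sup>2"
        using nonres_mode_1[OF d c r r0 j] n0 by (intro power_mono sum_nonneg) auto
      also have "\<dots> = p ^ 6 * r\<^sup>2 / \<gamma>\<^sup>2" by (simp add: power_divide power_mult_distrib power_mult[symmetric])
      also have "\<dots> \<le> p ^ 4 * r\<^sup>2 / \<gamma>\<^sup>2" using p0 p1 by (intro divide_right_mono mult_right_mono power_decreasing) auto
      finally show ?thesis .
    qed
    show "(\<Sum>j\<in>{1, -1}. (\<Sum>k\<in>sec j. nonres ?Z (j, k))\<^sup>2) \<le> 2 * (p ^ 4 * r\<^sup>2 / \<gamma>\<^sup>2)"
      using sq[of 1] sq[of "-1"] by simp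
  qed
  ultimately have "\<bar>(\<Sum>j\<in>{1, -1}. (norm (c j))\<^sup>2) - om 1 * action 1 ?Z\<bar> \<le> 4 * p ^ 4 * r\<^sup>2 / \<gamma> + C1 * (p ^ 4 * r\<^sup>2 + 2 * (p ^ 4 * r\<^sup>2 / \<gamma>\<^sup>2))"
    by linarith
  also have "\<dots> = p ^ 4 * r\<^sup>2 * C2" by (simp add: C2_def algebra_simps)
  finally show ?thesis .
qed

subsection \<open>Long-time bounds\<close>

definition step_err :: real where "step_err = (Rsmall / Rbig) ^ N + p ^ nat (2 * K)"

lemma step_err_nonneg: "step_err \<ge> 0"
  unfolding step_err_def using Rsmall_pos Rbig_pos p0 by simp

text \<open>A continuity argument: the conserved total action controls the resonant part, and the
  nonresonant part is quadratically small.\<close>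

lemma long_time:
  assumes seq: "\<And>n. c (Suc n) = flow_step (c n)"
    and r0: "r > 0" and r: "16 * hconst (Suc N) * r \<le> \<gamma>"
    and k0: "\<kappa> > 0" and k1: "\<kappa> \<le> 1/16" and kC: "128 * CJ * \<kappa>\<^sup>2 \<le> 1" and kp: "2 * p\<^sup>2 \<le> \<kappa> * (\<gamma> * h)"
    and init: "mode_norm wt (c 0) \<le> \<kappa> * r / 8"
    and time: "real n * \<tau> * step_err \<le> \<kappa>\<^sup>2 * (p * h) ^ nat K / (64 * CJ)"
  shows "mode_norm wt (c n) \<le> \<kappa> * r"
    and "\<bar>(\<Sum>j\<in>{1, -1}. (norm (c n j))\<^sup>2) - (\<Sum>j\<in>{1, -1}. (norm (c 0 j))\<^sup>2)\<bar> \<le>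
      2 * (p ^ 4 * r\<^sup>2 * C2) + 4 * C1 * (p * h) * r\<^sup>2 * (real n * \<tau> * step_err)"
proof -
  have rN: "16 * hconst m * r \<le> \<gamma>" if "m \<le> Suc N" for m
  proof -
    have "hconst m * r \<le> hconst (Suc N) * r" using that r0 by (intro mult_right_mono hconst_mono) auto
    then show ?thesis using r by linarith
  qed
  define a where "a = (\<lambda>n. SOME a. decomp (c n) a)"
  have D: "decomp (c n) (a n)" if "mode_norm wt (c n) \<le> r / 2" for n
  proof -
    have "\<exists>a. decomp (c n) a"
      using mod_map_fixpoint[of "c n" r] that rN[of N] unfolding decomp_def by simp
    then show ?thesis unfolding a_def by (rule someI_ex)
  qed
  have kr: "0 < \<kappa> * r" "\<kappa> * r \<le> r / 16" using k0 r0 k1 mult_right_mono[OF k1, of r] by auto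
  let ?Z = "\<lambda>n x. a n x 0"
  \<comment> \<open>In the ball of radius 2 \<kappa> r the quadratic term and, by \<open>kp\<close>,
    the slow-variation term each contribute at most \<kappa> / 2.\<close>
  have Zb: "rn wt (nonres (?Z n)) \<le> \<kappa> * mode_norm wt (c n)" if b: "mode_norm wt (c n) \<le> 2 * (\<kappa> * r)" for n
  proof -
    let ?m = "mode_norm wt (c n)"
    have d: "decomp (c n) (a n)" using b kr r0 by (intro D) linarith
    have h1: "4 / \<gamma> * hconst N \<le> 1 / (4 * r)" using rN[of N] gam0 r0 by (simp add: field_simps)
    have "4 / \<gamma> * hconst N * ?m\<^sup>2 \<le> 1 / (4 * r) * ?m\<^sup>2" using h1 by (rule mult_right_mono) simp
    also have "\<dots> = (?m / (4 * r)) * ?m" by (simp add: power2_eq_square)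
    also have "\<dots> \<le> (\<kappa> / 2) * ?m" using b r0 mode_norm_nonneg by (intro mult_right_mono) (auto simp: field_simps)
    finally have 1: "4 / \<gamma> * hconst N * ?m\<^sup>2 \<le> (\<kappa> / 2) * ?m" .
    have "p\<^sup>2 / (\<gamma> * h) \<le> \<kappa> / 2" using kp gam0 h0 by (simp add: field_simps)
    then have 2: "p\<^sup>2 / (\<gamma> * h) * ?m \<le> (\<kappa> / 2) * ?m" using mode_norm_nonneg by (rule mult_right_mono)
    show ?thesis using order_trans[OF nonres_bound[OF d] add_mono[OF 1 2]] by simp
  qed
  \<comment> \<open>A single step at most doubles the norm, so the decomposition still exists at the
    time where the bound is to be recovered.\<close>
  have next_bound: "mode_norm wt (c (Suc n)) \<le> 2 * (\<kappa> * r)" if b: "mode_norm wt (c n) \<le> \<kappa> * r" for n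
  proof -
    have "\<tau> * (hconst 0 * (mode_norm wt (c n))\<^sup>2) \<le> \<tau> * (hconst 0 * (\<kappa> * r)\<^sup>2)"
      using tau0 hconst_nonneg b mode_norm_nonneg by (intro mult_left_mono power_mono) auto
    also have "\<dots> = \<tau> * (hconst 0 * r) * \<kappa> * (\<kappa> * r)" by (simp add: power2_eq_square)
    also have "\<dots> \<le> \<tau> * \<gamma> * 1 * (\<kappa> * r)"
      using rN[of 0] tau0 gam0 k0 k1 r0 hconst_nonneg[of 0] mult_nonneg_nonneg[of "hconst 0" r]
      by (intro mult_right_mono mult_mono mult_left_mono) auto
    also have "\<dots> \<le> 1 * 1 * (\<kappa> * r)" using tau_gam kr by (intro mult_right_mono) auto
    finally show ?thesis using flow_step_bound[of "c n"] b unfolding seq by linarith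
  qed
  let ?L = "2 * r" and ?E = "2 * \<tau> * r * step_err"
  have stp: "rn (\<lambda>_. 1) (\<lambda>x. norm (?Z (Suc n) x - graded_step (?Z n) x)) \<le> ?E"
     and siz: "rn wt (\<lambda>x. norm (?Z (Suc n) x) + norm (graded_step (?Z n) x)) \<le> ?L"
    if b: "mode_norm wt (c n) \<le> \<kappa> * r" for n
  proof -
    have b8: "mode_norm wt (c n) \<le> r / 8" and b2: "mode_norm wt (c (Suc n)) \<le> r / 2" and b4: "mode_norm wt (c n) \<le> r / 2"
      using b next_bound[OF b] kr r0 by linarith+
    note d = D[OF b4] and d' = D[OF b2]
    show "rn (\<lambda>_. 1) (\<lambda>x. norm (?Z (Suc n) x - graded_step (?Z n) x)) \<le> ?E"
      using decomp_step[OF d d'[unfolded seq] r _ b8] b2 r0 unfolding seq step_err_def by simp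
    have na: "nrm N wt Rbig (a n) \<le> r / 4" using d b8 by (simp add: decomp_def)
    have "rn wt (\<lambda>x. norm (graded_step (?Z n) x)) \<le> nrm N wt Rsmall (shifted (a n))"
    proof (rule rn_mono)
      fix x assume x: "x \<in> active"
      show "norm (graded_step (?Z n) x) \<le> jet_norm N Rsmall (shifted (a n) x)"
        using norm_le_jet_norm[of Rsmall 0 N "shifted (a n) x"] Rsmall_pos shifted_0[OF d x] by simp
    qed (auto simp: wt_pos)
    also have "\<dots> \<le> r" using nrm_shifted_small[OF d na rN] r0 by simp
    finally have 1: "rn wt (\<lambda>x. norm (graded_step (?Z n) x)) \<le> r" .
    have "rn wt (\<lambda>x. norm (?Z (Suc n) x)) \<le> r" using rn_le_nrm[of "a (Suc n)"] d' b2 by (simp add: decomp_def)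
    with 1 show "rn wt (\<lambda>x. norm (?Z (Suc n) x) + norm (graded_step (?Z n) x)) \<le> ?L"
      using rn_add[of wt "\<lambda>x. norm (?Z (Suc n) x)" "\<lambda>x. norm (graded_step (?Z n) x)"] by simp
  qed
  let ?D = "CJ / (p * h) ^ nat K * (?L * ?E)"
  have drift: "\<bar>total_action (?Z n) - total_action (?Z 0)\<bar> \<le> real n * ?D" if "\<And>m. m < n \<Longrightarrow> mode_norm wt (c m) \<le> \<kappa> * r" for n
    using that
  proof (induction n)
    case (Suc n)
    have b: "mode_norm wt (c n) \<le> \<kappa> * r" using Suc.prems by simp
    have "\<bar>total_action (?Z (Suc n)) - total_action (?Z n)\<bar> = \<bar>total_action (?Z (Suc n)) - total_action (graded_step (?Z n))\<bar>"
      by (simp only: total_action_graded_step)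
    also have "\<dots> \<le> CJ / (p * h) ^ nat K * (rn wt (\<lambda>x. norm (?Z (Suc n) x) + norm (graded_step (?Z n) x)) * rn (\<lambda>_. 1) (\<lambda>x. norm (?Z (Suc n) x - graded_step (?Z n) x)))"
      using total_action_diff[of "?Z (Suc n)" "graded_step (?Z n)"] by (simp add: mult.assoc)
    also have "\<dots> \<le> ?D" using stp[OF b] siz[OF b] CJ_pos ph_pos rn_nonneg r0 by (intro mult_left_mono mult_mono) auto
    finally have s: "\<bar>total_action (?Z (Suc n)) - total_action (?Z n)\<bar> \<le> ?D" .
    have "\<bar>total_action (?Z n) - total_action (?Z 0)\<bar> \<le> real n * ?D" by (rule Suc.IH) (use Suc.prems in simp)
    moreover have "real (Suc n) * ?D = real n * ?D + ?D" by (simp only: of_nat_Suc distrib_right mult_1 add.commute)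
    ultimately show ?case using s by linarith
  qed simp
  have bd: "mode_norm wt (c m) \<le> \<kappa> * r" if "m \<le> n" for m
    using that
  proof (induction m rule: less_induct)
    case (less m)
    show ?case
    proof (cases m)
      case 0
      have "mode_norm wt (c 0) \<le> \<kappa> * r" using init kr by linarith
      then show ?thesis using 0 by simp
    next
      case (Suc m')
      have prev: "mode_norm wt (c i) \<le> \<kappa> * r" if "i < m" for i using less that by simp
      have b0: "mode_norm wt (c 0) \<le> 2 * (\<kappa> * r)" and bm: "mode_norm wt (c m) \<le> 2 * (\<kappa> * r)"
      proof -
        show "mode_norm wt (c 0) \<le> 2 * (\<kappa> * r)" using init kr by linarith
        show "mode_norm wt (c m) \<le> 2 * (\<kappa> * r)" using next_bound[of m'] prev[of m'] Suc by simp
      qed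
      let ?y = "\<lambda>n. mode_norm wt (\<lambda>j. ?Z n (j, unit_index j))" and ?z = "\<lambda>n. rn wt (nonres (?Z n))"
      have z: "?z i \<le> 2 * \<kappa> * (\<kappa> * r)" if "mode_norm wt (c i) \<le> 2 * (\<kappa> * r)" for i
        using order_trans[OF Zb[OF that] mult_left_mono[OF that, of \<kappa>]] k0 by simp
      have CJz: "CJ * (?z i)\<^sup>2 \<le> (\<kappa> * r)\<^sup>2 / 32" if "mode_norm wt (c i) \<le> 2 * (\<kappa> * r)" for i
      proof -
        have "CJ * (?z i)\<^sup>2 \<le> CJ * (2 * \<kappa> * (\<kappa> * r))\<^sup>2" using z[OF that] rn_nonneg CJ_pos by (intro mult_left_mono power_mono) auto
        also have "\<dots> = (4 * CJ * \<kappa>\<^sup>2) * (\<kappa> * r)\<^sup>2" by (simp add: power2_eq_square)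
        also have "\<dots> \<le> (1 / 32) * (\<kappa> * r)\<^sup>2" using kC by (intro mult_right_mono) auto
        finally show ?thesis by simp
      qed
      have "real m * ?D \<le> (\<kappa> * r)\<^sup>2 / 16"
      proof -
        have "real m * \<tau> * step_err \<le> real n * \<tau> * step_err" using less.prems tau0 step_err_nonneg by (intro mult_right_mono) auto
        also note time
        finally have t: "real m * \<tau> * step_err \<le> \<kappa>\<^sup>2 * (p * h) ^ nat K / (64 * CJ)" .
        have "real m * ?D = 4 * CJ * r\<^sup>2 / (p * h) ^ nat K * (real m * \<tau> * step_err)" by (simp add: power2_eq_square mult_ac)
        also have "\<dots> \<le> 4 * CJ * r\<^sup>2 / (p * h) ^ nat K * (\<kappa>\<^sup>2 * (p * h) ^ nat K / (64 * CJ))"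
          using CJ_pos ph_pos by (intro mult_left_mono t) auto
        also have "\<dots> = (\<kappa> * r)\<^sup>2 / 16" using CJ_pos p0 h0 by (simp add: power_mult_distrib field_simps)
        finally show ?thesis .
      qed
      with drift[of m] prev have dr: "\<bar>total_action (?Z m) - total_action (?Z 0)\<bar> \<le> (\<kappa> * r)\<^sup>2 / 16" by fastforce
      have d0: "mode_norm wt (c 0) \<le> r / 2" and dm: "mode_norm wt (c m) \<le> r / 2" using b0 bm kr by linarith+
      have "?y 0 \<le> mode_norm wt (c 0) + ?z 0" using mode_norm_le_resonant(2)[OF D[OF d0]] .
      also have "\<dots> \<le> \<kappa> * r / 8 + \<kappa> * r / 8"
        using init z[OF b0] mult_right_mono[OF k1, of "\<kappa> * r"] kr by linarith
      finally have "(?y 0)\<^sup>2 \<le> (\<kappa> * r / 4)\<^sup>2" using mode_norm_nonneg by (intro power_mono) auto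
      then have y0: "(?y 0)\<^sup>2 \<le> (\<kappa> * r)\<^sup>2 / 16" by (simp add: power_divide)
      \<comment> \<open>In units of (\<kappa> r)^2: initial value 1/16, drift 1/16, and twice 1/32
        for the nonresonant parts, in total 3/16.\<close>
      have "(?y m)\<^sup>2 \<le> (\<kappa> * r)\<^sup>2 / 4"
        using total_action_resonant[of "?Z m"] total_action_resonant[of "?Z 0"] CJz[OF b0] CJz[OF bm] dr y0 by linarith
      then have "(?y m)\<^sup>2 \<le> (\<kappa> * r / 2)\<^sup>2" by (simp add: power_divide)
      then have ym: "?y m \<le> \<kappa> * r / 2" by (rule power2_le_imp_le) (use kr in simp)
      have "mode_norm wt (c m) \<le> ?y m + ?z m" using mode_norm_le_resonant(1)[OF D[OF dm]] .
      then show ?thesis using ym z[OF bm] mult_right_mono[OF k1, of "\<kappa> * r"] kr by linarith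
    qed
  qed
  show "mode_norm wt (c n) \<le> \<kappa> * r" by (rule bd) simp
  have drift1: "om 1 * \<bar>action 1 (?Z m) - action 1 (?Z 0)\<bar> \<le> real m * (C1 * (p * h) * (?L * ?E))" if "m \<le> n" for m
    using that
  proof (induction m)
    case (Suc m)
    have b: "mode_norm wt (c m) \<le> \<kappa> * r" using bd Suc.prems by simp
    have "om 1 * \<bar>action 1 (?Z (Suc m)) - action 1 (?Z m)\<bar> = om 1 * \<bar>action 1 (?Z (Suc m)) - action 1 (graded_step (?Z m))\<bar>"
      by (simp only: action_graded_step)
    also have "\<dots> \<le> C1 * (p * h) * (rn wt (\<lambda>x. norm (?Z (Suc m) x) + norm (graded_step (?Z m) x)) * rn (\<lambda>_. 1) (\<lambda>x. norm (?Z (Suc m) x - graded_step (?Z m) x)))"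
      using action_1_diff[of "?Z (Suc m)" "graded_step (?Z m)"] by (simp add: mult.assoc)
    also have "\<dots> \<le> C1 * (p * h) * (?L * ?E)" using stp[OF b] siz[OF b] C1_nonneg ph_pos rn_nonneg r0 by (intro mult_left_mono mult_mono) auto
    finally have 1: "om 1 * \<bar>action 1 (?Z (Suc m)) - action 1 (?Z m)\<bar> \<le> C1 * (p * h) * (?L * ?E)" .
    have "om 1 * \<bar>action 1 (?Z (Suc m)) - action 1 (?Z 0)\<bar> \<le> om 1 * (\<bar>action 1 (?Z (Suc m)) - action 1 (?Z m)\<bar> + \<bar>action 1 (?Z m) - action 1 (?Z 0)\<bar>)"
      using om_pos[of 1] by (intro mult_left_mono) auto
    also have "\<dots> = om 1 * \<bar>action 1 (?Z (Suc m)) - action 1 (?Z m)\<bar> + om 1 * \<bar>action 1 (?Z m) - action 1 (?Z 0)\<bar>"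
      by (rule distrib_left)
    also have "\<dots> \<le> C1 * (p * h) * (?L * ?E) + real m * (C1 * (p * h) * (?L * ?E))"
      by (rule add_mono[OF 1 Suc.IH]) (use Suc.prems in simp)
    also have "\<dots> = real (Suc m) * (C1 * (p * h) * (?L * ?E))" by (simp only: of_nat_Suc distrib_right mult_1)
    finally show ?case .
  qed simp
  have e: "\<bar>(\<Sum>j\<in>{1, -1}. (norm (c i j))\<^sup>2) - om 1 * action 1 (?Z i)\<bar> \<le> p ^ 4 * r\<^sup>2 * C2" if "i \<le> n" for i
  proof (rule mode_1_action)
    show "decomp (c i) (a i)" using bd[OF that] kr by (intro D) linarith
    show "mode_norm wt (c i) \<le> r / 8" using bd[OF that] kr by linarith
    have "rn wt (nonres (?Z i)) \<le> \<kappa> * (\<kappa> * r)" using Zb[of i] mult_left_mono[OF bd[OF that], of \<kappa>] bd[OF that] kr k0 by linarith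
    also have "\<dots> \<le> 1 * (\<kappa> * r)" using k1 kr by (intro mult_right_mono) auto
    finally show "rn wt (nonres (?Z i)) \<le> r / 8" using kr by linarith
  qed (use rN r0 in auto)
  have "om 1 * \<bar>action 1 (?Z n) - action 1 (?Z 0)\<bar> = \<bar>om 1 * action 1 (?Z n) - om 1 * action 1 (?Z 0)\<bar>"
    using om_pos[of 1] by (simp add: abs_mult right_diff_distrib[symmetric])
  then have "\<bar>(\<Sum>j\<in>{1, -1}. (norm (c n j))\<^sup>2) - (\<Sum>j\<in>{1, -1}. (norm (c 0 j))\<^sup>2)\<bar> \<le> 2 * (p ^ 4 * r\<^sup>2 * C2) + real n * (C1 * (p * h) * (?L * ?E))"
    using e[OF order_refl] e[OF le0] drift1[OF order_refl] by linarith
  then show "\<bar>(\<Sum>j\<in>{1, -1}. (norm (c n j))\<^sup>2) - (\<Sum>j\<in>{1, -1}. (norm (c 0 j))\<^sup>2)\<bar> \<le>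
      2 * (p ^ 4 * r\<^sup>2 * C2) + 4 * C1 * (p * h) * r\<^sup>2 * (real n * \<tau> * step_err)"
    by (simp add: power2_eq_square mult_ac)
qed

end

subsection \<open>The trigonometric integrator as a kicked rotation\<close>

lemma cyclic_conv_alt:
  assumes "M > 0"
  shows "cyclic_conv M f g j = (\<Sum>i\<in>modes M. f i * g (mode_rep M (j - i)))"
proof -
  have iff: "[i1 + i2 = j] (mod 2 * M) \<longleftrightarrow> i2 = mode_rep M (j - i1)" if "i2 \<in> modes M" for i1 i2
  proof -
    have "i2 = mode_rep M (j - i1) \<longleftrightarrow> mode_rep M i2 = mode_rep M (j - i1)" using that by (simp add: mode_rep_id)
    also have "\<dots> \<longleftrightarrow> [i2 = j - i1] (mod 2 * M)" by (rule mode_rep_eq_iff)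
    also have "\<dots> \<longleftrightarrow> [i1 + i2 = i1 + (j - i1)] (mod 2 * M)" by (rule cong_add_lcancel[symmetric])
    finally show ?thesis by simp
  qed
  have "{(j1, j2) \<in> modes M \<times> modes M. [j1 + j2 = j] (mod 2 * M)} = (\<lambda>i. (i, mode_rep M (j - i))) ` modes M"
    using iff mode_rep_in[OF assms] by (auto simp: image_iff)
  then show ?thesis unfolding cyclic_conv_def by (simp add: sum.reindex inj_on_def)
qed

context modulation
begin

text \<open>As \<psi> = sinc \<phi>, the nonlinearity of the integrator is sinc(\<tau> \<omega>_j)
  times this sum. The outer filter is then the same as the inner ones, which makes the kick the
  gradient of a cubic potential.\<close>

definition kick :: "(int \<Rightarrow> complex) \<Rightarrow> int \<Rightarrow> complex" where
  "kick u j = of_real (fl j) * (\<Sum>i\<in>modes M. (of_real (fl i) * u i) * (of_real (fl (mode_rep M (j - i))) * u (mode_rep M (j - i))))"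

definition real_state :: "(int \<Rightarrow> complex) \<Rightarrow> bool" where
  "real_state u \<longleftrightarrow> (\<forall>j\<in>modes M. u (mode_rep M (- j)) = cnj (u j))"

lemma kick_real:
  assumes "real_state u" shows "real_state (kick u)"
  unfolding real_state_def
proof
  fix j assume j: "j \<in> modes M"
  let ?F = "\<lambda>j i. (of_real (fl i) * u i) * (of_real (fl (mode_rep M (j - i))) * u (mode_rep M (j - i)))"
  let ?n = "mode_rep M (- j)"
  have r: "of_real (fl (mode_rep M (- i))) * u (mode_rep M (- i)) = cnj (of_real (fl i) * u i)" if "i \<in> modes M" for i
    using assms that fl_sym[OF that] by (simp add: real_state_def)
  have "(\<Sum>i\<in>modes M. ?F ?n i) = (\<Sum>i\<in>modes M. ?F ?n (mode_rep M (- i)))"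
    by (rule sum.reindex_bij_betw[OF bij_mode_rep_uminus[OF M0], symmetric])
  also have "\<dots> = (\<Sum>i\<in>modes M. cnj (?F j i))"
  proof (intro sum.cong refl)
    fix i assume i: "i \<in> modes M"
    have "mode_rep M (?n - mode_rep M (- i)) = mode_rep M (- mode_rep M (j - i))" by (simp add: mode_rep_simps algebra_simps)
    then show "?F ?n (mode_rep M (- i)) = cnj (?F j i)"
      using r[OF i] r[OF mode_rep_in[OF M0], of "j - i"] by simp
  qed
  finally show "kick u ?n = cnj (kick u j)" using fl_sym[OF j] by (simp add: kick_def cnj_sum)
qed

lemma force_kick:
  assumes "\<And>i. i \<in> modes M \<Longrightarrow> c i + cnj (c (mode_rep M (- i))) = of_real (2 * om i) * u i"
  shows "force c j = - \<i> * kick u j"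
proof -
  have q: "of_real (fl i / (2 * om i)) * (c i + cnj (c (mode_rep M (- i)))) = of_real (fl i) * u i" if "i \<in> modes M" for i
    using assms[OF that] om_pos[of i] by simp
  then show ?thesis unfolding force_def kick_def using mode_rep_in[OF M0]
    by (simp add: mult.assoc)
qed

text \<open>For the label (j, -<j>) the divisor is cis (-2 \<tau> \<omega>_j) - 1, and the
  non-resonance condition keeps it away from 0.\<close>

lemma sin_nonzero: 
  assumes j: "j \<in> modes M" shows "sin (\<tau> * om j) \<noteq> 0"
proof
  assume s: "sin (\<tau> * om j) = 0"
  let ?x = "(j, - unit_index j)"
  have u: "\<bar>(- unit_index j) l\<bar> = unit_index j l" for l by (simp add: unit_index_def)
  have act: "?x \<in> active" using cost_unit[of "- unit_index j", OF u j] profile_le[of j] K3 unit_multi[OF j] j by (auto simp: active_def multi_indices_def)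
  have nr: "\<not> resonant ?x"
  proof
    assume "resonant ?x"
    then have "(- unit_index j) \<bar>j\<bar> = unit_index j \<bar>j\<bar>" by (simp add: resonant_def)
    then show False by (simp add: unit_index_def)
  qed
  have "(j, unit_index j) \<in> active" by (rule active_unit[OF j])
  then have "phase (j, unit_index j) = rot j" using phase_resonant[of "(j, unit_index j)"] by (simp add: resonant_def)
  moreover have "phase ?x = cnj (phase (j, unit_index j))"
    by (simp add: phase_def dot_omega_def sum_negf cis_cnj)
  ultimately have "cnj (rot j) = rot j * (divisor ?x + 1)" using phase_rot[of ?x] by simp
  moreover have "cnj (rot j) = rot j" using s by (simp add: rot_def complex_eq_iff)
  moreover have "rot j \<noteq> 0" by (simp add: rot_def)
  ultimately have "divisor ?x = 0" by (metis add_right_cancel add_0 mult_cancel_left mult.right_neutral)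
  then show False using divisor_nz[OF act nr] by simp
qed

text \<open>Sum and difference of the two-step recursion and the velocity equation give one-step
  relations with half a kick at either end. The starting formula is the first relation at n =
  0.\<close>

lemma integrator_step_u:
  assumes flt: "\<And>j. fl j = \<phi> (\<tau> * om j)" and psi: "\<And>x. \<psi> x = sinc x * \<phi> x"
    and ti: "trig_integrator \<rho> \<phi> \<psi> M \<tau> u v" and j: "j \<in> modes M"
  shows "u (Suc n) j = of_real (cos (\<tau> * om j)) * u n j + of_real (\<tau> * sinc (\<tau> * om j)) * (v n j + of_real (\<tau> / 2) * kick (u n) j)"
    and "of_real (\<tau> * sinc (\<tau> * om j)) * (v (Suc n) j - of_real (\<tau> / 2) * kick (u (Suc n)) j) = of_real (cos (\<tau> * om j)) * u (Suc n) j - u n j"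
proof -
  have nl: "nonlinearity \<rho> \<phi> \<psi> M \<tau> u j = of_real (sinc (\<tau> * om j)) * kick u j" for u
    unfolding nonlinearity_def kick_def cyclic_conv_alt[OF M0] psi flt by (simp add: mult.assoc)
  let ?c = "complex_of_real (cos (\<tau> * om j))" and ?s = "complex_of_real (sinc (\<tau> * om j))" and ?t = "complex_of_real \<tau>"
  have two: "u (Suc (Suc n)) j - 2 * ?c * u (Suc n) j + u n j = ?t\<^sup>2 * ?s * kick (u (Suc n)) j" for n
  proof -
    have A: "\<forall>n\<ge>1. \<forall>j\<in>modes M. u (n + 1) j - of_real (2 * cos (\<tau> * om j)) * u n j + u (n - 1) j = of_real (\<tau>\<^sup>2) * nonlinearity \<rho> \<phi> \<psi> M \<tau> (u n) j"
      using ti unfolding trig_integrator_def by blast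
    then have "u (Suc n + 1) j - of_real (2 * cos (\<tau> * om j)) * u (Suc n) j + u (Suc n - 1) j = of_real (\<tau>\<^sup>2) * nonlinearity \<rho> \<phi> \<psi> M \<tau> (u (Suc n)) j"
      by (intro spec[OF A, of "Suc n", THEN mp, THEN bspec] j) simp
    moreover have "\<tau> \<noteq> 0" "om j \<noteq> 0" using tau0 om_pos[of j] by auto
    ultimately show ?thesis unfolding nl by (simp add: mult.assoc)
  qed
  have vel: "2 * ?t * ?s * v (Suc n) j = u (Suc (Suc n)) j - u n j" for n
  proof -
    have A: "\<forall>n\<ge>1. \<forall>j\<in>modes M. of_real (2 * \<tau> * sinc (\<tau> * om j)) * v n j = u (n + 1) j - u (n - 1) j"
      using ti unfolding trig_integrator_def by blast
    then have "of_real (2 * \<tau> * sinc (\<tau> * om j)) * v (Suc n) j = u (Suc n + 1) j - u (Suc n - 1) j"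
      by (intro spec[OF A, of "Suc n", THEN mp, THEN bspec] j) simp
    then show ?thesis by simp
  qed
  show "u (Suc n) j = ?c * u n j + of_real (\<tau> * sinc (\<tau> * om j)) * (v n j + of_real (\<tau> / 2) * kick (u n) j)"
  proof (cases n)
    case 0
    have "u 1 j = ?c * u 0 j + of_real (\<tau> * sinc (\<tau> * om j)) * v 0 j + of_real (\<tau>\<^sup>2 / 2) * nonlinearity \<rho> \<phi> \<psi> M \<tau> (u 0) j"
      using ti j unfolding trig_integrator_def by blast
    then show ?thesis using 0 by (simp add: nl power2_eq_square algebra_simps)
  next
    case (Suc m)
    have "2 * u (Suc n) j = (u (Suc (Suc m)) j - 2 * ?c * u (Suc m) j + u m j) + 2 * ?c * u (Suc m) j + (u (Suc (Suc m)) j - u m j)"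
      by (simp add: Suc)
    also have "\<dots> = 2 * (?c * u n j + of_real (\<tau> * sinc (\<tau> * om j)) * (v n j + of_real (\<tau> / 2) * kick (u n) j))"
      unfolding two vel[symmetric] by (simp add: Suc power2_eq_square algebra_simps)
    finally show ?thesis by (rule iffD1[OF mult_left_cancel, rotated]) simp
  qed
  have "2 * (of_real (\<tau> * sinc (\<tau> * om j)) * (v (Suc n) j - of_real (\<tau> / 2) * kick (u (Suc n)) j)) =
     2 * ?t * ?s * v (Suc n) j - ?t\<^sup>2 * ?s * kick (u (Suc n)) j" by (simp add: power2_eq_square algebra_simps)
  also have "\<dots> = 2 * (?c * u (Suc n) j - u n j)" unfolding vel two[symmetric] by (simp add: algebra_simps)
  finally show "of_real (\<tau> * sinc (\<tau> * om j)) * (v (Suc n) j - of_real (\<tau> / 2) * kick (u (Suc n)) j) = ?c * u (Suc n) j - u n j"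
    by (rule iffD1[OF mult_left_cancel, rotated]) simp
qed

text \<open>The first relation multiplied by \<omega>_j is the first row of a rotation. The second
  row follows from cos^2 + sin^2 = 1 after division by sin(\<tau> \<omega>_j).\<close>

lemma integrator_rotation:
  assumes flt: "\<And>j. fl j = \<phi> (\<tau> * om j)" and psi: "\<And>x. \<psi> x = sinc x * \<phi> x"
    and ti: "trig_integrator \<rho> \<phi> \<psi> M \<tau> u v" and j: "j \<in> modes M"
  shows "of_real (om j) * u (Suc n) j = of_real (cos (\<tau> * om j)) * (of_real (om j) * u n j) + of_real (sin (\<tau> * om j)) * (v n j + of_real (\<tau> / 2) * kick (u n) j)"
    and "v (Suc n) j - of_real (\<tau> / 2) * kick (u (Suc n)) j = - (of_real (sin (\<tau> * om j)) * (of_real (om j) * u n j)) + of_real (cos (\<tau> * om j)) * (v n j + of_real (\<tau> / 2) * kick (u n) j)"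
proof -
  note st = integrator_step_u[OF flt psi ti j, of n]
  let ?c = "complex_of_real (cos (\<tau> * om j))" and ?s = "complex_of_real (sin (\<tau> * om j))" and ?o = "complex_of_real (om j)"
  let ?w = "v n j + of_real (\<tau> / 2) * kick (u n) j" and ?w' = "v (Suc n) j - of_real (\<tau> / 2) * kick (u (Suc n)) j"
  have o: "?o \<noteq> 0" and s: "?s \<noteq> 0" using om_pos[of j] sin_nonzero[OF j] by auto
  have sc: "of_real (\<tau> * sinc (\<tau> * om j)) = ?s / ?o" using om_pos[of j] tau0 by simp
  have cs: "?c * ?c + ?s * ?s = 1" by (metis of_real_1 of_real_add of_real_mult sin_cos_squared_add2 power2_eq_square add.commute sin_cos_squared_add)
  show 1: "?o * u (Suc n) j = ?c * (?o * u n j) + ?s * ?w"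
    using st(1) o unfolding sc by (simp add: field_simps)
  have "?s * ?w' = ?o * (?s / ?o * ?w')" using o by simp
  also have "?s / ?o * ?w' = ?c * u (Suc n) j - u n j" using st(2) unfolding sc .
  also have "?o * (?c * u (Suc n) j - u n j) = ?c * (?o * u (Suc n) j) - ?o * u n j" by (simp add: algebra_simps)
  also have "\<dots> = ?c * (?c * (?o * u n j) + ?s * ?w) - (?c * ?c + ?s * ?s) * (?o * u n j)" unfolding 1 cs by simp
  also have "\<dots> = ?s * (- (?s * (?o * u n j)) + ?c * ?w)" by (simp add: algebra_simps)
  finally show "?w' = - (?s * (?o * u n j)) + ?c * ?w" using s by simp
qed

definition state :: "(int \<Rightarrow> complex) \<Rightarrow> (int \<Rightarrow> complex) \<Rightarrow> int \<Rightarrow> complex" where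
  "state u v j = of_real (om j) * u j - \<i> * v j"

lemma state_sym:
  assumes "real_state u" "real_state v" "j \<in> modes M"
  shows "state u v j + cnj (state u v (mode_rep M (- j))) = of_real (2 * om j) * u j"
    and "cnj (state u v (mode_rep M (- j))) = of_real (om j) * u j + \<i> * v j"
  using assms om_sym[OF assms(3)] by (simp_all add: state_def real_state_def)

text \<open>The momentum is recorded before the half kick that completes the time step.\<close>

lemma integrator_flow:
  assumes flt: "\<And>j. fl j = \<phi> (\<tau> * om j)" and psi: "\<And>x. \<psi> x = sinc x * \<phi> x"
    and ti: "trig_integrator \<rho> \<phi> \<psi> M \<tau> u v"
    and ru: "real_state (u 0)" and rv: "real_state (v 0)"
  obtains c where "\<And>n. c (Suc n) = flow_step (c n)"
    and "\<And>n j. j \<in> modes M \<Longrightarrow> state (u n) (v n) j = c n j + of_real (\<tau> / 2) * force (c n) j"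
    and "\<And>n. real_state (u n)" and "\<And>n. real_state (v n)"
    and "c 0 = (\<lambda>j. state (u 0) (v 0) j - of_real (\<tau> / 2) * force (state (u 0) (v 0)) j)"
proof -
  define c where "c = (\<lambda>n. (flow_step ^^ n) (\<lambda>j. state (u 0) (v 0) j - of_real (\<tau> / 2) * force (state (u 0) (v 0)) j))"
  have seq: "c (Suc n) = flow_step (c n)" for n by (simp add: c_def)
  \<comment> \<open>Adding i \<beta> \<open>kick\<close> with real \<beta> changes the momentum but
    not c_j + cnj c_(-j), so the force is the same before, halfway through and after a kick.\<close>
  have fk: "force f j = - \<i> * kick (u n) j"
    if f: "\<And>j. j \<in> modes M \<Longrightarrow> f j = state (u n) (v n) j + \<i> * of_real \<beta> * kick (u n) j"
    and r: "real_state (u n)" "real_state (v n)" for f :: "int \<Rightarrow> complex" and \<beta> n j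
  proof (rule force_kick)
    fix i assume i: "i \<in> modes M"
    show "f i + cnj (f (mode_rep M (- i))) = of_real (2 * om i) * u n i"
      using state_sym(1)[OF r i] kick_real[OF r(1)] i f[OF i] f[OF mode_rep_in[OF M0], of "- i"]
      by (simp add: real_state_def algebra_simps)
  qed
  have inv: "(\<forall>j\<in>modes M. c n j = state (u n) (v n) j + \<i> * of_real (\<tau> / 2) * kick (u n) j) \<and> real_state (u n) \<and> real_state (v n)" for n
  proof (induction n)
    case 0
    have "force (state (u 0) (v 0)) j = - \<i> * kick (u 0) j" for j
      by (rule fk[of _ 0 0]) (simp_all add: ru rv)
    then show ?case using ru rv by (simp add: c_def)
  next
    case (Suc n)
    note rn = Suc.IH[THEN conjunct2]
    have f: "force (c n) j = - \<i> * kick (u n) j" for j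
      using Suc.IH by (intro fk[of _ n "\<tau> / 2"]) auto
    note rot = integrator_rotation[OF flt psi ti, where n = n]
    have kr: "real_state (kick (u n))" using kick_real rn by blast
    have "real_state (u (Suc n))"
      unfolding real_state_def
    proof
      fix j assume j: "j \<in> modes M"
      let ?n = "mode_rep M (- j)"
      have nm: "?n \<in> modes M" by (rule mode_rep_in[OF M0])
      have "of_real (om j) * u (Suc n) ?n = of_real (om j) * cnj (u (Suc n) j)"
        using arg_cong[OF rot(1)[OF j], of cnj] rot(1)[OF nm] rn kr j by (simp add: real_state_def om_sym)
      then show "u (Suc n) ?n = cnj (u (Suc n) j)" using om_pos[of j] by simp
    qed
    note ru' = this
    have "real_state (v (Suc n))"
      unfolding real_state_def
    proof
      fix j assume j: "j \<in> modes M"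
      let ?n = "mode_rep M (- j)"
      have nm: "?n \<in> modes M" by (rule mode_rep_in[OF M0])
      have "v (Suc n) ?n - of_real (\<tau> / 2) * kick (u (Suc n)) ?n = cnj (v (Suc n) j - of_real (\<tau> / 2) * kick (u (Suc n)) j)"
        unfolding rot(2)[OF j] rot(2)[OF nm] using rn kr j by (simp add: real_state_def om_sym)
      then show "v (Suc n) ?n = cnj (v (Suc n) j)" using kick_real[OF ru'] j by (simp add: real_state_def)
    qed
    moreover have "c (Suc n) j = state (u (Suc n)) (v (Suc n)) j + \<i> * of_real (\<tau> / 2) * kick (u (Suc n)) j" if j: "j \<in> modes M" for j
    proof -
      let ?w = "v n j + of_real (\<tau> / 2) * kick (u n) j" and ?q = "of_real (om j) * u n j"
      have "c (Suc n) j = rot j * (c n j + of_real \<tau> * (- \<i> * kick (u n) j))" by (simp add: seq flow_step_def f)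
      also have "c n j + of_real \<tau> * (- \<i> * kick (u n) j) = ?q - \<i> * ?w"
        using Suc.IH j by (simp add: state_def algebra_simps)
      also have "rot j * (?q - \<i> * ?w) = (of_real (cos (\<tau> * om j)) + \<i> * of_real (sin (\<tau> * om j))) * (?q - \<i> * ?w)"
        by (simp add: rot_def complex_eq_iff)
      also have "\<dots> = (of_real (cos (\<tau> * om j)) * ?q + of_real (sin (\<tau> * om j)) * ?w)
         - \<i> * (- (of_real (sin (\<tau> * om j)) * ?q) + of_real (cos (\<tau> * om j)) * ?w)"
        by (simp add: algebra_simps)
      also have "\<dots> = of_real (om j) * u (Suc n) j - \<i> * (v (Suc n) j - of_real (\<tau> / 2) * kick (u (Suc n)) j)"
        unfolding rot[OF j] ..
      finally show ?thesis by (simp add: state_def algebra_simps)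
    qed
    ultimately show ?case using ru' by simp
  qed
  show thesis
  proof (rule that[of c])
    fix n j assume j: "j \<in> modes M"
    have "force (c n) j = - \<i> * kick (u n) j" using inv[of n] by (intro fk[of _ n "\<tau> / 2"]) auto
    then show "state (u n) (v n) j = c n j + of_real (\<tau> / 2) * force (c n) j" using inv[of n] j by simp
  qed (use inv seq in \<open>auto simp: c_def\<close>)
qed

text \<open>The parallelogram law for \<omega> u - i v and \<omega> u + i v, which by reality is the
  conjugate state of the opposite mode.\<close>

lemma mode_energy_state:
  assumes "real_state u" "real_state v"
  shows "mode_energy \<rho> M u v l = ((norm (state u v (mode_rep M l)))\<^sup>2 + (norm (state u v (mode_rep M (- l))))\<^sup>2) / 4"
proof -
  let ?m = "mode_rep M l"
  have m: "?m \<in> modes M" by (rule mode_rep_in[OF M0])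
  have n: "mode_rep M (- l) = mode_rep M (- ?m)" by (simp add: mode_rep_simps)
  have "norm (state u v (mode_rep M (- l))) = norm (of_real (om ?m) * u ?m + \<i> * v ?m)"
    unfolding n state_sym(2)[OF assms m, symmetric] by simp
  then have "(norm (state u v ?m))\<^sup>2 + (norm (state u v (mode_rep M (- l))))\<^sup>2 = 2 * ((norm (of_real (om ?m) * u ?m))\<^sup>2 + (norm (v ?m))\<^sup>2)"
    by (simp add: state_def) (simp only: cmod_power2, simp add: power2_eq_square algebra_simps)
  then show ?thesis by (simp add: mode_energy_def)
qed

lemma mode_norm_add_scaled:
  "mode_norm wt (\<lambda>j. f j + of_real t * g j) \<le> mode_norm wt f + \<bar>t\<bar> * mode_norm wt g"
proof -
  have "mode_norm wt (\<lambda>j. f j + of_real t * g j) \<le> L2_set (\<lambda>j. sg j * (norm (f j) / wt (j, unit_index j)) + \<bar>t\<bar> * (sg j * (norm (g j) / wt (j, unit_index j)))) (modes M)"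
    unfolding mode_norm_def
  proof (rule L2_set_mono)
    fix j
    have "norm (f j + of_real t * g j) \<le> norm (f j) + \<bar>t\<bar> * norm (g j)"
      using norm_triangle_ineq[of "f j" "of_real t * g j"] by (simp add: norm_mult)
    then have "sg j * (norm (f j + of_real t * g j) / wt (j, unit_index j)) \<le> sg j * ((norm (f j) + \<bar>t\<bar> * norm (g j)) / wt (j, unit_index j))"
      using sg_pos[of j] wt_pos[of "(j, unit_index j)"] by (intro mult_left_mono divide_right_mono) auto
    then show "sg j * (norm (f j + of_real t * g j) / wt (j, unit_index j)) \<le> sg j * (norm (f j) / wt (j, unit_index j)) + \<bar>t\<bar> * (sg j * (norm (g j) / wt (j, unit_index j)))"
      by (simp add: add_divide_distrib distrib_left mult_ac)
    show "0 \<le> sg j * (norm (f j + of_real t * g j) / wt (j, unit_index j))" using sg_pos[of j] wt_pos[of "(j, unit_index j)"] by simp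
  qed
  also have "\<dots> \<le> mode_norm wt f + L2_set (\<lambda>j. \<bar>t\<bar> * (sg j * (norm (g j) / wt (j, unit_index j)))) (modes M)"
    unfolding mode_norm_def by (rule L2_set_triangle_ineq)
  also have "L2_set (\<lambda>j. \<bar>t\<bar> * (sg j * (norm (g j) / wt (j, unit_index j)))) (modes M) = \<bar>t\<bar> * mode_norm wt g"
    unfolding mode_norm_def by (intro L2_set_right_distrib[symmetric]) simp
  finally show ?thesis .
qed

text \<open>Because \<tau> \<gamma> \<le> 1, half a kick is no larger than the state, so values at
  grid points and between kicks are comparable.\<close>

lemma half_kick_bound:
  assumes r: "16 * hconst 0 * r \<le> \<gamma>" and c: "mode_norm wt c \<le> q" and q: "0 \<le> q" "q \<le> r" and t: "\<bar>t\<bar> = \<tau> / 2"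
  shows "mode_norm wt (\<lambda>j. c j + of_real t * force c j) \<le> 2 * q"
proof -
  have "\<bar>t\<bar> * mode_norm wt (force c) \<le> \<tau> / 2 * (hconst 0 * (mode_norm wt c)\<^sup>2)"
    unfolding t using tau0 by (intro mult_left_mono force_bound) auto
  also have "\<dots> \<le> \<tau> / 2 * (hconst 0 * (r * q))"
    unfolding power2_eq_square using tau0 hconst_nonneg c q mode_norm_nonneg by (intro mult_left_mono mult_mono) auto
  also have "\<dots> = \<tau> * (hconst 0 * r) * (q / 2)" by simp
  also have "\<dots> \<le> \<tau> * \<gamma> * (q / 2)" using r q tau0 gam0 hconst_nonneg[of 0] mult_nonneg_nonneg[of "hconst 0" r]
    by (intro mult_right_mono mult_left_mono) auto
  also have "\<dots> \<le> 1 * (q / 2)" using tau_gam q by (intro mult_right_mono) auto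
  finally show ?thesis using mode_norm_add_scaled[of c t "force c"] c q by linarith
qed

lemma abs_mode_rep_half:
  assumes "l \<in> {0..M}" shows "\<bar>mode_rep M l\<bar> = l" "\<bar>mode_rep M (- l)\<bar> = l"
proof -
  have m: "- l \<in> modes M" using assms M0 by (auto simp: modes_def)
  then show "\<bar>mode_rep M (- l)\<bar> = l" using assms by (simp add: mode_rep_id)
  then show "\<bar>mode_rep M l\<bar> = l" using abs_mode_rep_minus[OF M0, of l] by simp
qed

text \<open>The representatives of l and of -l are summed separately, since they coincide for l = 0
  and l = M. Each sum is at most the full one, whence 2/4.\<close>

lemma weighted_energy_bound:
  assumes "real_state u" "real_state v"
  shows "(\<Sum>l=0..M. sobolev_weight s l / (level_weight l)\<^sup>2 * mode_energy \<rho> M u v l) \<le> (mode_norm wt (state u v))\<^sup>2 / 2"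
proof -
  define g where "g = (\<lambda>j. sobolev_weight s j / (level_weight j)\<^sup>2 * (norm (state u v j))\<^sup>2)"
  have g0: "g j \<ge> 0" for j using sobolev_weight_nonneg by (simp add: g_def)
  have w: "sobolev_weight s i / (level_weight i)\<^sup>2 = sobolev_weight s j / (level_weight j)\<^sup>2" if "\<bar>i\<bar> = j" for i j
  proof -
    have "\<bar>j\<bar> = j" using that by simp
    then show ?thesis unfolding sobolev_weight_def level_weight_def using profile_abs[of i] that by simp
  qed
  have S: "(mode_norm wt (state u v))\<^sup>2 = (\<Sum>j\<in>modes M. g j)"
    unfolding mode_norm_def L2_set_def
    by (subst real_sqrt_pow2) (auto intro!: sum_nonneg sum.cong simp: g_def sobolev_weight_nonneg wt_unit_level power_mult_distrib power_divide sobolev_root_sq)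
  have half: "(\<Sum>l=0..M. g (f l)) \<le> (\<Sum>j\<in>modes M. g j)"
    if f: "\<And>l. l \<in> {0..M} \<Longrightarrow> \<bar>f l\<bar> = l" and fm: "\<And>l. f l \<in> modes M" for f
  proof -
    have "inj_on f {0..M}" by (rule inj_onI) (metis f)
    then have "(\<Sum>l=0..M. g (f l)) = (\<Sum>j\<in>f ` {0..M}. g j)" by (simp add: sum.reindex)
    also have "\<dots> \<le> (\<Sum>j\<in>modes M. g j)" using fm g0 by (intro sum_mono2) auto
    finally show ?thesis .
  qed
  have "(\<Sum>l=0..M. sobolev_weight s l / (level_weight l)\<^sup>2 * mode_energy \<rho> M u v l) = (\<Sum>l=0..M. (g (mode_rep M l) + g (mode_rep M (- l))) / 4)"
  proof (intro sum.cong refl)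
    fix l assume l: "l \<in> {0..M}"
    show "sobolev_weight s l / (level_weight l)\<^sup>2 * mode_energy \<rho> M u v l = (g (mode_rep M l) + g (mode_rep M (- l))) / 4"
      unfolding mode_energy_state[OF assms] g_def w[OF abs_mode_rep_half(1)[OF l]] w[OF abs_mode_rep_half(2)[OF l]] by (simp add: distrib_left)
  qed
  also have "\<dots> = ((\<Sum>l=0..M. g (mode_rep M l)) + (\<Sum>l=0..M. g (mode_rep M (- l)))) / 4"
    by (simp add: sum.distrib sum_divide_distrib add_divide_distrib)
  also have "\<dots> \<le> ((\<Sum>j\<in>modes M. g j) + (\<Sum>j\<in>modes M. g j)) / 4"
    by (intro divide_right_mono add_mono half abs_mode_rep_half mode_rep_in M0) auto
  finally show ?thesis unfolding S by simp
qed

definition C3 :: real where "C3 = 2 / \<gamma> * (b * (b / sqrt \<rho>)\<^sup>2)"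

text \<open>The amplitude of the mode is of size p h and the force on it of size (p h)^3, so the
  half kick changes the energy only at fourth order.\<close>

lemma mode_1_half_kick:
  assumes j: "j \<in> {1, -1}" and r: "16 * hconst 0 * r \<le> \<gamma>" and c: "mode_norm wt c \<le> q" and q: "0 \<le> q" "q \<le> r" "q \<le> 1 / 2"
  shows "\<bar>(norm (c j + of_real (\<tau> / 2) * force c j))\<^sup>2 - (norm (c j))\<^sup>2\<bar> \<le> C3 * p ^ 4"
proof -
  let ?a = "\<lambda>j. c j + of_real (\<tau> / 2) * force c j" and ?B = "b * (b / sqrt \<rho>)\<^sup>2"
  have B0: "?B \<ge> 0" using b0 by simp
  have a1: "norm (?a j) \<le> p * h * 1" "norm (c j) \<le> p * h * 1"
  proof -
    have "mode_norm wt ?a \<le> 1" using half_kick_bound[OF r c q(1,2), of "\<tau> / 2"] tau0 q by simp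
    then have "p * h * mode_norm wt ?a \<le> p * h * 1" using ph_pos by (intro mult_left_mono) auto
    then show "norm (?a j) \<le> p * h * 1" using mode_1_norm_le[OF j, of ?a] by linarith
    have "p * h * mode_norm wt c \<le> p * h * 1" using ph_pos c q by (intro mult_left_mono) auto
    then show "norm (c j) \<le> p * h * 1" using mode_1_norm_le[OF j, of c] by linarith
  qed
  have "norm (?a j - c j) = \<tau> / 2 * norm (force c j)" using tau0 by (simp add: norm_mult)
  also have "\<dots> \<le> 1 / \<gamma> * (?B * (p * h) ^ 3 * 1)"
  proof (intro mult_mono)
    have "norm (force c j) \<le> ?B * (p * h) ^ 3 * (mode_norm wt c)\<^sup>2" by (rule force_bound_mode_1[OF j])
    also have "\<dots> \<le> ?B * (p * h) ^ 3 * 1" using c q mode_norm_nonneg B0 ph_pos by (intro mult_left_mono power_le_one) auto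
    finally show "norm (force c j) \<le> ?B * (p * h) ^ 3 * 1" .
    have "\<tau> / 2 \<le> \<tau>" using tau0 by simp
    then show "\<tau> / 2 \<le> 1 / \<gamma>" using tau_le_gam by linarith
  qed (use gam0 in auto)
  finally have df: "norm (?a j - c j) \<le> 1 / \<gamma> * (?B * (p * h) ^ 3 * 1)" .
  have "\<bar>(norm (?a j))\<^sup>2 - (norm (c j))\<^sup>2\<bar> \<le> (norm (?a j) + norm (c j)) * norm (?a j - c j)" by (rule square_diff_bound)
  also have "\<dots> \<le> (p * h * 1 + p * h * 1) * (1 / \<gamma> * (?B * (p * h) ^ 3 * 1))"
  proof (rule mult_mono[OF add_mono[OF a1] df])
    show "0 \<le> p * h * 1 + p * h * 1" using ph_pos by linarith
  qed simp
  also have "\<dots> = C3 * (p * h) ^ 4" by (simp add: C3_def power3_eq_cube power4_eq_xxxx)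
  also have "\<dots> \<le> C3 * p ^ 4"
    using p0 h0 h1 B0 gam0 by (intro mult_left_mono power_mono) (auto simp: C3_def)
  finally show ?thesis .
qed

definition C4 :: "real \<Rightarrow> real" where "C4 r = C3 + r\<^sup>2 * C2 / 2 + C1 * r\<^sup>2"

lemma energy_bounds:
  assumes flt: "\<And>j. fl j = \<phi> (\<tau> * om j)" and psi: "\<And>x. \<psi> x = sinc x * \<phi> x"
    and ti: "trig_integrator \<rho> \<phi> \<psi> M \<tau> u v"
    and ru: "real_coeffs M (u 0)" and rv: "real_coeffs M (v 0)"
    and r0: "r > 0" and r1: "r \<le> 1" and r: "16 * hconst (Suc N) * r \<le> \<gamma>"
    and k0: "\<kappa> > 0" and k1: "\<kappa> \<le> 1/16" and kC: "128 * CJ * \<kappa>\<^sup>2 \<le> 1" and kp: "2 * p\<^sup>2 \<le> \<kappa> * (\<gamma> * h)"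
    and init1: "mode_energy \<rho> M (u 0) (v 0) 1 \<le> (\<kappa> * r / 64 * (p * h))\<^sup>2"
    and init0: "\<And>j. j \<in> modes M \<Longrightarrow> \<bar>j\<bar> \<noteq> 1 \<Longrightarrow> mode_energy \<rho> M (u 0) (v 0) j = 0"
    and time: "real n * \<tau> * step_err \<le> \<kappa>\<^sup>2 * (p * h) ^ nat K / (64 * CJ)"
  shows "(\<Sum>l=0..M. sobolev_weight s l / (level_weight l)\<^sup>2 * mode_energy \<rho> M (u n) (v n) l) \<le> 1"
    and "\<bar>mode_energy \<rho> M (u n) (v n) 1 - mode_energy \<rho> M (u 0) (v 0) 1\<bar> \<le> C4 r * p ^ 4"
proof -
  have r0': "16 * hconst 0 * r \<le> \<gamma>"
  proof -
    have "hconst 0 * r \<le> hconst (Suc N) * r" using r0 by (intro mult_right_mono hconst_mono) auto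
    then show ?thesis using r by linarith
  qed
  have "real_state (u 0)" "real_state (v 0)" using ru rv by (simp_all add: real_coeffs_def real_state_def)
  then obtain c where c: "\<And>n. c (Suc n) = flow_step (c n)"
    and st: "\<And>n j. j \<in> modes M \<Longrightarrow> state (u n) (v n) j = c n j + of_real (\<tau> / 2) * force (c n) j"
    and ru': "\<And>n. real_state (u n)" and rv': "\<And>n. real_state (v n)"
    and c0: "c 0 = (\<lambda>j. state (u 0) (v 0) j - of_real (\<tau> / 2) * force (state (u 0) (v 0)) j)"
    by (rule integrator_flow[OF flt psi ti]) blast
  have kr: "0 < \<kappa> * r" "\<kappa> * r \<le> r" "\<kappa> * r \<le> 1 / 16"
    using k0 r0 k1 r1 mult_mono[of \<kappa> "1/16" r 1] by (auto simp: mult_le_cancel_right1)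
  \<comment> \<open>Each of the two excited modes contributes \<kappa> r / 32; the half kick may
    double the sum to the \<kappa> r / 8 that \<open>long_time\<close> expects.\<close>
  let ?m = "\<kappa> * r / 16"
  have a0: "mode_norm wt (state (u 0) (v 0)) \<le> ?m"
  proof -
    let ?a = "state (u 0) (v 0)"
    have z: "norm (?a j) = 0" if j: "j \<in> modes M" "\<bar>j\<bar> \<noteq> 1" for j
      using init0[OF j] mode_energy_state[OF ru' rv', of 0 0 j] j by (simp add: mode_rep_id add_nonneg_eq_0_iff)
    have one: "norm (?a j) \<le> \<kappa> * r / 32 * (p * h)" if j: "j \<in> {1, -1}" for j
    proof -
      have "mode_rep M 1 = 1" "mode_rep M (-1) = -1" using mode_1 by (auto intro: mode_rep_id)
      then have "(norm (?a 1))\<^sup>2 + (norm (?a (-1)))\<^sup>2 = 4 * mode_energy \<rho> M (u 0) (v 0) 1"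
        using mode_energy_state[OF ru' rv', of 0 0 1] by simp
      moreover have "0 \<le> (norm (?a 1))\<^sup>2" "0 \<le> (norm (?a (-1)))\<^sup>2" by simp_all
      ultimately have "(norm (?a 1))\<^sup>2 \<le> 4 * mode_energy \<rho> M (u 0) (v 0) 1" "(norm (?a (-1)))\<^sup>2 \<le> 4 * mode_energy \<rho> M (u 0) (v 0) 1" by linarith+
      then have "(norm (?a j))\<^sup>2 \<le> 4 * mode_energy \<rho> M (u 0) (v 0) 1" using j by blast
      also have "\<dots> \<le> 4 * (\<kappa> * r / 64 * (p * h))\<^sup>2" using init1 by simp
      also have "\<dots> = (\<kappa> * r / 32 * (p * h))\<^sup>2" by (simp add: power2_eq_square)
      finally show ?thesis by (rule power2_le_imp_le) (use kr ph_pos in auto)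
    qed
    have w1: "wt (j, unit_index j) = p * h" "sg j = 1" if "j \<in> {1, -1}" for j
      using wt_unit[OF mode_1[OF that]] that K3 by (auto simp: energy_profile_def sobolev_root_def)
    have "mode_norm wt ?a \<le> (\<Sum>j\<in>modes M. sg j * (norm (?a j) / wt (j, unit_index j)))"
      unfolding mode_norm_def using sg_pos wt_pos by (intro L2_set_le_sum mult_nonneg_nonneg divide_nonneg_pos) (auto intro: less_imp_le)
    also have "\<dots> = (\<Sum>j\<in>{1, -1}. sg j * (norm (?a j) / wt (j, unit_index j)))"
      using z mode_1 by (intro sum.mono_neutral_right) auto
    also have "\<dots> \<le> (\<Sum>j\<in>{1, -1 :: int}. \<kappa> * r / 32)"
    proof (rule sum_mono)
      fix j :: int assume j: "j \<in> {1, -1}"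
      show "sg j * (norm (?a j) / wt (j, unit_index j)) \<le> \<kappa> * r / 32"
        unfolding w1[OF j] using one[OF j] ph_pos by (simp add: pos_divide_le_eq)
    qed
    finally show ?thesis by simp
  qed
  have init: "mode_norm wt (c 0) \<le> \<kappa> * r / 8"
  proof -
    have "?m \<le> r" "0 \<le> ?m" "\<bar>- (\<tau> / 2)\<bar> = \<tau> / 2" using kr tau0 by linarith+
    then show ?thesis using half_kick_bound[OF r0' a0, of "- (\<tau> / 2)"] by (simp add: c0)
  qed
  note lt = long_time[OF c r0 r k0 k1 kC kp init]
  have cn: "mode_norm wt (c n) \<le> \<kappa> * r" by (rule lt(1)[OF time])
  have "mode_norm wt (state (u n) (v n)) = mode_norm wt (\<lambda>j. c n j + of_real (\<tau> / 2) * force (c n) j)"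
    unfolding mode_norm_def by (intro L2_set_cong) (auto simp: st)
  also have "\<dots> \<le> 2 * (\<kappa> * r)" using half_kick_bound[OF r0' cn, of "\<tau> / 2"] kr tau0 by simp
  also have "\<dots> \<le> 1" using kr by simp
  finally have "(mode_norm wt (state (u n) (v n)))\<^sup>2 \<le> 1" using mode_norm_nonneg by (intro power_le_one) auto
  then show "(\<Sum>l=0..M. sobolev_weight s l / (level_weight l)\<^sup>2 * mode_energy \<rho> M (u n) (v n) l) \<le> 1"
    using weighted_energy_bound[OF ru' rv', of n n] by linarith
  have E: "mode_energy \<rho> M (u i) (v i) 1 = (\<Sum>j\<in>{1, -1}. (norm (c i j + of_real (\<tau> / 2) * force (c i) j))\<^sup>2) / 4" for i
  proof -
    have "mode_rep M 1 = 1" "mode_rep M (-1) = -1" using mode_1 by (auto intro: mode_rep_id)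
    then show ?thesis using mode_energy_state[OF ru' rv', of i i 1] st[of 1 i] st[of "-1" i] mode_1 by simp
  qed
  have hk: "\<bar>(\<Sum>j\<in>{1, -1}. (norm (c i j + of_real (\<tau> / 2) * force (c i) j))\<^sup>2) - (\<Sum>j\<in>{1, -1}. (norm (c i j))\<^sup>2)\<bar> \<le> 2 * (C3 * p ^ 4)"
    if ci: "mode_norm wt (c i) \<le> \<kappa> * r" for i
    using mode_1_half_kick[OF _ r0' ci, of 1] mode_1_half_kick[OF _ r0' ci, of "-1"] kr by simp
  have c0b: "mode_norm wt (c 0) \<le> \<kappa> * r" using init kr by linarith
  have "4 * C1 * (p * h) * r\<^sup>2 * (real n * \<tau> * step_err) \<le> 4 * C1 * (p * h) * r\<^sup>2 * (p * h) ^ 3"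
  proof (intro mult_left_mono)
    \<comment> \<open>Together with K \<ge> 3 this turns the time restriction into a drift factor of
      at most (p h)^3.\<close>
    have "CJ \<ge> 1 / 64"
    proof -
      have "1 * (1 * (1 * 1)) \<le> (real_of_int (2 * K + 1)) * (real_of_int (K + 1) powr (2 * s) * (real_of_int (K + 1) * sqrt ((1 + \<rho>) / \<rho>)))"
        using K3 s12 rho0 by (intro mult_mono ge_one_powr_ge_zero real_sqrt_ge_one) (auto simp: field_simps)
      then show ?thesis by (simp add: CJ_def)
    qed
    then have "\<kappa>\<^sup>2 * (p * h) ^ nat K / (64 * CJ) \<le> 1 * (p * h) ^ 3 / 1"
      using k0 k1 ph_pos ph_le_1 K3 by (intro frac_le mult_mono power_le_one power_decreasing) auto
    then show "real n * \<tau> * step_err \<le> (p * h) ^ 3" using time by simp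
  qed (use C1_nonneg ph_pos in auto)
  also have "\<dots> = 4 * C1 * r\<^sup>2 * (p * h) ^ 4" by (simp add: power3_eq_cube power4_eq_xxxx)
  also have "\<dots> \<le> 4 * C1 * r\<^sup>2 * p ^ 4" using C1_nonneg p0 h0 h1 by (intro mult_left_mono power_mono) auto
  finally have "\<bar>(\<Sum>j\<in>{1, -1}. (norm (c n j))\<^sup>2) - (\<Sum>j\<in>{1, -1}. (norm (c 0 j))\<^sup>2)\<bar> \<le> 2 * (p ^ 4 * r\<^sup>2 * C2) + 4 * C1 * r\<^sup>2 * p ^ 4"
    using lt(2)[OF time] by linarith
  moreover have "\<bar>A / 4 - A' / 4\<bar> \<le> (2 * x + y) / 4" if "\<bar>A - B\<bar> \<le> x" "\<bar>A' - B'\<bar> \<le> x" "\<bar>B - B'\<bar> \<le> y" for A A' B B' x y :: real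
  proof -
    have "A - A' \<le> 2 * x + y" using that[unfolded abs_le_iff] by linarith
    moreover have "A' - A \<le> 2 * x + y" using that[unfolded abs_le_iff] by linarith
    ultimately show ?thesis unfolding diff_divide_distrib[symmetric] by (simp add: abs_le_iff divide_right_mono)
  qed
  ultimately have "\<bar>mode_energy \<rho> M (u n) (v n) 1 - mode_energy \<rho> M (u 0) (v 0) 1\<bar> \<le> (2 * (2 * (C3 * p ^ 4)) + (2 * (p ^ 4 * r\<^sup>2 * C2) + 4 * C1 * r\<^sup>2 * p ^ 4)) / 4"
    unfolding E using hk[OF cn] hk[OF c0b] by blast
  also have "\<dots> = C4 r * p ^ 4" by (simp add: C4_def algebra_simps)
  finally show "\<bar>mode_energy \<rho> M (u n) (v n) 1 - mode_energy \<rho> M (u 0) (v 0) 1\<bar> \<le> C4 r * p ^ 4" .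
qed

end

subsection \<open>The choice of constants\<close>

lemma norm_cis_minus_1: "norm (cis t - 1) = 2 * \<bar>sin (t / 2)\<bar>"
  using dist_exp_i_1[of t] by (simp add: cis_conv_exp)

text \<open>The divisor of a label is the lower-sign expression of the non-resonance condition,
  whose only excluded index is the resonant one.\<close>

lemma nonresonant_modulation:
  assumes "\<rho> > 0" "s > 1/2" "0 < \<gamma>" "\<gamma> \<le> 1" and K: "K \<ge> 3" "M \<ge> K" and tau: "\<tau> > 0"
    and p: "0 < p" "p \<le> 1/4" and h: "0 < \<epsilon> powr (\<nu> / 2)" "\<epsilon> powr (\<nu> / 2) \<le> 1" and ph: "4 * p\<^sup>2 \<le> \<gamma> * \<epsilon> powr (\<nu> / 2)"
    and b: "\<And>x. \<bar>\<phi> x\<bar> \<le> b" and N: "N \<ge> 1" and nr: "nonresonant \<rho> K M \<tau> \<epsilon> \<nu> \<gamma>"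
  shows "modulation K M \<rho> s \<gamma> b \<tau> p (\<epsilon> powr (\<nu> / 2)) (\<lambda>j. \<phi> (\<tau> * omega \<rho> j)) N"
proof -
  interpret L: label_costs K M by standard (use K in auto)
  have half: "norm (cis (\<tau> * (dot_omega \<rho> M (snd x) - omega \<rho> (fst x))) - 1) = 2 * \<bar>sin (\<tau> * (omega \<rho> (fst x) - dot_omega \<rho> M (snd x)) / 2)\<bar>" for x
  proof -
    have "\<tau> * (dot_omega \<rho> M (snd x) - omega \<rho> (fst x)) / 2 = - (\<tau> * (omega \<rho> (fst x) - dot_omega \<rho> M (snd x)) / 2)" by (simp add: right_diff_distrib diff_divide_distrib)
    then show ?thesis unfolding norm_cis_minus_1 by (metis sin_minus abs_minus_cancel)
  qed
  have nrx: "(snd x \<noteq> unit_index (fst x) \<longrightarrow> \<bar>sin (\<tau> * (omega \<rho> (fst x) - dot_omega \<rho> M (snd x)) / 2)\<bar> \<ge> \<gamma> * \<tau> * \<epsilon> powr (\<nu> / 2)) \<and>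
     (snd x \<noteq> unit_index (fst x) \<and> snd x \<noteq> - unit_index (fst x) \<and> \<bar>fst x\<bar> \<le> K \<longrightarrow> \<bar>sin (\<tau> * (omega \<rho> (fst x) - dot_omega \<rho> M (snd x)) / 2)\<bar> \<ge> \<gamma> * \<tau>)"
    if "x \<in> L.active" for x
    using nr that L.active_subset unfolding nonresonant_def by (auto simp: case_prod_beta)
  \<comment> \<open>The step size is bounded by the strong condition at j = 0, k = 0, as a sine is
    at most 1.\<close>
  have tg: "\<tau> * \<gamma> \<le> 1"
  proof -
    let ?x = "(0 :: int, (\<lambda>_. 0) :: int \<Rightarrow> int)"
    have "?x \<in> L.active" using K by (auto simp: L.active_def L.cost_def L.high_sum_def L.low_cost_def L.mode_cost_def modes_def multi_indices_def)
    moreover have "(\<lambda>_. 0) \<noteq> unit_index 0" "(\<lambda>_. 0) \<noteq> - unit_index 0" by (auto simp: unit_index_def fun_eq_iff)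
    ultimately have "\<gamma> * \<tau> \<le> \<bar>sin (\<tau> * (omega \<rho> 0 - dot_omega \<rho> M (\<lambda>_. 0)) / 2)\<bar>" using nrx[of ?x] K by simp
    also have "\<dots> \<le> 1" by simp
    finally show ?thesis by (simp add: mult.commute)
  qed
  show ?thesis
  proof
    fix j assume j: "j \<in> modes M"
    have "\<bar>mode_rep M (- j)\<bar> = \<bar>j\<bar>" using abs_mode_rep_minus[OF L.M0, of j] j by (simp add: mode_rep_id)
    then have "(mode_rep M (- j))\<^sup>2 = j\<^sup>2" by (metis power2_abs)
    then have "(real_of_int (mode_rep M (- j)))\<^sup>2 = (real_of_int j)\<^sup>2" by (metis of_int_power)
    then show "\<phi> (\<tau> * omega \<rho> (mode_rep M (- j))) = \<phi> (\<tau> * omega \<rho> j)" by (simp add: omega_def)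
  next
    fix x assume x: "x \<in> L.active" "snd x \<noteq> unit_index (fst x)"
    show "2 * \<gamma> * \<tau> * \<epsilon> powr (\<nu> / 2) \<le> norm (cis (\<tau> * (dot_omega \<rho> M (snd x) - omega \<rho> (fst x))) - 1)"
      unfolding half using nrx[OF x(1)] x(2) by simp
    show "2 * \<gamma> * \<tau> \<le> norm (cis (\<tau> * (dot_omega \<rho> M (snd x) - omega \<rho> (fst x))) - 1)"
      if "snd x \<noteq> - unit_index (fst x)" "\<bar>fst x\<bar> \<le> K"
      unfolding half using nrx[OF x(1)] x(2) that by simp
  qed (use assms tg in auto)
qed

theorem theorem1:
  fixes \<rho> \<nu> s \<gamma> :: real and \<phi> \<psi> :: "real \<Rightarrow> real" and K :: int
  assumes "\<rho> > 0"
    and "admissible_filters \<phi> \<psi>"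
    and "K \<ge> 3"
    and "0 \<le> \<nu>" and "\<nu> < 1/2"
    and "s > 1/2"
    and "0 < \<gamma>" and "\<gamma> \<le> 1"
  shows "\<exists>\<epsilon>0 c C :: real. \<epsilon>0 > 0 \<and> c > 0 \<and> C > 0 \<and>
    (\<forall>(M :: int) (\<tau> :: real) (\<epsilon> :: real)
      (u :: nat \<Rightarrow> int \<Rightarrow> complex) (v :: nat \<Rightarrow> int \<Rightarrow> complex).
      M \<ge> K \<longrightarrow> \<tau> > 0 \<longrightarrow> 0 < \<epsilon> \<longrightarrow> \<epsilon> \<le> \<epsilon>0 \<longrightarrow>
      nonresonant \<rho> K M \<tau> \<epsilon> \<nu> \<gamma> \<longrightarrow>
      real_coeffs M (u 0) \<longrightarrow> real_coeffs M (v 0) \<longrightarrow>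
      trig_integrator \<rho> \<phi> \<psi> M \<tau> u v \<longrightarrow>
      mode_energy \<rho> M (u 0) (v 0) 1 \<le> \<epsilon> \<longrightarrow>
      (\<forall>j \<in> modes M. \<bar>j\<bar> \<noteq> 1 \<longrightarrow> mode_energy \<rho> M (u 0) (v 0) j = 0) \<longrightarrow>
      (\<forall>n :: nat. real n * \<tau> \<le> c * \<epsilon> powr (- of_int K * (1 - 2 * \<nu>) / 2) \<longrightarrow>
        (\<Sum>l=0..M. sobolev_weight s l * \<epsilon> powr (- of_int (energy_profile K l))
                    * mode_energy \<rho> M (u n) (v n) l) \<le> C \<and>
        \<epsilon> powr (- of_int (energy_profile K 1))
          * \<bar>mode_energy \<rho> M (u n) (v n) 1 - mode_energy \<rho> M (u 0) (v 0) 1\<bar>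
          \<le> C * \<epsilon> powr (1 - 2 * \<nu>)))"
proof -
  obtain b where b: "\<And>x. \<bar>\<phi> x\<bar> \<le> b"
    using assms(2) unfolding admissible_filters_def bounded_iff by auto
  have psi: "\<psi> x = sinc x * \<phi> x" for x using assms(2) unfolding admissible_filters_def by blast
  \<comment> \<open>\<nu> < 1/2 gives 1 - 3\<nu>/2 > 1/4. With N = 4K the N-th power of
    \<open>Rsmall / Rbig\<close>, of order \<epsilon> powr (1 - 3\<nu>/2), is then no larger than
    the truncation error of order \<epsilon> powr (K(1-\<nu>)).\<close>
  define N where "N = 4 * nat K"
  \<comment> \<open>These locale constants depend on neither \<tau> nor \<open>M\<close>. Their
    positivity is known only inside an instance of the locale, hence the absolute values
    below.\<close>
  define H where "H = modulation.hconst \<rho> s b (Suc N)"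
  define J where "J = modulation.CJ K \<rho> s"
  define r where "r = \<gamma> / (16 * (\<bar>H\<bar> + 1))"
  define \<kappa> where "\<kappa> = 1 / (16 + 128 * \<bar>J\<bar>)"
  \<comment> \<open>Then \<kappa> r / 64 times \<open>p * h\<close> is exactly \<epsilon> powr
    (1/2), as the initial condition of \<open>energy_bounds\<close> requires.\<close>
  define \<Lambda> where "\<Lambda> = 64 / (\<kappa> * r)"
  \<comment> \<open>The first entry gives \<open>p\<close> \<le> 1/4, the second the smallness
    \<open>kp\<close> of p squared relative to \<kappa> \<gamma> h.\<close>
  define t where "t = min (1 / (4 * \<Lambda>)) (\<kappa> * \<gamma> / (2 * \<Lambda>\<^sup>2))"
  define CE where "CE = (4 * \<Lambda>\<^sup>2 / \<gamma>) ^ N + \<Lambda> ^ nat (2 * K)"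
  define c where "c = \<kappa>\<^sup>2 * \<Lambda> ^ nat K / (64 * (\<bar>J\<bar> + 1) * CE)"
  define C where "C = \<Lambda> ^ (2 * nat K) + \<bar>modulation.C4 K \<rho> \<gamma> b r\<bar> * \<Lambda> ^ 4"
  have r0: "r > 0" and r1: "r \<le> 1" and rH: "16 * H * r \<le> \<gamma>"
  proof -
    show "r > 0" using assms by (simp add: r_def)
    have "\<gamma> / (16 * (\<bar>H\<bar> + 1)) \<le> 1 / 1" using assms by (intro frac_le) auto
    then show "r \<le> 1" by (simp add: r_def)
    have "16 * H * r = (16 * (H * \<gamma>)) / (16 * (\<bar>H\<bar> + 1))" by (simp only: r_def times_divide_eq_right mult.assoc)
    also have "\<dots> = H * \<gamma> / (\<bar>H\<bar> + 1)" by (rule mult_divide_mult_cancel_left) simp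
    also have "\<dots> = \<gamma> * (H / (\<bar>H\<bar> + 1))" by simp
    also have "\<dots> \<le> \<gamma> * 1" using assms by (intro mult_left_mono) (auto simp: divide_le_eq)
    finally show "16 * H * r \<le> \<gamma>" by simp
  qed
  have k0: "\<kappa> > 0" and k1: "\<kappa> \<le> 1/16" and kJ: "128 * J * \<kappa>\<^sup>2 \<le> 1"
  proof -
    show k0: "\<kappa> > 0" by (simp add: \<kappa>_def add_pos_nonneg)
    show k1: "\<kappa> \<le> 1/16" unfolding \<kappa>_def by (intro frac_le) auto
    have "128 * J * \<kappa> \<le> 128 * \<bar>J\<bar> * \<kappa>" using k0 by (intro mult_right_mono) auto
    also have "\<dots> \<le> 1" unfolding \<kappa>_def by (simp add: divide_le_eq add_pos_nonneg)
    finally have "128 * J * \<kappa> * \<kappa> \<le> 1 * \<kappa>" using k0 by (intro mult_right_mono) auto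
    also have "\<dots> \<le> 1" using k1 by simp
    finally show "128 * J * \<kappa>\<^sup>2 \<le> 1" by (simp add: power2_eq_square mult.assoc)
  qed
  have L1: "\<Lambda> \<ge> 1"
  proof -
    have "\<kappa> * r \<le> 1 * 1" using k0 k1 r0 r1 by (intro mult_mono) auto
    then show ?thesis using k0 r0 by (simp add: \<Lambda>_def le_divide_eq)
  qed
  have t0: "t > 0" using L1 k0 assms by (simp add: t_def)
  have CE0: "CE > 0" using L1 assms by (auto simp: CE_def intro!: add_nonneg_pos)
  have c0: "c > 0" using k0 L1 CE0 by (simp add: c_def add_nonneg_pos)
  have C0: "C > 0" using L1 by (simp add: C_def add_pos_nonneg)
  have main: "(\<Sum>l=0..M. sobolev_weight s l * \<epsilon> powr (- of_int (energy_profile K l)) * mode_energy \<rho> M (u n) (v n) l) \<le> C \<and>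
        \<epsilon> powr (- of_int (energy_profile K 1)) * \<bar>mode_energy \<rho> M (u n) (v n) 1 - mode_energy \<rho> M (u 0) (v 0) 1\<bar> \<le> C * \<epsilon> powr (1 - 2 * \<nu>)"
    if M: "M \<ge> K" and tau: "\<tau> > 0" and eps: "0 < \<epsilon>" "\<epsilon> \<le> min 1 (t ^ 4)" and nr: "nonresonant \<rho> K M \<tau> \<epsilon> \<nu> \<gamma>"
      and ru: "real_coeffs M (u 0)" and rv: "real_coeffs M (v 0)" and ti: "trig_integrator \<rho> \<phi> \<psi> M \<tau> u v"
      and e1: "mode_energy \<rho> M (u 0) (v 0) 1 \<le> \<epsilon>" and e0: "\<forall>j \<in> modes M. \<bar>j\<bar> \<noteq> 1 \<longrightarrow> mode_energy \<rho> M (u 0) (v 0) j = 0"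
      and n: "real n * \<tau> \<le> c * \<epsilon> powr (- of_int K * (1 - 2 * \<nu>) / 2)"
    for M \<tau> \<epsilon> u v n
  proof -
    define p where "p = \<Lambda> * \<epsilon> powr ((1 - \<nu>) / 2)"
    define h where "h = \<epsilon> powr (\<nu> / 2)"
    have L0: "\<Lambda> > 0" using L1 by linarith
    have pos: "p > 0" "h > 0" using eps L0 by (simp_all add: p_def h_def)
    have h1: "h \<le> 1" unfolding h_def using eps assms(4) by (intro powr_le1) auto
    \<comment> \<open>Both (1-\<nu>)/2 and 1 - 3\<nu>/2 are at least 1/4 for \<nu> < 1/2; hence the
      threshold t^4 for \<epsilon>.\<close>
    have small: "\<epsilon> powr a \<le> t" if "a \<ge> 1/4" for a
    proof -
      have "\<epsilon> powr a \<le> \<epsilon> powr (1/4)" using eps that by (intro powr_mono') auto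
      also have "\<dots> \<le> (t ^ 4) powr (1/4)" using eps by (intro powr_mono2) auto
      also have "t ^ 4 = t powr 4" using t0 by simp
      also have "(t powr 4) powr (1/4) = t" unfolding powr_powr using t0 by simp
      finally show ?thesis .
    qed
    have p4: "p \<le> 1/4"
    proof -
      have "p \<le> \<Lambda> * t" unfolding p_def using assms L1 by (intro mult_left_mono small) auto
      also have "\<dots> \<le> \<Lambda> * (1 / (4 * \<Lambda>))" using L1 by (intro mult_left_mono) (auto simp: t_def)
      finally show ?thesis using L1 by simp
    qed
    have p2: "p\<^sup>2 = \<Lambda>\<^sup>2 * \<epsilon> powr (1 - 3 * \<nu> / 2) * h"
    proof -
      have "\<epsilon> powr ((1 - \<nu>) / 2) * \<epsilon> powr ((1 - \<nu>) / 2) = \<epsilon> powr (1 - 3 * \<nu> / 2) * \<epsilon> powr (\<nu> / 2)"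
        unfolding powr_add[symmetric] by (rule arg_cong[where f = "\<lambda>x. \<epsilon> powr x"]) (simp add: field_simps)
      then show ?thesis by (simp only: p_def h_def power2_eq_square mult_ac)
    qed
    have kp: "2 * p\<^sup>2 \<le> \<kappa> * (\<gamma> * h)"
    proof -
      have "\<Lambda>\<^sup>2 * \<epsilon> powr (1 - 3 * \<nu> / 2) \<le> \<Lambda>\<^sup>2 * t" using assms by (intro mult_left_mono small) auto
      also have "\<dots> \<le> \<Lambda>\<^sup>2 * (\<kappa> * \<gamma> / (2 * \<Lambda>\<^sup>2))" by (intro mult_left_mono) (auto simp: t_def)
      also have "\<dots> = \<kappa> * \<gamma> / 2" using L1 by simp
      finally have "\<Lambda>\<^sup>2 * \<epsilon> powr (1 - 3 * \<nu> / 2) * h \<le> \<kappa> * \<gamma> / 2 * h" using pos by (intro mult_right_mono) auto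
      then show ?thesis unfolding p2 by simp
    qed
    have ph4: "4 * p\<^sup>2 \<le> \<gamma> * h"
    proof -
      have "2 * (\<kappa> * (\<gamma> * h)) \<le> 1 * (\<gamma> * h)" using k1 assms pos by (simp only: mult.assoc[symmetric], intro mult_right_mono) auto
      then show ?thesis using kp by simp
    qed
    have "\<epsilon> powr ((1 - \<nu>) / 2) * \<epsilon> powr (\<nu> / 2) = \<epsilon> powr (1/2)"
      unfolding powr_add[symmetric] by (rule arg_cong[where f = "\<lambda>x. \<epsilon> powr x"]) (simp add: field_simps)
    then have ph: "p * h = \<Lambda> * \<epsilon> powr (1/2)" by (simp only: p_def h_def mult.assoc)
    interpret modulation K M \<rho> s \<gamma> b \<tau> p h "\<lambda>j. \<phi> (\<tau> * omega \<rho> j)" N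
      unfolding h_def
      by (rule nonresonant_modulation) (use assms M tau eps pos h1 p4 ph4 b nr in \<open>auto simp: N_def h_def\<close>)
    have pw: "(\<epsilon> powr a) ^ m = \<epsilon> powr (a * real m)" for a m
      using eps powr_power[of \<epsilon> a m] by (simp add: mult.commute)
    have Kn: "real (nat K) = of_int K" using assms by simp
    have err: "step_err \<le> CE * \<epsilon> powr (of_int K * (1 - \<nu>))"
    proof -
      have "Rsmall / Rbig = 4 * \<Lambda>\<^sup>2 / \<gamma> * \<epsilon> powr (1 - 3 * \<nu> / 2)"
        using pos by (simp add: Rsmall_def Rbig_def p2)
      then have "(Rsmall / Rbig) ^ N = (4 * \<Lambda>\<^sup>2 / \<gamma>) ^ N * \<epsilon> powr ((1 - 3 * \<nu> / 2) * real N)"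
        by (simp only: power_mult_distrib pw)
      also have "\<dots> \<le> (4 * \<Lambda>\<^sup>2 / \<gamma>) ^ N * \<epsilon> powr (of_int K * (1 - \<nu>))"
      proof (intro mult_left_mono powr_mono')
        have "of_int K * (1 - \<nu>) \<le> of_int K * (4 * (1 - 3 * \<nu> / 2))" using assms by (intro mult_left_mono) auto
        then show "of_int K * (1 - \<nu>) \<le> (1 - 3 * \<nu> / 2) * real N" using Kn by (simp add: N_def mult_ac)
      qed (use eps assms in auto)
      finally have 1: "(Rsmall / Rbig) ^ N \<le> (4 * \<Lambda>\<^sup>2 / \<gamma>) ^ N * \<epsilon> powr (of_int K * (1 - \<nu>))" .
      have "p ^ nat (2 * K) = \<Lambda> ^ nat (2 * K) * \<epsilon> powr (of_int K * (1 - \<nu>))"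
      proof -
        have "real (nat (2 * K)) = 2 * of_int K" using assms by simp
        then have "(1 - \<nu>) / 2 * real (nat (2 * K)) = of_int K * (1 - \<nu>)" by (simp add: field_simps)
        then show ?thesis unfolding p_def power_mult_distrib pw by (simp only:)
      qed
      with 1 show ?thesis by (simp add: step_err_def CE_def distrib_right)
    qed
    have time: "real n * \<tau> * step_err \<le> \<kappa>\<^sup>2 * (p * h) ^ nat K / (64 * CJ)"
    proof -
      have "real n * \<tau> * step_err \<le> (c * \<epsilon> powr (- of_int K * (1 - 2 * \<nu>) / 2)) * (CE * \<epsilon> powr (of_int K * (1 - \<nu>)))"
        by (rule mult_mono[OF n err]) (use c0 step_err_nonneg in auto)
      also have "\<dots> = c * CE * (\<epsilon> powr (- of_int K * (1 - 2 * \<nu>) / 2) * \<epsilon> powr (of_int K * (1 - \<nu>)))" by simp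
      \<comment> \<open>The exponent of the time scale and that of the step error add up to K/2, the
        exponent of \<epsilon> in \<open>(p * h) ^ nat K\<close>.\<close>
      also have "\<epsilon> powr (- of_int K * (1 - 2 * \<nu>) / 2) * \<epsilon> powr (of_int K * (1 - \<nu>)) = \<epsilon> powr (of_int K / 2)"
        unfolding powr_add[symmetric] by (rule arg_cong[where f = "\<lambda>x. \<epsilon> powr x"]) (simp add: field_simps)
      finally have X: "real n * \<tau> * step_err \<le> c * CE * \<epsilon> powr (of_int K / 2)" .
      have "c * CE = \<kappa>\<^sup>2 * \<Lambda> ^ nat K / (64 * (\<bar>J\<bar> + 1))" using CE0 by (simp add: c_def)
      also have "\<dots> \<le> \<kappa>\<^sup>2 * \<Lambda> ^ nat K / (64 * CJ)"
        using CJ_pos L1 by (intro divide_left_mono) (auto simp: J_def)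
      finally have "c * CE * \<epsilon> powr (of_int K / 2) \<le> \<kappa>\<^sup>2 * \<Lambda> ^ nat K / (64 * CJ) * \<epsilon> powr (of_int K / 2)"
        by (rule mult_right_mono) simp
      also have "\<kappa>\<^sup>2 * \<Lambda> ^ nat K / (64 * CJ) * \<epsilon> powr (of_int K / 2) = \<kappa>\<^sup>2 * (p * h) ^ nat K / (64 * CJ)"
        unfolding ph power_mult_distrib pw using Kn by simp
      finally show ?thesis using X by linarith
    qed
    have i1: "mode_energy \<rho> M (u 0) (v 0) 1 \<le> (\<kappa> * r / 64 * (p * h))\<^sup>2"
    proof -
      have "\<kappa> * r / 64 * (p * h) = \<epsilon> powr (1/2)" using k0 r0 by (simp add: ph \<Lambda>_def)
      moreover have "(\<epsilon> powr (1/2))\<^sup>2 = \<epsilon>" using eps by (simp add: pw)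
      ultimately show ?thesis using e1 by simp
    qed
    note eb = energy_bounds[OF refl psi ti ru rv r0 r1 rH[unfolded H_def] k0 k1 kJ[unfolded J_def] kp i1 _ time]
    have E0: "mode_energy \<rho> M (u n) (v n) l \<ge> 0" for l by (simp add: mode_energy_def)
    have "(\<Sum>l=0..M. sobolev_weight s l * \<epsilon> powr (- of_int (energy_profile K l)) * mode_energy \<rho> M (u n) (v n) l)
       \<le> (\<Sum>l=0..M. \<Lambda> ^ (2 * nat K) * (sobolev_weight s l / (level_weight l)\<^sup>2 * mode_energy \<rho> M (u n) (v n) l))"
    proof (rule sum_mono)
      fix l
      \<comment> \<open>Powers of \<epsilon> and level weights differ by the power 2e(l) of
        \<Lambda>, largest at e(l) = K.\<close>
      let ?e = "nat (energy_profile K l)"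
      have "(level_weight l)\<^sup>2 = \<Lambda> ^ (2 * ?e) * \<epsilon> powr (of_int (energy_profile K l))"
        unfolding level_weight_def ph using profile_pos[of l]
        by (simp add: power_mult_distrib pw power_mult[symmetric] mult.commute)
      then have "\<epsilon> powr (- of_int (energy_profile K l)) = \<Lambda> ^ (2 * ?e) / (level_weight l)\<^sup>2"
        using L1 eps by (simp add: powr_minus_divide)
      also have "\<dots> \<le> \<Lambda> ^ (2 * nat K) / (level_weight l)\<^sup>2"
        using L1 profile_le[of l] by (intro divide_right_mono power_increasing) auto
      finally have "sobolev_weight s l * (\<epsilon> powr (- of_int (energy_profile K l)) * mode_energy \<rho> M (u n) (v n) l)
         \<le> sobolev_weight s l * (\<Lambda> ^ (2 * nat K) / (level_weight l)\<^sup>2 * mode_energy \<rho> M (u n) (v n) l)"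
        using E0 sobolev_weight_nonneg by (intro mult_left_mono mult_right_mono)
      then show "sobolev_weight s l * \<epsilon> powr (- of_int (energy_profile K l)) * mode_energy \<rho> M (u n) (v n) l
         \<le> \<Lambda> ^ (2 * nat K) * (sobolev_weight s l / (level_weight l)\<^sup>2 * mode_energy \<rho> M (u n) (v n) l)"
        by (simp add: mult_ac)
    qed
    also have "\<dots> = \<Lambda> ^ (2 * nat K) * (\<Sum>l=0..M. sobolev_weight s l / (level_weight l)\<^sup>2 * mode_energy \<rho> M (u n) (v n) l)"
      by (rule sum_distrib_left[symmetric])
    also have "\<dots> \<le> \<Lambda> ^ (2 * nat K) * 1" using eb(1) e0 L1 by (intro mult_left_mono) auto
    also have "\<dots> \<le> C" using L1 by (simp add: C_def)
    finally have first: "(\<Sum>l=0..M. sobolev_weight s l * \<epsilon> powr (- of_int (energy_profile K l)) * mode_energy \<rho> M (u n) (v n) l) \<le> C" .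
    let ?d = "\<bar>mode_energy \<rho> M (u n) (v n) 1 - mode_energy \<rho> M (u 0) (v 0) 1\<bar>"
    have "?d \<le> C4 r * p ^ 4" using eb(2) e0 by blast
    also have "\<dots> \<le> \<bar>C4 r\<bar> * p ^ 4" using pos by (intro mult_right_mono) auto
    also have "p ^ 4 = \<Lambda> ^ 4 * \<epsilon> powr (2 - 2 * \<nu>)" 
    proof -
      have "(1 - \<nu>) / 2 * real 4 = 2 - 2 * \<nu>" by (simp add: field_simps)
      then show ?thesis unfolding p_def power_mult_distrib pw by (simp only:)
    qed
    finally have "\<epsilon> powr (- 1) * ?d \<le> \<epsilon> powr (- 1) * (\<bar>C4 r\<bar> * (\<Lambda> ^ 4 * \<epsilon> powr (2 - 2 * \<nu>)))"
      by (rule mult_left_mono) simp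
    also have "\<dots> = \<bar>C4 r\<bar> * \<Lambda> ^ 4 * (\<epsilon> powr (- 1) * \<epsilon> powr (2 - 2 * \<nu>))" by (simp only: mult_ac)
    also have "\<epsilon> powr (- 1) * \<epsilon> powr (2 - 2 * \<nu>) = \<epsilon> powr (1 - 2 * \<nu>)"
      unfolding powr_add[symmetric] by simp
    also have "\<bar>C4 r\<bar> * \<Lambda> ^ 4 * \<epsilon> powr (1 - 2 * \<nu>) \<le> C * \<epsilon> powr (1 - 2 * \<nu>)"
      using L1 by (intro mult_right_mono) (auto simp: C_def)
    finally have "\<epsilon> powr (- 1) * ?d \<le> C * \<epsilon> powr (1 - 2 * \<nu>)" .
    moreover have "energy_profile K 1 = 1" using assms by (simp add: energy_profile_def)
    ultimately show ?thesis using first by simp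
  qed
  show ?thesis
  proof (rule exI[of _ "min 1 (t ^ 4)"], rule exI[of _ c], rule exI[of _ C], intro conjI allI impI)
    show "min 1 (t ^ 4) > 0" using t0 by simp
  qed (use c0 C0 main in blast)+
qed

end
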